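(* For every integer $n\ge0$ there is a canonical isomorphism $$\bigl(M_{n+2}^!/\mathcal{D}^{n+1}M^!_{-n}\bigr)\otimes_{\mathbb{Q}}\mathbb{C}\ \overset{\sim}{\longrightarrow}\ H^1(\mathrm{SL}_2(\mathbb{Z});V^B_n\otimes_{\mathbb{Q}}\mathbb{C}),$$ given by sending the class of $f\in M^!_{n+2}$ to the cohomology class of the cocycle $$\gamma\mapsto(2\pi i)^{n+1}\int_{\gamma^{-1}z_0}^{z_0}f(z)\,(z\mathbf{a}-\mathbf{b})^n\,dz,$$ which does not depend on the choice of $z_0\in\mathfrak{H}$.
   Context: For $m\in\mathbb{Z}$, $M_m^!$ is the $\mathbb{Q}$-vector space of weakly holomorphic modular forms of weight $m$ for $\mathrm{SL}_2(\mathbb{Z})$ with rational Fourier coefficients: holomorphic functions $f$ on the upper half plane $\mathfrak{H}$ with $f(\gamma z)=(cz+d)^m f(z)$ for all $\gamma=\begin{pmatrix}a&b\\c&d\end{pmatrix}\in \mathrm{SL}_2(\mathbb{Z})$ and with Fourier expansion $f=\sum_{k\ge -N}a_kq^k$, $a_k\in\mathbb{Q}$, $q=e^{2\pi i z}$. The operator is $\mathcal{D}=q\frac{d}{dq}$; by Bol's identity $\mathcal{D}^{n+1}$ maps $M^!_{-n}$ into $M^!_{n+2}$ for $n\ge0$. $V^B=\mathbb{Q}\mathbf{a}\oplus\mathbb{Q}\mathbf{b}$ is the standard two-dimensional representation and $V^B_n=\mathrm{Sym}^nV^B$. Convention: $\mathrm{SL}_2(\mathbb{Z})$ acts on the right by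 $\mathbf{a}|\gamma=\delta\mathbf{a}+c\mathbf{b}$, $\mathbf{b}|\gamma=\beta\mathbf{a}+\alpha\mathbf{b}$ for $\gamma=\begin{pmatrix}\alpha&\beta\\c&\delta\end{pmatrix}$ (so that $F(z)=f(z)(z\mathbf{a}-\mathbf{b})^ndz$ satisfies $F(\gamma z)|\gamma=F(z)$ for $f\in M_{n+2}^!$), and one-cocycles satisfy $\kappa(\gamma\gamma')=\kappa(\gamma)|\gamma'+\kappa(\gamma')$. *)

theory Defs
  imports
    "HOL-Complex_Analysis.Complex_Analysis"
    "HOL-Computational_Algebra.Polynomial"
    "HOL-Algebra.Module"
    "HOL-Algebra.AbelCoset"
    "HOL-Algebra.Generated_Groups"
    "HOL-Algebra.Free_Abelian_Groups"
begin

section \<open>Vector spaces, quotients, complexification\<close>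

text \<open>
  Vector spaces are represented by the module records of HOL-Algebra. Their multiplicative
  components play no role and are left undefined.
\<close>

text \<open>
  Scalar multiplication on \<open>M/U\<close>: \<open>r\<close> times a coset \<open>X\<close> is the coset \<open>U + r x\<close> for any \<open>x \<in> X\<close>;
  the union is over equal sets when \<open>U\<close> is stable under scalars.
\<close>
definition quotient_module :: "('r, 'm) module \<Rightarrow> 'm set \<Rightarrow> ('r, 'm set) module" where
  "quotient_module M U =
     \<lparr>carrier = a_rcosets\<^bsub>M\<^esub> U,
      monoid.mult = undefined, monoid.one = undefined,
      ring.zero = U, ring.add = (\<lambda>X Y. X <+>\<^bsub>M\<^esub> Y),
      module.smult = (\<lambda>r X. \<Union>x\<in>X. U +>\<^bsub>M\<^esub> (r \<odot>\<^bsub>M\<^esub> x))\<rparr>"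

definition linear_iso :: "('r, 'm) module \<Rightarrow> ('r, 'n) module \<Rightarrow> ('m \<Rightarrow> 'n) set" where
  "linear_iso M N =
     {\<Phi> \<in> iso (add_monoid M) (add_monoid N).
        \<forall>r. \<forall>x\<in>carrier M. \<Phi> (r \<odot>\<^bsub>M\<^esub> x) = r \<odot>\<^bsub>N\<^esub> \<Phi> x}"

text \<open>
  The tensor product \<open>W \<otimes>\<^sub>\<rat> \<complex>\<close>, for a rational vector space \<open>W\<close>: the free abelian group on
  \<open>W \<times> \<complex>\<close> modulo the subgroup generated by the bilinearity relations, with
  \<open>c \<cdot> (w \<otimes> d) = w \<otimes> (c d)\<close>.
\<close>
definition tensor_relations :: "(rat, 'w) module \<Rightarrow> ('w \<times> complex \<Rightarrow>\<^sub>0 int) set" where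
  "tensor_relations W =
     {frag_of (x \<oplus>\<^bsub>W\<^esub> y, c) - frag_of (x, c) - frag_of (y, c) | x y c.
        x \<in> carrier W \<and> y \<in> carrier W}
   \<union> {frag_of (x, c + d) - frag_of (x, c) - frag_of (x, d) | x c d. x \<in> carrier W}
   \<union> {frag_of (r \<odot>\<^bsub>W\<^esub> x, c) - frag_of (x, of_rat r * c) | r x c. x \<in> carrier W}"

definition tensor_kernel :: "(rat, 'w) module \<Rightarrow> ('w \<times> complex \<Rightarrow>\<^sub>0 int) set" where
  "tensor_kernel W =
     generate (free_Abelian_group (carrier W \<times> (UNIV :: complex set))) (tensor_relations W)"

text \<open>
  The free abelian group on \<open>W \<times> \<complex>\<close>, written additively. Its scalar multiplication satisfies
  the module axioms only after passing to the quotient by the relations.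
\<close>
definition free_on_pairs :: "(rat, 'w) module \<Rightarrow> (complex, 'w \<times> complex \<Rightarrow>\<^sub>0 int) module" where
  "free_on_pairs W =
     \<lparr>carrier = carrier (free_Abelian_group (carrier W \<times> (UNIV :: complex set))),
      monoid.mult = undefined, monoid.one = undefined,
      ring.zero = 0, ring.add = (+),
      module.smult = (\<lambda>c p. frag_extend (\<lambda>(w, d). frag_of (w, c * d)) p)\<rparr>"

definition tensor_complex ::
    "(rat, 'w) module \<Rightarrow> (complex, ('w \<times> complex \<Rightarrow>\<^sub>0 int) set) module" where
  "tensor_complex W = quotient_module (free_on_pairs W) (tensor_kernel W)"

definition pure_tensor ::
    "(rat, 'w) module \<Rightarrow> 'w \<Rightarrow> complex \<Rightarrow> ('w \<times> complex \<Rightarrow>\<^sub>0 int) set" where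
  "pure_tensor W w c = tensor_kernel W +>\<^bsub>free_on_pairs W\<^esub> frag_of (w, c)"


section \<open>First group cohomology for a right action\<close>

text \<open>
  \<open>act g v\<close> stands for \<open>v|g\<close>. Cochains are functions on \<open>carrier G\<close>, extended by
  \<open>undefined\<close> to the ambient type.
\<close>
definition cocycle_module ::
    "'g monoid \<Rightarrow> ('r, 'v) module \<Rightarrow> ('g \<Rightarrow> 'v \<Rightarrow> 'v) \<Rightarrow> ('r, 'g \<Rightarrow> 'v) module" where
  "cocycle_module G V act =
     \<lparr>carrier = {\<kappa> \<in> carrier G \<rightarrow>\<^sub>E carrier V.
        \<forall>g\<in>carrier G. \<forall>h\<in>carrier G. \<kappa> (g \<otimes>\<^bsub>G\<^esub> h) = act h (\<kappa> g) \<oplus>\<^bsub>V\<^esub> \<kappa> h},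
      monoid.mult = undefined, monoid.one = undefined,
      ring.zero = (\<lambda>g\<in>carrier G. \<zero>\<^bsub>V\<^esub>),
      ring.add = (\<lambda>\<kappa> \<mu>. \<lambda>g\<in>carrier G. \<kappa> g \<oplus>\<^bsub>V\<^esub> \<mu> g),
      module.smult = (\<lambda>r \<kappa>. \<lambda>g\<in>carrier G. r \<odot>\<^bsub>V\<^esub> \<kappa> g)\<rparr>"

definition coboundaries ::
    "'g monoid \<Rightarrow> ('r, 'v) module \<Rightarrow> ('g \<Rightarrow> 'v \<Rightarrow> 'v) \<Rightarrow> ('g \<Rightarrow> 'v) set" where
  "coboundaries G V act = {(\<lambda>g\<in>carrier G. act g v \<ominus>\<^bsub>V\<^esub> v) | v. v \<in> carrier V}"

definition H1 ::
    "'g monoid \<Rightarrow> ('r, 'v) module \<Rightarrow> ('g \<Rightarrow> 'v \<Rightarrow> 'v) \<Rightarrow> ('r, ('g \<Rightarrow> 'v) set) module" where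
  "H1 G V act = quotient_module (cocycle_module G V act) (coboundaries G V act)"

definition cohomology_class ::
    "'g monoid \<Rightarrow> ('r, 'v) module \<Rightarrow> ('g \<Rightarrow> 'v \<Rightarrow> 'v) \<Rightarrow> ('g \<Rightarrow> 'v) \<Rightarrow> ('g \<Rightarrow> 'v) set" where
  "cohomology_class G V act \<kappa> = coboundaries G V act +>\<^bsub>cocycle_module G V act\<^esub> \<kappa>"


section \<open>Weakly holomorphic modular forms\<close>

definition SL2Z :: "(int^2^2) monoid" where
  "SL2Z = \<lparr>carrier = {\<gamma>. det \<gamma> = 1}, monoid.mult = (**), monoid.one = mat 1\<rparr>"

definition upper_half_plane :: "complex set" where
  "upper_half_plane = {z. Im z > 0}"

definition automorphy_factor :: "int^2^2 \<Rightarrow> complex \<Rightarrow> complex" where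
  "automorphy_factor \<gamma> z = of_int (\<gamma> $ 2 $ 1) * z + of_int (\<gamma> $ 2 $ 2)"

definition moebius_action :: "int^2^2 \<Rightarrow> complex \<Rightarrow> complex" where
  "moebius_action \<gamma> z =
     (of_int (\<gamma> $ 1 $ 1) * z + of_int (\<gamma> $ 1 $ 2)) / automorphy_factor \<gamma> z"

text \<open>
  Functions on the upper half plane are represented by functions on the complex plane that vanish
  outside it, so that equality of functions is equality on the upper half plane.
\<close>
definition weakly_holomorphic_forms :: "int \<Rightarrow> (complex \<Rightarrow> complex) set" where
  "weakly_holomorphic_forms m =
     {f. (\<forall>z. z \<notin> upper_half_plane \<longrightarrow> f z = 0)
       \<and> f holomorphic_on upper_half_plane
       \<and> (\<forall>\<gamma>\<in>carrier SL2Z. \<forall>z\<in>upper_half_plane.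
            f (moebius_action \<gamma> z) = automorphy_factor \<gamma> z powi m * f z)
       \<and> (\<exists>(N :: int) (a :: int \<Rightarrow> rat). \<forall>z\<in>upper_half_plane.
            ((\<lambda>k. of_rat (a k) * exp (2 * of_real pi * \<i> * z) powi k) has_sum f z) {- N..})}"

definition weakly_holomorphic_module :: "int \<Rightarrow> (rat, complex \<Rightarrow> complex) module" where
  "weakly_holomorphic_module m =
     \<lparr>carrier = weakly_holomorphic_forms m,
      monoid.mult = undefined, monoid.one = undefined,
      ring.zero = (\<lambda>z. 0), ring.add = (\<lambda>f g z. f z + g z),
      module.smult = (\<lambda>r f z. of_rat r * f z)\<rparr>"

text \<open>The operator \<open>q d/dq\<close> for \<open>q = exp (2 \<pi> i z)\<close>, that is, \<open>(2 \<pi> i)\<^sup>-\<^sup>1 d/dz\<close>.\<close>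
definition qderiv :: "(complex \<Rightarrow> complex) \<Rightarrow> complex \<Rightarrow> complex" where
  "qderiv f z = (if z \<in> upper_half_plane then deriv f z / (2 * of_real pi * \<i>) else 0)"

definition forms_mod_bol :: "nat \<Rightarrow> (rat, (complex \<Rightarrow> complex) set) module" where
  "forms_mod_bol n =
     quotient_module (weakly_holomorphic_module (int n + 2))
       ((qderiv ^^ (n + 1)) ` weakly_holomorphic_forms (- int n))"

definition form_class :: "nat \<Rightarrow> (complex \<Rightarrow> complex) \<Rightarrow> (complex \<Rightarrow> complex) set" where
  "form_class n f =
     ((qderiv ^^ (n + 1)) ` weakly_holomorphic_forms (- int n))
       +>\<^bsub>weakly_holomorphic_module (int n + 2)\<^esub> f"


section \<open>Symmetric powers of the standard representation\<close>

text \<open>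
  \<open>Sym\<^sup>n (\<rat>a \<oplus> \<rat>b) \<otimes> \<complex>\<close> is the space of homogeneous polynomials of degree \<open>n\<close> in \<open>a, b\<close> with complex
  coefficients. A polynomial in \<open>a, b\<close> is a polynomial in \<open>a\<close> whose coefficients are polynomials
  in \<open>b\<close>, so that \<open>coeff (coeff P i) j\<close> is the coefficient of \<open>a\<^sup>i b\<^sup>j\<close>.
\<close>
definition var_a :: "complex poly poly" where
  "var_a = [:0, 1:]"

definition var_b :: "complex poly poly" where
  "var_b = [:[:0, 1:]:]"

definition const_poly :: "complex \<Rightarrow> complex poly poly" where
  "const_poly c = [:[:c:]:]"

definition sym_power :: "nat \<Rightarrow> (complex, complex poly poly) module" where
  "sym_power n =
     \<lparr>carrier = {P. \<forall>i j. coeff (coeff P i) j \<noteq> 0 \<longrightarrow> i + j = n},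
      monoid.mult = undefined, monoid.one = undefined,
      ring.zero = 0, ring.add = (+),
      module.smult = (\<lambda>c P. const_poly c * P)\<rparr>"

text \<open>Substitution of \<open>A\<close> for \<open>a\<close> and \<open>B\<close> for \<open>b\<close>.\<close>
definition subst_ab ::
    "complex poly poly \<Rightarrow> complex poly poly \<Rightarrow> complex poly poly \<Rightarrow> complex poly poly" where
  "subst_ab A B P = poly (map_poly (\<lambda>p. poly (map_poly const_poly p) B) P) A"

text \<open>
  \<open>P|\<gamma>\<close>, where \<open>a|\<gamma> = \<gamma>\<^sub>2\<^sub>2 a + \<gamma>\<^sub>2\<^sub>1 b\<close> and \<open>b|\<gamma> = \<gamma>\<^sub>1\<^sub>2 a + \<gamma>\<^sub>1\<^sub>1 b\<close>.
\<close>
definition slash :: "int^2^2 \<Rightarrow> complex poly poly \<Rightarrow> complex poly poly" where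
  "slash \<gamma> =
     subst_ab (of_int (\<gamma> $ 2 $ 2) * var_a + of_int (\<gamma> $ 2 $ 1) * var_b)
              (of_int (\<gamma> $ 1 $ 2) * var_a + of_int (\<gamma> $ 1 $ 1) * var_b)"


section \<open>Period cocycles\<close>

text \<open>
  Coefficientwise contour integral of a family of homogeneous polynomials of degree \<open>n\<close>.
\<close>
definition sym_contour_integral ::
    "nat \<Rightarrow> (real \<Rightarrow> complex) \<Rightarrow> (complex \<Rightarrow> complex poly poly) \<Rightarrow> complex poly poly" where
  "sym_contour_integral n \<eta> F =
     (\<Sum>i\<le>n. const_poly (contour_integral \<eta> (\<lambda>z. coeff (coeff (F z) i) (n - i)))
              * var_a ^ i * var_b ^ (n - i))"

text \<open>
  The upper half plane is convex and the integrand is holomorphic there, so the integral may be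
  taken along the straight segment.
\<close>
definition period_cocycle ::
    "nat \<Rightarrow> (complex \<Rightarrow> complex) \<Rightarrow> complex \<Rightarrow> int^2^2 \<Rightarrow> complex poly poly" where
  "period_cocycle n f z0 =
     (\<lambda>\<gamma>\<in>carrier SL2Z.
        const_poly ((2 * of_real pi * \<i>) ^ (n + 1)) *
        sym_contour_integral n (linepath (moebius_action (inv\<^bsub>SL2Z\<^esub> \<gamma>) z0) z0)
          (\<lambda>z. const_poly (f z) * (const_poly z * var_a - var_b) ^ n))"

end

theory Submission
  imports Defs
begin

text \<open>
  The map sends a form \<open>f\<close> of weight \<open>n + 2\<close> to the class of its period cocycle. Seen as a
  polynomial in \<open>w\<close> (the value \<open>1\<close> for \<open>a\<close> and \<open>w\<close> for \<open>b\<close>), the polynomial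
  \<open>(z a - b)\<^sup>n\<close> is \<open>(z - w)\<^sup>n\<close>, and the cocycle is
  the failure of the Eichler integral \<open>E(w) = \<integral> f(z) (z - w)\<^sup>n dz\<close>, taken from \<open>z0\<close> to \<open>w\<close>, to be modular of
  weight \<open>- n\<close>. Everything follows from three facts.

  Kernel. The cocycle of \<open>f\<close> is a coboundary if and only if a polynomial of degree at most \<open>n\<close> can be
  subtracted from \<open>E\<close> so that the difference is modular of weight \<open>- n\<close>. Up to a constant, the operator
  \<open>(q d/dq)\<^sup>n\<^sup>+\<^sup>1\<close> maps \<open>E\<close> to \<open>f\<close>, and it annihilates exactly these polynomials, so this says that
  \<open>f\<close> is the image under \<open>(q d/dq)\<^sup>n\<^sup>+\<^sup>1\<close> of a complex weakly holomorphic form (lemma \<open>period_cocycle_coboundary_iff\<close>).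

  Image. The modular group is generated by \<open>S\<close>, which fixes \<open>\<i>\<close>, and by \<open>U\<close>, which fixes
  \<open>\<rho> = exp (2 \<pi> \<i> / 3)\<close>, both of finite order. For even \<open>n\<close> every cocycle splits on each of the two
  cyclic groups generated by them, so that up to coboundaries it is given by one polynomial, the difference of the two splittings. For the
  cocycle of \<open>f\<close> this polynomial is the integral of \<open>f(z) (z a - b)\<^sup>n\<close> between \<open>\<i>\<close> and
  \<open>\<rho>\<close>. It takes every value (lemma \<open>periods_surjective\<close>): otherwise some nonzero polynomial
  \<open>p(z)\<close> would satisfy \<open>\<integral> f p dz = 0\<close> along the unit arc for all \<open>f\<close>; multiplying \<open>f\<close> by powers of the modular invariant
  \<open>j\<close>, which is real and injective on this arc, and approximating by polynomials in \<open>j\<close>, one finds \<open>f p = 0\<close>.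
  For odd \<open>n\<close> the element \<open>-1\<close> of the group forces the cohomology and the spaces of forms to vanish.

  Rationality. Complex forms are complex linear combinations of forms with rational coefficients
  (lemma \<open>forms_over_UNIV_eq_span\<close>), and rational forms that are linearly independent over \<open>\<rat>\<close>
  stay so over \<open>\<complex>\<close>, since linear relations can be read off from the rational Fourier
  coefficients. Hence the tensor product with \<open>\<complex>\<close> is the quotient of the spaces of complex forms
  (lemma \<open>eval_tensor_kernel\<close>).

  The supply of modular forms comes from a single transformation law, that of the Eisenstein series
  \<open>E2\<close> of weight two. Ramanujan's differential equations produce \<open>E4\<close> and \<open>E6\<close> from it, and
  \<open>q d\<Delta>/dq = E2 \<Delta>\<close> produces the discriminant. The same equations show
  that \<open>j\<close> is monotone on the arc.
\<close>

section \<open>Summation over the integers and over the lattice of integer pairs\<close>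

lemma has_sum_int_split:
  fixes f :: "int \<Rightarrow> complex"
  assumes "((\<lambda>n. f (int n)) has_sum a) UNIV" "((\<lambda>n. f (- int n - 1)) has_sum b) UNIV"
  shows "(f has_sum (a + b)) UNIV"
proof -
  have "(f has_sum a) {0..}"
    using assms(1) by (subst has_sum_reindex_bij_witness[of _ nat int _ f, symmetric, where s = a]) auto
  moreover have "(f has_sum b) {..<0}"
    using assms(2)
    by (subst has_sum_reindex_bij_witness[of UNIV "\<lambda>k. nat (- k - 1)" "\<lambda>n. - int n - 1" "{..<0}" f, symmetric, where s = b]) auto
  ultimately have "(f has_sum (a + b)) ({0..} \<union> {..<0})"
    by (intro has_sum_Un_disjoint) auto
  moreover have "{0..} \<union> {..<0} = (UNIV :: int set)" by auto
  ultimately show ?thesis by simp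
qed

lemma filterlim_symmetric_int_intervals:
  "filterlim (\<lambda>N. {- int N..int N}) (finite_subsets_at_top UNIV) sequentially"
  unfolding filterlim_finite_subsets_at_top
proof safe
  fix X :: "int set" assume "finite X"
  define M where "M = Max (insert 0 (abs ` X))"
  have M: "\<bar>x\<bar> \<le> M" if "x \<in> X" for x
    unfolding M_def using \<open>finite X\<close> that by (intro Max_ge) auto
  show "\<forall>\<^sub>F N in sequentially. finite {- int N..int N} \<and> X \<subseteq> {- int N..int N} \<and> {- int N..int N} \<subseteq> UNIV"
    using eventually_ge_at_top[of "nat M"]
  proof eventually_elim
    case (elim N)
    show ?case using M elim by (fastforce simp: abs_le_iff)
  qed
qed

lemma has_sum_int_telescope:
  fixes f g :: "int \<Rightarrow> complex"
  assumes "f summable_on UNIV" "\<And>d. f d = g d - g (d + 1)"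
    and "(\<lambda>N. g (- int N) - g (int N + 1)) \<longlonglongrightarrow> L"
  shows "(f has_sum L) UNIV"
proof -
  from assms(1) have s: "(f has_sum infsum f UNIV) UNIV" by simp
  have eq: "sum f {- int N..int N} = g (- int N) - g (int N + 1)" for N
  proof (induction N)
    case 0
    then show ?case by (simp add: assms(2))
  next
    case (Suc N)
    have *: "{- int (Suc N)..int (Suc N)} = insert (- int N - 1) (insert (int N + 1) {- int N..int N})"
      by auto
    have e: "- int N - 1 = - 1 - int N" by simp
    show ?case unfolding * using assms(2)[of "- int N - 1"] assms(2)[of "int N + 1"]
      by (subst sum.insert; (subst sum.insert)?) (auto simp: Suc e add.commute)
  qed
  have "(\<lambda>N. sum f {- int N..int N}) \<longlonglongrightarrow> infsum f UNIV"
    using filterlim_compose[OF s[unfolded has_sum_def] filterlim_symmetric_int_intervals] by (simp add: o_def)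
  with assms(3) have "L = infsum f UNIV" unfolding eq by (rule LIMSEQ_unique)
  with s show ?thesis by simp
qed

lemma summable_inverse_one_plus_square_int:
  "(\<lambda>c::int. 1 / (1 + (of_int c)\<^sup>2) :: real) summable_on UNIV"
proof -
  define f where "f = (\<lambda>c::int. 1 / (1 + (of_int c)\<^sup>2) :: real)"
  have "(\<lambda>n::nat. 1 / (1 + (real n)\<^sup>2)) summable_on UNIV"
  proof (rule norm_summable_imp_summable_on, rule summable_comparison_test_ev)
    show "summable (\<lambda>n. inverse ((real n)^2))" using inverse_power_summable[of 2] by simp
    show "\<forall>\<^sub>F n in sequentially. norm (norm (1 / (1 + (real n)\<^sup>2))) \<le> inverse ((real n)\<^sup>2)"
      using eventually_gt_at_top[of 0] by eventually_elim (simp add: field_simps add_pos_nonneg)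
  qed
  hence *: "(\<lambda>n. f (int n)) summable_on UNIV" by (simp add: f_def)
  have "f summable_on {0..}"
    using * by (subst summable_on_reindex_bij_witness[of _ nat int _ f, symmetric]) auto
  moreover have "f summable_on {..0}"
    using * by (subst summable_on_reindex_bij_witness[of UNIV "\<lambda>k. nat (-k)" "\<lambda>n. - int n" "{..0}" f, symmetric])
               (auto simp: f_def)
  ultimately have "f summable_on ({0..} \<union> {..0})" by (rule summable_on_union)
  moreover have "{0..} \<union> {..0} = (UNIV::int set)" by auto
  ultimately show ?thesis by (simp add: f_def)
qed

lemma summable_inverse_product_int:
  "(\<lambda>(c::int, d::int). 1 / ((1 + (of_int c)\<^sup>2) * (1 + (of_int d)\<^sup>2)) :: real) summable_on UNIV \<times> UNIV"
proof -
  define f where "f = (\<lambda>c::int. 1 / (1 + (of_int c)\<^sup>2) :: real)"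
  have s: "f summable_on UNIV" using summable_inverse_one_plus_square_int by (simp add: f_def)
  have "(\<lambda>p. f (fst p) * f (snd p)) summable_on UNIV \<times> UNIV"
  proof (rule summable_on_SigmaI[where g = "\<lambda>c. f c * infsum f UNIV"])
    show "((\<lambda>d. f (fst (c, d)) * f (snd (c, d))) has_sum f c * infsum f UNIV) UNIV" for c
      using has_sum_cmult_right[OF has_sum_infsum[OF s], of "f c"] by simp
    show "(\<lambda>c. f c * infsum f UNIV) summable_on UNIV" by (intro summable_on_cmult_left s)
  qed (auto simp: f_def)
  thus ?thesis by (simp add: f_def case_prod_unfold)
qed

text \<open>
  Both lattice sums below are compared with \<open>\<Sum> (1 + c\<^sup>2)\<inverse> (1 + d\<^sup>2)\<inverse>\<close> by means of this coercivity of
  the real linear form \<open>(x, y) \<mapsto> x z + y\<close>.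
\<close>
lemma real_linear_form_coercive:
  assumes "Im z > 0"
  obtains \<delta> where "\<delta> > 0" "\<And>x y :: real. cmod (of_real x * z + of_real y) \<ge> \<delta> * (\<bar>x\<bar> + \<bar>y\<bar>)"
proof
  define K where "K = 1 / Im z + (1 + cmod z / Im z)"
  have K: "K > 0" using assms by (auto simp: K_def intro!: add_pos_nonneg)
  thus "1 / K > 0" by simp
  fix x y :: real
  define w where "w = of_real x * z + of_real y"
  have 1: "\<bar>x\<bar> * Im z \<le> cmod w"
    using abs_Im_le_cmod[of w] assms by (simp add: w_def abs_mult)
  have "\<bar>y\<bar> = cmod (w - of_real x * z)" by (simp add: w_def)
  also have "\<dots> \<le> cmod w + \<bar>x\<bar> * cmod z"
    using norm_triangle_ineq4[of w "of_real x * z"] by (simp add: norm_mult)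
  also have "\<bar>x\<bar> * cmod z \<le> (cmod w / Im z) * cmod z"
    using 1 assms by (intro mult_right_mono) (auto simp: field_simps)
  finally have 2: "\<bar>y\<bar> \<le> cmod w + cmod w / Im z * cmod z" by simp
  have "\<bar>x\<bar> + \<bar>y\<bar> \<le> cmod w * K"
    using 1 2 assms by (simp add: K_def field_simps)
  thus "cmod (of_real x * z + of_real y) \<ge> 1 / K * (\<bar>x\<bar> + \<bar>y\<bar>)"
    using K by (simp add: w_def field_simps)
qed

section \<open>Partial fractions of the cotangent\<close>

lemma nonreal_not_Ints: "Im z \<noteq> 0 \<Longrightarrow> z \<notin> \<int>" "Im z \<noteq> 0 \<Longrightarrow> z \<notin> \<int>\<^sub>\<le>\<^sub>0" for z :: complex
  by (auto elim!: Ints_cases nonpos_Ints_cases)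

lemma sin_pi_nonreal: "Im z \<noteq> 0 \<Longrightarrow> sin (of_real pi * z) \<noteq> 0" for z :: complex
  using nonreal_not_Ints(1)[of z] sin_eq_0[of "of_real pi * z"] by (auto simp: mult.commute)

text \<open>The logarithmic derivative of the reflection formula of the Gamma function.\<close>
lemma Digamma_reflection:
  assumes "Im z \<noteq> 0"
  shows "Digamma (1 - z) - Digamma z = of_real pi * cot (of_real pi * z)"
proof -
  have nI: "z \<notin> \<int>\<^sub>\<le>\<^sub>0" "1 - z \<notin> \<int>\<^sub>\<le>\<^sub>0" using assms by (auto intro!: nonreal_not_Ints(2))
  have G: "Gamma z \<noteq> 0" "Gamma (1 - z) \<noteq> 0" using nI by (auto simp: Gamma_eq_zero_iff)
  let ?f = "\<lambda>z::complex. Gamma z * Gamma (1 - z) * sin (of_real pi * z)"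
  have "(?f has_field_derivative
      (Gamma z * Digamma z * Gamma (1 - z) - Gamma z * (Gamma (1 - z) * Digamma (1 - z))) * sin (of_real pi * z)
      + Gamma z * Gamma (1 - z) * (cos (of_real pi * z) * of_real pi)) (at z)"
    using nI by (auto intro!: derivative_eq_intros simp: algebra_simps)
  moreover have "(?f has_field_derivative 0) (at z)"
  proof (rule has_field_derivative_transform_within_open[OF DERIV_const])
    show "open {w. Im w \<noteq> 0}" 
      by (rule open_Collect_neq) (auto intro!: continuous_intros)
    show "z \<in> {w. Im w \<noteq> 0}" using assms by simp
    fix x assume "x \<in> {w. Im w \<noteq> 0}"
    thus "of_real pi = ?f x" by (subst Gamma_reflection_complex) (auto simp: sin_pi_nonreal)
  qed
  ultimately have "(Gamma z * Digamma z * Gamma (1 - z) - Gamma z * (Gamma (1 - z) * Digamma (1 - z))) * sin (of_real pi * z)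
      + Gamma z * Gamma (1 - z) * (cos (of_real pi * z) * of_real pi) = 0"
    by (rule DERIV_unique)
  hence "Gamma z * Gamma (1 - z) * ((Digamma z - Digamma (1 - z)) * sin (of_real pi * z) + of_real pi * cos (of_real pi * z)) = 0"
    by (simp add: algebra_simps)
  hence "(Digamma z - Digamma (1 - z)) * sin (of_real pi * z) + of_real pi * cos (of_real pi * z) = 0"
    using G by simp
  thus ?thesis using sin_pi_nonreal[OF assms] by (simp add: cot_def field_simps)
qed

text \<open>
  The terms with \<open>c \<ge> 0\<close> and with \<open>c < 0\<close> sum to differences of values of the digamma function,
  which the reflection formula combines to the cotangent.
\<close>
lemma cot_difference_sums:
  assumes "Im w \<noteq> 0" "Im w' \<noteq> 0"
    and summable: "(\<lambda>c::int. 1 / (of_int c + w) - 1 / (of_int c + w')) summable_on UNIV"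
  shows "((\<lambda>c::int. 1 / (of_int c + w) - 1 / (of_int c + w')) has_sum
           (of_real pi * cot (of_real pi * w) - of_real pi * cot (of_real pi * w'))) UNIV"
proof -
  define f where "f = (\<lambda>c::int. 1 / (of_int c + w) - 1 / (of_int c + w'))"
  have nz: "w \<noteq> 0" "w' \<noteq> 0" "1 - w \<noteq> 0" "1 - w' \<noteq> 0" using assms by (auto simp: complex_eq_iff)
  have dig: "(\<lambda>k. (inverse (of_nat (Suc k)) - inverse (x + of_nat k)) - (inverse (of_nat (Suc k)) - inverse (y + of_nat k))) sums (Digamma x - Digamma y)"
    if "x \<noteq> 0" "y \<noteq> 0" for x y :: complex
    using sums_diff[OF summable_sums[OF summable_Digamma[OF that(1)]] summable_sums[OF summable_Digamma[OF that(2)]]]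
    by (simp add: Digamma_def)
  have sm: "(\<lambda>n. f (int n)) summable_on UNIV" "(\<lambda>n. f (- int n - 1)) summable_on UNIV"
  proof -
    have "f summable_on range int" "f summable_on range (\<lambda>n. - int n - 1)"
      using summable by (auto intro: summable_on_subset simp: f_def)
    thus "(\<lambda>n. f (int n)) summable_on UNIV" "(\<lambda>n. f (- int n - 1)) summable_on UNIV"
      by (auto simp: summable_on_reindex inj_on_def o_def)
  qed
  have 1: "((\<lambda>n. f (int n)) has_sum (Digamma w' - Digamma w)) UNIV"
  proof -
    have "(\<lambda>n. f (int n)) sums (Digamma w' - Digamma w)"
      using dig[OF nz(2,1)] by (simp add: f_def inverse_eq_divide add_ac)
    thus ?thesis using sm(1) has_sum_imp_sums[OF has_sum_infsum[OF sm(1)]] sums_unique2 has_sum_infsum by metis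
  qed
  have 2: "((\<lambda>n. f (- int n - 1)) has_sum (Digamma (1 - w) - Digamma (1 - w'))) UNIV"
  proof -
    have "f (- int n - 1) = (inverse (of_nat (Suc n)) - inverse (1 - w + of_nat n)) - (inverse (of_nat (Suc n)) - inverse (1 - w' + of_nat n))" for n
    proof -
      have "1 / (of_int (- int n - 1) + x) = - inverse (1 - x + of_nat n)" for x :: complex
      proof -
        have "of_int (- int n - 1) + x = - (1 - x + of_nat n)" by simp
        thus ?thesis by (simp only: inverse_eq_divide divide_minus_right)
      qed
      thus ?thesis by (simp add: f_def)
    qed
    hence "(\<lambda>n. f (- int n - 1)) sums (Digamma (1 - w) - Digamma (1 - w'))"
      using dig[OF nz(3,4)] by simp
    thus ?thesis using sm(2) has_sum_imp_sums[OF has_sum_infsum[OF sm(2)]] sums_unique2 has_sum_infsum by metis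
  qed
  have "(f has_sum ((Digamma w' - Digamma w) + (Digamma (1 - w) - Digamma (1 - w')))) UNIV"
    by (rule has_sum_int_split[OF 1 2])
  thus ?thesis using Digamma_reflection[OF assms(1)] Digamma_reflection[OF assms(2)]
    by (simp add: f_def algebra_simps)
qed

section \<open>The Eisenstein series of weight two\<close>

lemma has_sum_nat_mult_power:
  fixes x :: "'a :: {real_normed_field, banach}"
  assumes "norm x < 1"
  shows "((\<lambda>m. of_nat m * x ^ m) has_sum (x / (1 - x)\<^sup>2)) {1..}"
proof -
  have s: "(\<lambda>n. of_nat (Suc n) * y ^ Suc n) sums (y / (1 - y)\<^sup>2)" if "norm y < 1" for y :: "'b :: {real_normed_field, banach}"
    using sums_mult[OF geometric_deriv_sums[OF that], of y] by (simp add: algebra_simps)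
  have "((\<lambda>n. of_nat (Suc n) * x ^ Suc n) has_sum (x / (1 - x)\<^sup>2)) UNIV"
  proof (rule norm_summable_imp_has_sum[OF _ s[OF assms]])
    have "summable (\<lambda>n. of_nat (Suc n) * norm x ^ Suc n)"
      using s[of "norm x"] assms by (auto simp: sums_iff)
    thus "summable (\<lambda>n. norm (of_nat (Suc n) * x ^ Suc n))"
      by (simp only: norm_mult norm_of_nat norm_power)
  qed
  thus ?thesis
    by (subst (asm) has_sum_reindex_bij_witness[of UNIV "\<lambda>m. m - 1" Suc "{1..}" "\<lambda>m. of_nat m * x ^ m" _ _ "x / (1 - x)\<^sup>2"]) auto
qed

definition sigma_one :: "nat \<Rightarrow> nat" where
  "sigma_one n = (\<Sum>d | d dvd n. d)"

text \<open>
  Expand each term of the Lambert series into \<open>\<Sum> m q\<^sup>c\<^sup>m\<close> and collect the pairs \<open>(c, m)\<close> by their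
  product.
\<close>
lemma lambert_sigma_one:
  fixes q :: complex
  assumes q: "norm q < 1"
  obtains t where "((\<lambda>c. q ^ c / (1 - q ^ c)\<^sup>2) has_sum t) {1..}"
    and "((\<lambda>n. of_nat (sigma_one n) * q ^ n) has_sum t) {1..}"
proof -
  define f where "f = (\<lambda>(c, m). of_nat m * q ^ (c * m))"
  define r where "r = norm q"
  have r: "r < 1" "r \<ge> 0" using q by (auto simp: r_def)
  have pw: "norm (x ^ c) < 1" if "norm x < 1" "c \<ge> 1" for x :: "'b :: {real_normed_field, banach}" and c :: nat
    using that by (simp add: norm_power power_less_one_iff)
  have abs: "(\<lambda>p. norm (f p)) summable_on {1..} \<times> {1..}"
    proof (rule summable_on_SigmaI)
      fix c :: nat assume c: "c \<in> {1..}"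
      show "((\<lambda>m. norm (f (c, m))) has_sum (r ^ c / (1 - r ^ c)\<^sup>2)) {1..}"
        using has_sum_nat_mult_power[of "r ^ c"] pw[of r c] r c
        by (simp add: f_def norm_mult norm_power power_mult r_def)
    next
      show "(\<lambda>c. r ^ c / (1 - r ^ c)\<^sup>2) summable_on {1..}"
      proof (rule summable_on_comparison_test)
        have "(\<lambda>c. r ^ c) summable_on UNIV"
          using r by (intro norm_summable_imp_summable_on) (simp add: norm_power summable_geometric_iff)
        thus "(\<lambda>c. r ^ c * (1 / (1 - r)\<^sup>2)) summable_on {1..}"
          by (intro summable_on_cmult_left) (auto intro: summable_on_subset)
        fix c :: nat assume c: "c \<in> {1..}"
        have "r ^ c \<le> r ^ 1" using r c by (intro power_decreasing) auto
        hence "(1 - r)\<^sup>2 \<le> (1 - r ^ c)\<^sup>2" using r by (intro power_mono) auto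
        thus "r ^ c / (1 - r ^ c)\<^sup>2 \<le> r ^ c * (1 / (1 - r)\<^sup>2)"
          using r by (auto simp: divide_inverse intro!: mult_left_mono le_imp_inverse_le)
        show "0 \<le> r ^ c / (1 - r ^ c)\<^sup>2" using r by simp
      qed
    qed auto
  hence sm: "f summable_on {1..} \<times> {1..}" by (rule abs_summable_summable)
  define t where "t = infsum f ({1..} \<times> {1..})"
  have ft: "(f has_sum t) (Sigma {1..} (\<lambda>_. {1..}))" using sm by (simp add: t_def)
  have 1: "((\<lambda>c. q ^ c / (1 - q ^ c)\<^sup>2) has_sum t) {1..}"
  proof (rule has_sum_SigmaD[OF ft])
    fix c :: nat assume "c \<in> {1..}"
    thus "((\<lambda>m. f (c, m)) has_sum (q ^ c / (1 - q ^ c)\<^sup>2)) {1..}"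
      using has_sum_nat_mult_power[of "q ^ c"] pw[OF q, of c] by (simp add: f_def power_mult)
  qed
  have "((\<lambda>(n, m). of_nat m * q ^ n) has_sum t) (Sigma {1..} (\<lambda>n. {d. d dvd n}))"
    using ft
    by (subst (asm) has_sum_reindex_bij_witness[of _ "\<lambda>(n, m). (n div m, m)" "\<lambda>(c, m). (c * m, m)"
          "Sigma {1..} (\<lambda>n. {d. d dvd n})" "\<lambda>(n, m). of_nat m * q ^ n" _ _ t])
       (auto simp: f_def Suc_le_eq dvd_div_eq_0_iff)
  hence 2: "((\<lambda>n. of_nat (sigma_one n) * q ^ n) has_sum t) {1..}"
  proof (rule has_sum_SigmaD)
    fix n :: nat assume "n \<in> {1..}"
    hence "finite {d. d dvd n}" by auto
    thus "((\<lambda>m. case (n, m) of (n, m) \<Rightarrow> of_nat m * q ^ n) has_sum (of_nat (sigma_one n) * q ^ n)) {d. d dvd n}"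
      by (intro has_sum_finiteI) (simp_all add: sigma_one_def sum_distrib_right)
  qed
  show ?thesis using 1 2 that by blast
qed

text \<open>
  The sum is the derivative of \<open>- \<pi> cot (\<pi> z)\<close>, that is, \<open>\<pi>\<^sup>2 / sin\<^sup>2 (\<pi> z)\<close>, rewritten in \<open>q\<close>.
\<close>
lemma has_sum_inverse_square_shift:
  assumes "Im z > 0"
  defines "q \<equiv> exp (2 * of_real pi * \<i> * z)"
  assumes summable: "(\<lambda>d::int. 1 / (z + of_int d)\<^sup>2) summable_on UNIV"
  shows "((\<lambda>d::int. 1 / (z + of_int d)\<^sup>2) has_sum (- 4 * (of_real pi)\<^sup>2 * (q / (1 - q)\<^sup>2))) UNIV"
proof -
  define f where "f = (\<lambda>d::int. 1 / (z + of_int d)\<^sup>2)"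
  have nz: "z \<noteq> 0" "1 - z \<noteq> 0" using assms by (auto simp: complex_eq_iff)
  have nI: "z \<notin> \<int>\<^sub>\<le>\<^sub>0" "1 - z \<notin> \<int>\<^sub>\<le>\<^sub>0" using assms(1) by (auto intro!: nonreal_not_Ints(2))
  have sm: "(\<lambda>n. f (int n)) summable_on UNIV" "(\<lambda>n. f (- int n - 1)) summable_on UNIV"
  proof -
    have "f summable_on range int" "f summable_on range (\<lambda>n. - int n - 1)"
      using summable by (auto intro: summable_on_subset simp: f_def)
    thus "(\<lambda>n. f (int n)) summable_on UNIV" "(\<lambda>n. f (- int n - 1)) summable_on UNIV"
      by (auto simp: summable_on_reindex inj_on_def o_def)
  qed
  have 1: "((\<lambda>n. f (int n)) has_sum (Polygamma 1 z)) UNIV"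
  proof -
    have "(\<lambda>n. f (int n)) sums (Polygamma 1 z)"
      using Polygamma_LIMSEQ[OF nz(1), of 1] by (simp add: f_def inverse_eq_divide numeral_2_eq_2)
    thus ?thesis using sm(1) has_sum_imp_sums[OF has_sum_infsum[OF sm(1)]] sums_unique2 has_sum_infsum by metis
  qed
  have 2: "((\<lambda>n. f (- int n - 1)) has_sum (Polygamma 1 (1 - z))) UNIV"
  proof -
    have "f (- int n - 1) = inverse ((1 - z + of_nat n)\<^sup>2)" for n
    proof -
      have "z + of_int (- int n - 1) = - (1 - z + of_nat n)" by simp
      thus ?thesis unfolding f_def by (simp only: power2_minus inverse_eq_divide)
    qed
    hence "(\<lambda>n. f (- int n - 1)) sums (Polygamma 1 (1 - z))"
      using Polygamma_LIMSEQ[OF nz(2), of 1] by (simp add: numeral_2_eq_2)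
    thus ?thesis using sm(2) has_sum_imp_sums[OF has_sum_infsum[OF sm(2)]] sums_unique2 has_sum_infsum by metis
  qed
  have s0: "sin (of_real pi * z) \<noteq> 0" using sin_pi_nonreal[of z] assms by auto
  have "((\<lambda>z. Digamma (1 - z) - Digamma z) has_field_derivative (- Polygamma 1 (1 - z) - Polygamma 1 z)) (at z)"
    using nI by (auto intro!: derivative_eq_intros DERIV_chain2[of Digamma])
  moreover have "((\<lambda>z. Digamma (1 - z) - Digamma z) has_field_derivative
      (- inverse ((sin (of_real pi * z))\<^sup>2) * (of_real pi) * of_real pi)) (at z)"
  proof (rule has_field_derivative_transform_within_open)
    show "((\<lambda>z. of_real pi * cot (of_real pi * z)) has_field_derivative
      (- inverse ((sin (of_real pi * z))\<^sup>2) * (of_real pi) * of_real pi)) (at z)"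
      using s0 by (auto intro!: derivative_eq_intros DERIV_chain2[of cot] DERIV_cot)
    show "open {w. Im w > 0}" by (rule open_halfspace_Im_gt)
  qed (use assms in \<open>auto simp: Digamma_reflection\<close>)
  ultimately have "- Polygamma 1 (1 - z) - Polygamma 1 z = - inverse ((sin (of_real pi * z))\<^sup>2) * (of_real pi) * of_real pi"
    by (rule DERIV_unique)
  hence 3: "Polygamma 1 z + Polygamma 1 (1 - z) = (of_real pi)\<^sup>2 / (sin (of_real pi * z))\<^sup>2"
    by (simp add: field_simps power2_eq_square minus_equation_iff)
  define E where "E = exp (\<i> * (of_real pi * z))"
  have E: "E \<noteq> 0" "q = E\<^sup>2" by (auto simp: E_def q_def exp_double[symmetric] algebra_simps)
  have sE: "sin (of_real pi * z) = (E - 1 / E) / (2 * \<i>)"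
    by (simp add: sin_exp_eq E_def exp_minus inverse_eq_divide)
  have "E\<^sup>2 \<noteq> 1"
  proof
    assume "E\<^sup>2 = 1"
    hence "E - 1 / E = 0" using E(1) by (simp add: field_simps power2_eq_square)
    thus False using s0 by (simp add: sE)
  qed
  hence "(of_real pi)\<^sup>2 / (sin (of_real pi * z))\<^sup>2 = - 4 * (of_real pi)\<^sup>2 * (q / (1 - q)\<^sup>2)"
    unfolding sE E(2) using E(1) s0[unfolded sE] by (simp add: field_simps power2_eq_square)
  with has_sum_int_split[OF 1 2] 3 show ?thesis by (simp add: f_def)
qed

lemma has_sum_inverse_square_int:
  "((\<lambda>d::int. 1 / (of_int d)\<^sup>2 :: complex) has_sum ((of_real pi)\<^sup>2 / 3)) UNIV"
proof -
  have "((\<lambda>n. 1 / (real n + 1)\<^sup>2) has_sum (pi\<^sup>2 / 6)) UNIV"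
    using inverse_squares_sums by (intro norm_summable_imp_has_sum) (auto simp: sums_iff add_ac)
  hence *: "((\<lambda>n. of_real (1 / (real n + 1)\<^sup>2) :: complex) has_sum of_real (pi\<^sup>2 / 6)) UNIV"
    by (rule has_sum_of_real)
  have 1: "((\<lambda>n. 1 / (of_int (int n))\<^sup>2 :: complex) has_sum of_real (pi\<^sup>2 / 6)) UNIV"
  proof -
    have "((\<lambda>n. 1 / (of_int (int n))\<^sup>2 :: complex) has_sum of_real (pi\<^sup>2 / 6)) {1..}"
      using * by (subst has_sum_reindex_bij_witness[of _ Suc "\<lambda>m. m - 1" UNIV _ _ _ "of_real (pi\<^sup>2 / 6)"])
                 (auto simp: of_nat_diff)
    thus ?thesis by (subst has_sum_cong_neutral[of "{1..}" UNIV]) auto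
  qed
  have 2: "((\<lambda>n. 1 / (of_int (- int n - 1))\<^sup>2 :: complex) has_sum of_real (pi\<^sup>2 / 6)) UNIV"
  proof -
    have "(of_int (- int n - 1))\<^sup>2 = (of_nat n + 1 :: complex)\<^sup>2" for n
      by (simp add: power2_eq_square algebra_simps)
    thus ?thesis using * by simp
  qed
  show ?thesis using has_sum_int_split[OF 1 2] by simp
qed

text \<open>
  The term at \<open>(c, d)\<close> of the Eisenstein series of weight two, and a perturbation of it that
  telescopes in \<open>d\<close>.
\<close>
definition eis_term :: "complex \<Rightarrow> int \<Rightarrow> int \<Rightarrow> complex" where
  "eis_term z c d = (if c = 0 \<and> d = 0 then 0 else 1 / (of_int c * z + of_int d)\<^sup>2)"

definition tele_term :: "complex \<Rightarrow> int \<Rightarrow> int \<Rightarrow> complex" where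
  "tele_term z c d = 1 / ((of_int c * z + of_int d)\<^sup>2 - 1 / 4)"

text \<open>
  Two terms that are each only quadratically small differ by a term of order four, which
  is summable over the lattice.
\<close>
lemma lattice_term_bounds:
  assumes z: "Im z > 0"
  obtains K where "K > 0"
    "\<And>c d. cmod (eis_term z c d) \<le> K / (1 + (of_int d)\<^sup>2)"
    "\<And>c d. cmod (eis_term z c d) \<le> K / (1 + (of_int c)\<^sup>2)"
    "\<And>c d. cmod (tele_term z c d) \<le> K / (1 + (of_int d)\<^sup>2)"
    "\<And>c d. cmod (tele_term z c d) \<le> K / (1 + (of_int c)\<^sup>2)"
    "\<And>c d. cmod (eis_term z c d - tele_term z c d) \<le> K / ((1 + (of_int c)\<^sup>2) * (1 + (of_int d)\<^sup>2))"
proof -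
  obtain \<delta> where \<delta>: "\<delta> > 0" "\<And>x y :: real. cmod (of_real x * z + of_real y) \<ge> \<delta> * (\<bar>x\<bar> + \<bar>y\<bar>)"
    using real_linear_form_coercive[OF z] by blast
  define K where "K = 8 / \<delta>\<^sup>2 + 3 / \<delta> ^ 4 + 4"
  have K: "K > 0" "K \<ge> 8 / \<delta>\<^sup>2" "K \<ge> 3 / \<delta> ^ 4" "K \<ge> 4" using \<delta>(1) by (auto simp: K_def add_pos_pos)
  have main: "cmod (eis_term z c d) \<le> K / (1 + (of_int d)\<^sup>2) \<and>
    cmod (eis_term z c d) \<le> K / (1 + (of_int c)\<^sup>2) \<and>
    cmod (tele_term z c d) \<le> K / (1 + (of_int d)\<^sup>2) \<and>
    cmod (tele_term z c d) \<le> K / (1 + (of_int c)\<^sup>2) \<and>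
    cmod (eis_term z c d - tele_term z c d) \<le> K / ((1 + (of_int c)\<^sup>2) * (1 + (of_int d)\<^sup>2))" for c d :: int
  proof (cases "c = 0 \<and> d = 0")
    case True
    thus ?thesis using K by (simp add: eis_term_def tele_term_def)
  next
    case False
    define w where "w = of_int c * z + of_int d"
    define s :: real where "s = \<bar>of_int c\<bar> + \<bar>of_int d\<bar>"
    have s1: "s \<ge> 1" using False by (simp add: s_def flip: of_int_abs) linarith
    have w1: "cmod w \<ge> \<delta> * s" using \<delta>(2)[of "of_int c" "of_int d"] by (simp add: w_def s_def)
    have half: "\<bar>of_int d\<bar> / 2 \<le> \<bar>of_int d + e\<bar>" if "\<bar>e\<bar> = 1/2" for e :: real
    proof (cases "d = 0")
      case False
      hence "\<bar>of_int d\<bar> \<ge> (1::real)" by (simp flip: of_int_abs)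
      thus ?thesis using that by linarith
    qed simp
    have w2: "cmod (w + of_real e) \<ge> \<delta> * (s / 2)" if "\<bar>e\<bar> = 1/2" for e :: real
    proof -
      have "\<delta> * (s / 2) \<le> \<delta> * (\<bar>of_int c\<bar> + \<bar>of_int d + e\<bar>)"
        using half[OF that] \<delta>(1) by (intro mult_left_mono) (auto simp: s_def)
      also have "\<dots> \<le> cmod (w + of_real e)"
        using \<delta>(2)[of "of_int c" "of_int d + e"] by (simp add: w_def add_ac)
      finally show ?thesis .
    qed
    have ds: "\<delta> * s > 0" using \<delta>(1) s1 by simp
    have e: "cmod (eis_term z c d) \<le> 1 / (\<delta>\<^sup>2 * s\<^sup>2)"
    proof -
      have "(\<delta> * s)\<^sup>2 \<le> (cmod w)\<^sup>2" using w1 ds by (intro power_mono) auto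
      moreover have "(\<delta> * s)\<^sup>2 > 0" using \<delta>(1) s1 by simp
      ultimately have "1 / (cmod w)\<^sup>2 \<le> 1 / (\<delta> * s)\<^sup>2" by (intro frac_le) auto
      thus ?thesis using False by (auto simp: eis_term_def norm_divide norm_power w_def power_mult_distrib)
    qed
    have fac: "w\<^sup>2 - 1/4 = (w + of_real (1/2)) * (w + of_real (-1/2))"
      by (simp add: power2_eq_square algebra_simps)
    have nb: "cmod (w\<^sup>2 - 1/4) \<ge> (\<delta> * (s / 2)) * (\<delta> * (s / 2))"
      unfolding fac norm_mult using w2[of "1/2"] w2[of "-1/2"] ds by (intro mult_mono) auto
    have p: "(\<delta> * (s / 2)) * (\<delta> * (s / 2)) > 0" using ds by simp
    have b: "cmod (tele_term z c d) \<le> 4 / (\<delta>\<^sup>2 * s\<^sup>2)"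
    proof -
      have "1 / cmod (w\<^sup>2 - 1/4) \<le> 1 / ((\<delta> * (s / 2)) * (\<delta> * (s / 2)))"
        using nb p by (intro frac_le) auto
      thus ?thesis by (simp add: tele_term_def norm_divide w_def power2_eq_square algebra_simps)
    qed
    have "cmod w > 0" "cmod (w\<^sup>2 - 1/4) > 0"
      using less_le_trans[OF ds w1] less_le_trans[OF p nb] by blast+
    hence w0: "w \<noteq> 0" "w\<^sup>2 - 1/4 \<noteq> 0" by (metis norm_zero less_irrefl)+
    have eb: "eis_term z c d - tele_term z c d = - (1 / 4) * (eis_term z c d * tele_term z c d)"
    proof -
      have "1 / A - 1 / (A - 1/4) = - (1/4) * (1/A * (1/(A - 1/4)))" if "A \<noteq> 0" "A - 1/4 \<noteq> 0" for A :: complex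
        using that by (simp add: diff_frac_eq)
      moreover have "eis_term z c d = 1 / w\<^sup>2" "tele_term z c d = 1 / (w\<^sup>2 - 1/4)" using False by (auto simp: eis_term_def tele_term_def w_def)
      ultimately show ?thesis using w0 by simp
    qed
    have "cmod (eis_term z c d - tele_term z c d) = 1 / 4 * (cmod (eis_term z c d) * cmod (tele_term z c d))"
      unfolding eb by (simp add: norm_mult)
    also have "\<dots> \<le> 1 / 4 * ((1 / (\<delta>\<^sup>2 * s\<^sup>2)) * (4 / (\<delta>\<^sup>2 * s\<^sup>2)))"
      using e b by (intro mult_left_mono mult_mono) auto
    also have "\<dots> = 1 / (\<delta> ^ 4 * s ^ 4)" by (simp add: power2_eq_square power4_eq_xxxx algebra_simps)
    finally have ebn: "cmod (eis_term z c d - tele_term z c d) \<le> 1 / (\<delta> ^ 4 * s ^ 4)" .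
    define x y :: real where "x = \<bar>of_int c\<bar>" and "y = \<bar>of_int d\<bar>"
    have xy: "x \<ge> 0" "y \<ge> 0" "s = x + y" "(of_int c)\<^sup>2 = x\<^sup>2" "(of_int d)\<^sup>2 = y\<^sup>2"
      by (auto simp: x_def y_def s_def)
    have s2: "1 \<le> s\<^sup>2" using s1 by (rule one_le_power)
    have s2': "x\<^sup>2 + y\<^sup>2 \<le> s\<^sup>2" using xy by (simp add: power2_eq_square algebra_simps)
    have s4: "(1 + x\<^sup>2) * (1 + y\<^sup>2) \<le> 3 * s ^ 4"
    proof -
      have a: "s\<^sup>2 * 1 \<le> s\<^sup>2 * s\<^sup>2" using s2 by (intro mult_left_mono) auto
      have b: "x\<^sup>2 * y\<^sup>2 \<le> s\<^sup>2 * s\<^sup>2" using xy by (intro mult_mono power_mono) auto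
      have "s ^ 4 = s\<^sup>2 * s\<^sup>2" by (simp add: power2_eq_square power4_eq_xxxx)
      thus ?thesis using a b s2 s2' by (simp add: algebra_simps)
    qed
    have t: "4 / (\<delta>\<^sup>2 * s\<^sup>2) \<le> K / (1 + t)" if "t \<ge> 0" "t \<le> s\<^sup>2" for t
    proof -
      have "4 / (\<delta>\<^sup>2 * s\<^sup>2) = (8 / \<delta>\<^sup>2) / (2 * s\<^sup>2)" by simp
      also have "\<dots> \<le> K / (1 + t)"
        using K s2 that by (intro frac_le) auto
      finally show ?thesis .
    qed
    have t1: "4 / (\<delta>\<^sup>2 * s\<^sup>2) \<le> K / (1 + (of_int c)\<^sup>2)" "4 / (\<delta>\<^sup>2 * s\<^sup>2) \<le> K / (1 + (of_int d)\<^sup>2)"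
    proof -
      have "0 \<le> x\<^sup>2" "0 \<le> y\<^sup>2" by simp_all
      hence "x\<^sup>2 \<le> s\<^sup>2" "y\<^sup>2 \<le> s\<^sup>2" using s2' by linarith+
      thus "4 / (\<delta>\<^sup>2 * s\<^sup>2) \<le> K / (1 + (of_int c)\<^sup>2)" "4 / (\<delta>\<^sup>2 * s\<^sup>2) \<le> K / (1 + (of_int d)\<^sup>2)"
        unfolding xy(4,5) by (auto intro: t)
    qed
    have e4: "1 / (\<delta>\<^sup>2 * s\<^sup>2) \<le> 4 / (\<delta>\<^sup>2 * s\<^sup>2)" by (intro divide_right_mono) auto
    have "1 / (\<delta> ^ 4 * s ^ 4) = (3 / \<delta> ^ 4) / (3 * s ^ 4)" by simp
    also have "\<dots> \<le> K / ((1 + x\<^sup>2) * (1 + y\<^sup>2))"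
      using K s4 by (intro frac_le) (auto intro!: mult_pos_pos add_pos_nonneg)
    finally show ?thesis using e b ebn t1 e4 unfolding xy(4,5) by linarith
  qed
  show ?thesis by (rule that[OF K(1)]) (use main in blast)+
qed

lemma summable_on_int_bound:
  assumes "\<And>c::int. cmod (f c) \<le> K / (1 + (of_int c)\<^sup>2)"
  shows "f summable_on UNIV"
proof -
  have "(\<lambda>c. norm (f c)) summable_on UNIV"
  proof (rule summable_on_comparison_test)
    show "(\<lambda>c::int. K * (1 / (1 + (of_int c)\<^sup>2))) summable_on UNIV"
      by (intro summable_on_cmult_right summable_inverse_one_plus_square_int)
  qed (use assms in auto)
  thus ?thesis by (rule abs_summable_summable)
qed

text \<open>The closed form of the sum of the Eisenstein terms over \<open>d\<close>.\<close>
definition eis_row :: "complex \<Rightarrow> int \<Rightarrow> complex" where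
  "eis_row z c = (if c = 0 then (of_real pi)\<^sup>2 / 3
     else let q = exp (2 * of_real pi * \<i> * z) ^ nat \<bar>c\<bar> in - 4 * (of_real pi)\<^sup>2 * (q / (1 - q)\<^sup>2))"

lemma eis_row_has_sum:
  assumes z: "Im z > 0"
  shows "(eis_term z c has_sum eis_row z c) UNIV"
proof -
  obtain K where K: "\<And>c d. cmod (eis_term z c d) \<le> K / (1 + (of_int d)\<^sup>2)"
    using lattice_term_bounds[OF z] by metis
  have sm: "eis_term z c summable_on UNIV" for c by (rule summable_on_int_bound[OF K])
  have pos: "(eis_term z c has_sum eis_row z c) UNIV" if c: "c > 0" for c
  proof -
    have eq: "eis_term z c = (\<lambda>d. 1 / (of_int c * z + of_int d)\<^sup>2)"
      using c by (auto simp: eis_term_def)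
    have "(eis_term z c has_sum - 4 * (of_real pi)\<^sup>2 * (exp (2 * of_real pi * \<i> * (of_int c * z)) /
        (1 - exp (2 * of_real pi * \<i> * (of_int c * z)))\<^sup>2)) UNIV"
      unfolding eq using c z sm[of c] by (intro has_sum_inverse_square_shift) (auto simp: eq)
    moreover have "exp (2 * of_real pi * \<i> * (of_int c * z)) = exp (2 * of_real pi * \<i> * z) ^ nat \<bar>c\<bar>"
      using c by (simp flip: exp_of_nat_mult add: mult_ac)
    ultimately show ?thesis using c by (simp add: eis_row_def Let_def)
  qed
  consider "c > 0" | "c = 0" | "c < 0" by linarith
  thus ?thesis
  proof cases
    case 2
    have "eis_term z 0 = (\<lambda>d. 1 / (of_int d)\<^sup>2)" by (auto simp: eis_term_def)
    thus ?thesis using has_sum_inverse_square_int 2 by (simp add: eis_row_def)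
  next
    case 3
    have *: "eis_term z (- c) (- d) = eis_term z c d" for d
    proof -
      have "of_int (- c) * z + of_int (- d) = - (of_int c * z + of_int d)" by simp
      thus ?thesis unfolding eis_term_def by (simp only: power2_minus) simp
    qed
    have "(eis_term z (- c) has_sum eis_row z (- c)) UNIV" using pos[of "- c"] 3 by simp
    hence "(eis_term z c has_sum eis_row z (- c)) UNIV"
      by (subst has_sum_reindex_bij_witness[of UNIV uminus uminus UNIV "eis_term z (- c)" _ _ "eis_row z (- c)"]) (auto simp: *)
    moreover have "eis_row z (- c) = eis_row z c" by (simp add: eis_row_def)
    ultimately show ?thesis by simp
  qed (rule pos)
qed

definition E2_fps :: "complex fps" where
  "E2_fps = Abs_fps (\<lambda>n. if n = 0 then 1 else - 24 * of_nat (sigma_one n))"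

lemma E2_fps_has_sum:
  assumes "((\<lambda>n. of_nat (sigma_one n) * q ^ n) has_sum t) {1..}"
  shows "((\<lambda>n. fps_nth E2_fps n * q ^ n) has_sum (1 - 24 * t)) UNIV"
proof -
  have "((\<lambda>n. fps_nth E2_fps n * q ^ n) has_sum (- 24 * t)) {1..}"
    using has_sum_cmult_right[OF assms, of "- 24"]
    by (rule iffD1[OF has_sum_cong, rotated]) (auto simp: E2_fps_def mult_ac)
  hence "((\<lambda>n. fps_nth E2_fps n * q ^ n) has_sum (fps_nth E2_fps 0 * q ^ 0 + - 24 * t)) (insert 0 {1..})"
    by (intro has_sum_insert) auto
  moreover have "insert 0 {1..} = (UNIV :: nat set)" by auto
  ultimately show ?thesis by (simp add: E2_fps_def)
qed

lemma fps_conv_radius_E2: "fps_conv_radius E2_fps \<ge> 1"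
  unfolding fps_conv_radius_def
proof (rule conv_radius_geI_ex')
  fix r :: real assume "0 < r" "ereal r < 1"
  hence "norm (of_real r :: complex) < 1" by simp
  then obtain t where "((\<lambda>n. of_nat (sigma_one n) * (of_real r :: complex) ^ n) has_sum t) {1..}"
    using lambert_sigma_one by blast
  thus "summable (\<lambda>n. fps_nth E2_fps n * of_real r ^ n)"
    using E2_fps_has_sum has_sum_imp_sums sums_summable by blast
qed

lemma eis_rows_has_sum:
  assumes z: "Im z > 0"
  shows "(eis_row z has_sum ((of_real pi)\<^sup>2 / 3 * eval_fps E2_fps (exp (2 * of_real pi * \<i> * z)))) UNIV"
proof -
  define q where "q = exp (2 * of_real pi * \<i> * z)"
  have "norm q < 1" using z by (simp add: q_def)
  then obtain t where t: "((\<lambda>c. q ^ c / (1 - q ^ c)\<^sup>2) has_sum t) {1..}"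
     "((\<lambda>n. of_nat (sigma_one n) * q ^ n) has_sum t) {1..}" using lambert_sigma_one by blast
  have E: "eval_fps E2_fps q = 1 - 24 * t"
    using has_sum_imp_sums[OF E2_fps_has_sum[OF t(2)]] by (simp add: eval_fps_def sums_iff)
  have r: "((\<lambda>c. eis_row z (int c)) has_sum (- 4 * (of_real pi)\<^sup>2 * t)) {1..}"
    using has_sum_cmult_right[OF t(1), of "- 4 * (of_real pi)\<^sup>2"]
    by (rule iffD1[OF has_sum_cong, rotated]) (auto simp: eis_row_def q_def Let_def)
  hence "((\<lambda>c. eis_row z (int c)) has_sum (eis_row z (int 0) + - 4 * (of_real pi)\<^sup>2 * t)) (insert 0 {1..})"
    by (intro has_sum_insert) auto
  moreover have "insert 0 {1..} = (UNIV :: nat set)" by auto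
  ultimately have 1: "((\<lambda>c. eis_row z (int c)) has_sum ((of_real pi)\<^sup>2 / 3 - 4 * (of_real pi)\<^sup>2 * t)) UNIV"
    by (simp add: eis_row_def)
  have 2: "((\<lambda>c. eis_row z (- int c - 1)) has_sum (- 4 * (of_real pi)\<^sup>2 * t)) UNIV"
    using r by (subst has_sum_reindex_bij_witness[of UNIV "\<lambda>m. m - 1" Suc "{1..}" "\<lambda>c. eis_row z (int c)" _ _ "- 4 * (of_real pi)\<^sup>2 * t"])
      (auto simp: eis_row_def nat_add_distrib Let_def)
  have "(of_real pi)\<^sup>2 / 3 * eval_fps E2_fps q = ((of_real pi)\<^sup>2 / 3 - 4 * (of_real pi)\<^sup>2 * t) + - 4 * (of_real pi)\<^sup>2 * t"
    by (simp add: E field_simps)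
  thus ?thesis using has_sum_int_split[OF 1 2] by (simp only: q_def)
qed

lemma has_sum_diff:
  fixes f g :: "'a \<Rightarrow> complex"
  assumes "(f has_sum a) A" "(g has_sum b) A"
  shows "((\<lambda>x. f x - g x) has_sum (a - b)) A"
  using has_sum_add[OF assms(1) has_sum_uminusI[OF assms(2)]] by simp

text \<open>Along a ray into the lower half plane \<open>exp (- 2 \<i> w)\<close> tends to zero.\<close>
lemma cot_at_bot_Im:
  assumes u: "Im u < 0"
  shows "(\<lambda>N. cot (u * (of_nat N + 1 / 2))) \<longlonglongrightarrow> \<i>"
proof -
  define p where "p = exp (- 2 * \<i> * u)"
  have p: "norm p < 1" using u by (simp add: p_def)
  have lim: "(\<lambda>N. exp (- \<i> * u) * p ^ N) \<longlonglongrightarrow> 0"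
    using tendsto_mult_left[OF LIMSEQ_power_zero[OF p], of "exp (- \<i> * u)"] by simp
  have "(\<lambda>N. \<i> * (1 + exp (- \<i> * u) * p ^ N) / (1 - exp (- \<i> * u) * p ^ N)) \<longlonglongrightarrow> \<i> * (1 + 0) / (1 - 0)"
    by (intro tendsto_intros lim) auto
  moreover have "\<i> * (1 + exp (- \<i> * u) * p ^ N) / (1 - exp (- \<i> * u) * p ^ N) = cot (u * (of_nat N + 1 / 2))" for N
  proof -
    define w where "w = u * (of_nat N + 1 / 2)"
    define E where "E = exp (\<i> * w)"
    have E: "E \<noteq> 0" "exp (- (\<i> * w)) = 1 / E" by (auto simp: E_def exp_minus inverse_eq_divide)
    have "- \<i> * u + of_nat N * (- 2 * \<i> * u) = - (\<i> * w) + - (\<i> * w)"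
      by (simp add: w_def algebra_simps)
    hence "exp (- \<i> * u) * p ^ N = exp (- (\<i> * w) + - (\<i> * w))"
      by (simp only: p_def exp_of_nat_mult[symmetric] exp_add[symmetric])
    also have "\<dots> = 1 / E\<^sup>2" unfolding exp_add E(2) by (simp add: power2_eq_square)
    finally have *: "exp (- \<i> * u) * p ^ N = 1 / E\<^sup>2" .
    have "cot w = (E + 1 / E) / 2 / ((E - 1 / E) / (2 * \<i>))"
      by (simp only: cot_def sin_exp_eq cos_exp_eq E(2) E_def[symmetric])
    also have "X / 2 / (Y / (2 * \<i>)) = \<i> * (X / Y)" for X Y :: complex
      by (cases "Y = 0") (simp_all add: field_simps)
    also have "E + 1 / E = E * (1 + 1 / E\<^sup>2)" using E(1) by (simp add: field_simps power2_eq_square)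
    also have "E - 1 / E = E * (1 - 1 / E\<^sup>2)" using E(1) by (simp add: field_simps power2_eq_square)
    finally show ?thesis unfolding * w_def[symmetric] using E(1) by simp
  qed
  ultimately show ?thesis by simp
qed

text \<open>
  Eisenstein's argument. The double series \<open>\<Sum> (c z + d)\<^sup>-\<^sup>2\<close> converges only conditionally, and
  passing from \<open>z\<close> to \<open>-1/z\<close> exchanges the order of summation. The telescoping perturbation
  \<open>((c z + d)\<^sup>2 - 1/4)\<inverse>\<close> makes the difference absolutely convergent; its own iterated sums are \<open>0\<close>
  if \<open>d\<close> is summed first and \<open>- 2 \<pi> \<i> / z\<close> if \<open>c\<close> is summed first, which accounts for the extra term.
\<close>
theorem E2_inversion:
  assumes z: "Im z > 0"
  shows "eval_fps E2_fps (exp (2 * of_real pi * \<i> * (- 1 / z)))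
       = z\<^sup>2 * eval_fps E2_fps (exp (2 * of_real pi * \<i> * z)) - 6 * \<i> * z / of_real pi"
proof -
  obtain K where K:
    "\<And>c d. cmod (tele_term z c d) \<le> K / (1 + (of_int d)\<^sup>2)"
    "\<And>c d. cmod (tele_term z c d) \<le> K / (1 + (of_int c)\<^sup>2)"
    "\<And>c d. cmod (eis_term z c d - tele_term z c d) \<le> K / ((1 + (of_int c)\<^sup>2) * (1 + (of_int d)\<^sup>2))"
    using lattice_term_bounds[OF z] by metis
  define g where "g = (\<lambda>(c, d). eis_term z c d - tele_term z c d)"
  have z0: "z \<noteq> 0" using z by auto
  have z': "Im (- 1 / z) > 0" using z z0 by (auto simp: Im_divide intro!: divide_pos_pos add_nonneg_pos)
  have nz: "of_int c * z + of_int d + of_real e \<noteq> 0" if "\<bar>e\<bar> = 1/2" for c d e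
  proof
    assume *: "of_int c * z + of_int d + of_real e = 0"
    hence "Im (of_int c * z + of_int d + of_real e) = 0" by simp
    hence "c = 0" using z by simp
    with * have "of_int d + of_real e = (0::complex)" by simp
    hence "Re (of_int d + of_real e) = 0" by simp
    hence "of_int d = - e" by simp
    hence "\<bar>of_int d\<bar> = (1/2 :: real)" using that by simp
    hence "of_int (2 * \<bar>d\<bar>) = (of_int 1 :: real)" by (simp only: of_int_mult of_int_abs)
    hence "2 * \<bar>d\<bar> = 1" by (simp only: of_int_eq_iff)
    thus False by presburger
  qed
  have tele: "tele_term z c d = 1 / (of_int c * z + of_int d - 1 / 2) - 1 / (of_int c * z + of_int d + 1 / 2)" for c d
  proof -
    define w where "w = of_int c * z + of_int d"
    have "w + 1/2 \<noteq> 0" "w - 1/2 \<noteq> 0" using nz[of "1/2" c d] nz[of "-1/2" c d] by (auto simp: w_def)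
    moreover have "w\<^sup>2 - 1/4 = (w + 1/2) * (w - 1/2)" by (simp add: power2_eq_square algebra_simps)
    ultimately show ?thesis unfolding tele_term_def w_def[symmetric] by (simp add: diff_frac_eq)
  qed
  \<comment> \<open>Summing over \<open>d\<close> first: the perturbation contributes \<open>0\<close>.\<close>
  have row: "(tele_term z c has_sum 0) UNIV" for c
  proof (rule has_sum_int_telescope)
    show "tele_term z c summable_on UNIV" by (rule summable_on_int_bound[OF K(1)])
    show "tele_term z c d = 1 / (of_int c * z + of_int d - 1 / 2) - 1 / (of_int c * z + of_int (d + 1) - 1 / 2)" for d
      unfolding tele by (simp add: algebra_simps)
    have 1: "(\<lambda>N. 1 / (of_int c * z + of_int (- int N) - 1 / 2)) \<longlonglongrightarrow> 0"
    proof -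
      have "(\<lambda>N. - inverse ((1/2 - of_int c * z) + of_nat N)) \<longlonglongrightarrow> - 0"
        by (intro tendsto_minus filterlim_compose[OF tendsto_inverse_0] tendsto_add_filterlim_at_infinity[OF tendsto_const] tendsto_of_nat)
      moreover have "1 / (of_int c * z + of_int (- int N) - 1 / 2) = - inverse ((1/2 - of_int c * z) + of_nat N)" for N
      proof -
        have "of_int c * z + of_int (- int N) - 1 / 2 = - ((1/2 - of_int c * z) + of_nat N)" by simp
        thus ?thesis by (simp only: inverse_eq_divide divide_minus_right)
      qed
      ultimately show ?thesis by simp
    qed
    have 2: "(\<lambda>N. 1 / (of_int c * z + of_int (int N + 1) - 1 / 2)) \<longlonglongrightarrow> 0"
    proof -
      have "(\<lambda>N. inverse ((of_int c * z + 1/2) + of_nat N)) \<longlonglongrightarrow> 0"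
        by (intro filterlim_compose[OF tendsto_inverse_0] tendsto_add_filterlim_at_infinity[OF tendsto_const] tendsto_of_nat)
      moreover have "of_int c * z + of_int (int N + 1) - 1 / 2 = (of_int c * z + 1/2) + of_nat N" for N by simp
      ultimately show ?thesis by (simp only: inverse_eq_divide)
    qed
    show "(\<lambda>N. 1 / (of_int c * z + of_int (- int N) - 1 / 2) - 1 / (of_int c * z + of_int (int N + 1) - 1 / 2)) \<longlonglongrightarrow> 0"
      using tendsto_diff[OF 1 2] by simp
  qed
  have gs: "g summable_on UNIV \<times> UNIV"
  proof -
    have "(\<lambda>p. norm (g p)) summable_on UNIV \<times> UNIV"
    proof (rule summable_on_comparison_test)
      show "(\<lambda>p. K * (case p of (c::int, d::int) \<Rightarrow> 1 / ((1 + (of_int c)\<^sup>2) * (1 + (of_int d)\<^sup>2)))) summable_on UNIV \<times> UNIV"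
        by (intro summable_on_cmult_right summable_inverse_product_int)
    qed (use K(3) in \<open>auto simp: g_def\<close>)
    thus ?thesis by (rule abs_summable_summable)
  qed
  define S where "S = infsum g (UNIV \<times> UNIV)"
  have gS: "(g has_sum S) (UNIV \<times> UNIV)" using gs by (simp add: S_def)
  have "(eis_row z has_sum S) UNIV"
  proof (rule has_sum_SigmaD[OF gS])
    show "((\<lambda>d. g (c, d)) has_sum eis_row z c) UNIV" for c
      using has_sum_diff[OF eis_row_has_sum[OF z, of c] row[of c]] by (simp add: g_def)
  qed
  hence S: "S = (of_real pi)\<^sup>2 / 3 * eval_fps E2_fps (exp (2 * of_real pi * \<i> * z))"
    using eis_rows_has_sum[OF z] has_sum_unique by blast
  \<comment> \<open>Summing over \<open>c\<close> first: the perturbation contributes a telescoping sum of cotangents, which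
    tend to \<open>\<plusminus>\<i>\<close> at the two ends.\<close>
  define \<psi> where "\<psi> = (\<lambda>d::int. of_real pi / z * cot (of_real pi * ((of_int d - 1 / 2) / z)))"
  have col_e: "((\<lambda>c. eis_term z c d) has_sum (eis_row (- 1 / z) d / z\<^sup>2)) UNIV" for d
  proof -
    have *: "eis_term z c d = inverse (z\<^sup>2) * eis_term (- 1 / z) d (- c)" for c
    proof -
      have "of_int d * (- 1 / z) + of_int (- c) = - (of_int c * z + of_int d) / z" using z0 by (simp add: field_simps)
      hence "(of_int d * (- 1 / z) + of_int (- c))\<^sup>2 = (of_int c * z + of_int d)\<^sup>2 / z\<^sup>2"
        by (simp only: power_divide power2_minus)
      thus ?thesis using z0 by (auto simp: eis_term_def inverse_eq_divide)
    qed
    have "((\<lambda>c. eis_term (- 1 / z) d (- c)) has_sum eis_row (- 1 / z) d) UNIV"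
      using eis_row_has_sum[OF z', of d]
      by (subst has_sum_reindex_bij_witness[of UNIV uminus uminus UNIV "eis_term (- 1 / z) d" _ _ "eis_row (- 1 / z) d"]) auto
    from has_sum_cmult_right[OF this, of "inverse (z\<^sup>2)"] show ?thesis
      by (simp add: * divide_inverse mult.commute)
  qed
  have col_b: "((\<lambda>c. tele_term z c d) has_sum (\<psi> d - \<psi> (d + 1))) UNIV" for d
  proof -
    define w where "w = (of_int d - 1 / 2) / z"
    define w' where "w' = (of_int d + 1 / 2) / z"
    have Im: "Im (of_real x / z) \<noteq> 0" if "x \<noteq> 0" for x :: real
      using z z0 that by (simp add: Im_divide complex_eq_iff)
    have hx: "of_int d - 1/2 \<noteq> (0::real)" "of_int d + 1/2 \<noteq> (0::real)"
    proof -
      have "of_int (2 * d) \<noteq> (of_int 1 :: real)" "of_int (2 * d) \<noteq> (of_int (- 1) :: real)"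
        unfolding of_int_eq_iff by presburger+
      thus "of_int d - 1/2 \<noteq> (0::real)" "of_int d + 1/2 \<noteq> (0::real)" by auto
    qed
    have w: "Im w \<noteq> 0" "Im w' \<noteq> 0" using Im[OF hx(1)] Im[OF hx(2)] by (simp_all add: w_def w'_def)
    have eq: "tele_term z c d = inverse z * (1 / (of_int c + w) - 1 / (of_int c + w'))" for c
    proof -
      have "of_int c + w = (of_int c * z + of_int d - 1 / 2) / z" "of_int c + w' = (of_int c * z + of_int d + 1 / 2) / z"
        using z0 by (simp_all add: w_def w'_def field_simps)
      thus ?thesis unfolding tele using z0 by (simp add: right_diff_distrib)
    qed
    have "(\<lambda>c. z * tele_term z c d) summable_on UNIV"
      by (intro summable_on_cmult_right summable_on_int_bound[OF K(2)])
    moreover have "(\<lambda>c. z * tele_term z c d) = (\<lambda>c. 1 / (of_int c + w) - 1 / (of_int c + w'))"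
      using z0 by (simp add: eq fun_eq_iff)
    ultimately have "(\<lambda>c::int. 1 / (of_int c + w) - 1 / (of_int c + w')) summable_on UNIV"
      by simp
    from has_sum_cmult_right[OF cot_difference_sums[OF w this], of "inverse z"]
    have "((\<lambda>c. tele_term z c d) has_sum
            (inverse z * (of_real pi * cot (of_real pi * w) - of_real pi * cot (of_real pi * w')))) UNIV"
      by (simp only: eq)
    moreover have "\<psi> d - \<psi> (d + 1) = inverse z * (of_real pi * cot (of_real pi * w) - of_real pi * cot (of_real pi * w'))"
    proof -
      have "of_int (d + 1) - 1 / 2 = (of_int d + 1 / 2 :: complex)" by simp
      hence "\<psi> (d + 1) = of_real pi / z * cot (of_real pi * w')" by (simp only: \<psi>_def w'_def)
      moreover have "\<psi> d = of_real pi / z * cot (of_real pi * w)" by (simp only: \<psi>_def w_def)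
      ultimately show ?thesis by (simp add: divide_inverse right_diff_distrib)
    qed
    ultimately show ?thesis by simp
  qed
  have "((\<lambda>(d, c). g (c, d)) has_sum S) (UNIV \<times> UNIV)" using gS by (subst (asm) has_sum_swap)
  hence swapped: "((\<lambda>d. eis_row (- 1 / z) d / z\<^sup>2 - (\<psi> d - \<psi> (d + 1))) has_sum S) UNIV"
  proof (rule has_sum_SigmaD)
    show "((\<lambda>c. case (d, c) of (d, c) \<Rightarrow> g (c, d)) has_sum (eis_row (- 1 / z) d / z\<^sup>2 - (\<psi> d - \<psi> (d + 1)))) UNIV" for d
      using has_sum_diff[OF col_e[of d] col_b[of d]] by (simp add: g_def del: diff_diff_eq2)
  qed
  define T where "T = (of_real pi)\<^sup>2 / 3 * eval_fps E2_fps (exp (2 * of_real pi * \<i> * (- 1 / z))) / z\<^sup>2"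
  have "((\<lambda>d. eis_row (- 1 / z) d / z\<^sup>2) has_sum T) UNIV"
    using has_sum_divide_const[OF eis_rows_has_sum[OF z'], of "z\<^sup>2"] by (simp add: T_def)
  from has_sum_diff[OF this swapped]
  have psi: "((\<lambda>d. \<psi> d - \<psi> (d + 1)) has_sum (T - S)) UNIV" by simp
  have "((\<lambda>d. \<psi> d - \<psi> (d + 1)) has_sum (- 2 * of_real pi * \<i> / z)) UNIV"
  proof (rule has_sum_int_telescope[OF has_sum_imp_summable[OF psi]])
    have u: "Im (of_real pi / z) < 0" using z z0 by (simp add: Im_divide divide_neg_pos complex_eq_iff add_pos_nonneg sum_power2_gt_zero_iff)
    have 1: "\<psi> (int N + 1) = of_real pi / z * cot (of_real pi / z * (of_nat N + 1 / 2))" for N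
    proof -
      have "of_real pi * ((of_int (int N + 1) - 1 / 2) / z) = of_real pi / z * (of_nat N + 1 / 2)" by simp
      thus ?thesis by (simp only: \<psi>_def)
    qed
    have 2: "\<psi> (- int N) = - \<psi> (int N + 1)" for N
    proof -
      have "of_int (- int N) - 1 / 2 = - (of_int (int N + 1) - 1 / 2 :: complex)" by simp
      hence *: "of_real pi * ((of_int (- int N) - 1 / 2) / z) = - (of_real pi * ((of_int (int N + 1) - 1 / 2) / z))"
        by (simp only: divide_minus_left mult_minus_right)
      show ?thesis unfolding \<psi>_def * cot_minus by simp
    qed
    have "(\<lambda>N. - 2 * (of_real pi / z * cot (of_real pi / z * (of_nat N + 1 / 2)))) \<longlonglongrightarrow> - 2 * (of_real pi / z * \<i>)"
      by (intro tendsto_intros cot_at_bot_Im u)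
    thus "(\<lambda>N. \<psi> (- int N) - \<psi> (int N + 1)) \<longlonglongrightarrow> - 2 * of_real pi * \<i> / z"
      unfolding 2 1 by (simp add: mult.assoc)
  qed auto
  with psi have "T - S = - 2 * of_real pi * \<i> / z" by (rule has_sum_unique)
  hence TS: "T = S - 2 * of_real pi * \<i> / z" by (simp add: algebra_simps)
  have "z\<^sup>2 * T = z\<^sup>2 * S - 2 * of_real pi * \<i> * z" unfolding TS using z0 by (simp add: right_diff_distrib power2_eq_square)
  hence *: "(of_real pi)\<^sup>2 * eval_fps E2_fps (exp (2 * of_real pi * \<i> * (- 1 / z))) 
     = (of_real pi)\<^sup>2 * (z\<^sup>2 * eval_fps E2_fps (exp (2 * of_real pi * \<i> * z))) - 6 * of_real pi * \<i> * z"
    using z0 unfolding T_def S by (simp add: field_simps)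
  have "(of_real pi :: complex)\<^sup>2 * (6 * \<i> * z / of_real pi) = 6 * of_real pi * \<i> * z"
    by (simp add: power2_eq_square)
  hence "(of_real pi)\<^sup>2 * eval_fps E2_fps (exp (2 * of_real pi * \<i> * (- 1 / z))) 
     = (of_real pi)\<^sup>2 * (z\<^sup>2 * eval_fps E2_fps (exp (2 * of_real pi * \<i> * z)) - 6 * \<i> * z / of_real pi)"
    unfolding right_diff_distrib * by simp
  thus ?thesis by (subst (asm) mult_cancel_left) auto
qed

section \<open>The modular group and its action on the upper half plane\<close>

abbreviation (input) upper_half :: "complex set" ("\<H>") where
  "\<H> \<equiv> upper_half_plane"

lemma in_UHP [simp]: "z \<in> \<H> \<longleftrightarrow> Im z > 0"
  by (simp add: upper_half_plane_def)

lemma open_UHP: "open \<H>" and convex_UHP: "convex \<H>"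
  unfolding upper_half_plane_def by (auto simp: open_halfspace_Im_gt convex_halfspace_Im_gt)

text \<open>Names for the entries of a matrix; the indexing infix also denotes coefficients of power series.\<close>
abbreviation (input) "m11 (A :: int^2^2) \<equiv> vec_nth (vec_nth A 1) 1"
abbreviation (input) "m12 (A :: int^2^2) \<equiv> vec_nth (vec_nth A 1) 2"
abbreviation (input) "m21 (A :: int^2^2) \<equiv> vec_nth (vec_nth A 2) 1"
abbreviation (input) "m22 (A :: int^2^2) \<equiv> vec_nth (vec_nth A 2) 2"

definition mat2 :: "int \<Rightarrow> int \<Rightarrow> int \<Rightarrow> int \<Rightarrow> int^2^2" where
  "mat2 a b c d = (\<chi> i j. if i = 1 then (if j = 1 then a else b) else (if j = 1 then c else d))"

lemma mat2_nth [simp]: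
  "m11 (mat2 a b c d) = a" "m12 (mat2 a b c d) = b"
  "m21 (mat2 a b c d) = c" "m22 (mat2 a b c d) = d"
  by (simp_all add: mat2_def)

lemma mat2_eqI: "m11 A = m11 B \<Longrightarrow> m12 A = m12 B \<Longrightarrow> m21 A = m21 B \<Longrightarrow> m22 A = m22 B \<Longrightarrow> A = B"
  for A B :: "int^2^2"
  by (auto simp: vec_eq_iff forall_2)

lemma mat2_mult_nth:
  "m11 (A ** B) = m11 A * m11 B + m12 A * m21 B" "m12 (A ** B) = m11 A * m12 B + m12 A * m22 B"
  "m21 (A ** B) = m21 A * m11 B + m22 A * m21 B" "m22 (A ** B) = m21 A * m12 B + m22 A * m22 B"
  by (simp_all add: matrix_matrix_mult_def sum_2)

lemma mat_one_nth: "m11 (mat 1 :: int^2^2) = 1" "m12 (mat 1 :: int^2^2) = 0"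
  "m21 (mat 1 :: int^2^2) = 0" "m22 (mat 1 :: int^2^2) = 1"
  by (simp_all add: mat_def)

lemma carrier_SL2Z: "\<gamma> \<in> carrier SL2Z \<longleftrightarrow> m11 \<gamma> * m22 \<gamma> - m12 \<gamma> * m21 \<gamma> = 1"
  by (simp add: SL2Z_def det_2)

lemma mult_SL2Z [simp]: "g \<otimes>\<^bsub>SL2Z\<^esub> h = g ** h" and one_SL2Z [simp]: "\<one>\<^bsub>SL2Z\<^esub> = mat 1"
  by (simp_all add: SL2Z_def)

lemma SL2Z_closed: "g \<in> carrier SL2Z \<Longrightarrow> h \<in> carrier SL2Z \<Longrightarrow> g ** h \<in> carrier SL2Z"
  by (simp add: SL2Z_def det_mul)

lemma group_SL2Z: "group SL2Z"
proof (rule groupI)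
  fix x assume x: "x \<in> carrier SL2Z"
  show "\<exists>y\<in>carrier SL2Z. y \<otimes>\<^bsub>SL2Z\<^esub> x = \<one>\<^bsub>SL2Z\<^esub>"
    by (rule bexI[of _ "mat2 (m22 x) (- m12 x) (- m21 x) (m11 x)"])
       (use x in \<open>auto intro!: mat2_eqI simp: carrier_SL2Z mat2_mult_nth mat_one_nth algebra_simps\<close>)
next
  fix x y z show "x \<otimes>\<^bsub>SL2Z\<^esub> y \<otimes>\<^bsub>SL2Z\<^esub> z = x \<otimes>\<^bsub>SL2Z\<^esub> (y \<otimes>\<^bsub>SL2Z\<^esub> z)"
    by (simp add: matrix_mul_assoc)
next
  fix x y assume "x \<in> carrier SL2Z" "y \<in> carrier SL2Z"
  thus "x \<otimes>\<^bsub>SL2Z\<^esub> y \<in> carrier SL2Z" unfolding mult_SL2Z by (rule SL2Z_closed)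
qed (simp_all add: mat_one_nth carrier_SL2Z)

lemma SL2Z_one: "mat 1 \<in> carrier SL2Z"
  by (simp add: SL2Z_def)

lemma automorphy_nonzero:
  assumes "\<gamma> \<in> carrier SL2Z" "z \<in> \<H>"
  shows "automorphy_factor \<gamma> z \<noteq> 0"
proof
  assume *: "automorphy_factor \<gamma> z = 0"
  hence "Im (automorphy_factor \<gamma> z) = 0" by simp
  hence "m21 \<gamma> = 0" using assms by (auto simp: automorphy_factor_def)
  moreover from this * have "m22 \<gamma> = 0" by (simp add: automorphy_factor_def)
  ultimately show False using assms(1) by (simp add: carrier_SL2Z)
qed

text \<open>
  The source of all transformation rules: \<open>z - w\<close> is multiplied by a factor in \<open>z\<close> and a factor in \<open>w\<close>.
\<close>
lemma moebius_diff:
  assumes g: "\<gamma> \<in> carrier SL2Z" "automorphy_factor \<gamma> z \<noteq> 0" "automorphy_factor \<gamma> w \<noteq> 0"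
  shows "moebius_action \<gamma> z - moebius_action \<gamma> w = (z - w) / (automorphy_factor \<gamma> z * automorphy_factor \<gamma> w)"
proof -
  have det: "of_int (m11 \<gamma>) * of_int (m22 \<gamma>) - of_int (m12 \<gamma>) * of_int (m21 \<gamma>) = (1 :: complex)"
    using g(1) unfolding carrier_SL2Z by (simp flip: of_int_mult of_int_diff)
  define a b c d :: complex where "a = of_int (m11 \<gamma>)" and "b = of_int (m12 \<gamma>)"
    and "c = of_int (m21 \<gamma>)" and "d = of_int (m22 \<gamma>)"
  have det': "a * d - b * c = 1" using det by (simp add: a_def b_def c_def d_def)
  have "(a * z + b) * (c * w + d) - (a * w + b) * (c * z + d) = (a * d - b * c) * (z - w)" by (simp add: algebra_simps)
  moreover have "c * z + d \<noteq> 0" "c * w + d \<noteq> 0" using g(2,3) by (auto simp: automorphy_factor_def c_def d_def)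
  ultimately show ?thesis unfolding moebius_action_def automorphy_factor_def
    by (simp add: diff_frac_eq det' flip: a_def b_def c_def d_def)
qed

lemma Im_moebius:
  assumes "\<gamma> \<in> carrier SL2Z" "z \<in> \<H>"
  shows "Im (moebius_action \<gamma> z) = Im z / (cmod (automorphy_factor \<gamma> z))\<^sup>2"
proof -
  define j where "j = automorphy_factor \<gamma> z"
  have j: "j \<noteq> 0" using automorphy_nonzero[OF assms] by (simp add: j_def)
  have cj: "automorphy_factor \<gamma> (cnj z) = cnj j" "moebius_action \<gamma> (cnj z) = cnj (moebius_action \<gamma> z)"
    by (simp_all add: automorphy_factor_def j_def moebius_action_def)
  have "moebius_action \<gamma> z - cnj (moebius_action \<gamma> z) = (z - cnj z) / (j * cnj j)"
    using moebius_diff[OF assms(1), of z "cnj z"] j by (simp add: cj j_def)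
  hence "2 * Im (moebius_action \<gamma> z) * \<i> = 2 * Im z * \<i> / of_real ((cmod j)\<^sup>2)"
    by (simp add: complex_diff_cnj complex_mult_cnj cmod_power2 del: of_real_power)
  hence "of_real (2 * Im (moebius_action \<gamma> z)) * \<i> = of_real (2 * Im z / (cmod j)\<^sup>2) * \<i>"
    by simp
  hence "of_real (2 * Im (moebius_action \<gamma> z)) = (of_real (2 * Im z / (cmod j)\<^sup>2) :: complex)"
    by (simp only: mult_cancel_right) simp
  thus ?thesis unfolding of_real_eq_iff j_def by simp
qed

lemma moebius_in_UHP [simp]:
  assumes "\<gamma> \<in> carrier SL2Z" "z \<in> \<H>"
  shows "Im (moebius_action \<gamma> z) > 0"
  using Im_moebius[OF assms] automorphy_nonzero[OF assms] assms(2) by simp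

lemma moebius_compose:
  assumes "g \<in> carrier SL2Z" "h \<in> carrier SL2Z" "z \<in> \<H>"
  shows "moebius_action (g ** h) z = moebius_action g (moebius_action h z)"
    and "automorphy_factor (g ** h) z = automorphy_factor g (moebius_action h z) * automorphy_factor h z"
proof -
  have h: "automorphy_factor h z \<noteq> 0" using automorphy_nonzero assms by blast
  have mz: "moebius_action h z * automorphy_factor h z = of_int (m11 h) * z + of_int (m12 h)"
    using h by (simp add: moebius_action_def)
  show 2: "automorphy_factor (g ** h) z = automorphy_factor g (moebius_action h z) * automorphy_factor h z"
  proof -
    have "automorphy_factor g (moebius_action h z) * automorphy_factor h z
      = of_int (m21 g) * (moebius_action h z * automorphy_factor h z) + of_int (m22 g) * automorphy_factor h z"
      by (simp add: automorphy_factor_def[of g] algebra_simps)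
    thus ?thesis unfolding mz by (simp add: automorphy_factor_def mat2_mult_nth algebra_simps)
  qed
  have g: "automorphy_factor g (moebius_action h z) \<noteq> 0" using automorphy_nonzero[OF assms(1)] assms by simp
  have 3: "(of_int (m11 g) * moebius_action h z + of_int (m12 g)) * automorphy_factor h z
     = of_int (m11 (g ** h)) * z + of_int (m12 (g ** h))"
  proof -
    have "(of_int (m11 g) * moebius_action h z + of_int (m12 g)) * automorphy_factor h z
      = of_int (m11 g) * (moebius_action h z * automorphy_factor h z) + of_int (m12 g) * automorphy_factor h z"
      by (simp add: algebra_simps)
    thus ?thesis unfolding mz by (simp add: automorphy_factor_def mat2_mult_nth algebra_simps)
  qed
  show "moebius_action (g ** h) z = moebius_action g (moebius_action h z)"
    unfolding moebius_action_def[of "g ** h"] moebius_action_def[of g] 2 3[symmetric] using h by simp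
qed

lemma moebius_one [simp]: "moebius_action (mat 1) z = z" "automorphy_factor (mat 1) z = 1"
  by (simp_all add: moebius_action_def automorphy_factor_def mat_one_nth)

lemma moebius_inv:
  assumes "\<gamma> \<in> carrier SL2Z" "z \<in> \<H>"
  shows "moebius_action \<gamma> (moebius_action (inv\<^bsub>SL2Z\<^esub> \<gamma>) z) = z"
        "moebius_action (inv\<^bsub>SL2Z\<^esub> \<gamma>) (moebius_action \<gamma> z) = z"
  using moebius_compose(1)[OF assms(1) group.inv_closed[OF group_SL2Z assms(1)] assms(2)]
        moebius_compose(1)[OF group.inv_closed[OF group_SL2Z assms(1)] assms(1) assms(2)]
        group.r_inv[OF group_SL2Z assms(1)] group.l_inv[OF group_SL2Z assms(1)] by simp_all

lemma has_field_derivative_moebius: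
  assumes "\<gamma> \<in> carrier SL2Z" "z \<in> \<H>"
  shows "(moebius_action \<gamma> has_field_derivative 1 / (automorphy_factor \<gamma> z)\<^sup>2) (at z)"
proof -
  have det: "of_int (m11 \<gamma>) * of_int (m22 \<gamma>) - of_int (m12 \<gamma>) * of_int (m21 \<gamma>) = (1 :: complex)"
    using assms(1) unfolding carrier_SL2Z by (simp flip: of_int_mult of_int_diff)
  have *: "of_int (m21 \<gamma>) * z + of_int (m22 \<gamma>) \<noteq> 0"
    using automorphy_nonzero[OF assms] by (simp add: automorphy_factor_def)
  have "(of_int (m11 \<gamma>) * (of_int (m21 \<gamma>) * z + of_int (m22 \<gamma>))
      - (of_int (m11 \<gamma>) * z + of_int (m12 \<gamma>)) * of_int (m21 \<gamma>) :: complex) = 1"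
    using det by (simp add: algebra_simps)
  thus ?thesis unfolding moebius_action_def automorphy_factor_def using *
    by (auto intro!: derivative_eq_intros simp: power2_eq_square mult_ac)
qed

lemma holomorphic_moebius: "\<gamma> \<in> carrier SL2Z \<Longrightarrow> moebius_action \<gamma> holomorphic_on \<H>"
  using has_field_derivative_moebius[of \<gamma>] by (auto simp: holomorphic_on_open[OF open_UHP] intro!: exI)

definition S_mat :: "int^2^2" where "S_mat = mat2 0 (- 1) 1 0"
definition T_mat :: "int \<Rightarrow> int^2^2" where "T_mat k = mat2 1 k 0 1"

lemma S_T_in_SL2Z [simp, intro]: "S_mat \<in> carrier SL2Z" "T_mat k \<in> carrier SL2Z"
  unfolding carrier_SL2Z by (simp_all add: S_mat_def T_mat_def)

lemma moebius_S_T [simp]: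
  "moebius_action S_mat z = - 1 / z" "automorphy_factor S_mat z = z"
  "moebius_action (T_mat k) z = z + of_int k" "automorphy_factor (T_mat k) z = 1"
  by (simp_all add: moebius_action_def automorphy_factor_def S_mat_def T_mat_def)

text \<open>
  The Euclidean algorithm on the first column: a translation reduces the upper entry modulo the
  lower one, and \<open>S_mat\<close> exchanges them.
\<close>
lemma SL2Z_generated [consumes 1, case_names one S T T']:
  assumes "\<gamma> \<in> carrier SL2Z"
    and one: "P (mat 1)"
    and S: "\<And>g. g \<in> carrier SL2Z \<Longrightarrow> P g \<Longrightarrow> P (S_mat ** g)"
    and T: "\<And>g. g \<in> carrier SL2Z \<Longrightarrow> P g \<Longrightarrow> P (T_mat 1 ** g)"
    and T': "\<And>g. g \<in> carrier SL2Z \<Longrightarrow> P g \<Longrightarrow> P (T_mat (- 1) ** g)"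
  shows "P \<gamma>"
proof -
  have Tk: "P (T_mat k ** g)" if "g \<in> carrier SL2Z" "P g" for k g
  proof (induction k rule: int_induct[where k = 0])
    case base
    have "T_mat 0 ** g = g" by (rule mat2_eqI) (simp_all add: T_mat_def mat2_mult_nth)
    thus ?case using that by simp
  next
    case (step1 i)
    have "T_mat (i + 1) ** g = T_mat 1 ** (T_mat i ** g)"
      by (rule mat2_eqI) (simp_all add: T_mat_def mat2_mult_nth algebra_simps)
    thus ?case using T[OF SL2Z_closed[OF S_T_in_SL2Z(2) that(1)] step1(2)] by simp
  next
    case (step2 i)
    have "T_mat (i - 1) ** g = T_mat (- 1) ** (T_mat i ** g)"
      by (rule mat2_eqI) (simp_all add: T_mat_def mat2_mult_nth algebra_simps)
    thus ?case using T'[OF SL2Z_closed[OF S_T_in_SL2Z(2) that(1)] step2(2)] by simp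
  qed
  have S3: "P g" if "g \<in> carrier SL2Z" "P (S_mat ** g)" for g
  proof -
    have "S_mat ** (S_mat ** (S_mat ** (S_mat ** g))) = g"
      by (rule mat2_eqI) (simp_all add: S_mat_def mat2_mult_nth)
    moreover have "P (S_mat ** (S_mat ** (S_mat ** (S_mat ** g))))"
      using S[OF _ S[OF _ S[OF _ that(2)]]] that(1) by (simp add: SL2Z_closed)
    ultimately show ?thesis by simp
  qed
  from assms(1) show ?thesis
  proof (induction "nat \<bar>m21 \<gamma>\<bar>" arbitrary: \<gamma> rule: less_induct)
    case less
    define a b c d where "a = m11 \<gamma>" and "b = m12 \<gamma>" and "c = m21 \<gamma>" and "d = m22 \<gamma>"
    note abcd = a_def b_def c_def d_def
    have det: "a * d - b * c = 1" using less.prems by (simp add: abcd carrier_SL2Z)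
    show ?case
    proof (cases "c = 0")
      case True
      hence ad: "a * d = 1" using det by simp
      hence "a = 1 \<and> d = 1 \<or> a = - 1 \<and> d = - 1" by (auto simp: zmult_eq_1_iff)
      thus ?thesis
      proof
        assume "a = 1 \<and> d = 1"
        hence "\<gamma> = T_mat b ** mat 1" using True by (intro mat2_eqI) (simp_all add: abcd T_mat_def mat2_mult_nth mat_one_nth)
        thus ?thesis using Tk[OF SL2Z_one one] by simp
      next
        assume "a = - 1 \<and> d = - 1"
        hence *: "\<gamma> = T_mat (- b) ** (S_mat ** (S_mat ** mat 1))" using True
          by (intro mat2_eqI) (simp_all add: abcd T_mat_def S_mat_def mat2_mult_nth mat_one_nth)
        have "P (S_mat ** (S_mat ** mat 1))"
          using S[OF _ S[OF SL2Z_one one]] SL2Z_one by (simp add: SL2Z_closed)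
        moreover have "S_mat ** (S_mat ** mat 1) \<in> carrier SL2Z" by (intro SL2Z_closed SL2Z_one S_T_in_SL2Z)
        ultimately show ?thesis unfolding * using Tk by blast
      qed
    next
      case False
      define k where "k = - (a div c)"
      define g where "g = S_mat ** (T_mat k ** \<gamma>)"
      have g: "g \<in> carrier SL2Z" unfolding g_def using less.prems by (intro SL2Z_closed) auto
      have "m21 g = a mod c"
        by (simp add: g_def S_mat_def T_mat_def mat2_mult_nth k_def abcd minus_div_mult_eq_mod[symmetric])
      hence "nat \<bar>m21 g\<bar> < nat \<bar>c\<bar>" using False abs_mod_less[of c a] by simp
      hence "P g" using less.hyps[of g] g by (simp add: c_def)
      hence "P (T_mat k ** \<gamma>)" unfolding g_def using S3[OF SL2Z_closed[OF S_T_in_SL2Z(2) less.prems]] by blast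
      hence "P (T_mat (- k) ** (T_mat k ** \<gamma>))" using Tk[OF SL2Z_closed[OF S_T_in_SL2Z(2) less.prems]] by blast
      moreover have "T_mat (- k) ** (T_mat k ** \<gamma>) = \<gamma>"
        by (rule mat2_eqI) (simp_all add: T_mat_def mat2_mult_nth algebra_simps)
      ultimately show ?thesis by simp
    qed
  qed
qed

text \<open>
  In every orbit the imaginary part attains its maximum, because \<open>Im (\<gamma> z) = Im z / \<bar>c z + d\<bar>\<^sup>2\<close> and
  only finitely many pairs \<open>(c, d)\<close> give \<open>\<bar>c z + d\<bar> \<le> 1\<close>. At a maximum with \<open>\<bar>Re\<bar> \<le> 1/2\<close> the
  modulus is at least \<open>1\<close>, since otherwise the inversion would increase the imaginary part.
\<close>
lemma orbit_meets_high_strip: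
  assumes z: "z \<in> \<H>"
  obtains \<gamma> where "\<gamma> \<in> carrier SL2Z" "Im (moebius_action \<gamma> z) \<ge> 1 / 2"
proof -
  obtain \<delta> where \<delta>: "\<delta> > 0" "\<And>x y :: real. cmod (of_real x * z + of_real y) \<ge> \<delta> * (\<bar>x\<bar> + \<bar>y\<bar>)"
    using real_linear_form_coercive[of z] z by auto
  define A where "A = {(c, d). \<exists>\<gamma>\<in>carrier SL2Z. m21 \<gamma> = c \<and> m22 \<gamma> = d \<and> cmod (automorphy_factor \<gamma> z) \<le> 1}"
  have "A \<subseteq> {- \<lceil>1 / \<delta>\<rceil>..\<lceil>1 / \<delta>\<rceil>} \<times> {- \<lceil>1 / \<delta>\<rceil>..\<lceil>1 / \<delta>\<rceil>}"
  proof safe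
    fix c d assume "(c, d) \<in> A"
    then obtain \<gamma> where "m21 \<gamma> = c" "m22 \<gamma> = d" "cmod (automorphy_factor \<gamma> z) \<le> 1" by (auto simp: A_def)
    hence "cmod (of_int c * z + of_int d) \<le> 1" by (simp add: automorphy_factor_def)
    hence "\<delta> * (\<bar>of_int c\<bar> + \<bar>of_int d\<bar>) \<le> 1" using \<delta>(2)[of "of_int c" "of_int d"] by simp
    hence *: "\<bar>of_int c\<bar> + \<bar>of_int d\<bar> \<le> 1 / \<delta>" using \<delta>(1) by (simp add: field_simps)
    have "of_int \<bar>c\<bar> \<le> 1 / \<delta>" "of_int \<bar>d\<bar> \<le> 1 / \<delta>" using * by auto
    hence "\<bar>c\<bar> \<le> \<lceil>1 / \<delta>\<rceil>" "\<bar>d\<bar> \<le> \<lceil>1 / \<delta>\<rceil>" by linarith+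
    thus "c \<in> {- \<lceil>1 / \<delta>\<rceil>..\<lceil>1 / \<delta>\<rceil>}" "d \<in> {- \<lceil>1 / \<delta>\<rceil>..\<lceil>1 / \<delta>\<rceil>}" by auto
  qed
  hence finA: "finite A" by (rule finite_subset) auto
  have "(0, 1) \<in> A" unfolding A_def using SL2Z_one
    by (auto simp: mat_one_nth intro!: bexI[of _ "mat 1"])
  hence neA: "A \<noteq> {}" by auto
  obtain p where p: "p \<in> A" "\<And>x. x \<in> A \<Longrightarrow> cmod (of_int (fst p) * z + of_int (snd p)) \<le> cmod (of_int (fst x) * z + of_int (snd x))"
    using ex_is_arg_min_if_finite[OF finA neA, of "\<lambda>x. cmod (of_int (fst x) * z + of_int (snd x))"]
    by (auto simp: is_arg_min_linorder)
  from p(1) obtain \<gamma> where \<gamma>: "\<gamma> \<in> carrier SL2Z" "m21 \<gamma> = fst p" "m22 \<gamma> = snd p" "cmod (automorphy_factor \<gamma> z) \<le> 1"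
    by (auto simp: A_def)
  have min: "cmod (automorphy_factor \<gamma> z) \<le> cmod (automorphy_factor g z)" if "g \<in> carrier SL2Z" for g
  proof (cases "cmod (automorphy_factor g z) \<le> 1")
    case True
    hence "(m21 g, m22 g) \<in> A" using that by (auto simp: A_def)
    from p(2)[OF this] show ?thesis by (simp add: automorphy_factor_def \<gamma>)
  qed (use \<gamma>(4) in linarith)
  define k where "k = - round (Re (moebius_action \<gamma> z))"
  define g where "g = T_mat k ** \<gamma>"
  define w where "w = moebius_action g z"
  have g: "g \<in> carrier SL2Z" unfolding g_def by (intro SL2Z_closed \<gamma>) auto
  have wH: "Im w > 0" unfolding w_def by (rule moebius_in_UHP[OF g z])
  have w: "w = moebius_action \<gamma> z + of_int k" unfolding w_def g_def
    by (subst moebius_compose(1)[OF _ \<gamma>(1) z]) auto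
  have ag: "automorphy_factor g z = automorphy_factor \<gamma> z" unfolding g_def
    by (subst moebius_compose(2)[OF _ \<gamma>(1) z]) auto
  have re: "\<bar>Re w\<bar> \<le> 1 / 2" using of_int_round_abs_le[of "Re (moebius_action \<gamma> z)"]
    by (simp add: w k_def abs_minus_commute)
  have "cmod (automorphy_factor g z) \<le> cmod (automorphy_factor (S_mat ** g) z)"
    unfolding ag by (intro min SL2Z_closed g) auto
  also have "automorphy_factor (S_mat ** g) z = w * automorphy_factor g z"
    unfolding w_def by (subst moebius_compose(2)[OF _ g z]) auto
  finally have w1: "cmod w \<ge> 1" using automorphy_nonzero[OF g z] by (simp add: norm_mult)
  have "(1/2)\<^sup>2 \<le> (Im w)\<^sup>2"
  proof -
    have re2: "(Re w)\<^sup>2 \<le> (1/2)\<^sup>2" using re by (metis abs_le_square_iff abs_of_nonneg zero_le_divide_1_iff zero_le_numeral)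
    have "1 \<le> (cmod w)\<^sup>2" using w1 by (rule one_le_power)
    hence "1 \<le> (Re w)\<^sup>2 + (Im w)\<^sup>2" by (simp only: cmod_power2)
    with re2 show ?thesis by (simp add: power2_eq_square)
  qed
  hence "1/2 \<le> Im w" using wH by (rule power2_le_imp_le[OF _ less_imp_le])
  thus ?thesis using that[OF g] by (simp add: w_def)
qed

text \<open>The two substitutions generate the group, and the automorphy factor is multiplicative.\<close>
lemma modular_from_generators:
  assumes f: "\<And>z. Im z > 0 \<Longrightarrow> f (z + 1) = f z" "\<And>z. Im z > 0 \<Longrightarrow> f (- 1 / z) = z powi m * f z"
    and "\<gamma> \<in> carrier SL2Z" "Im z > 0"
  shows "f (moebius_action \<gamma> z) = automorphy_factor \<gamma> z powi m * (f z :: complex)"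
  using assms(3)
proof (induction rule: SL2Z_generated)
  case one
  thus ?case by simp
next
  case (S g)
  note c = moebius_compose[OF S_T_in_SL2Z(1) S(1), of z]
  have "Im (moebius_action g z) > 0" using moebius_in_UHP[OF S(1)] assms(4) by simp
  thus ?case using S(2) c assms(4) f(2)[of "moebius_action g z"] by (simp add: power_int_mult_distrib)
next
  case (T g)
  note c = moebius_compose[OF S_T_in_SL2Z(2)[of 1] T(1), of z]
  have "Im (moebius_action g z) > 0" using moebius_in_UHP[OF T(1)] assms(4) by simp
  thus ?case using T(2) c assms(4) by (simp add: f(1))
next
  case (T' g)
  note c = moebius_compose[OF S_T_in_SL2Z(2)[of "- 1"] T'(1), of z]
  have "Im (moebius_action g z) > 0" using moebius_in_UHP[OF T'(1)] assms(4) by simp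
  thus ?case using T'(2) c assms(4) f(1)[of "moebius_action g z - 1"] by simp
qed

section \<open>Modular functions and their expansions at the cusp\<close>

definition nome :: "complex \<Rightarrow> complex" where
  "nome z = exp (2 * of_real pi * \<i> * z)"

lemma nome_nonzero [simp]: "nome z \<noteq> 0"
  and norm_nome_less_1 [simp]: "Im z > 0 \<Longrightarrow> norm (nome z) < 1"
  and nome_plus_1 [simp]: "nome (z + 1) = nome z"
  by (auto simp: nome_def distrib_left exp_add)

lemma has_field_derivative_nome [derivative_intros]:
  "(f has_field_derivative f') (at z within A) \<Longrightarrow>
   ((\<lambda>z. nome (f z)) has_field_derivative (2 * of_real pi * \<i> * nome (f z) * f')) (at z within A)"
  unfolding nome_def by (auto intro!: derivative_eq_intros simp: algebra_simps)

lemma nome_surj: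
  assumes "q \<noteq> 0" "norm q < 1"
  obtains z where "Im z > 0" "nome z = q"
proof
  define z where "z = Ln q / (2 * of_real pi * \<i>)"
  show "nome z = q" using assms by (simp add: nome_def z_def)
  have "z = - \<i> * Ln q / of_real (2 * pi)" by (simp add: z_def divide_simps)
  hence "Im z = - ln (norm q) / (2 * pi)" using assms by simp
  thus "Im z > 0" using assms by (simp add: divide_neg_pos ln_less_zero_iff)
qed

lemma fps_conv_radius_ge_1D: "fps_conv_radius F \<ge> 1 \<Longrightarrow> norm q < 1 \<Longrightarrow> ereal (norm q) < fps_conv_radius F"
  by (erule less_le_trans[rotated]) (simp add: one_ereal_def)

lemma fps_conv_radius_ge_1_arith:
  assumes "fps_conv_radius F \<ge> 1" "fps_conv_radius G \<ge> 1"
  shows "fps_conv_radius (F + G :: complex fps) \<ge> 1" "fps_conv_radius (F - G) \<ge> 1"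
    "fps_conv_radius (F * G) \<ge> 1"
proof -
  have "1 \<le> min (fps_conv_radius F) (fps_conv_radius G)" using assms by simp
  thus "fps_conv_radius (F + G) \<ge> 1" "fps_conv_radius (F - G) \<ge> 1" "fps_conv_radius (F * G) \<ge> 1"
    by (blast intro: order_trans fps_conv_radius_add fps_conv_radius_diff fps_conv_radius_mult)+
qed

lemma fps_conv_radius_ge_1_deriv:
  "fps_conv_radius F \<ge> 1 \<Longrightarrow> fps_conv_radius (fps_deriv F :: complex fps) \<ge> 1"
  by (rule order_trans[OF _ fps_conv_radius_deriv])

lemmas fps_conv_radius_ge_1_intros = fps_conv_radius_ge_1_arith fps_conv_radius_ge_1_deriv

text \<open>An expansion \<open>f = q\<^sup>r F(q)\<close>; the constant coefficient of \<open>F\<close> may vanish.\<close>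
definition q_expansion :: "(complex \<Rightarrow> complex) \<Rightarrow> int \<Rightarrow> complex fps \<Rightarrow> bool" where
  "q_expansion f r F \<longleftrightarrow> fps_conv_radius F \<ge> 1 \<and> (\<forall>z\<in>\<H>. f z = nome z powi r * eval_fps F (nome z))"

lemma q_expansionD:
  assumes "q_expansion f r F"
  shows "fps_conv_radius F \<ge> 1" "Im z > 0 \<Longrightarrow> f z = nome z powi r * eval_fps F (nome z)"
    "Im z > 0 \<Longrightarrow> ereal (norm (nome z)) < fps_conv_radius F"
  using assms fps_conv_radius_ge_1D[of F "nome z"] by (auto simp: q_expansion_def)

lemma q_expansion_mult:
  assumes "q_expansion f r F" "q_expansion g s G"
  shows "q_expansion (\<lambda>z. f z * g z) (r + s) (F * G)"
  using assms q_expansionD[OF assms(1)] q_expansionD[OF assms(2)]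
  by (auto simp: q_expansion_def eval_fps_mult power_int_add fps_conv_radius_ge_1_intros)

lemma q_expansion_lower:
  assumes "q_expansion f r F" "s \<le> r"
  shows "q_expansion f s (fps_X ^ nat (r - s) * F)"
proof -
  have "nome z powi r = nome z powi s * nome z ^ nat (r - s)" for z
    using assms(2) by (simp flip: power_int_of_nat power_int_add)
  thus ?thesis using assms q_expansionD[OF assms(1)]
    by (auto simp: q_expansion_def eval_fps_mult fps_conv_radius_ge_1_intros)
qed

lemma q_expansion_add:
  assumes "q_expansion f r F" "q_expansion g r G"
  shows "q_expansion (\<lambda>z. f z + g z) r (F + G)"
  using assms q_expansionD[OF assms(1)] q_expansionD[OF assms(2)]
  by (auto simp: q_expansion_def eval_fps_add distrib_left fps_conv_radius_ge_1_intros)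

lemma q_expansion_const: "q_expansion (\<lambda>z. c) 0 (fps_const c)"
  by (simp add: q_expansion_def)

lemma q_expansion_cmult:
  assumes "q_expansion f r F"
  shows "q_expansion (\<lambda>z. c * f z) r (fps_const c * F)"
  using q_expansion_mult[OF q_expansion_const assms] by simp

lemma q_expansion_cong:
  assumes "q_expansion f r F" "\<And>z. Im z > 0 \<Longrightarrow> f z = g z"
  shows "q_expansion g r F"
  using assms by (simp add: q_expansion_def)

lemma eval_fps_eq_punctured:
  assumes F: "fps_conv_radius F \<ge> 1" and G: "fps_conv_radius G \<ge> 1"
    and eq: "\<And>z. Im z > 0 \<Longrightarrow> eval_fps F (nome z) = eval_fps G (nome z)"
  shows "F = G"
proof (rule eval_fps_eqD)
  have pos: "fps_conv_radius F > 0" "fps_conv_radius G > 0"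
    using F G by (auto intro: less_le_trans[of 0 1])
  thus "fps_conv_radius F > 0" "fps_conv_radius G > 0" .
  have ev: "\<forall>\<^sub>F q in at 0. eval_fps F q = eval_fps G q"
    unfolding eventually_at
  proof (intro exI[of _ 1] conjI ballI impI)
    fix q :: complex assume "q \<noteq> 0 \<and> dist q 0 < 1"
    then obtain z where "Im z > 0" "nome z = q" using nome_surj[of q] by auto
    thus "eval_fps F q = eval_fps G q" using eq by auto
  qed simp
  have "isCont (eval_fps F) 0" "isCont (eval_fps G) 0"
    using pos by (auto intro!: continuous_eval_fps simp: zero_ereal_def)
  hence "eval_fps F \<midarrow>0\<rightarrow> eval_fps F 0" "eval_fps G \<midarrow>0\<rightarrow> eval_fps G 0" by (auto simp: isCont_def)
  moreover have "eval_fps G \<midarrow>0\<rightarrow> eval_fps F 0" using calculation(1) ev by (rule Lim_transform_eventually)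
  ultimately have "eval_fps F 0 = eval_fps G 0" using LIM_unique by blast
  with ev show "\<forall>\<^sub>F z in nhds 0. eval_fps F z = eval_fps G z"
    by (auto simp: eventually_at_filter elim: eventually_mono)
qed

lemma q_expansion_unique:
  assumes "q_expansion f r F" "q_expansion f r G"
  shows "F = G"
  using assms by (intro eval_fps_eq_punctured) (auto simp: q_expansion_def)

lemma has_field_derivative_q_expansion:
  assumes "q_expansion f r F" and z: "Im z > 0"
  shows "(f has_field_derivative 2 * of_real pi * \<i> *
    (nome z powi r * eval_fps (fps_const (of_int r) * F + fps_X * fps_deriv F) (nome z))) (at z)"
proof -
  note F = q_expansionD[OF assms(1)]
  have "((\<lambda>z. nome z powi r * eval_fps F (nome z)) has_field_derivative
      (of_int r * nome z powi (r - 1) * (2 * of_real pi * \<i> * nome z) * eval_fps F (nome z)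
        + nome z powi r * (eval_fps (fps_deriv F) (nome z) * (2 * of_real pi * \<i> * nome z)))) (at z)"
    using z F(3)[of z] by (auto intro!: derivative_eq_intros DERIV_chain2[OF has_field_derivative_eval_fps] simp: algebra_simps)
  also have "of_int r * nome z powi (r - 1) * (2 * of_real pi * \<i> * nome z) * eval_fps F (nome z)
        + nome z powi r * (eval_fps (fps_deriv F) (nome z) * (2 * of_real pi * \<i> * nome z))
     = 2 * of_real pi * \<i> * (nome z powi r * (of_int r * eval_fps F (nome z) + nome z * eval_fps (fps_deriv F) (nome z)))"
    by (simp add: power_int_diff field_simps)
  also have "of_int r * eval_fps F (nome z) + nome z * eval_fps (fps_deriv F) (nome z)
     = eval_fps (fps_const (of_int r) * F + fps_X * fps_deriv F) (nome z)"
    using z F(1)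
    by (simp add: eval_fps_add eval_fps_mult fps_conv_radius_ge_1D fps_conv_radius_ge_1_intros)
  finally show ?thesis
    by (rule has_field_derivative_transform_within_open[OF _ open_UHP]) (use z F(2) in auto)
qed

lemma holomorphic_q_expansion:
  assumes "q_expansion f r F"
  shows "f holomorphic_on \<H>"
  unfolding holomorphic_on_open[OF open_UHP]
proof
  fix z assume "z \<in> \<H>"
  thus "\<exists>f'. (f has_field_derivative f') (at z)"
    using has_field_derivative_q_expansion[OF assms, of z] by auto
qed

lemma q_expansion_qderiv:
  assumes "q_expansion f r F"
  shows "q_expansion (qderiv f) r (fps_const (of_int r) * F + fps_X * fps_deriv F)"
  using q_expansionD(1)[OF assms] DERIV_imp_deriv[OF has_field_derivative_q_expansion[OF assms]]
  by (auto simp: q_expansion_def qderiv_def intro!: fps_conv_radius_ge_1_intros)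

definition modular_functions :: "int \<Rightarrow> (complex \<Rightarrow> complex) set" where
  "modular_functions m = {f. (\<forall>z. z \<notin> \<H> \<longrightarrow> f z = 0) \<and> f holomorphic_on \<H> \<and>
     (\<forall>\<gamma>\<in>carrier SL2Z. \<forall>z\<in>\<H>. f (moebius_action \<gamma> z) = automorphy_factor \<gamma> z powi m * f z)}"

lemma modular_functionsD:
  assumes "f \<in> modular_functions m"
  shows "z \<notin> \<H> \<Longrightarrow> f z = 0" "f holomorphic_on \<H>"
    "\<gamma> \<in> carrier SL2Z \<Longrightarrow> z \<in> \<H> \<Longrightarrow> f (moebius_action \<gamma> z) = automorphy_factor \<gamma> z powi m * f z"
    "Im z > 0 \<Longrightarrow> f (z + 1) = f z"
    "Im z > 0 \<Longrightarrow> f (- 1 / z) = z powi m * f z"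
proof -
  show "z \<notin> \<H> \<Longrightarrow> f z = 0" "f holomorphic_on \<H>"
    "\<gamma> \<in> carrier SL2Z \<Longrightarrow> z \<in> \<H> \<Longrightarrow> f (moebius_action \<gamma> z) = automorphy_factor \<gamma> z powi m * f z" for \<gamma>
    using assms by (auto simp: modular_functions_def)
  from this(3)[of "T_mat 1"] show "Im z > 0 \<Longrightarrow> f (z + 1) = f z" by simp
  have "S_mat \<in> carrier SL2Z \<Longrightarrow> z \<in> \<H> \<Longrightarrow> f (moebius_action S_mat z) = automorphy_factor S_mat z powi m * f z"
    using assms unfolding modular_functions_def by blast
  thus "Im z > 0 \<Longrightarrow> f (- 1 / z) = z powi m * f z" by simp
qed

lemma modular_functionsI:
  assumes "\<And>z. z \<notin> \<H> \<Longrightarrow> f z = 0" "f holomorphic_on \<H>"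
    and "\<And>z. Im z > 0 \<Longrightarrow> f (z + 1) = f z" "\<And>z. Im z > 0 \<Longrightarrow> f (- 1 / z) = z powi m * f z"
  shows "f \<in> modular_functions m"
  using assms modular_from_generators[of f m] by (auto simp: modular_functions_def)

lemma modular_functions_mult:
  assumes "f \<in> modular_functions k" "g \<in> modular_functions l"
  shows "(\<lambda>z. f z * g z) \<in> modular_functions (k + l)"
proof (rule modular_functionsI)
  fix z :: complex assume "Im z > 0"
  moreover from this have "z \<noteq> 0" by auto
  ultimately show "f (- 1 / z) * g (- 1 / z) = z powi (k + l) * (f z * g z)"
    by (simp only: modular_functionsD[OF assms(1)] modular_functionsD[OF assms(2)] power_int_add) (simp add: power_int_add)
qed (use modular_functionsD[OF assms(1)] modular_functionsD[OF assms(2)] in \<open>auto intro!: holomorphic_intros\<close>)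

lemma modular_functions_add:
  assumes "f \<in> modular_functions k" "g \<in> modular_functions k"
  shows "(\<lambda>z. f z + g z) \<in> modular_functions k"
  using assms by (auto simp: modular_functions_def distrib_left intro!: holomorphic_intros)

lemma modular_functions_cmult:
  "f \<in> modular_functions k \<Longrightarrow> (\<lambda>z. c * f z) \<in> modular_functions k"
  by (auto simp: modular_functions_def intro!: holomorphic_intros)

lemma modular_functions_odd:
  assumes f: "f \<in> modular_functions m" and "odd m"
  shows "f z = 0"
proof (cases "z \<in> \<H>")
  case True
  have g: "mat2 (- 1) 0 0 (- 1) \<in> carrier SL2Z" by (simp add: carrier_SL2Z)
  have "f z = (- 1) powi m * f z"
    using modular_functionsD(3)[OF f g True] by (simp add: moebius_action_def automorphy_factor_def)
  thus ?thesis using assms(2) by (simp add: power_int_minus_left)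
qed (use modular_functionsD(1)[OF f] in auto)

text \<open>
  Weakly holomorphic forms with expansion coefficients in \<open>K\<close>. Only \<open>K = \<rat>\<close> and \<open>K = UNIV\<close> occur: the
  second space turns out to be the complexification of the first.
\<close>
definition forms_over :: "complex set \<Rightarrow> int \<Rightarrow> (complex \<Rightarrow> complex) set" where
  "forms_over K m = {f \<in> modular_functions m. \<exists>r F. q_expansion f r F \<and> (\<forall>k. fps_nth F k \<in> K)}"

lemma forms_overD: "f \<in> forms_over K m \<Longrightarrow> f \<in> modular_functions m"
  by (simp add: forms_over_def)

lemma forms_over_UNIV: "f \<in> forms_over UNIV m \<longleftrightarrow> f \<in> modular_functions m \<and> (\<exists>r F. q_expansion f r F)"
  by (simp add: forms_over_def)

lemma forms_over_mono: "f \<in> forms_over K m \<Longrightarrow> f \<in> forms_over UNIV m"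
  by (auto simp: forms_over_def)

lemma forms_over_holomorphic: "f \<in> forms_over K m \<Longrightarrow> f holomorphic_on \<H>"
  by (auto simp: forms_over_def dest: modular_functionsD(2))

lemma forms_overI:
  "f \<in> modular_functions m \<Longrightarrow> q_expansion f r F \<Longrightarrow> (\<And>k. fps_nth F k \<in> K) \<Longrightarrow> f \<in> forms_over K m"
  by (auto simp: forms_over_def)

definition coeff_field :: "complex set \<Rightarrow> bool" where
  "coeff_field K \<longleftrightarrow> K = \<rat> \<or> K = UNIV"

lemma coeff_field [simp]: "coeff_field \<rat>" "coeff_field UNIV"
  by (simp_all add: coeff_field_def)

lemma coeff_field_closed:
  assumes "coeff_field K"
  shows "0 \<in> K" "1 \<in> K" "of_int n \<in> K" "x \<in> K \<Longrightarrow> y \<in> K \<Longrightarrow> x + y \<in> K" "x \<in> K \<Longrightarrow> y \<in> K \<Longrightarrow> x * y \<in> K"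
    "x \<in> K \<Longrightarrow> y \<in> K \<Longrightarrow> x / y \<in> K"
    "of_nat n' \<in> K" "(\<And>i. i \<in> I \<Longrightarrow> h i \<in> K) \<Longrightarrow> sum h I \<in> K" "of_rat \<rho> \<in> K"
  using assms by (auto simp: coeff_field_def)

lemma fps_mult_coeffs:
  assumes "coeff_field K" "\<And>k. fps_nth F k \<in> K" "\<And>k. fps_nth G k \<in> K"
  shows "fps_nth (F * G) k \<in> K"
  unfolding fps_mult_nth using assms by (intro coeff_field_closed) auto

lemma fps_X_power_mult_coeffs:
  assumes "coeff_field K" "\<And>k. fps_nth F k \<in> K"
  shows "fps_nth (fps_X ^ n * F) k \<in> K"
  using assms by (simp add: fps_X_power_mult_nth coeff_field_closed)

lemma forms_over_mult:
  assumes "coeff_field K" "f \<in> forms_over K k" "g \<in> forms_over K l"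
  shows "(\<lambda>z. f z * g z) \<in> forms_over K (k + l)"
proof -
  obtain r F s G where F: "q_expansion f r F" "\<And>i. fps_nth F i \<in> K" and G: "q_expansion g s G" "\<And>i. fps_nth G i \<in> K"
    using assms(2,3) by (auto simp: forms_over_def)
  show ?thesis
    by (rule forms_overI[OF modular_functions_mult q_expansion_mult[OF F(1) G(1)]])
       (use assms F G in \<open>auto intro: forms_overD fps_mult_coeffs\<close>)
qed

lemma forms_over_add:
  assumes K: "coeff_field K" and "f \<in> forms_over K k" "g \<in> forms_over K k"
  shows "(\<lambda>z. f z + g z) \<in> forms_over K k"
proof -
  obtain r F s G where F: "q_expansion f r F" "\<And>i. fps_nth F i \<in> K" and G: "q_expansion g s G" "\<And>i. fps_nth G i \<in> K"
    using assms(2,3) by (auto simp: forms_over_def)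
  define t where "t = min r s"
  have "q_expansion (\<lambda>z. f z + g z) t (fps_X ^ nat (r - t) * F + fps_X ^ nat (s - t) * G)"
    by (intro q_expansion_add q_expansion_lower F G) (auto simp: t_def)
  moreover have "fps_nth (fps_X ^ nat (r - t) * F + fps_X ^ nat (s - t) * G) i \<in> K" for i
    unfolding fps_add_nth by (intro coeff_field_closed K fps_X_power_mult_coeffs F G)
  ultimately show ?thesis using assms by (intro forms_overI modular_functions_add) (auto dest: forms_overD)
qed

lemma forms_over_cmult:
  assumes K: "coeff_field K" and "f \<in> forms_over K k" "c \<in> K"
  shows "(\<lambda>z. c * f z) \<in> forms_over K k"
proof -
  obtain r F where F: "q_expansion f r F" "\<And>i. fps_nth F i \<in> K"
    using assms(2) by (auto simp: forms_over_def)
  have "fps_nth (fps_const c * F) i \<in> K" for i using F(2) assms by (simp add: coeff_field_closed)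
  thus ?thesis
    by (rule forms_overI[OF modular_functions_cmult q_expansion_cmult[OF F(1)], rotated]) (use assms in \<open>auto dest: forms_overD\<close>)
qed

lemma forms_over_zero: "coeff_field K \<Longrightarrow> (\<lambda>z. 0) \<in> forms_over K m"
  by (rule forms_overI[of _ _ 0 0]) (auto simp: q_expansion_def coeff_field_closed modular_functions_def)

lemma weakly_holomorphic_forms_eq: "weakly_holomorphic_forms m = forms_over \<rat> m"
proof (intro equalityI subsetI)
  fix f assume "f \<in> weakly_holomorphic_forms m"
  hence f: "f \<in> modular_functions m"
    and "\<exists>(N :: int) (a :: int \<Rightarrow> rat). \<forall>z\<in>\<H>.
            ((\<lambda>k. of_rat (a k) * exp (2 * of_real pi * \<i> * z) powi k) has_sum f z) {- N..}"
    unfolding weakly_holomorphic_forms_def modular_functions_def by blast+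
  then obtain N :: int and a :: "int \<Rightarrow> rat"
    where "\<forall>z\<in>\<H>. ((\<lambda>k. of_rat (a k) * exp (2 * of_real pi * \<i> * z) powi k) has_sum f z) {- N..}" by blast
  hence a: "\<And>z. Im z > 0 \<Longrightarrow> ((\<lambda>k. of_rat (a k) * nome z powi k) has_sum f z) {- N..}"
    unfolding nome_def by simp
  define F :: "complex fps" where "F = Abs_fps (\<lambda>j. of_rat (a (int j - N)))"
  have hs: "((\<lambda>j. fps_nth F j * nome z ^ j) has_sum (nome z powi N * f z)) UNIV" if z: "Im z > 0" for z
  proof -
    have "((\<lambda>j. of_rat (a (int j - N)) * nome z powi (int j - N)) has_sum f z) UNIV"
      using a[OF z]
      by (subst has_sum_reindex_bij_witness[of UNIV "\<lambda>k. nat (k + N)" "\<lambda>j. int j - N" "{- N..}" "\<lambda>k. of_rat (a k) * nome z powi k" _ _ "f z"]) auto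
    from has_sum_cmult_right[OF this, of "nome z powi N"] show ?thesis
      by (rule iffD1[OF has_sum_cong, rotated]) (simp add: F_def power_int_diff)
  qed
  have conv: "fps_conv_radius F \<ge> 1"
    unfolding fps_conv_radius_def
  proof (rule conv_radius_geI_ex)
    fix r :: real assume "0 < r" "ereal r < 1"
    then obtain z where z: "Im z > 0" "nome z = of_real r"
      using nome_surj[of "of_real r"] by auto
    thus "\<exists>z. norm z = r \<and> summable (\<lambda>n. fps_nth F n * z ^ n)"
      using has_sum_imp_sums[OF hs[OF z(1)]] \<open>0 < r\<close> by (intro exI[of _ "of_real r"]) (auto intro: sums_summable)
  qed
  have "q_expansion f (- N) F"
    unfolding q_expansion_def
  proof (safe intro!: conv)
    fix z assume "z \<in> \<H>"
    hence z: "Im z > 0" by simp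
    have "eval_fps F (nome z) = nome z powi N * f z"
      using has_sum_imp_sums[OF hs[OF z]] by (simp add: eval_fps_def sums_iff)
    thus "f z = nome z powi - N * eval_fps F (nome z)"
      by (simp add: power_int_minus field_simps)
  qed
  moreover have "fps_nth F k \<in> \<rat>" for k by (simp add: F_def)
  ultimately show "f \<in> forms_over \<rat> m" using f by (auto simp: forms_over_def)
next
  fix f assume "f \<in> forms_over \<rat> m"
  then obtain r F where f: "f \<in> modular_functions m" and F: "q_expansion f r F" "\<And>k. fps_nth F k \<in> \<rat>"
    by (auto simp: forms_over_def)
  have "\<forall>k. \<exists>x. fps_nth F k = of_rat x" using F(2) by (auto elim: Rats_cases)
  then obtain b where b: "\<And>k. fps_nth F k = of_rat (b k)" by metis
  define a where "a = (\<lambda>k. b (nat (k - r)))"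
  have "((\<lambda>k. of_rat (a k) * nome z powi k) has_sum f z) {- (- r)..}" if "z \<in> \<H>" for z
  proof -
    have z: "Im z > 0" using that by simp
    note FD = q_expansionD[OF F(1)]
    have "((\<lambda>j. fps_nth F j * nome z ^ j) has_sum eval_fps F (nome z)) UNIV"
      by (rule norm_summable_imp_has_sum[OF norm_summable_fps[OF FD(3)[OF z]] sums_eval_fps[OF FD(3)[OF z]]])
    from has_sum_cmult_right[OF this, of "nome z powi r"]
    have "((\<lambda>j. nome z powi r * (fps_nth F j * nome z ^ j)) has_sum f z) UNIV" using FD(2)[OF z] by simp
    thus ?thesis
      by (subst has_sum_reindex_bij_witness[of _ "\<lambda>j. int j + r" "\<lambda>k. nat (k - r)" UNIV "\<lambda>j. nome z powi r * (fps_nth F j * nome z ^ j)" _ _ "f z"])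
         (auto simp: a_def b power_int_add[symmetric] simp flip: power_int_of_nat)
  qed
  hence "\<exists>(N :: int) (a :: int \<Rightarrow> rat). \<forall>z\<in>\<H>. ((\<lambda>k. of_rat (a k) * exp (2 * of_real pi * \<i> * z) powi k) has_sum f z) {- N..}"
    unfolding nome_def by blast
  thus "f \<in> weakly_holomorphic_forms m" using f
    unfolding weakly_holomorphic_forms_def modular_functions_def by blast
qed

section \<open>The forms E2, E4, E6 and the discriminant\<close>

definition E2 :: "complex \<Rightarrow> complex" where
  "E2 z = (if z \<in> \<H> then eval_fps E2_fps (nome z) else 0)"

text \<open>
  The next two definitions are two of Ramanujan's differential equations, read as definitions. They
  make the modularity of \<open>E4\<close> and \<open>E6\<close> and the rationality of their expansions consequences of
  the corresponding facts about \<open>E2\<close>.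
\<close>
definition E4 :: "complex \<Rightarrow> complex" where
  "E4 z = E2 z * E2 z - 12 * qderiv E2 z"

definition E6 :: "complex \<Rightarrow> complex" where
  "E6 z = E2 z * E4 z - 3 * qderiv E4 z"

lemma qderiv_fps_nth:
  "fps_nth (fps_const (of_int r) * F + fps_X * fps_deriv F) k = (of_int r + of_nat k) * fps_nth (F :: complex fps) k"
  by (cases k) (simp_all add: algebra_simps)

lemma q_expansion_diff:
  assumes "q_expansion f r F" "q_expansion g r G"
  shows "q_expansion (\<lambda>z. f z - g z) r (F - G)"
  using assms q_expansionD[OF assms(1)] q_expansionD[OF assms(2)]
  by (auto simp: q_expansion_def eval_fps_diff right_diff_distrib fps_conv_radius_ge_1_intros)

lemma q_expansion_E2: "q_expansion E2 0 E2_fps"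
  using fps_conv_radius_E2 by (simp add: q_expansion_def E2_def)

definition E4_fps :: "complex fps" where
  "E4_fps = E2_fps * E2_fps - fps_const 12 * (fps_const (of_int 0) * E2_fps + fps_X * fps_deriv E2_fps)"

definition E6_fps :: "complex fps" where
  "E6_fps = E2_fps * E4_fps - fps_const 3 * (fps_const (of_int 0) * E4_fps + fps_X * fps_deriv E4_fps)"

lemma q_expansion_E4: "q_expansion E4 0 E4_fps"
  using q_expansion_diff[OF q_expansion_mult[OF q_expansion_E2 q_expansion_E2, simplified]
    q_expansion_cmult[OF q_expansion_qderiv[OF q_expansion_E2], of 12]]
  by (simp add: E4_fps_def E4_def[abs_def])

lemma q_expansion_E6: "q_expansion E6 0 E6_fps"
  using q_expansion_diff[OF q_expansion_mult[OF q_expansion_E2 q_expansion_E4, simplified]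
    q_expansion_cmult[OF q_expansion_qderiv[OF q_expansion_E4], of 3]]
  by (simp add: E6_fps_def E6_def[abs_def])

lemma E2_fps_rational: "fps_nth E2_fps k \<in> \<rat>"
  by (simp add: E2_fps_def)

lemma E4_fps_rational: "fps_nth E4_fps k \<in> \<rat>"
  unfolding E4_fps_def fps_sub_nth fps_mult_left_const_nth qderiv_fps_nth
  by (intro Rats_diff Rats_mult fps_mult_coeffs E2_fps_rational Rats_add) auto

lemma E6_fps_rational: "fps_nth E6_fps k \<in> \<rat>"
  unfolding E6_fps_def fps_sub_nth fps_mult_left_const_nth qderiv_fps_nth
  by (intro Rats_diff Rats_mult fps_mult_coeffs E2_fps_rational E4_fps_rational Rats_add) auto

lemma sigma_one_1: "sigma_one (Suc 0) = 1"
  by (simp add: sigma_one_def)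

lemma E_fps_first_coeffs:
  "fps_nth E2_fps 0 = 1" "fps_nth E2_fps (Suc 0) = - 24"
  "fps_nth E4_fps 0 = 1" "fps_nth E4_fps (Suc 0) = 240"
  "fps_nth E6_fps 0 = 1" "fps_nth E6_fps (Suc 0) = - 504"
proof -
  show a: "fps_nth E2_fps 0 = 1" "fps_nth E2_fps (Suc 0) = - 24"
    by (simp_all add: E2_fps_def sigma_one_1)
  show b: "fps_nth E4_fps 0 = 1" "fps_nth E4_fps (Suc 0) = 240"
    unfolding E4_fps_def fps_sub_nth fps_mult_left_const_nth qderiv_fps_nth
    by (simp_all add: fps_mult_nth a)
  show "fps_nth E6_fps 0 = 1" "fps_nth E6_fps (Suc 0) = - 504"
    unfolding E6_fps_def fps_sub_nth fps_mult_left_const_nth qderiv_fps_nth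
    by (simp_all add: fps_mult_nth a b)
qed

lemma qderiv_deriv: "Im z > 0 \<Longrightarrow> deriv f z = 2 * of_real pi * \<i> * qderiv f z"
  by (simp add: qderiv_def)

lemma has_field_derivative_qderiv:
  assumes "f holomorphic_on \<H>" "Im z > 0"
  shows "(f has_field_derivative (2 * of_real pi * \<i> * qderiv f z)) (at z)"
  using holomorphic_derivI[OF assms(1) open_UHP, of z UNIV] assms(2) qderiv_deriv[of z f] by simp

lemma holomorphic_qderiv:
  assumes "f holomorphic_on \<H>"
  shows "qderiv f holomorphic_on \<H>"
proof -
  have "(\<lambda>z. deriv f z / (2 * of_real pi * \<i>)) holomorphic_on \<H>"
    by (intro holomorphic_intros holomorphic_deriv assms open_UHP) auto
  thus ?thesis by (rule holomorphic_transform) (simp add: qderiv_def)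
qed

lemma Im_inversion_pos: "Im z > 0 \<Longrightarrow> Im (- 1 / z) > 0"
  using moebius_in_UHP[OF S_T_in_SL2Z(1), of z] by simp

lemma qderiv_inversion:
  assumes f: "f holomorphic_on \<H>" and g: "\<And>z. Im z > 0 \<Longrightarrow> f (- 1 / z) = g z"
    and z: "Im z > 0" and g': "(g has_field_derivative g') (at z)"
  shows "qderiv f (- 1 / z) = z\<^sup>2 * g' / (2 * of_real pi * \<i>)"
proof -
  have z0: "z \<noteq> 0" using z by auto
  have "((\<lambda>z. - 1 / z) has_field_derivative (1 / z\<^sup>2)) (at z)"
    using z0 by (auto intro!: derivative_eq_intros simp: power2_eq_square)
  from DERIV_chain2[OF has_field_derivative_qderiv[OF f Im_inversion_pos[OF z]] this]
  have "((\<lambda>z. f (- 1 / z)) has_field_derivative 2 * of_real pi * \<i> * qderiv f (- 1 / z) * (1 / z\<^sup>2)) (at z)" .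
  moreover have "((\<lambda>z. f (- 1 / z)) has_field_derivative g') (at z)"
    by (rule has_field_derivative_transform_within_open[OF g' open_UHP]) (use g z in auto)
  ultimately have "2 * of_real pi * \<i> * qderiv f (- 1 / z) * (1 / z\<^sup>2) = g'" by (rule DERIV_unique)
  thus ?thesis using z0 by (auto simp: field_simps)
qed

lemma E2_inversion': "Im z > 0 \<Longrightarrow> E2 (- 1 / z) = z\<^sup>2 * E2 z - 6 * \<i> * z / of_real pi"
  using E2_inversion[of z] Im_inversion_pos[of z] by (simp add: E2_def nome_def)

lemma E2_holomorphic: "E2 holomorphic_on \<H>" and E4_holomorphic: "E4 holomorphic_on \<H>"
  and E6_holomorphic: "E6 holomorphic_on \<H>"
  by (rule holomorphic_q_expansion[OF q_expansion_E2] holomorphic_q_expansion[OF q_expansion_E4]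
      holomorphic_q_expansion[OF q_expansion_E6])+

lemma q_expansion_periodic:
  assumes "q_expansion f r F" "Im z > 0"
  shows "f (z + 1) = f z"
  using q_expansionD(2)[OF assms] q_expansionD(2)[OF assms(1), of "z + 1"] assms(2) by simp

lemma E4_modular: "E4 \<in> modular_functions 4"
proof (rule modular_functionsI)
  fix z assume z: "Im z > 0"
  have d: "((\<lambda>z. z\<^sup>2 * E2 z - 6 * \<i> * z / of_real pi) has_field_derivative
     (2 * z * E2 z + z\<^sup>2 * (2 * of_real pi * \<i> * qderiv E2 z) - 6 * \<i> / of_real pi)) (at z)"
    by (auto intro!: derivative_eq_intros has_field_derivative_qderiv[OF E2_holomorphic z])
  have E4: "E4 (- 1 / z) = (z\<^sup>2 * E2 z - 6 * \<i> * z / of_real pi)\<^sup>2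
     - 12 * (z\<^sup>2 * (2 * z * E2 z + z\<^sup>2 * (2 * of_real pi * \<i> * qderiv E2 z) - 6 * \<i> / of_real pi) / (2 * of_real pi * \<i>))"
  proof -
    have "qderiv E2 (- 1 / z) = z\<^sup>2 * (2 * z * E2 z + z\<^sup>2 * (2 * of_real pi * \<i> * qderiv E2 z) - 6 * \<i> / of_real pi) / (2 * of_real pi * \<i>)"
      by (rule qderiv_inversion[OF E2_holomorphic E2_inversion' z d])
    thus ?thesis by (simp only: E4_def E2_inversion'[OF z] power2_eq_square)
  qed
  have alg: "(z\<^sup>2 * e - 6 * \<i> * z / p)\<^sup>2 - 12 * (z\<^sup>2 * (2 * z * e + z\<^sup>2 * (2 * p * \<i> * d) - 6 * \<i> / p) / (2 * p * \<i>))
     = z ^ 4 * (e * e - 12 * d)" if "p \<noteq> 0" for e d p :: complex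
    using that by (simp add: field_simps power2_eq_square power4_eq_xxxx)
  show "E4 (- 1 / z) = z powi 4 * E4 z"
    unfolding E4 by (subst alg) (auto simp: E4_def)
qed (use E4_holomorphic q_expansion_periodic[OF q_expansion_E4] in \<open>auto simp: E4_def E2_def qderiv_def\<close>)

text \<open>
  The Serre derivative: the term by which the derivative of \<open>f\<close> fails to be modular is cancelled by the
  corresponding term of \<open>E2\<close>.
\<close>
lemma serre_derivative_modular:
  assumes f: "f \<in> modular_functions m"
  shows "(\<lambda>z. qderiv f z - of_int m / 12 * E2 z * f z) \<in> modular_functions (m + 2)"
proof (rule modular_functionsI)
  note fD = modular_functionsD[OF f]
  show "(\<lambda>z. qderiv f z - of_int m / 12 * E2 z * f z) holomorphic_on \<H>"
    by (intro holomorphic_intros holomorphic_qderiv E2_holomorphic fD(2))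
  show "qderiv f z - of_int m / 12 * E2 z * f z = 0" if "z \<notin> \<H>" for z
    using that fD(1)[OF that] by (simp add: qderiv_def)
  fix z assume z: "Im z > 0"
  have z0: "z \<noteq> 0" using z by auto
  have "deriv f (z + 1) = deriv f z"
  proof -
    have "((\<lambda>w. f (w + 1)) has_field_derivative deriv f (z + 1)) (at z)"
      using DERIV_shift[of f "deriv f (z + 1)" z 1] holomorphic_derivI[OF fD(2) open_UHP, of "z + 1" UNIV] z by simp
    hence "(f has_field_derivative deriv f (z + 1)) (at z)"
      by (rule has_field_derivative_transform_within_open[OF _ open_UHP]) (use z fD(4) in auto)
    thus ?thesis by (simp add: DERIV_imp_deriv)
  qed
  thus "qderiv f (z + 1) - of_int m / 12 * E2 (z + 1) * f (z + 1) = qderiv f z - of_int m / 12 * E2 z * f z"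
    using z fD(4)[OF z] q_expansion_periodic[OF q_expansion_E2 z] by (simp add: qderiv_def)
  have d: "((\<lambda>z. z powi m * f z) has_field_derivative
     (of_int m * z powi (m - 1) * f z + z powi m * (2 * of_real pi * \<i> * qderiv f z))) (at z)"
    using z0 by (auto intro!: derivative_eq_intros has_field_derivative_qderiv[OF fD(2) z] simp: algebra_simps)
  have q: "qderiv f (- 1 / z) = z\<^sup>2 * (of_int m * (z powi m / z) * f z + z powi m * (2 * of_real pi * \<i> * qderiv f z)) / (2 * of_real pi * \<i>)"
    using qderiv_inversion[OF fD(2) fD(5) z d] z0 by (simp add: power_int_diff)
  have alg: "z\<^sup>2 * (k * (w / z) * g + w * (2 * p * \<i> * d)) / (2 * p * \<i>) - k / 12 * (z\<^sup>2 * e - 6 * \<i> * z / p) * (w * g)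
     = w * z\<^sup>2 * (d - k / 12 * e * g)" if "p \<noteq> 0" for k w g d e p :: complex
    using that z0 by (simp add: field_simps power2_eq_square)
  show "qderiv f (- 1 / z) - of_int m / 12 * E2 (- 1 / z) * f (- 1 / z)
     = z powi (m + 2) * (qderiv f z - of_int m / 12 * E2 z * f z)"
    unfolding q E2_inversion'[OF z] fD(5)[OF z] using z0 by (subst alg) (auto simp: power_int_add)
qed

lemma E6_modular: "E6 \<in> modular_functions 6"
proof -
  have "E6 = (\<lambda>z. - 3 * (qderiv E4 z - of_int 4 / 12 * E2 z * E4 z))"
    by (simp add: E6_def fun_eq_iff)
  thus ?thesis using modular_functions_cmult[OF serre_derivative_modular[OF E4_modular], of "- 3"] by simp
qed

lemma E4_form: "E4 \<in> forms_over \<rat> 4" and E6_form: "E6 \<in> forms_over \<rat> 6"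
  by (rule forms_overI[OF E4_modular q_expansion_E4 E4_fps_rational] forms_overI[OF E6_modular q_expansion_E6 E6_fps_rational])+

text \<open>The series of \<open>- log \<Prod> (1 - q\<^sup>n)\<close>.\<close>
definition log_eta_fps :: "complex fps" where
  "log_eta_fps = Abs_fps (\<lambda>n. of_nat (sigma_one n) / of_nat n)"

lemma fps_conv_radius_log_eta: "fps_conv_radius log_eta_fps \<ge> 1"
  unfolding fps_conv_radius_def
proof (rule conv_radius_geI_ex')
  fix r :: real assume r: "0 < r" "ereal r < 1"
  hence "norm (of_real r :: complex) < 1" by simp
  hence "summable (\<lambda>n. norm (fps_nth E2_fps n * (of_real r :: complex) ^ n))"
    by (intro norm_summable_fps fps_conv_radius_ge_1D fps_conv_radius_E2)
  thus "summable (\<lambda>n. fps_nth log_eta_fps n * (of_real r :: complex) ^ n)"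
  proof (rule summable_norm_cancel[OF summable_comparison_test'[where N = 1]])
    fix n :: nat assume n: "n \<ge> 1"
    have "real (sigma_one n) / real n \<le> real (sigma_one n) / 1"
      using n by (intro divide_left_mono) auto
    hence "real (sigma_one n) / real n * cmod (of_real r ^ n) \<le> 24 * real (sigma_one n) * cmod (of_real r ^ n)"
      by (intro mult_right_mono) auto
    thus "norm (norm (fps_nth log_eta_fps n * (of_real r :: complex) ^ n)) \<le> norm (fps_nth E2_fps n * (of_real r :: complex) ^ n)"
      using n by (simp add: log_eta_fps_def E2_fps_def norm_mult norm_divide)
  qed
qed

text \<open>
  The product \<open>q \<Prod> (1 - q\<^sup>n)\<^sup>2\<^sup>4\<close>, written through its logarithm, so that it visibly has no zeros and
  satisfies \<open>q d\<Delta>/dq = E2 \<Delta>\<close>.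
\<close>
definition Delta :: "complex \<Rightarrow> complex" where
  "Delta z = (if z \<in> \<H> then nome z * exp (- 24 * eval_fps log_eta_fps (nome z)) else 0)"

lemma Delta_nonzero: "Im z > 0 \<Longrightarrow> Delta z \<noteq> 0"
  by (simp add: Delta_def)

text \<open>Logarithmic differentiation of the product for the discriminant.\<close>
lemma E2_fps_log_eta: "E2_fps = 1 - fps_const 24 * (fps_X * fps_deriv log_eta_fps)"
proof (rule fps_ext)
  fix n show "fps_nth E2_fps n = fps_nth (1 - fps_const 24 * (fps_X * fps_deriv log_eta_fps)) n"
    by (cases n) (simp_all add: E2_fps_def log_eta_fps_def del: of_nat_Suc)
qed

lemma eval_E2_log_eta:
  assumes "norm q < 1"
  shows "eval_fps E2_fps q = 1 - 24 * (q * eval_fps (fps_deriv log_eta_fps) q)"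
proof -
  note c = fps_conv_radius_ge_1_deriv[OF fps_conv_radius_log_eta]
  have 1: "fps_conv_radius (fps_X * fps_deriv log_eta_fps) \<ge> 1"
    by (intro fps_conv_radius_ge_1_intros c) simp
  have 2: "fps_conv_radius (fps_const 24 * (fps_X * fps_deriv log_eta_fps)) \<ge> 1"
    by (intro fps_conv_radius_ge_1_intros 1) simp
  show ?thesis unfolding E2_fps_log_eta using assms fps_conv_radius_ge_1D[OF 1 assms] fps_conv_radius_ge_1D[OF 2 assms]
    fps_conv_radius_ge_1D[OF c assms]
    by (simp add: eval_fps_diff eval_fps_mult)
qed

lemma has_field_derivative_Delta:
  assumes z: "Im z > 0"
  shows "(Delta has_field_derivative 2 * of_real pi * \<i> * (E2 z * Delta z)) (at z)"
proof -
  have c: "ereal (norm (nome z)) < fps_conv_radius log_eta_fps"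
    using z by (intro fps_conv_radius_ge_1D fps_conv_radius_log_eta) simp
  define e where "e = eval_fps log_eta_fps (nome z)"
  define e' where "e' = eval_fps (fps_deriv log_eta_fps) (nome z)"
  have "((\<lambda>z. nome z * exp (- 24 * eval_fps log_eta_fps (nome z))) has_field_derivative
     (nome z * (exp (- 24 * e) * (- 24 * (e' * (2 * of_real pi * \<i> * nome z)))) + 2 * of_real pi * \<i> * nome z * exp (- 24 * e))) (at z)"
    using c unfolding e_def e'_def
    by (auto intro!: derivative_eq_intros DERIV_chain2[OF has_field_derivative_eval_fps])
  also have "nome z * (exp (- 24 * e) * (- 24 * (e' * (2 * of_real pi * \<i> * nome z)))) + 2 * of_real pi * \<i> * nome z * exp (- 24 * e)
     = 2 * of_real pi * \<i> * ((1 - 24 * (nome z * e')) * (nome z * exp (- 24 * e)))"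
    by (simp add: algebra_simps)
  also have "1 - 24 * (nome z * e') = E2 z" using z eval_E2_log_eta[of "nome z"] by (simp add: E2_def e'_def)
  also have "nome z * exp (- 24 * e) = Delta z" using z by (simp add: Delta_def e_def)
  finally show ?thesis
    by (rule has_field_derivative_transform_within_open[OF _ open_UHP]) (use z in \<open>auto simp: Delta_def\<close>)
qed

lemma Delta_holomorphic: "Delta holomorphic_on \<H>"
  using has_field_derivative_Delta by (auto simp: holomorphic_on_open[OF open_UHP] intro!: exI)

text \<open>
  Both sides satisfy the same linear differential equation, by the transformation law of \<open>E2\<close>, and
  they agree at the fixed point \<open>\<i>\<close>.
\<close>
lemma Delta_inversion:
  assumes z: "Im z > 0"
  shows "Delta (- 1 / z) = z ^ 12 * Delta z"
proof -
  define R where "R = (\<lambda>z. Delta (- 1 / z) / (z ^ 12 * Delta z))"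
  have "R constant_on \<H>"
  proof (rule has_field_derivative_0_imp_constant_on)
    fix z assume "z \<in> \<H>"
    hence z: "Im z > 0" by simp
    hence z0: "z \<noteq> 0" by auto
    have nz: "Delta z \<noteq> 0" "z ^ 12 * Delta z \<noteq> 0" using Delta_nonzero[OF z] z0 by auto
    define p :: complex where "p = of_real pi"
    have p: "p \<noteq> 0" by (simp add: p_def)
    have i: "((\<lambda>z. - 1 / z) has_field_derivative (1 / z\<^sup>2)) (at z)"
      using z0 by (auto intro!: derivative_eq_intros simp: power2_eq_square)
    have 1: "((\<lambda>z. Delta (- 1 / z)) has_field_derivative 2 * p * \<i> * (E2 (- 1 / z) * Delta (- 1 / z)) * (1 / z\<^sup>2)) (at z)"
      unfolding p_def by (rule DERIV_chain2[OF has_field_derivative_Delta[OF Im_inversion_pos[OF z]] i])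
    have "2 * p * \<i> * (E2 (- 1 / z) * Delta (- 1 / z)) * (1 / z\<^sup>2) = (2 * p * \<i> * E2 z + 12 / z) * Delta (- 1 / z)"
      unfolding E2_inversion'[OF z] p_def[symmetric] using z0 p by (simp add: field_simps power2_eq_square)
    note 1 = 1[unfolded this]
    have 2: "((\<lambda>z. z ^ 12 * Delta z) has_field_derivative (12 * z ^ 11 * Delta z + z ^ 12 * (2 * p * \<i> * (E2 z * Delta z)))) (at z)"
      unfolding p_def using z by (auto intro!: derivative_eq_intros has_field_derivative_Delta)
    have "12 * z ^ 11 * Delta z + z ^ 12 * (2 * p * \<i> * (E2 z * Delta z)) = (2 * p * \<i> * E2 z + 12 / z) * (z ^ 12 * Delta z)"
      using z0 by (simp add: field_simps flip: power_Suc)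
    note 2 = 2[unfolded this]
    from DERIV_divide[OF 1 2 nz(2)] show "(R has_field_derivative 0) (at z)" unfolding R_def by (simp add: algebra_simps)
  qed (auto simp: open_UHP convex_UHP convex_connected)
  then obtain c where c: "\<And>z. Im z > 0 \<Longrightarrow> R z = c" by (auto simp: constant_on_def)
  have "(\<i> :: complex) ^ 12 = (\<i> ^ 4) ^ 3" by (simp flip: power_mult)
  hence "R \<i> = 1" using Delta_nonzero[of \<i>] by (simp add: R_def)
  hence "R z = 1" using c[of \<i>] c[OF z] by simp
  moreover have "z \<noteq> 0" using z by auto
  ultimately show ?thesis using Delta_nonzero[OF z] by (simp add: R_def)
qed

definition Delta_pow :: "int \<Rightarrow> complex \<Rightarrow> complex" where
  "Delta_pow k z = (if z \<in> \<H> then Delta z powi k else 0)"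

lemma Delta_pow_modular: "Delta_pow k \<in> modular_functions (12 * k)"
proof (rule modular_functionsI)
  have "(\<lambda>z. Delta z powi k) holomorphic_on \<H>"
    by (intro holomorphic_intros Delta_holomorphic) (auto simp: Delta_nonzero)
  thus "Delta_pow k holomorphic_on \<H>" by (rule holomorphic_transform) (simp add: Delta_pow_def)
  fix z assume z: "Im z > 0"
  show "Delta_pow k (z + 1) = Delta_pow k z" using z by (simp add: Delta_pow_def Delta_def)
  show "Delta_pow k (- 1 / z) = z powi (12 * k) * Delta_pow k z"
    using z Im_inversion_pos[OF z] Delta_inversion[OF z]
    by (simp add: Delta_pow_def power_int_mult_distrib power_int_mult)
qed (simp add: Delta_pow_def)

lemma exp_power_int: "exp x powi k = exp (of_int k * (x :: complex))"
  by (cases k rule: int_cases2) (simp_all add: power_int_minus exp_minus flip: exp_of_nat_mult)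

text \<open>
  The series \<open>P\<close> solves \<open>P' = c L' P\<close> with rational \<open>c\<close> and \<open>L\<close>, so its coefficients are
  determined recursively in \<open>\<rat>\<close>.
\<close>
lemma q_expansion_Delta_pow:
  obtains P where "q_expansion (Delta_pow k) k P" "fps_nth P 0 = 1" "\<And>i. fps_nth P i \<in> \<rat>"
proof -
  define c :: complex where "c = of_int (- 24 * k)"
  define g where "g = (\<lambda>q. exp (c * eval_fps log_eta_fps q))"
  have L: "ereal (norm q) < fps_conv_radius log_eta_fps" if "norm q < 1" for q
    using that by (intro fps_conv_radius_ge_1D fps_conv_radius_log_eta)
  have der: "(g has_field_derivative c * eval_fps (fps_deriv log_eta_fps) q * g q) (at q)" if "norm q < 1" for q
    unfolding g_def using L[OF that] by (auto intro!: derivative_eq_intros DERIV_chain2[OF has_field_derivative_eval_fps])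
  have hol: "g holomorphic_on eball 0 1"
    unfolding one_ereal_def eball_ereal using der by (auto simp: holomorphic_on_open intro!: exI)
  define P where "P = fps_expansion g 0"
  have P: "fps_conv_radius P \<ge> 1" unfolding P_def using hol by (rule conv_radius_fps_expansion)
  have eP: "eval_fps P q = g q" if "norm q < 1" for q
    using eval_fps_expansion[OF hol, of q] that by (simp add: P_def one_ereal_def)
  have ode: "fps_deriv P = fps_const c * fps_deriv log_eta_fps * P"
  proof (rule eval_fps_eq_punctured)
    note i = fps_conv_radius_ge_1_intros
    note cv = fps_conv_radius_ge_1_deriv[OF fps_conv_radius_log_eta]
    have cL: "fps_conv_radius (fps_const c * fps_deriv log_eta_fps) \<ge> 1" by (intro i cv) simp
    show "fps_conv_radius (fps_deriv P) \<ge> 1" "fps_conv_radius (fps_const c * fps_deriv log_eta_fps * P) \<ge> 1"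
      by (intro i P cL)+
    fix z assume z: "Im z > 0"
    hence q: "norm (nome z) < 1" by simp
    have "(eval_fps P has_field_derivative eval_fps (fps_deriv P) (nome z)) (at (nome z))"
      by (rule has_field_derivative_eval_fps[OF fps_conv_radius_ge_1D[OF P q]])
    hence "(g has_field_derivative eval_fps (fps_deriv P) (nome z)) (at (nome z))"
      by (rule has_field_derivative_transform_within_open[of _ _ _ "ball 0 1"]) (use q eP in auto)
    hence "eval_fps (fps_deriv P) (nome z) = c * eval_fps (fps_deriv log_eta_fps) (nome z) * g (nome z)"
      using der[OF q] by (rule DERIV_unique)
    thus "eval_fps (fps_deriv P) (nome z) = eval_fps (fps_const c * fps_deriv log_eta_fps * P) (nome z)"
      using fps_conv_radius_ge_1D[OF cv q] fps_conv_radius_ge_1D[OF P q] fps_conv_radius_ge_1D[OF cL q]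
      by (simp add: eval_fps_mult eP[OF q])
  qed
  have "eval_fps log_eta_fps 0 = 0" by (simp add: eval_fps_at_0 log_eta_fps_def)
  hence P0: "fps_nth P 0 = 1" using eP[of 0] by (simp add: eval_fps_at_0 g_def)
  have rat: "fps_nth P i \<in> \<rat>" for i
  proof (induction i rule: less_induct)
    case (less n)
    show ?case
    proof (cases n)
      case (Suc m)
      have "fps_nth (fps_deriv P) m = (\<Sum>i=0..m. fps_nth (fps_const c * fps_deriv log_eta_fps) i * fps_nth P (m - i))"
        unfolding ode fps_mult_nth ..
      also have "\<dots> \<in> \<rat>" using less.IH Suc
        by (intro Rats_sum Rats_mult) (auto simp: c_def log_eta_fps_def)
      finally have "of_nat (Suc m) * fps_nth P (Suc m) \<in> \<rat>" by simp
      hence "of_nat (Suc m) * fps_nth P (Suc m) / of_nat (Suc m) \<in> \<rat>" by (intro Rats_divide) auto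
      thus ?thesis using Suc by (simp del: of_nat_Suc)
    qed (simp add: P0)
  qed
  have "q_expansion (Delta_pow k) k P"
    unfolding q_expansion_def
    by (auto simp: P eP g_def Delta_pow_def Delta_def power_int_mult_distrib exp_power_int c_def mult_ac)
  thus ?thesis using P0 rat that by blast
qed

lemma Delta_pow_form: "Delta_pow k \<in> forms_over \<rat> (12 * k)"
  by (metis q_expansion_Delta_pow forms_overI Delta_pow_modular)

section \<open>Every form is a complex combination of rational forms\<close>

text \<open>
  A function of weight zero without pole at the cusp is a function of \<open>q\<close> on the unit disc all of
  whose values are taken on a smaller closed disc; the maximum modulus principle applies.
\<close>
lemma weight_zero_constant:
  assumes f: "f \<in> modular_functions 0" and F: "q_expansion f 0 F" and z: "Im z > 0"
  shows "f z = fps_nth F 0"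
proof -
  note FD = q_expansionD[OF F]
  define G where "G = eval_fps F"
  \<comment> \<open>The values of \<open>q\<close> on the strip \<open>Im z \<ge> 1/2\<close>, which meets every orbit, and the cusp \<open>q = 0\<close>.\<close>
  define K where "K = cball (0::complex) (exp (- pi))"
  have K: "K \<subseteq> ball 0 1"
  proof
    fix x assume "x \<in> K"
    hence "norm x \<le> exp (- pi)" by (simp add: K_def)
    also have "\<dots> < 1" by simp
    finally show "x \<in> ball 0 1" by simp
  qed
  have hol: "G holomorphic_on ball 0 1" unfolding G_def
    using FD(1) by (intro holomorphic_on_eval_fps) (auto intro: fps_conv_radius_ge_1D)
  have "continuous_on K (\<lambda>q. norm (G q))"
    by (intro continuous_on_norm holomorphic_on_imp_continuous_on holomorphic_on_subset[OF hol K])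
  moreover have "compact K" "K \<noteq> {}" by (auto simp: K_def)
  ultimately obtain p where p: "p \<in> K" "\<And>q. q \<in> K \<Longrightarrow> norm (G q) \<le> norm (G p)"
    using continuous_attains_sup[of K "\<lambda>q. norm (G q)"] by blast
  have le: "norm (G q) \<le> norm (G p)" if q: "norm q < 1" for q
  proof (cases "q = 0")
    case True
    thus ?thesis by (intro p(2)) (simp add: K_def)
  next
    case False
    then obtain z where z: "Im z > 0" "nome z = q" using q nome_surj by blast
    obtain \<gamma> where \<gamma>: "\<gamma> \<in> carrier SL2Z" "Im (moebius_action \<gamma> z) \<ge> 1 / 2"
      using orbit_meets_high_strip[of z] z by auto
    define w where "w = moebius_action \<gamma> z"
    have w: "Im w \<ge> 1 / 2" "Im w > 0" using \<gamma>(2) by (auto simp: w_def)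
    have "f w = f z" using modular_functionsD(3)[OF f \<gamma>(1), of z] z by (simp add: w_def)
    hence "G q = G (nome w)" using FD(2)[OF z(1)] FD(2)[OF w(2)] z by (simp add: G_def)
    moreover have "nome w \<in> K" using w by (simp add: K_def nome_def)
    ultimately show ?thesis using p(2) by simp
  qed
  have "G constant_on ball 0 1"
    by (rule maximum_modulus_principle[OF hol, of "ball 0 1" p]) (use p K le in auto)
  then obtain c where c: "\<And>q. norm q < 1 \<Longrightarrow> G q = c" by (auto simp: constant_on_def)
  have "f z = G (nome z)" using FD(2)[OF z] by (simp add: G_def)
  also have "\<dots> = G 0" using c z by simp
  also have "\<dots> = fps_nth F 0" by (simp add: G_def eval_fps_at_0)
  finally show ?thesis .
qed

lemma modular_functions_power: "f \<in> modular_functions m \<Longrightarrow> (\<lambda>z. f z ^ Suc n) \<in> modular_functions (int (Suc n) * m)"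
proof (induction n)
  case (Suc n)
  have "m + int (Suc n) * m = int (Suc (Suc n)) * m" by (simp add: algebra_simps)
  thus ?case using modular_functions_mult[OF Suc.prems Suc.IH[OF Suc.prems]] by (simp only: power_Suc)
qed simp

lemma q_expansion_power: "q_expansion f 0 F \<Longrightarrow> q_expansion (\<lambda>z. f z ^ n) 0 (F ^ n)"
proof (induction n)
  case 0
  thus ?case using q_expansion_const[of 1] by simp
next
  case (Suc n)
  thus ?case using q_expansion_mult[OF Suc.prems Suc.IH[OF Suc.prems]] by simp
qed

lemma modular_functions_eq_0I: "f \<in> modular_functions m \<Longrightarrow> (\<And>z. Im z > 0 \<Longrightarrow> f z = 0) \<Longrightarrow> f = (\<lambda>z. 0)"
  using modular_functionsD(1)[of f m] by (auto simp: fun_eq_iff)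

text \<open>
  The product \<open>f\<^sup>1\<^sup>2 \<Delta>\<^sup>-\<^sup>m\<close> has weight zero and vanishes at the cusp.
\<close>
lemma weight_negative_zero:
  assumes f: "f \<in> modular_functions m" and F: "q_expansion f 0 F" and m: "m < 0"
  shows "f = (\<lambda>z. 0)"
proof (rule modular_functions_eq_0I[OF f])
  fix z assume z: "Im z > 0"
  obtain P where P: "q_expansion (Delta_pow (- m)) (- m) P" by (rule q_expansion_Delta_pow)
  define g where "g = (\<lambda>z. f z ^ 12 * Delta_pow (- m) z)"
  have "g \<in> modular_functions 0"
    using modular_functions_mult[OF modular_functions_power[OF f, of 11] Delta_pow_modular[of "- m"]]
    by (simp add: g_def)
  moreover have "q_expansion g 0 (fps_X ^ nat (- m) * (F ^ 12 * P))"
    using q_expansion_lower[OF q_expansion_mult[OF q_expansion_power[OF F, of 12] P], of 0] m by (simp add: g_def)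
  ultimately have "g z = fps_nth (fps_X ^ nat (- m) * (F ^ 12 * P)) 0"
    using z by (rule weight_zero_constant)
  also have "\<dots> = 0" using m by (simp add: fps_X_power_mult_nth)
  finally show "f z = 0" using z Delta_nonzero[OF z] by (simp add: g_def Delta_pow_def)
qed

text \<open>The discriminant has a simple zero at the cusp and no other zero.\<close>
lemma cusp_form_divide_Delta:
  assumes f: "f \<in> modular_functions m" and F: "q_expansion f 0 F" "fps_nth F 0 = 0"
  obtains h H where "h \<in> modular_functions (m - 12)" "q_expansion h 0 H" "f = (\<lambda>z. Delta_pow 1 z * h z)"
proof -
  define h where "h = (\<lambda>z. f z * Delta_pow (- 1) z)"
  obtain P where P: "q_expansion (Delta_pow (- 1)) (- 1) P" by (rule q_expansion_Delta_pow)
  have eq: "F = fps_X * fps_shift 1 F"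
  proof (rule fps_ext)
    fix n show "fps_nth F n = fps_nth (fps_X * fps_shift 1 F) n" using F(2) by (cases n) simp_all
  qed
  have "q_expansion f 1 (fps_shift 1 F)"
    unfolding q_expansion_def
  proof safe
    note FD = q_expansionD[OF F(1)]
    show c: "fps_conv_radius (fps_shift 1 F) \<ge> 1" using FD(1) by simp
    fix z assume "z \<in> \<H>"
    hence z: "Im z > 0" by simp
    have "eval_fps F (nome z) = nome z * eval_fps (fps_shift 1 F) (nome z)"
      using z c fps_conv_radius_ge_1D[OF c, of "nome z"] by (subst eq, subst eval_fps_mult) auto
    thus "f z = nome z powi 1 * eval_fps (fps_shift 1 F) (nome z)" using FD(2)[OF z] by simp
  qed
  from q_expansion_mult[OF this P] have "q_expansion h 0 (fps_shift 1 F * P)" by (simp add: h_def)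
  moreover have "h \<in> modular_functions (m - 12)"
    using modular_functions_mult[OF f Delta_pow_modular[of "- 1"]] by (simp add: h_def)
  moreover have "f = (\<lambda>z. Delta_pow 1 z * h z)"
    using modular_functionsD(1)[OF f] Delta_nonzero by (auto simp: h_def Delta_pow_def fun_eq_iff power_int_minus)
  ultimately show ?thesis using that by blast
qed

text \<open>
  The difference is divisible by the discriminant, and the quotient has negative weight.
\<close>
lemma form_determined_by_constant_term:
  assumes f: "f \<in> modular_functions m" "q_expansion f 0 F"
    and g: "g \<in> modular_functions m" "q_expansion g 0 G" "fps_nth G 0 = 1" and m: "m < 12"
  shows "f = (\<lambda>z. fps_nth F 0 * g z)"
proof -
  define d where "d = (\<lambda>z. f z + (- fps_nth F 0) * g z)"
  have d: "d \<in> modular_functions m" unfolding d_def by (intro modular_functions_add modular_functions_cmult f g)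
  have D: "q_expansion d 0 (F + fps_const (- fps_nth F 0) * G)"
    unfolding d_def by (intro q_expansion_add q_expansion_cmult f g)
  have "fps_nth (F + fps_const (- fps_nth F 0) * G) 0 = 0" using g(3) by simp
  then obtain h H where h: "h \<in> modular_functions (m - 12)" "q_expansion h 0 H" "d = (\<lambda>z. Delta_pow 1 z * h z)"
    using cusp_form_divide_Delta[OF d D] by blast
  have "h = (\<lambda>z. 0)" using weight_negative_zero[OF h(1,2)] m by simp
  hence "d = (\<lambda>z. 0)" using h(3) by simp
  thus ?thesis by (auto simp: d_def fun_eq_iff)
qed

text \<open>
  The squares and cubes of such a form are multiples of \<open>E4\<close> and \<open>E6\<close>. The first two coefficients
  of both expansions would have to satisfy contradictory relations.
\<close>
lemma weight_two_zero:
  assumes f: "f \<in> modular_functions 2" and F: "q_expansion f 0 F"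
  shows "f = (\<lambda>z. 0)"
proof -
  define c d where "c = fps_nth (F ^ 2) 0" and "d = fps_nth (F ^ 3) 0"
  have f2: "(\<lambda>z. f z ^ 2) = (\<lambda>z. c * E4 z)"
    unfolding c_def using modular_functions_power[OF f, of 1] q_expansion_power[OF F, of 2]
    by (intro form_determined_by_constant_term[OF _ _ E4_modular q_expansion_E4]) (auto simp: E_fps_first_coeffs numeral_2_eq_2)
  have f3: "(\<lambda>z. f z ^ 3) = (\<lambda>z. d * E6 z)"
    unfolding d_def using modular_functions_power[OF f, of 2] q_expansion_power[OF F, of 3]
    by (intro form_determined_by_constant_term[OF _ _ E6_modular q_expansion_E6]) (auto simp: E_fps_first_coeffs numeral_3_eq_3)
  have e2: "F ^ 2 = fps_const c * E4_fps"
    using q_expansion_power[OF F, of 2] q_expansion_cmult[OF q_expansion_E4, of c] q_expansion_unique unfolding f2 by blast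
  have e3: "F ^ 3 = fps_const d * E6_fps"
    using q_expansion_power[OF F, of 3] q_expansion_cmult[OF q_expansion_E6, of d] q_expansion_unique unfolding f3 by blast
  define x y where "x = fps_nth F 0" and "y = fps_nth F (Suc 0)"
  have p2: "fps_nth (F ^ 2) 0 = x\<^sup>2" "fps_nth (F ^ 2) (Suc 0) = 2 * x * y"
    by (simp_all add: numeral_2_eq_2 fps_mult_nth x_def y_def)
  have p3: "fps_nth (F ^ 3) 0 = x ^ 3" "fps_nth (F ^ 3) (Suc 0) = 3 * x\<^sup>2 * y"
    by (simp_all add: numeral_3_eq_3 numeral_2_eq_2 fps_mult_nth x_def y_def algebra_simps)
  have c: "c = x\<^sup>2" "2 * x * y = 240 * c"
    using p2 arg_cong[OF e2, of "\<lambda>F. fps_nth F (Suc 0)"] by (simp_all add: c_def E_fps_first_coeffs)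
  have d: "d = x ^ 3" "3 * x\<^sup>2 * y = - 504 * d"
    using p3 arg_cong[OF e3, of "\<lambda>F. fps_nth F (Suc 0)"] by (simp_all add: d_def E_fps_first_coeffs)
  have "x = 0"
  proof (rule ccontr)
    assume x: "x \<noteq> 0"
    have "y = 120 * x" using c x by (simp add: power2_eq_square)
    moreover have "3 * (x\<^sup>2 * (y + 168 * x)) = 0" using d by (simp add: power2_eq_square power3_eq_cube algebra_simps)
    hence "y + 168 * x = 0" using x by simp
    ultimately show False using x by simp
  qed
  hence "(\<lambda>z. f z ^ 2) = (\<lambda>z. 0)" unfolding f2 c by simp
  thus ?thesis by (simp add: fun_eq_iff)
qed

text \<open>
  Products of a power of \<open>E4\<close> with \<open>E4\<close> or \<open>E6\<close> have every even weight from four on.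
\<close>
lemma normalized_form_exists:
  assumes "even m" "m \<ge> 4"
  obtains B P where "B \<in> modular_functions m" "q_expansion B 0 P" "fps_nth P 0 = 1" "\<And>k. fps_nth P k \<in> \<rat>"
proof -
  have "\<exists>B P. B \<in> modular_functions (4 + 2 * int k) \<and> q_expansion B 0 P \<and> fps_nth P 0 = 1 \<and> (\<forall>i. fps_nth P i \<in> \<rat>)" for k
  proof (induction k rule: less_induct)
    case (less k)
    consider "k = 0" | "k = 1" | "k \<ge> 2" by linarith
    thus ?case
    proof cases
      case 1
      thus ?thesis using E4_modular q_expansion_E4 E_fps_first_coeffs(3) E4_fps_rational by (intro exI[of _ E4] exI[of _ E4_fps]) simp
    next
      case 2
      thus ?thesis using E6_modular q_expansion_E6 E_fps_first_coeffs(5) E6_fps_rational by (intro exI[of _ E6] exI[of _ E6_fps]) simp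
    next
      case 3
      then obtain B P where B: "B \<in> modular_functions (4 + 2 * int (k - 2))" "q_expansion B 0 P" "fps_nth P 0 = 1" "\<And>i. fps_nth P i \<in> \<rat>"
        using less[of "k - 2"] by auto
      have w: "4 + (4 + 2 * int (k - 2)) = 4 + 2 * int k" using 3 by simp
      show ?thesis
        using modular_functions_mult[OF E4_modular B(1)] q_expansion_mult[OF q_expansion_E4 B(2)] B(3,4) unfolding w
        by (intro exI[of _ "\<lambda>z. E4 z * B z"] exI[of _ "E4_fps * P"])
           (auto simp: E_fps_first_coeffs intro!: fps_mult_coeffs E4_fps_rational)
    qed
  qed
  from this[of "nat ((m - 4) div 2)"] show ?thesis using assms that by auto
qed

inductive_set complex_span :: "(complex \<Rightarrow> complex) set \<Rightarrow> (complex \<Rightarrow> complex) set" for S where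
  zero: "(\<lambda>z. 0) \<in> complex_span S"
| step: "f \<in> complex_span S \<Longrightarrow> g \<in> S \<Longrightarrow> (\<lambda>z. f z + c * g z) \<in> complex_span S"

lemma complex_span_base: "g \<in> S \<Longrightarrow> (\<lambda>z. c * g z) \<in> complex_span S"
  using complex_span.step[OF complex_span.zero] by simp

lemma complex_span_add:
  assumes "f \<in> complex_span S" "g \<in> complex_span S"
  shows "(\<lambda>z. f z + g z) \<in> complex_span S"
  using assms(2)
proof induction
  case zero
  thus ?case using assms(1) by simp
next
  case (step g h c)
  from complex_span.step[OF step.IH step.hyps(2), of c] show ?case by (simp add: add.assoc)
qed

lemma complex_span_mult:
  assumes "f \<in> complex_span S" "\<And>g. g \<in> S \<Longrightarrow> (\<lambda>z. h z * g z) \<in> S'"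
  shows "(\<lambda>z. h z * f z) \<in> complex_span S'"
  using assms(1)
proof induction
  case zero
  thus ?case using complex_span.zero by simp
next
  case (step f g c)
  from complex_span.step[OF step.IH assms(2)[OF step.hyps(2)], of c] show ?case by (simp add: algebra_simps)
qed

text \<open>
  By induction on the weight: subtract a multiple of a rational form to make the constant term vanish, and
  divide by the discriminant.
\<close>
lemma holomorphic_form_in_span:
  assumes "f \<in> modular_functions m" "q_expansion f 0 F"
  shows "f \<in> complex_span (forms_over \<rat> m)"
  using assms
proof (induction "nat m" arbitrary: m f F rule: less_induct)
  case less
  note f = less.prems
  have "(m < 0 \<or> m = 2 \<or> odd m) \<or> m = 0 \<or> (m \<ge> 4 \<and> even m)" by presburger
  then consider "m < 0 \<or> m = 2 \<or> odd m" | "m = 0" | "m \<ge> 4" "even m" by blast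
  thus ?case
  proof cases
    case 1
    hence "f = (\<lambda>z. 0)" using weight_negative_zero[OF f] weight_two_zero f modular_functions_odd[OF f(1)] by auto
    thus ?thesis using complex_span.zero by simp
  next
    case 2
    have "f z = fps_nth F 0 * Delta_pow 0 z" for z
      using weight_zero_constant[of f F z] f 2 modular_functionsD(1)[OF f(1), of z] by (cases "Im z > 0") (auto simp: Delta_pow_def)
    hence "f = (\<lambda>z. fps_nth F 0 * Delta_pow 0 z)" by blast
    thus ?thesis using complex_span_base[OF Delta_pow_form[of 0], of "fps_nth F 0"] 2 by simp
  next
    case 3
    then obtain B P where B: "B \<in> modular_functions m" "q_expansion B 0 P" "fps_nth P 0 = 1" "\<And>k. fps_nth P k \<in> \<rat>"
      using normalized_form_exists by blast
    define d where "d = (\<lambda>z. f z + (- fps_nth F 0) * B z)"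
    have d: "d \<in> modular_functions m" unfolding d_def by (intro modular_functions_add modular_functions_cmult f B)
    have D: "q_expansion d 0 (F + fps_const (- fps_nth F 0) * P)"
      unfolding d_def by (intro q_expansion_add q_expansion_cmult f B)
    have "fps_nth (F + fps_const (- fps_nth F 0) * P) 0 = 0" using B(3) by simp
    then obtain h H where h: "h \<in> modular_functions (m - 12)" "q_expansion h 0 H" "d = (\<lambda>z. Delta_pow 1 z * h z)"
      using cusp_form_divide_Delta[OF d D] by blast
    have "h \<in> complex_span (forms_over \<rat> (m - 12))" using less.hyps[OF _ h(1,2)] 3 by simp
    hence "d \<in> complex_span (forms_over \<rat> m)" unfolding h(3)
    proof (rule complex_span_mult)
      fix g assume "g \<in> forms_over \<rat> (m - 12)"
      thus "(\<lambda>z. Delta_pow 1 z * g z) \<in> forms_over \<rat> m"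
        using forms_over_mult[OF _ Delta_pow_form[of 1], of g "m - 12"] by simp
    qed
    from complex_span.step[OF this forms_overI[OF B(1,2,4)], of "fps_nth F 0"] show ?thesis by (simp add: d_def)
  qed
qed

text \<open>A power of the discriminant clears the pole at the cusp.\<close>
theorem forms_over_UNIV_eq_span:
  assumes "f \<in> forms_over UNIV m"
  shows "f \<in> complex_span (forms_over \<rat> m)"
proof -
  obtain r F where f: "f \<in> modular_functions m" "q_expansion f r F" using assms by (auto simp: forms_over_UNIV)
  define N where "N = max 0 (- r)"
  obtain P where P: "q_expansion (Delta_pow N) N P" by (rule q_expansion_Delta_pow)
  define g where "g = (\<lambda>z. f z * Delta_pow N z)"
  have "g \<in> complex_span (forms_over \<rat> (m + 12 * N))"
  proof (rule holomorphic_form_in_span)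
    show "g \<in> modular_functions (m + 12 * N)" unfolding g_def by (intro modular_functions_mult f Delta_pow_modular)
    show "q_expansion g 0 (fps_X ^ nat (r + N - 0) * (F * P))"
      unfolding g_def by (rule q_expansion_lower[OF q_expansion_mult[OF f(2) P]]) (simp add: N_def)
  qed
  hence "(\<lambda>z. Delta_pow (- N) z * g z) \<in> complex_span (forms_over \<rat> m)"
  proof (rule complex_span_mult)
    fix h assume "h \<in> forms_over \<rat> (m + 12 * N)"
    thus "(\<lambda>z. Delta_pow (- N) z * h z) \<in> forms_over \<rat> m"
      using forms_over_mult[OF _ Delta_pow_form[of "- N"], of h "m + 12 * N"] by simp
  qed
  moreover have "(\<lambda>z. Delta_pow (- N) z * g z) = f"
    using modular_functionsD(1)[OF f(1)] Delta_nonzero by (auto simp: g_def Delta_pow_def fun_eq_iff power_int_minus)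
  ultimately show ?thesis by simp
qed

text \<open>The third of Ramanujan's equations holds because the space of forms of weight eight is one-dimensional.\<close>
lemma qderiv_E6:
  assumes "Im z > 0"
  shows "qderiv E6 z = (E2 z * E6 z - E4 z ^ 2) / 2"
proof -
  define f where "f = (\<lambda>z. - 2 * (qderiv E6 z - of_int 6 / 12 * E2 z * E6 z))"
  have f: "f \<in> modular_functions 8"
    unfolding f_def using modular_functions_cmult[OF serre_derivative_modular[OF E6_modular], of "- 2"] by simp
  define F where "F = fps_const (- 2) * ((fps_const (of_int 0) * E6_fps + fps_X * fps_deriv E6_fps) - fps_const (of_int 6 / 12) * (E2_fps * E6_fps))"
  have "q_expansion (\<lambda>z. - 2 * (qderiv E6 z - of_int 6 / 12 * (E2 z * E6 z))) 0 F"
    unfolding F_def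
    by (intro q_expansion_cmult q_expansion_diff q_expansion_qderiv q_expansion_E6
        q_expansion_mult[OF q_expansion_E2 q_expansion_E6, simplified])
  hence F: "q_expansion f 0 F" by (simp add: f_def mult.assoc)
  have F0: "fps_nth F 0 = 1" by (simp add: F_def E_fps_first_coeffs)
  have "f = (\<lambda>z. fps_nth F 0 * (E4 z * E4 z))"
    using modular_functions_mult[OF E4_modular E4_modular] q_expansion_mult[OF q_expansion_E4 q_expansion_E4]
    by (intro form_determined_by_constant_term[OF f F]) (auto simp: E_fps_first_coeffs)
  from fun_cong[OF this, of z] have "E4 z * E4 z = E2 z * E6 z - 2 * qderiv E6 z" using F0
    by (simp add: f_def algebra_simps)
  thus ?thesis by (simp add: power2_eq_square)
qed

text \<open>
  Going up to weight \<open>m + 12\<close> and dividing by the discriminant covers weight two.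
\<close>
lemma nonzero_form_exists:
  assumes "even m" "m \<ge> 0"
  obtains f z where "f \<in> forms_over \<rat> m" "Im z > 0" "f z \<noteq> 0"
proof -
  obtain B P where B: "B \<in> modular_functions (m + 12)" "q_expansion B 0 P" "fps_nth P 0 = 1" "\<And>k. fps_nth P k \<in> \<rat>"
    using normalized_form_exists[of "m + 12"] assms by auto
  have "\<exists>z. Im z > 0 \<and> B z \<noteq> 0"
  proof (rule ccontr)
    assume "\<nexists>z. Im z > 0 \<and> B z \<noteq> 0"
    hence "q_expansion B 0 0" by (auto simp: q_expansion_def)
    hence "P = 0" using q_expansion_unique[OF B(2)] by blast
    thus False using B(3) by simp
  qed
  then obtain z where z: "Im z > 0" "B z \<noteq> 0" by blast
  have "(\<lambda>z. Delta_pow (- 1) z * B z) \<in> forms_over \<rat> m"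
    using forms_over_mult[OF _ Delta_pow_form[of "- 1"] forms_overI[OF B(1,2,4)]] by simp
  thus ?thesis by (rule that[OF _ z(1)]) (use z Delta_nonzero[OF z(1)] in \<open>auto simp: Delta_pow_def\<close>)
qed

section \<open>The modular invariant is real and injective on an arc\<close>

lemma holomorphic_UHP_primitive:
  assumes "f holomorphic_on \<H>"
  obtains P where "\<And>z. Im z > 0 \<Longrightarrow> (P has_field_derivative f z) (at z)"
    and "\<And>a b. Im a > 0 \<Longrightarrow> Im b > 0 \<Longrightarrow> contour_integral (linepath a b) f = P b - P a"
proof -
  obtain P where P: "\<And>x. x \<in> \<H> \<Longrightarrow> (P has_field_derivative f x) (at x within \<H>)"
    using holomorphic_convex_primitive'[OF convex_UHP open_UHP assms] by blast
  have "contour_integral (linepath a b) f = P b - P a" if "Im a > 0" "Im b > 0" for a b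
  proof (rule contour_integral_unique)
    have "path_image (linepath a b) \<subseteq> \<H>"
      using that convex_UHP by (simp add: closed_segment_subset)
    from contour_integral_primitive[OF P valid_path_linepath this]
    show "(f has_contour_integral P b - P a) (linepath a b)" by simp
  qed
  moreover have "(P has_field_derivative f z) (at z)" if "Im z > 0" for z
    using P[of z] that at_within_open[OF _ open_UHP, of z] by simp
  ultimately show ?thesis using that by blast
qed

text \<open>The modular invariant, of weight zero with a simple pole at the cusp.\<close>
definition jfun :: "complex \<Rightarrow> complex" where
  "jfun z = E4 z * (E4 z * (E4 z * Delta_pow (- 1) z))"

lemma jfun_form: "jfun \<in> forms_over \<rat> 0"
proof -
  have "(\<lambda>z. E4 z * (E4 z * (E4 z * Delta_pow (- 1) z))) \<in> forms_over \<rat> (4 + (4 + (4 + 12 * (- 1))))"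
    by (intro forms_over_mult E4_form Delta_pow_form) auto
  thus ?thesis by (simp add: jfun_def[abs_def])
qed

lemma jfun_not_constant: "\<exists>z. Im z > 0 \<and> jfun z \<noteq> c"
proof (rule ccontr)
  assume *: "\<nexists>z. Im z > 0 \<and> jfun z \<noteq> c"
  obtain P where P: "q_expansion (Delta_pow (- 1)) (- 1) P" "fps_nth P 0 = 1" by (rule q_expansion_Delta_pow)
  have J: "q_expansion jfun (- 1) (E4_fps * (E4_fps * (E4_fps * P)))"
    using q_expansion_mult[OF q_expansion_E4 q_expansion_mult[OF q_expansion_E4 q_expansion_mult[OF q_expansion_E4 P(1)]]]
    by (simp add: jfun_def[abs_def])
  have "q_expansion (\<lambda>z. c) (- 1) (fps_X ^ nat (0 - - 1) * fps_const c)"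
    by (rule q_expansion_lower[OF q_expansion_const]) simp
  hence "q_expansion jfun (- 1) (fps_X * fps_const c)" using * by (auto elim!: q_expansion_cong)
  with J have "E4_fps * (E4_fps * (E4_fps * P)) = fps_X * fps_const c" by (rule q_expansion_unique)
  from arg_cong[OF this, of "\<lambda>F. fps_nth F 0"] show False by (simp add: E_fps_first_coeffs P(2))
qed

text \<open>
  From the derivatives of \<open>E4\<close> and of the discriminant; the terms with \<open>E2\<close> cancel.
\<close>
lemma has_field_derivative_jfun:
  assumes z: "Im z > 0"
  shows "(jfun has_field_derivative (- 2 * of_real pi * \<i> * (E4 z ^ 2 * E6 z / Delta z))) (at z)"
proof -
  define p :: complex where "p = of_real pi"
  have D: "Delta z \<noteq> 0" by (rule Delta_nonzero[OF z])
  have dE4: "qderiv E4 z = (E2 z * E4 z - E6 z) / 3" by (simp add: E6_def)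
  have "((\<lambda>z. E4 z ^ 3 / Delta z) has_field_derivative
     ((3 * E4 z ^ 2 * (2 * p * \<i> * qderiv E4 z)) * Delta z - E4 z ^ 3 * (2 * p * \<i> * (E2 z * Delta z))) / (Delta z * Delta z)) (at z)"
    unfolding p_def using D
    by (auto intro!: derivative_eq_intros has_field_derivative_qderiv[OF E4_holomorphic z] has_field_derivative_Delta[OF z])
  also have "((3 * E4 z ^ 2 * (2 * p * \<i> * qderiv E4 z)) * Delta z - E4 z ^ 3 * (2 * p * \<i> * (E2 z * Delta z))) / (Delta z * Delta z)
     = - 2 * p * \<i> * (E4 z ^ 2 * E6 z / Delta z)"
    unfolding dE4 using D by (simp add: field_simps power2_eq_square power3_eq_cube)
  finally show ?thesis unfolding p_def
    by (rule has_field_derivative_transform_within_open[OF _ open_UHP])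
       (use z in \<open>auto simp: jfun_def Delta_pow_def power_int_minus power3_eq_cube divide_inverse\<close>)
qed

lemma cnj_Rats: "x \<in> \<rat> \<Longrightarrow> cnj x = x"
  by (erule Rats_cases') simp

text \<open>On the unit circle \<open>-cnj z = -1/z\<close>, so complex conjugation acts through the inversion.\<close>
lemma cnj_q_expansion_unit_circle:
  assumes F: "q_expansion f r F" "\<And>k. fps_nth F k \<in> \<rat>" and z: "Im z > 0" "cmod z = 1"
  shows "cnj (f z) = f (- 1 / z)"
proof -
  have "z * cnj z = 1" using z(2) by (simp add: complex_norm_square[symmetric])
  moreover have "z \<noteq> 0" using z by auto
  ultimately have "cnj z = 1 / z" by (simp add: nonzero_eq_divide_eq mult.commute)
  hence w: "- 1 / z = - cnj z" by simp
  have q: "nome (- 1 / z) = cnj (nome z)" unfolding w by (simp add: nome_def exp_cnj)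
  have "(\<lambda>n. cnj (fps_nth F n * nome z ^ n)) sums cnj (eval_fps F (nome z))"
    unfolding sums_cnj by (rule sums_eval_fps[OF q_expansionD(3)[OF F(1) z(1)]])
  hence "eval_fps F (cnj (nome z)) = cnj (eval_fps F (nome z))"
    by (simp add: eval_fps_def sums_iff cnj_Rats[OF F(2)])
  thus ?thesis
    using q_expansionD(2)[OF F(1) z(1)] q_expansionD(2)[OF F(1) Im_inversion_pos[OF z(1)]] q
    by simp
qed

lemma has_real_derivative_along_circle:
  assumes "(F has_field_derivative F') (at (cis t))"
  shows "((\<lambda>t. Re (F (cis t))) has_real_derivative Re (F' * (\<i> * cis t))) (at t)"
proof -
  have "(cis has_vector_derivative \<i> * cis t) (at t)"
    unfolding has_vector_derivative_def using has_derivative_cis[OF has_derivative_ident, of t] by simp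
  from field_vector_diff_chain_at[OF this assms]
  have "((\<lambda>t. F (cis t)) has_vector_derivative \<i> * cis t * F') (at t)" by (simp add: o_def)
  from has_field_derivative_Re[OF this] show ?thesis by (simp add: mult_ac)
qed

lemma holomorphic_zero_on_arc:
  assumes g: "g holomorphic_on \<H>" and st: "0 < s" "s < t" "t < pi"
    and zero: "\<And>x. s \<le> x \<Longrightarrow> x \<le> t \<Longrightarrow> g (cis x) = 0" and w: "Im w > 0"
  shows "g w = 0"
proof -
  define T where "T = cis ` {s..t}"
  have T: "compact T" "connected T" unfolding T_def
    by (intro compact_continuous_image connected_continuous_image continuous_intros; simp)+
  have "cis s \<noteq> cis t"
  proof
    assume "cis s = cis t"
    from arg_cong[OF this, of Re] have "cos s = cos t" by simp
    thus False using cos_inj_pi[of s t] st by simp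
  qed
  moreover have "cis s \<in> T" "cis t \<in> T" using st by (auto simp: T_def)
  ultimately have "infinite T" using connected_finite_iff_sing[OF T(2)] by auto
  then obtain \<xi> where \<xi>: "\<xi> \<in> T" "\<xi> islimpt T" using T(1) unfolding compact_eq_Bolzano_Weierstrass by blast
  have TH: "T \<subseteq> \<H>" using st by (auto simp: T_def sin_gt_zero)
  show ?thesis
  proof (rule analytic_continuation[OF g open_UHP convex_connected[OF convex_UHP] TH _ \<xi>(2)])
    show "\<xi> \<in> \<H>" using \<xi>(1) TH by blast
    show "g v = 0" if "v \<in> T" for v using that zero by (auto simp: T_def)
  qed (use w in simp)
qed

text \<open>
  On the arc from \<open>\<i>\<close> to \<open>exp (2 \<pi> \<i> / 3)\<close> the functions \<open>a = z\<^sup>2 E4\<close>, \<open>b = z\<^sup>3 E6\<close>, \<open>d = z\<^sup>6 \<Delta>\<close> and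
  \<open>u = z E2 - 3 \<i> / \<pi>\<close> are real. Ramanujan's equations become
  \<open>b' = - \<pi> (u b - a\<^sup>2)\<close>, \<open>d' = - 2 \<pi> u d\<close> and \<open>j' = 2 \<pi> a\<^sup>2 b / d\<close> in the angle. The first two give
  \<open>(b / \<surd>\<bar>d\<bar>)' \<ge> 0\<close>; since \<open>b\<close> vanishes at \<open>\<i>\<close>, it stays nonnegative, and \<open>j\<close> is monotone by the third.
\<close>
lemma jfun_arc:
  shows jfun_arc_real: "0 < t \<Longrightarrow> t < pi \<Longrightarrow> jfun (cis t) = of_real (Re (jfun (cis t)))"
    and jfun_arc_inj: "inj_on (\<lambda>t. Re (jfun (cis t))) {pi / 2..2 * pi / 3}"
proof -
  have pos: "Im (cis t) > 0" if "0 < t" "t < pi" for t using that by (simp add: sin_gt_zero)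
  have realI: "x = of_real (Re x)" if "cnj x = x" for x using that by (simp add: complex_eq_iff)
  define a b d u where "a = (\<lambda>z. z ^ 2 * E4 z)" and "b = (\<lambda>z. z ^ 3 * E6 z)" and "d = (\<lambda>z. z ^ 6 * Delta z)"
    and "u = (\<lambda>z. z * E2 z - 3 * \<i> / of_real pi)"
  obtain P where P: "q_expansion (Delta_pow 1) 1 P" "\<And>k. fps_nth P k \<in> \<rat>" by (rule q_expansion_Delta_pow[of 1]) blast
  have D1: "Delta_pow 1 z = Delta z" if "Im z > 0" for z using that by (simp add: Delta_pow_def)
  have real: "a (cis t) = of_real (Re (a (cis t)))" "b (cis t) = of_real (Re (b (cis t)))"
    "d (cis t) = of_real (Re (d (cis t)))" "u (cis t) = of_real (Re (u (cis t)))"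
    "jfun (cis t) = of_real (Re (jfun (cis t)))" if t: "0 < t" "t < pi" for t
  proof -
    define z where "z = cis t"
    have z: "Im z > 0" "cmod z = 1" "z \<noteq> 0" using pos[OF t] by (auto simp: z_def)
    have "z * cnj z = 1" using z(2) by (simp add: complex_norm_square[symmetric])
    hence cz: "cnj z = 1 / z" using z(3) by (simp add: nonzero_eq_divide_eq mult.commute)
    have "cnj (E4 z) = z ^ 4 * E4 z"
      using cnj_q_expansion_unit_circle[OF q_expansion_E4 E4_fps_rational z(1,2)] modular_functionsD(5)[OF E4_modular z(1)] by simp
    hence "cnj (a z) = a z" using z(3) by (simp add: a_def cz field_simps power2_eq_square power4_eq_xxxx)
    thus "a (cis t) = of_real (Re (a (cis t)))" unfolding z_def by (rule realI)
    have "cnj (E6 z) = z ^ 6 * E6 z"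
      using cnj_q_expansion_unit_circle[OF q_expansion_E6 E6_fps_rational z(1,2)] modular_functionsD(5)[OF E6_modular z(1)] by simp
    hence "cnj (b z) = b z" using z(3) by (simp add: b_def cz field_simps eval_nat_numeral)
    thus "b (cis t) = of_real (Re (b (cis t)))" unfolding z_def by (rule realI)
    have "cnj (Delta z) = z ^ 12 * Delta z"
      using cnj_q_expansion_unit_circle[OF P z(1,2)] Delta_inversion[OF z(1)] Im_inversion_pos[OF z(1)] z(1) D1 by simp
    hence "cnj (d z) = d z" using z(3) by (simp add: d_def cz field_simps eval_nat_numeral)
    thus "d (cis t) = of_real (Re (d (cis t)))" unfolding z_def by (rule realI)
    have "cnj (E2 z) = z\<^sup>2 * E2 z - 6 * \<i> * z / of_real pi"
      using cnj_q_expansion_unit_circle[OF q_expansion_E2 E2_fps_rational z(1,2)] E2_inversion'[OF z(1)] by simp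
    hence "cnj (u z) = (1 / z) * (z\<^sup>2 * E2 z - 6 * \<i> * z / of_real pi) + 3 * \<i> / of_real pi"
      by (simp add: u_def cz)
    also have "(1 / z) * (z\<^sup>2 * e - 6 * \<i> * z / p) + 3 * \<i> / p = z * e - 3 * \<i> / p" if "p \<noteq> 0" for e p
      using z(3) that by (simp add: field_simps power2_eq_square)
    hence "(1 / z) * (z\<^sup>2 * E2 z - 6 * \<i> * z / of_real pi) + 3 * \<i> / of_real pi = u z" unfolding u_def by simp
    finally have "cnj (u z) = u z" .
    thus "u (cis t) = of_real (Re (u (cis t)))" unfolding z_def by (rule realI)
    obtain r F where "q_expansion jfun r F" "\<And>k. fps_nth F k \<in> \<rat>" using jfun_form by (auto simp: forms_over_def)
    hence "cnj (jfun z) = jfun z"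
      using cnj_q_expansion_unit_circle[of jfun r F z] z modular_functionsD(5)[OF forms_overD[OF jfun_form] z(1)] by simp
    thus "jfun (cis t) = of_real (Re (jfun (cis t)))" unfolding z_def by (rule realI)
  qed
  show "0 < t \<Longrightarrow> t < pi \<Longrightarrow> jfun (cis t) = of_real (Re (jfun (cis t)))" by (rule real(5))
  define A B D U J where "A = (\<lambda>t. Re (a (cis t)))" and "B = (\<lambda>t. Re (b (cis t)))"
    and "D = (\<lambda>t. Re (d (cis t)))" and "U = (\<lambda>t. Re (u (cis t)))" and "J = (\<lambda>t. Re (jfun (cis t)))"
  have DB: "(B has_real_derivative - pi * (U t * B t - (A t)\<^sup>2)) (at t)"
    and DD: "(D has_real_derivative - 2 * pi * U t * D t) (at t)"
    and DJ: "(J has_real_derivative 2 * pi * (A t)\<^sup>2 * B t / D t) (at t)"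
    and D0: "D t \<noteq> 0" if t: "0 < t" "t < pi" for t
  proof -
    define z where "z = cis t"
    define p :: complex where "p = of_real pi"
    have z: "Im z > 0" "z \<noteq> 0" using pos[OF t] by (auto simp: z_def)
    have p: "p \<noteq> 0" by (simp add: p_def)
    note r = real[OF t, folded z_def]
    have e2: "z * E2 z = u z + 3 * \<i> / p" by (simp add: u_def p_def)
    have "(b has_field_derivative (3 * z ^ 2 * E6 z + z ^ 3 * (2 * p * \<i> * qderiv E6 z))) (at z)"
      unfolding b_def p_def by (auto intro!: derivative_eq_intros has_field_derivative_qderiv[OF E6_holomorphic z(1)])
    hence "((\<lambda>t. Re (b (cis t))) has_real_derivative Re ((3 * z ^ 2 * E6 z + z ^ 3 * (2 * p * \<i> * qderiv E6 z)) * (\<i> * z))) (at t)"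
      unfolding z_def by (rule has_real_derivative_along_circle)
    also have "(3 * z ^ 2 * E6 z + z ^ 3 * (2 * p * \<i> * qderiv E6 z)) * (\<i> * z) = 3 * \<i> * b z - p * ((z * E2 z) * b z - (a z)\<^sup>2)"
      unfolding qderiv_E6[OF z(1)] by (simp add: a_def b_def eval_nat_numeral field_simps)
    also have "\<dots> = - p * (u z * b z - (a z)\<^sup>2)" unfolding e2 using p by (simp add: field_simps)
    also have "\<dots> = of_real (- pi * (U t * B t - (A t)\<^sup>2))"
      using r by (simp add: p_def A_def B_def U_def z_def)
    finally show "(B has_real_derivative - pi * (U t * B t - (A t)\<^sup>2)) (at t)" unfolding B_def by simp
    have "(d has_field_derivative (6 * z ^ 5 * Delta z + z ^ 6 * (2 * p * \<i> * (E2 z * Delta z)))) (at z)"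
      unfolding d_def p_def by (auto intro!: derivative_eq_intros has_field_derivative_Delta[OF z(1)])
    hence "((\<lambda>t. Re (d (cis t))) has_real_derivative Re ((6 * z ^ 5 * Delta z + z ^ 6 * (2 * p * \<i> * (E2 z * Delta z))) * (\<i> * z))) (at t)"
      unfolding z_def by (rule has_real_derivative_along_circle)
    also have "(6 * z ^ 5 * Delta z + z ^ 6 * (2 * p * \<i> * (E2 z * Delta z))) * (\<i> * z) = 6 * \<i> * d z - 2 * p * ((z * E2 z) * d z)"
      by (simp add: d_def eval_nat_numeral field_simps)
    also have "\<dots> = - 2 * p * u z * d z" unfolding e2 using p by (simp add: field_simps)
    also have "\<dots> = of_real (- 2 * pi * U t * D t)" using r by (simp add: p_def U_def D_def z_def)
    finally show "(D has_real_derivative - 2 * pi * U t * D t) (at t)" unfolding D_def by simp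
    have dn: "d z \<noteq> 0" using Delta_nonzero[OF z(1)] z by (simp add: d_def)
    thus "D t \<noteq> 0" using r(3) by (auto simp: D_def z_def)
    have "((\<lambda>t. Re (jfun (cis t))) has_real_derivative Re ((- 2 * p * \<i> * (E4 z ^ 2 * E6 z / Delta z)) * (\<i> * z))) (at t)"
      unfolding z_def p_def using has_field_derivative_jfun[OF pos[OF t]] by (rule has_real_derivative_along_circle)
    also have "(- 2 * p * \<i> * (E4 z ^ 2 * E6 z / Delta z)) * (\<i> * z) = 2 * p * (a z)\<^sup>2 * b z / d z"
      using z Delta_nonzero[OF z(1)] by (simp add: a_def b_def d_def eval_nat_numeral field_simps)
    also have "\<dots> = of_real (2 * pi * (A t)\<^sup>2 * B t / D t)"
      using r by (simp add: p_def A_def B_def D_def z_def)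
    finally show "(J has_real_derivative 2 * pi * (A t)\<^sup>2 * B t / D t) (at t)" unfolding J_def by simp
  qed
  have B0: "B (pi / 2) = 0"
  proof -
    have "E6 (- 1 / \<i>) = \<i> powi 6 * E6 \<i>" by (rule modular_functionsD(5)[OF E6_modular]) simp
    moreover have "\<i> powi 6 = -1" by (simp add: eval_nat_numeral)
    ultimately have "E6 \<i> = 0" by simp
    thus ?thesis by (simp add: B_def b_def)
  qed
  have Bpos: "B t \<ge> 0" if t: "pi / 2 \<le> t" "t < pi" for t
  proof -
    \<comment> \<open>The quotient of \<open>B\<close> by the square root of \<open>\<bar>D\<bar>\<close>.\<close>
    define M where "M = (\<lambda>t. B t * exp (- ln ((D t)\<^sup>2) / 4))"
    have "M (pi / 2) \<le> M t"
    proof (rule DERIV_nonneg_imp_nondecreasing[OF t(1)])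
      fix x assume x: "pi / 2 \<le> x" "x \<le> t"
      hence x': "0 < x" "x < pi" using t pi_gt_zero by linarith+
      have "(M has_real_derivative
         (- pi * (U x * B x - (A x)\<^sup>2)) * exp (- ln ((D x)\<^sup>2) / 4)
         + B x * (exp (- ln ((D x)\<^sup>2) / 4) * (- (2 * D x * (- 2 * pi * U x * D x) / (D x)\<^sup>2) / 4))) (at x)"
        unfolding M_def using D0[OF x'] DB[OF x'] DD[OF x']
        by (auto intro!: derivative_eq_intros simp: divide_simps)
      also have "- (2 * D x * (- 2 * pi * U x * D x) / (D x)\<^sup>2) / 4 = pi * U x"
        using D0[OF x'] by (simp add: field_simps power2_eq_square)
      also have "(- pi * (U x * B x - (A x)\<^sup>2)) * exp (- ln ((D x)\<^sup>2) / 4) + B x * (exp (- ln ((D x)\<^sup>2) / 4) * (pi * U x))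
        = pi * (A x)\<^sup>2 * exp (- ln ((D x)\<^sup>2) / 4)" by (simp add: algebra_simps)
      finally show "\<exists>y. (M has_real_derivative y) (at x) \<and> 0 \<le> y" by (intro exI conjI) auto
    qed
    thus ?thesis using B0 by (simp add: M_def zero_le_mult_iff)
  qed
  have Dsign: "D t * D (pi / 2) > 0" if t: "pi / 2 \<le> t" "t < pi" for t
  proof (rule ccontr)
    assume "\<not> D t * D (pi / 2) > 0"
    moreover have "D (pi / 2) * D (pi / 2) > 0" using D0[of "pi / 2"] by (simp add: zero_less_mult_iff linorder_neq_iff disj_commute)
    moreover have "continuous_on {pi / 2..t} (\<lambda>x. D x * D (pi / 2))"
    proof (intro continuous_intros continuous_at_imp_continuous_on ballI)
      fix x assume x: "x \<in> {pi / 2..t}"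
      hence "0 < x" "x < pi" using t pi_gt_zero by auto
      thus "isCont D x" using DD DERIV_isCont by blast
    qed
    ultimately obtain x where x: "pi / 2 \<le> x" "x \<le> t" "D x * D (pi / 2) = 0"
      using IVT2'[of "\<lambda>x. D x * D (pi / 2)" t 0 "pi / 2"] t by auto
    thus False using D0[of x] D0[of "pi / 2"] t pi_gt_zero by auto
  qed
  show "inj_on (\<lambda>t. Re (jfun (cis t))) {pi / 2..2 * pi / 3}"
  proof (rule linorder_inj_onI', rule notI)
    fix s t assume st: "s \<in> {pi / 2..2 * pi / 3}" "t \<in> {pi / 2..2 * pi / 3}" "s < t"
      and eq: "Re (jfun (cis s)) = Re (jfun (cis t))"
    \<comment> \<open>The factor makes the sign of the derivative of \<open>J\<close> immaterial, since \<open>D\<close> does not change sign.\<close>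
    define H where "H = (\<lambda>t. D (pi / 2) * J t)"
    have rng: "0 < x" "x < pi" "pi / 2 \<le> x" if "s \<le> x" "x \<le> t" for x using that st pi_gt_zero by auto
    have mono: "H x \<le> H y" if "s \<le> x" "x \<le> y" "y \<le> t" for x y
    proof (rule DERIV_nonneg_imp_nondecreasing[OF that(2)])
      fix w assume w: "x \<le> w" "w \<le> y"
      hence w': "0 < w" "w < pi" "pi / 2 \<le> w" using rng[of w] that by auto
      have "(H has_real_derivative D (pi / 2) * (2 * pi * (A w)\<^sup>2 * B w / D w)) (at w)"
        unfolding H_def by (intro DERIV_cmult DJ w')
      moreover have "D (pi / 2) * (2 * pi * (A w)\<^sup>2 * B w / D w) = 2 * pi * (A w)\<^sup>2 * B w * (D (pi / 2))\<^sup>2 / (D w * D (pi / 2))"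
        using D0[of "pi / 2"] by (simp add: field_simps power2_eq_square)
      moreover have "2 * pi * (A w)\<^sup>2 * B w * (D (pi / 2))\<^sup>2 / (D w * D (pi / 2)) \<ge> 0"
        using Bpos[OF w'(3,2)] Dsign[OF w'(3,2)] by (intro divide_nonneg_pos mult_nonneg_nonneg) auto
      ultimately show "\<exists>y. (H has_real_derivative y) (at w) \<and> 0 \<le> y" by auto
    qed
    have const: "jfun (cis x) = of_real (J s)" if "s \<le> x" "x \<le> t" for x
    proof -
      have "H s \<le> H x" "H x \<le> H t" "H s = H t" using mono[of s x] mono[of x t] that eq by (auto simp: H_def J_def)
      hence "H x = H s" by simp
      hence "J x = J s" using D0[of "pi / 2"] by (simp add: H_def)
      thus ?thesis using real(5)[of x] rng[OF that] by (simp add: J_def)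
    qed
    have "jfun w - of_real (J s) = 0" if "Im w > 0" for w
    proof (rule holomorphic_zero_on_arc[where g = "\<lambda>w. jfun w - of_real (J s)"])
      show "(\<lambda>w. jfun w - of_real (J s)) holomorphic_on \<H>"
        by (intro holomorphic_intros forms_over_holomorphic[OF jfun_form])
      show "0 < s" "s < t" "t < pi" using rng[of s] rng[of t] st(3) by auto
      show "jfun (cis x) - of_real (J s) = 0" if "s \<le> x" "x \<le> t" for x using const[OF that] by simp
    qed (rule that)
    thus False using jfun_not_constant[of "of_real (J s)"] by auto
  qed
qed

section \<open>Periods along the arc take arbitrary values\<close>

text \<open>
  Since \<open>J\<close> is injective, polynomials in \<open>J\<close> are dense by the Stone-Weierstrass theorem, so \<open>\<psi>\<close> is
  orthogonal to itself.
\<close>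
lemma orthogonal_to_powers_zero:
  fixes \<psi> J :: "real \<Rightarrow> real"
  assumes ab: "a < b" and cont: "continuous_on {a..b} \<psi>" "continuous_on {a..b} J"
    and inj: "inj_on J {a..b}"
    and orth: "\<And>k. integral {a..b} (\<lambda>t. \<psi> t * J t ^ k) = 0" and t: "t \<in> {a..b}"
  shows "\<psi> t = 0"
proof -
  have poly: "integral {a..b} (\<lambda>t. \<psi> t * poly p (J t)) = 0" for p
  proof -
    have "integral {a..b} (\<lambda>t. \<psi> t * poly p (J t)) = integral {a..b} (\<lambda>t. \<Sum>i\<le>degree p. coeff p i * (\<psi> t * J t ^ i))"
      by (simp add: poly_altdef sum_distrib_left mult_ac)
    also have "\<dots> = (\<Sum>i\<le>degree p. integral {a..b} (\<lambda>t. coeff p i * (\<psi> t * J t ^ i)))"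
      by (intro integral_sum integrable_continuous_interval continuous_intros cont) auto
    also have "\<dots> = 0" by (simp add: orth)
    finally show ?thesis .
  qed
  define I M where "I = integral {a..b} (\<lambda>t. \<psi> t * \<psi> t)" and "M = integral {a..b} (\<lambda>t. \<bar>\<psi> t\<bar>)"
  have M: "M \<ge> 0" unfolding M_def by (intro integral_nonneg integrable_continuous_interval continuous_intros cont) auto
  have le: "I \<le> e * M" if e: "e > 0" for e
  proof -
    have "\<exists>g. (\<exists>p. g = (\<lambda>t. poly p (J t))) \<and> (\<forall>x\<in>{a..b}. \<bar>\<psi> x - g x\<bar> < e)"
    proof (rule Stone_Weierstrass_HOL[of _ "\<lambda>g. \<exists>p. g = (\<lambda>t. poly p (J t))"])
      show "\<exists>p. (\<lambda>x. c) = (\<lambda>t. poly p (J t))" for c by (rule exI[of _ "[:c:]"]) simp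
      show "continuous_on {a..b} f" if "\<exists>p. f = (\<lambda>t. poly p (J t))" for f
        using that cont by (auto intro!: continuous_intros)
      show "\<exists>p. (\<lambda>x. f x + g x) = (\<lambda>t. poly p (J t))"
        if fg: "(\<exists>p. f = (\<lambda>t. poly p (J t))) \<and> (\<exists>p. g = (\<lambda>t. poly p (J t)))" for f g
      proof -
        from fg obtain p q where "f = (\<lambda>t. poly p (J t))" "g = (\<lambda>t. poly q (J t))" by blast
        thus ?thesis by (intro exI[of _ "p + q"]) simp
      qed
      show "\<exists>p. (\<lambda>x. f x * g x) = (\<lambda>t. poly p (J t))"
        if fg: "(\<exists>p. f = (\<lambda>t. poly p (J t))) \<and> (\<exists>p. g = (\<lambda>t. poly p (J t)))" for f g
      proof -
        from fg obtain p q where "f = (\<lambda>t. poly p (J t))" "g = (\<lambda>t. poly q (J t))" by blast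
        thus ?thesis by (intro exI[of _ "p * q"]) simp
      qed
      show "\<exists>f. (\<exists>p. f = (\<lambda>t. poly p (J t))) \<and> f x \<noteq> f y" if "x \<in> {a..b} \<and> y \<in> {a..b} \<and> x \<noteq> y" for x y
        using that inj by (intro exI[of _ "\<lambda>t. poly [:0, 1:] (J t)"] conjI exI[of _ "[:0, 1:]"]) (auto dest: inj_onD)
    qed (use cont e in auto)
    then obtain p where p: "\<forall>x\<in>{a..b}. \<bar>\<psi> x - poly p (J x)\<bar> < e" by blast
    have "I = I - integral {a..b} (\<lambda>t. \<psi> t * poly p (J t))" by (simp add: poly)
    also have "\<dots> = integral {a..b} (\<lambda>t. \<psi> t * \<psi> t - \<psi> t * poly p (J t))"
      unfolding I_def by (intro integral_diff[symmetric] integrable_continuous_interval continuous_intros cont)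
    also have "\<dots> \<le> integral {a..b} (\<lambda>t. e * \<bar>\<psi> t\<bar>)"
    proof (intro integral_le integrable_continuous_interval continuous_intros cont)
      fix x assume x: "x \<in> {a..b}"
      have "\<psi> x * \<psi> x - \<psi> x * poly p (J x) \<le> \<bar>\<psi> x * (\<psi> x - poly p (J x))\<bar>" by (simp add: algebra_simps)
      also have "\<dots> \<le> e * \<bar>\<psi> x\<bar>"
        using bspec[OF p x] by (simp add: abs_mult mult.commute[of e] mult_left_mono less_imp_le)
      finally show "\<psi> x * \<psi> x - \<psi> x * poly p (J x) \<le> e * \<bar>\<psi> x\<bar>" .
    qed
    also have "\<dots> = e * M" by (simp add: M_def)
    finally show ?thesis .
  qed
  have "I \<le> 0"
  proof (rule ccontr)
    assume I: "\<not> I \<le> 0"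
    hence "I \<le> (I / (2 * (M + 1))) * M" using M by (intro le) auto
    also have "\<dots> = I * (M / (2 * (M + 1)))" by simp
    also have "\<dots> < I * 1" using I M by (intro mult_strict_left_mono) (auto simp: field_simps)
    finally show False by simp
  qed
  moreover have "I \<ge> 0" unfolding I_def by (intro integral_nonneg integrable_continuous_interval continuous_intros cont) auto
  ultimately have "I = 0" by simp
  hence "\<forall>x\<in>{a..b}. \<psi> x * \<psi> x = 0"
    unfolding I_def using ab cont by (subst (asm) integral_eq_0_iff) (auto intro!: continuous_intros)
  thus ?thesis using t by simp
qed

definition rho :: complex where "rho = cis (2 * pi / 3)"

lemma Im_rho: "Im rho > 0"
  unfolding rho_def using pi_gt_zero by (auto intro!: sin_gt_zero)

lemma forms_over_jfun_power:
  assumes "f \<in> forms_over UNIV m"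
  shows "(\<lambda>z. jfun z ^ k * f z) \<in> forms_over UNIV m"
proof (induction k)
  case (Suc k)
  have "jfun \<in> forms_over UNIV 0" using jfun_form by (rule forms_over_mono)
  from forms_over_mult[OF _ this Suc.IH] show ?case by (simp add: mult.assoc)
qed (use assms in simp)

text \<open>
  The forms \<open>j\<^sup>k f\<close> all have vanishing period against \<open>p\<close>. Since \<open>j\<close> is a real coordinate on the arc,
  the Stone-Weierstrass theorem makes the integrand vanish identically.
\<close>
lemma period_functionals_independent:
  assumes n: "even n" and zero: "\<And>f. f \<in> forms_over UNIV (int n + 2) \<Longrightarrow>
      contour_integral (linepath \<i> rho) (\<lambda>z. f z * poly p z) = 0"
  shows "p = 0"
proof -
  obtain f0 z0 where f0: "f0 \<in> forms_over \<rat> (int n + 2)" "Im z0 > 0" "f0 z0 \<noteq> 0"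
    using nonzero_form_exists[of "int n + 2"] n by auto
  have f0h: "f0 holomorphic_on \<H>" by (rule forms_over_holomorphic[OF f0(1)])
  define a b where "a = pi / 2" and "b = 2 * pi / 3"
  have ab: "a < b" "0 < a" "b < pi" using pi_gt_zero by (auto simp: a_def b_def)
  have pos: "Im (cis t) > 0" "0 < t" "t < pi" if "t \<in> {a..b}" for t
    using that ab by (auto intro!: sin_gt_zero)
  have ends: "cis a = \<i>" "cis b = rho" by (simp_all add: a_def b_def rho_def)
  define J where "J = (\<lambda>t. Re (jfun (cis t)))"
  define \<phi> where "\<phi> = (\<lambda>t. f0 (cis t) * poly p (cis t) * (\<i> * cis t))"
  have contc: "continuous_on {a..b} (\<lambda>t. g (cis t))" if "g holomorphic_on \<H>" for g
    by (rule continuous_on_compose2[OF holomorphic_on_imp_continuous_on[OF that]]) (use pos in \<open>auto intro!: continuous_intros\<close>)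
  have cont: "continuous_on {a..b} \<phi>" "continuous_on {a..b} J"
    unfolding \<phi>_def J_def by (intro continuous_intros contc f0h forms_over_holomorphic[OF jfun_form])+
  have int0: "integral {a..b} (\<lambda>t. \<phi> t * of_real (J t ^ k)) = 0" for k
  proof -
    define g where "g = (\<lambda>z. (jfun z ^ k * f0 z) * poly p z)"
    have form: "(\<lambda>z. jfun z ^ k * f0 z) \<in> forms_over UNIV (int n + 2)"
      by (intro forms_over_jfun_power forms_over_mono[OF f0(1)])
    have "g holomorphic_on \<H>"
      unfolding g_def by (intro holomorphic_intros forms_over_holomorphic[OF jfun_form] f0h)
    then obtain P where P: "\<And>z. Im z > 0 \<Longrightarrow> (P has_field_derivative g z) (at z)"
      "\<And>a b. Im a > 0 \<Longrightarrow> Im b > 0 \<Longrightarrow> contour_integral (linepath a b) g = P b - P a"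
      using holomorphic_UHP_primitive by blast
    have "((\<lambda>t. \<i> * cis t * g (cis t)) has_integral (P (cis b) - P (cis a))) {a..b}"
    proof (rule fundamental_theorem_of_calculus)
      fix t assume t: "t \<in> {a..b}"
      have "(cis has_vector_derivative \<i> * cis t) (at t)"
        unfolding has_vector_derivative_def using has_derivative_cis[OF has_derivative_ident, of t] by simp
      from field_vector_diff_chain_at[OF this P(1)[OF pos(1)[OF t]]]
      show "((\<lambda>t. P (cis t)) has_vector_derivative \<i> * cis t * g (cis t)) (at t within {a..b})"
        by (simp add: o_def has_vector_derivative_at_within)
    qed (use ab in simp)
    moreover have "P (cis b) - P (cis a) = 0"
      using P(2)[of \<i> rho] Im_rho zero[OF form] by (simp add: ends g_def)
    ultimately have "integral {a..b} (\<lambda>t. \<i> * cis t * g (cis t)) = 0" by (simp add: integral_unique)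
    moreover have "integral {a..b} (\<lambda>t. \<i> * cis t * g (cis t)) = integral {a..b} (\<lambda>t. \<phi> t * of_real (J t ^ k))"
    proof (rule integral_cong)
      fix t assume "t \<in> {a..b}"
      hence "jfun (cis t) = of_real (J t)" unfolding J_def using jfun_arc_real pos by blast
      thus "\<i> * cis t * g (cis t) = \<phi> t * of_real (J t ^ k)" by (simp add: g_def \<phi>_def)
    qed
    ultimately show ?thesis by simp
  qed
  have intg: "(\<lambda>t. \<phi> t * of_real (J t ^ k)) integrable_on {a..b}" for k
    by (intro integrable_continuous_interval continuous_intros cont)
  have inj: "inj_on J {a..b}" using jfun_arc_inj by (simp add: J_def a_def b_def)
  have "\<phi> t = 0" if t: "t \<in> {a..b}" for t
  proof -
    have "Re (\<phi> t) = 0"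
    proof (rule orthogonal_to_powers_zero[OF ab(1) _ cont(2) inj _ t])
      show "continuous_on {a..b} (\<lambda>t. Re (\<phi> t))" by (intro continuous_intros cont)
      fix k show "integral {a..b} (\<lambda>t. Re (\<phi> t) * J t ^ k) = 0"
        using integral_linear[OF intg[of k] bounded_linear_Re] int0[of k] by (simp add: o_def)
    qed
    moreover have "Im (\<phi> t) = 0"
    proof (rule orthogonal_to_powers_zero[OF ab(1) _ cont(2) inj _ t])
      show "continuous_on {a..b} (\<lambda>t. Im (\<phi> t))" by (intro continuous_intros cont)
      fix k show "integral {a..b} (\<lambda>t. Im (\<phi> t) * J t ^ k) = 0"
        using integral_linear[OF intg[of k] bounded_linear_Im] int0[of k] by (simp add: o_def)
    qed
    ultimately show ?thesis by (simp add: complex_eq_iff)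
  qed
  hence arc0: "f0 (cis t) * poly p (cis t) = 0" if "a \<le> t" "t \<le> b" for t
    using that by (simp add: \<phi>_def)
  have prod0: "f0 w * poly p w = 0" if "Im w > 0" for w
  proof (rule holomorphic_zero_on_arc[where g = "\<lambda>w. f0 w * poly p w"])
    show "(\<lambda>w. f0 w * poly p w) holomorphic_on \<H>" by (intro holomorphic_intros f0h)
    show "0 < a" "a < b" "b < pi" by (rule ab)+
  qed (use arc0 that in auto)
  have "continuous (at z0) f0"
    by (rule DERIV_isCont[OF has_field_derivative_qderiv[OF f0h f0(2)]])
  then obtain e where e: "e > 0" "\<And>w. dist z0 w < e \<Longrightarrow> f0 w \<noteq> 0"
    using continuous_at_avoid[of z0 f0 0] f0(3) by blast
  have "open (ball z0 e \<inter> \<H>)" "z0 \<in> ball z0 e \<inter> \<H>" using e(1) f0(2) open_UHP by auto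
  hence "infinite (ball z0 e \<inter> \<H>)" by (metis empty_iff finite_imp_not_open)
  moreover have "ball z0 e \<inter> \<H> \<subseteq> {w. poly p w = 0}"
  proof
    fix w assume "w \<in> ball z0 e \<inter> \<H>"
    hence "f0 w \<noteq> 0" "Im w > 0" using e(2) by auto
    thus "w \<in> {w. poly p w = 0}" using prod0[of w] by simp
  qed
  ultimately have "infinite {w. poly p w = 0}" using finite_subset by blast
  thus "p = 0" using poly_roots_finite by blast
qed

text \<open>
  The joint map is onto if the functionals are linearly independent. By induction on \<open>N\<close>: elements \<open>e j\<close> dual
  to the first \<open>N\<close> functionals correct any element to one annihilated by them, and the last functional cannot
  vanish on all of these.
\<close>
lemma functionals_jointly_surjective:
  fixes L :: "nat \<Rightarrow> (complex \<Rightarrow> complex) \<Rightarrow> complex"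
  assumes zero: "(\<lambda>z. 0) \<in> W" and lin: "\<And>f g c. f \<in> W \<Longrightarrow> g \<in> W \<Longrightarrow> (\<lambda>z. f z + c * g z) \<in> W"
    and L: "\<And>i f g c. f \<in> W \<Longrightarrow> g \<in> W \<Longrightarrow> L i (\<lambda>z. f z + c * g z) = L i f + c * L i g"
    and indep: "\<And>c. (\<And>f. f \<in> W \<Longrightarrow> (\<Sum>i<N. c i * L i f) = 0) \<Longrightarrow> \<forall>i<N. c i = 0"
  shows "\<exists>f\<in>W. \<forall>i<N. L i f = \<tau> i"
  using indep
proof (induction N arbitrary: \<tau>)
  case 0
  thus ?case using zero by auto
next
  case (Suc N)
  have IH: "\<exists>f\<in>W. \<forall>i<N. L i f = \<tau> i" for \<tau>
  proof (rule Suc.IH)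
    fix c :: "nat \<Rightarrow> complex" assume c: "\<And>f. f \<in> W \<Longrightarrow> (\<Sum>i<N. c i * L i f) = 0"
    have "\<forall>i<Suc N. (c(N := 0)) i = 0"
      by (rule Suc.prems) (use c in simp)
    thus "\<forall>i<N. c i = 0" by (metis fun_upd_other less_SucI nat_neq_iff)
  qed
  obtain e where e: "\<And>j. e j \<in> W" "\<And>j i. i < N \<Longrightarrow> L i (e j) = (if i = j then 1 else 0)"
    using IH[of "\<lambda>i. if i = _ then 1 else 0"] by metis
  have "\<exists>g\<in>W. (\<forall>i<N. L i g = 0) \<and> L N g \<noteq> 0"
  proof (rule ccontr)
    assume no: "\<not> (\<exists>g\<in>W. (\<forall>i<N. L i g = 0) \<and> L N g \<noteq> 0)"
    \<comment> \<open>The coefficients of a linear relation between the functionals.\<close>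
    define c where "c = (\<lambda>j. if j = N then 1 else - L N (e j))"
    have "\<forall>i<Suc N. c i = 0"
    proof (rule Suc.prems)
      fix f assume f: "f \<in> W"
      have "\<exists>h\<in>W. \<forall>i. L i h = L i f + (\<Sum>j<M. (- L j f) * L i (e j))" for M
      proof (induction M)
        case (Suc M)
        then obtain h where "h \<in> W" and h: "\<And>i. L i h = L i f + (\<Sum>j<M. (- L j f) * L i (e j))" by blast
        show ?case
        proof (rule bexI[OF _ lin[OF \<open>h \<in> W\<close> e(1)[of M], of "- L M f"]], rule allI)
          fix i show "L i (\<lambda>z. h z + - L M f * e M z) = L i f + (\<Sum>j<Suc M. (- L j f) * L i (e j))"
            unfolding L[OF \<open>h \<in> W\<close> e(1)[of M]] by (simp add: h)
        qed
      qed (use f in auto)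
      from this[of N] obtain h where h: "h \<in> W" "\<And>i. L i h = L i f + (\<Sum>j<N. (- L j f) * L i (e j))" by blast
      have "L i h = 0" if "i < N" for i
      proof -
        have "(\<Sum>j<N. (- L j f) * L i (e j)) = (\<Sum>j<N. if j = i then - L i f else 0)"
          using that by (intro sum.cong) (auto simp: e(2))
        thus ?thesis using that by (simp add: h(2))
      qed
      hence "L N h = 0" using no h(1) by blast
      hence "L N f + (\<Sum>j<N. (- L j f) * L N (e j)) = 0" by (simp add: h(2))
      moreover have "(\<Sum>i<N. c i * L i f) = (\<Sum>j<N. (- L j f) * L N (e j))"
        by (intro sum.cong) (auto simp: c_def)
      ultimately show "(\<Sum>i<Suc N. c i * L i f) = 0" by (simp add: c_def add.commute)
    qed
    hence "c N = 0" by blast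
    thus False by (simp add: c_def)
  qed
  then obtain g where g: "g \<in> W" "\<And>i. i < N \<Longrightarrow> L i g = 0" "L N g \<noteq> 0" by blast
  obtain f where f: "f \<in> W" "\<And>i. i < N \<Longrightarrow> L i f = \<tau> i" using IH[of \<tau>] by blast
  show ?case
  proof (rule bexI[OF _ lin[OF f(1) g(1), of "(\<tau> N - L N f) / L N g"]], intro allI impI)
    fix i assume "i < Suc N"
    thus "L i (\<lambda>z. f z + (\<tau> N - L N f) / L N g * g z) = \<tau> i"
      unfolding L[OF f(1) g(1)] using f g by (cases "i = N") auto
  qed
qed

lemma contour_integral_UHP_linear:
  assumes "f holomorphic_on \<H>" "g holomorphic_on \<H>" "Im a > 0" "Im b > 0"
  shows "contour_integral (linepath a b) (\<lambda>z. f z + c * g z)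
       = contour_integral (linepath a b) f + c * contour_integral (linepath a b) g"
proof -
  have "path_image (linepath a b) \<subseteq> \<H>"
    using assms(3,4) convex_UHP by (simp add: closed_segment_subset)
  note ci = contour_integrable_holomorphic_simple[OF _ open_UHP valid_path_linepath this]
  have "contour_integral (linepath a b) (\<lambda>z. f z + c * g z)
       = contour_integral (linepath a b) f + contour_integral (linepath a b) (\<lambda>z. c * g z)"
    by (intro contour_integral_add ci holomorphic_intros assms)
  thus ?thesis by (simp add: contour_integral_lmul[OF ci[OF assms(2)]])
qed

text \<open>
  A relation between the periods with coefficients \<open>c i\<close> says that \<open>f(z) p(z)\<close> has integral zero for all
  \<open>f\<close>, where \<open>p\<close> is the polynomial with these coefficients.
\<close>
theorem periods_surjective:
  assumes "even n"
  shows "\<exists>f\<in>forms_over UNIV (int n + 2). \<forall>i\<le>n. contour_integral (linepath \<i> rho) (\<lambda>z. f z * z ^ i) = \<tau> i"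
proof -
  define W where "W = forms_over UNIV (int n + 2)"
  define L where "L = (\<lambda>i f. contour_integral (linepath \<i> rho) (\<lambda>z. f z * z ^ i))"
  have hol: "(\<lambda>z. f z * z ^ i) holomorphic_on \<H>" if "f \<in> W" for f i
    using that by (intro holomorphic_intros) (auto simp: W_def dest: forms_over_holomorphic)
  have L: "L i (\<lambda>z. f z + c * g z) = L i f + c * L i g" if "f \<in> W" "g \<in> W" for i f g c
    using contour_integral_UHP_linear[OF hol[OF that(1), of i] hol[OF that(2), of i], of \<i> rho c] Im_rho
    by (simp add: L_def algebra_simps)
  have "\<exists>f\<in>W. \<forall>i<Suc n. L i f = \<tau> i"
  proof (rule functionals_jointly_surjective[OF _ _ L])
    show "(\<lambda>z. 0) \<in> W" unfolding W_def by (rule forms_over_zero) simp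
    show "(\<lambda>z. f z + c * g z) \<in> W" if "f \<in> W" "g \<in> W" for f g c
      using that unfolding W_def by (intro forms_over_add forms_over_cmult) auto
    fix c :: "nat \<Rightarrow> complex" assume c: "\<And>f. f \<in> W \<Longrightarrow> (\<Sum>i<Suc n. c i * L i f) = 0"
    define p where "p = (\<Sum>i<Suc n. monom (c i) i)"
    have "p = 0"
    proof (rule period_functionals_independent[OF assms])
      fix f assume "f \<in> forms_over UNIV (int n + 2)"
      hence f: "f \<in> W" by (simp add: W_def)
      have "contour_integral (linepath \<i> rho) (\<lambda>z. \<Sum>i<M. c i * (f z * z ^ i)) = (\<Sum>i<M. c i * L i f)" for M
      proof (induction M)
        case (Suc M)
        have "(\<lambda>z. \<Sum>i<M. c i * (f z * z ^ i)) holomorphic_on \<H>"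
          by (intro holomorphic_intros hol f)
        from contour_integral_UHP_linear[OF this hol[OF f, of M], of \<i> rho "c M"] Im_rho Suc
        show ?case by (simp add: L_def)
      qed simp
      from this[of "Suc n"] have "contour_integral (linepath \<i> rho) (\<lambda>z. \<Sum>i<Suc n. c i * (f z * z ^ i)) = 0"
        using c[OF f] by simp
      moreover have "(\<lambda>z. \<Sum>i<Suc n. c i * (f z * z ^ i)) = (\<lambda>z. f z * poly p z)"
        by (simp add: p_def poly_sum poly_monom sum_distrib_left mult_ac distrib_left del: sum.lessThan_Suc)
      ultimately show "contour_integral (linepath \<i> rho) (\<lambda>z. f z * poly p z) = 0" by simp
    qed
    have "coeff p i = c i" if "i < Suc n" for i
      using that by (simp add: p_def coeff_sum coeff_monom del: sum.lessThan_Suc)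
    thus "\<forall>i<Suc n. c i = 0" using \<open>p = 0\<close> by auto
  qed
  thus ?thesis by (auto simp: W_def L_def less_Suc_eq_le)
qed

section \<open>Symmetric powers as spaces of polynomials\<close>

abbreviation (input) Sym :: "nat \<Rightarrow> complex poly poly set" where
  "Sym n \<equiv> carrier (sym_power n)"

lemma Sym_iff: "P \<in> Sym n \<longleftrightarrow> (\<forall>i j. coeff (coeff P i) j \<noteq> 0 \<longrightarrow> i + j = n)"
  by (simp add: sym_power_def)

lemma monomial_eq: "const_poly c * var_a ^ i * var_b ^ k = monom (monom c k) i"
proof -
  have a: "var_a ^ i = monom 1 i" by (simp add: var_a_def monom_altdef)
  have b: "var_b ^ k = [:monom 1 k:]"
    by (induction k) (simp_all add: var_b_def one_pCons monom_0 monom_altdef)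
  have "monom (1 :: complex poly) i * [:monom 1 k:] = monom (monom 1 k) i"
    by (simp add: monom_altdef mult.commute)
  hence "const_poly c * var_a ^ i * var_b ^ k = const_poly c * monom (monom 1 k) i"
    unfolding a b by (simp only: mult.assoc)
  also have "\<dots> = monom (monom c k) i" by (simp add: const_poly_def smult_monom)
  finally show ?thesis .
qed

lemma monomial_in_Sym: "i + k = n \<Longrightarrow> monom (monom c k) i \<in> Sym n"
  by (auto simp: Sym_iff coeff_monom split: if_splits)

lemma Sym_add: "P \<in> Sym n \<Longrightarrow> Q \<in> Sym n \<Longrightarrow> P + Q \<in> Sym n"
  unfolding Sym_iff coeff_add by (metis add.right_neutral)

lemma Sym_uminus: "P \<in> Sym n \<Longrightarrow> - P \<in> Sym n"
  by (simp add: Sym_iff)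

lemma Sym_diff: "P \<in> Sym n \<Longrightarrow> Q \<in> Sym n \<Longrightarrow> P - Q \<in> Sym n"
  using Sym_add[of P n "- Q"] Sym_uminus by simp

lemma Sym_zero: "0 \<in> Sym n"
  by (simp add: Sym_iff)

lemma Sym_sum: "(\<And>i. i \<in> I \<Longrightarrow> P i \<in> Sym n) \<Longrightarrow> sum P I \<in> Sym n"
  by (induction I rule: infinite_finite_induct) (auto intro: Sym_add Sym_zero)

lemma Sym_expand:
  assumes "P \<in> Sym n"
  shows "P = (\<Sum>i\<le>n. monom (monom (coeff (coeff P i) (n - i)) (n - i)) i)"
proof (intro poly_eqI)
  fix i j
  have "coeff (coeff (\<Sum>i\<le>n. monom (monom (coeff (coeff P i) (n - i)) (n - i)) i) i) j
     = (\<Sum>k\<le>n. if k = i then (if n - i = j then coeff (coeff P i) (n - i) else 0) else 0)"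
    unfolding coeff_sum by (intro sum.cong refl) (auto simp: coeff_monom)
  also have "\<dots> = (if i \<le> n then (if n - i = j then coeff (coeff P i) (n - i) else 0) else 0)"
    by (simp add: sum.delta)
  also have "\<dots> = coeff (coeff P i) j"
    using assms unfolding Sym_iff by (smt (verit) add_diff_cancel_left' le_add1)
  finally show "coeff (coeff P i) j = coeff (coeff (\<Sum>i\<le>n. monom (monom (coeff (coeff P i) (n - i)) (n - i)) i) i) j" ..
qed

lemma Sym_mult:
  assumes "P \<in> Sym m" "Q \<in> Sym n"
  shows "P * Q \<in> Sym (m + n)"
  by (subst Sym_expand[OF assms(1)], subst Sym_expand[OF assms(2)])
     (auto simp: sum_product mult_monom intro!: Sym_sum monomial_in_Sym)

lemma Sym_power: "P \<in> Sym 1 \<Longrightarrow> P ^ k \<in> Sym k"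
proof (induction k)
  case 0
  show ?case using monomial_in_Sym[of 0 0 0 1] by (simp add: monom_0 one_pCons)
next
  case (Suc k)
  thus ?case using Sym_mult[of P 1 "P ^ k" k] by simp
qed

lemma const_poly_in_Sym: "const_poly c \<in> Sym 0"
  using monomial_in_Sym[of 0 0 0 c] by (simp add: monom_0 const_poly_def)

lemma Sym_const_mult: "P \<in> Sym n \<Longrightarrow> const_poly c * P \<in> Sym n"
  using Sym_mult[OF const_poly_in_Sym, of P n c] by simp

text \<open>
  A homogeneous polynomial of degree \<open>n\<close> is identified with the polynomial \<open>P(1, w)\<close> of degree at most
  \<open>n\<close> in \<open>w\<close>. The action becomes \<open>p \<mapsto> (c w + d)\<^sup>n p(\<gamma> w)\<close>.
\<close>
definition eval_ab :: "complex poly poly \<Rightarrow> complex \<Rightarrow> complex \<Rightarrow> complex" where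
  "eval_ab P x y = poly (poly P [:x:]) y"

abbreviation (input) dehom :: "complex poly poly \<Rightarrow> complex \<Rightarrow> complex" where
  "dehom P w \<equiv> eval_ab P 1 w"

lemma eval_ab_simps [simp]:
  "eval_ab (P + Q) x y = eval_ab P x y + eval_ab Q x y"
  "eval_ab (P - Q) x y = eval_ab P x y - eval_ab Q x y"
  "eval_ab (- P) x y = - eval_ab P x y"
  "eval_ab (P * Q) x y = eval_ab P x y * eval_ab Q x y"
  "eval_ab (P ^ k) x y = eval_ab P x y ^ k"
  "eval_ab 0 x y = 0" "eval_ab (const_poly c) x y = c"
  "eval_ab var_a x y = x" "eval_ab var_b x y = y"
  by (simp_all add: eval_ab_def const_poly_def var_a_def var_b_def poly_power)

lemma of_int_const_poly: "of_int k = const_poly (of_int k)"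
  by (simp add: const_poly_def of_int_poly)

lemma eval_ab_of_int [simp]: "eval_ab (of_int k) x y = of_int k"
  unfolding of_int_const_poly by simp

lemma eval_ab_sum: "eval_ab (sum P I) x y = (\<Sum>i\<in>I. eval_ab (P i) x y)"
  by (induction I rule: infinite_finite_induct) auto

lemma eval_ab_monomial: "eval_ab (monom (monom c k) i) x y = c * x ^ i * y ^ k"
  unfolding monomial_eq[symmetric] by simp

lemma eval_ab_Sym:
  assumes "P \<in> Sym n"
  shows "eval_ab P x y = (\<Sum>i\<le>n. coeff (coeff P i) (n - i) * x ^ i * y ^ (n - i))"
  by (subst Sym_expand[OF assms]) (simp add: eval_ab_sum eval_ab_monomial)

lemma eval_ab_homogeneous:
  assumes "P \<in> Sym n"
  shows "eval_ab P (t * x) (t * y) = t ^ n * eval_ab P x y"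
proof -
  have "t ^ n = t ^ i * t ^ (n - i)" if "i \<le> n" for i using that by (simp flip: power_add)
  thus ?thesis unfolding eval_ab_Sym[OF assms] sum_distrib_left
    by (intro sum.cong) (auto simp: power_mult_distrib mult_ac)
qed

lemma infinite_UHP: "infinite \<H>"
proof -
  have "\<i> \<in> \<H>" by simp
  thus ?thesis using finite_imp_not_open open_UHP by blast
qed

text \<open>A polynomial in \<open>w\<close> that vanishes on the upper half plane is zero.\<close>
lemma Sym_eqI:
  assumes "P \<in> Sym n" "Q \<in> Sym n" "\<And>w. Im w > 0 \<Longrightarrow> dehom P w = dehom Q w"
  shows "P = Q"
proof -
  define D where "D = P - Q"
  have D: "D \<in> Sym n" unfolding D_def using assms by (intro Sym_diff)
  define p where "p = (\<Sum>i\<le>n. monom (coeff (coeff D i) (n - i)) (n - i))"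
  have "poly p w = dehom D w" for w
    unfolding eval_ab_Sym[OF D] p_def by (simp add: poly_sum poly_monom)
  hence "\<H> \<subseteq> {w. poly p w = 0}" using assms(3) by (auto simp: D_def)
  hence "infinite {w. poly p w = 0}" using infinite_UHP finite_subset by blast
  hence p0: "p = 0" using poly_roots_finite by blast
  have "coeff (coeff D i) (n - i) = 0" if "i \<le> n" for i
  proof -
    have "coeff p (n - i) = (\<Sum>k\<le>n. if k = i then coeff (coeff D k) (n - k) else 0)"
      unfolding p_def coeff_sum using that by (intro sum.cong) (auto simp: coeff_monom)
    thus ?thesis using that p0 by simp
  qed
  hence "D = 0" by (subst Sym_expand[OF D]) simp
  thus ?thesis by (simp add: D_def)
qed

lemma Sym_of_poly:
  assumes "degree p \<le> n"
  obtains P where "P \<in> Sym n" "\<And>w. dehom P w = poly p w"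
proof
  define P where "P = (\<Sum>j\<le>n. monom (monom (coeff p j) j) (n - j))"
  show "P \<in> Sym n" unfolding P_def by (intro Sym_sum monomial_in_Sym) auto
  have "poly p w = (\<Sum>j\<le>n. coeff p j * w ^ j)" for w
    unfolding poly_altdef using assms by (intro sum.mono_neutral_left) (auto simp: coeff_eq_0)
  thus "dehom P w = poly p w" for w by (simp add: P_def eval_ab_sum eval_ab_monomial)
qed

lemma dehom_polynomial:
  assumes "P \<in> Sym n"
  obtains p where "degree p \<le> n" "\<And>w. dehom P w = poly p w"
proof
  define p where "p = (\<Sum>i\<le>n. monom (coeff (coeff P i) (n - i)) (n - i))"
  show "degree p \<le> n" unfolding p_def by (intro degree_sum_le) (auto intro: order_trans[OF degree_monom_le])
  show "dehom P w = poly p w" for w unfolding eval_ab_Sym[OF assms] p_def by (simp add: poly_sum poly_monom)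
qed

lemma poly_map_poly_altdef:
  fixes f :: "'a :: zero \<Rightarrow> 'b :: comm_ring_1"
  assumes "degree p \<le> n" "f 0 = 0"
  shows "poly (map_poly f p) x = (\<Sum>i\<le>n. f (coeff p i) * x ^ i)"
proof -
  have "poly (map_poly f p) x = (\<Sum>i\<le>degree (map_poly f p). f (coeff p i) * x ^ i)"
    using assms(2) by (simp add: poly_altdef coeff_map_poly)
  also have "\<dots> = (\<Sum>i\<le>n. f (coeff p i) * x ^ i)"
  proof (intro sum.mono_neutral_left)
    have "degree (map_poly f p) \<le> degree p"
      by (rule degree_le) (auto simp: coeff_map_poly assms(2) coeff_eq_0)
    thus "{..degree (map_poly f p)} \<subseteq> {..n}" using assms(1) by auto
    show "\<forall>i\<in>{..n} - {..degree (map_poly f p)}. f (coeff p i) * x ^ i = 0"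
      using coeff_eq_0[of "map_poly f p"] by (auto simp: coeff_map_poly assms(2))
  qed simp
  finally show ?thesis .
qed

lemma subst_ab_Sym:
  assumes P: "P \<in> Sym n"
  shows "subst_ab A B P = (\<Sum>i\<le>n. const_poly (coeff (coeff P i) (n - i)) * B ^ (n - i) * A ^ i)"
proof -
  have c0: "const_poly 0 = 0" by (simp add: const_poly_def)
  have deg: "degree P \<le> n" "degree (coeff P i) \<le> n" for i
    using P unfolding Sym_iff
    by (metis (no_types, lifting) coeff_0 coeff_eq_0 degree_le leading_coeff_0_iff le_add1 linorder_not_less)
       (metis (no_types, lifting) P[unfolded Sym_iff] degree_le le_add2 not_less)
  have "subst_ab A B P = (\<Sum>i\<le>n. poly (map_poly const_poly (coeff P i)) B * A ^ i)"
    unfolding subst_ab_def by (rule poly_map_poly_altdef[OF deg(1)]) simp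
  also have "\<dots> = (\<Sum>i\<le>n. const_poly (coeff (coeff P i) (n - i)) * B ^ (n - i) * A ^ i)"
  proof (intro sum.cong refl)
    fix i assume i: "i \<in> {..n}"
    have "poly (map_poly const_poly (coeff P i)) B = (\<Sum>j\<le>n. const_poly (coeff (coeff P i) j) * B ^ j)"
      by (rule poly_map_poly_altdef[OF deg(2)]) (rule c0)
    also have "\<dots> = (\<Sum>j\<le>n. if j = n - i then const_poly (coeff (coeff P i) j) * B ^ j else 0)"
    proof (intro sum.cong refl)
      fix j
      show "const_poly (coeff (coeff P i) j) * B ^ j = (if j = n - i then const_poly (coeff (coeff P i) j) * B ^ j else 0)"
      proof (cases "coeff (coeff P i) j = 0")
        case False
        hence "i + j = n" using P unfolding Sym_iff by blast
        thus ?thesis by auto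
      qed (auto simp: c0)
    qed
    also have "\<dots> = const_poly (coeff (coeff P i) (n - i)) * B ^ (n - i)" using i by simp
    finally show "poly (map_poly const_poly (coeff P i)) B * A ^ i = const_poly (coeff (coeff P i) (n - i)) * B ^ (n - i) * A ^ i" by simp
  qed
  finally show ?thesis .
qed

lemma linear_in_Sym: "of_int k * var_a + of_int l * var_b \<in> Sym 1"
proof -
  have "const_poly (of_int k) * var_a ^ 1 * var_b ^ 0 + const_poly (of_int l) * var_a ^ 0 * var_b ^ 1 \<in> Sym 1"
    unfolding monomial_eq by (intro Sym_add monomial_in_Sym) auto
  thus ?thesis by (simp add: of_int_const_poly)
qed

lemma slash_in_Sym:
  assumes "P \<in> Sym n"
  shows "slash \<gamma> P \<in> Sym n"
proof -
  have *: "const_poly c * B ^ (n - i) * A ^ i \<in> Sym n" if "i \<le> n" "A \<in> Sym 1" "B \<in> Sym 1" for A B c i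
    using Sym_mult[OF Sym_mult[OF const_poly_in_Sym Sym_power[OF that(3), of "n - i"]] Sym_power[OF that(2), of i]] that(1) by simp
  show ?thesis unfolding slash_def subst_ab_Sym[OF assms]
    by (intro Sym_sum) (rule *[OF _ linear_in_Sym linear_in_Sym], simp)
qed

lemma dehom_slash:
  assumes P: "P \<in> Sym n" and g: "\<gamma> \<in> carrier SL2Z" and w: "Im w > 0"
  shows "dehom (slash \<gamma> P) w = automorphy_factor \<gamma> w ^ n * dehom P (moebius_action \<gamma> w)"
proof -
  define x y where "x = automorphy_factor \<gamma> w" and "y = of_int (m11 \<gamma>) * w + of_int (m12 \<gamma>)"
  have x0: "x \<noteq> 0" using automorphy_nonzero[OF g] w by (simp add: x_def)
  have "dehom (slash \<gamma> P) w = (\<Sum>i\<le>n. coeff (coeff P i) (n - i) * y ^ (n - i) * x ^ i)"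
    unfolding slash_def subst_ab_Sym[OF P] by (simp add: eval_ab_sum x_def y_def automorphy_factor_def add.commute mult.commute)
  also have "\<dots> = eval_ab P x y" unfolding eval_ab_Sym[OF P] by (simp add: mult_ac)
  also have "\<dots> = eval_ab P (x * 1) (x * (y / x))" using x0 by simp
  also have "\<dots> = x ^ n * dehom P (y / x)" by (rule eval_ab_homogeneous[OF P])
  finally show ?thesis by (simp add: x_def y_def moebius_action_def)
qed

lemma slash_add:
  assumes "P \<in> Sym n" "Q \<in> Sym n" "\<gamma> \<in> carrier SL2Z"
  shows "slash \<gamma> (P + Q) = slash \<gamma> P + slash \<gamma> Q"
  using assms by (intro Sym_eqI[of _ n]) (auto simp: slash_in_Sym Sym_add dehom_slash[of _ n] distrib_left)

lemma slash_const_mult: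
  assumes "P \<in> Sym n" "\<gamma> \<in> carrier SL2Z"
  shows "slash \<gamma> (const_poly c * P) = const_poly c * slash \<gamma> P"
  using assms by (intro Sym_eqI[of _ n]) (auto simp: slash_in_Sym Sym_const_mult dehom_slash[of _ n])

lemma slash_uminus:
  assumes "P \<in> Sym n" "\<gamma> \<in> carrier SL2Z"
  shows "slash \<gamma> (- P) = - slash \<gamma> P"
  using assms by (intro Sym_eqI[of _ n]) (auto simp: slash_in_Sym Sym_uminus dehom_slash[of _ n])

lemma slash_diff:
  assumes "P \<in> Sym n" "Q \<in> Sym n" "\<gamma> \<in> carrier SL2Z"
  shows "slash \<gamma> (P - Q) = slash \<gamma> P - slash \<gamma> Q"
  using assms by (intro Sym_eqI[of _ n]) (auto simp: slash_in_Sym Sym_diff dehom_slash[of _ n] right_diff_distrib)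

lemma slash_compose:
  assumes "P \<in> Sym n" "g \<in> carrier SL2Z" "h \<in> carrier SL2Z"
  shows "slash (g ** h) P = slash h (slash g P)"
  using assms
  by (intro Sym_eqI[of _ n])
     (auto simp: slash_in_Sym dehom_slash[of _ n] SL2Z_closed moebius_compose power_mult_distrib mult_ac)

lemma slash_one: "P \<in> Sym n \<Longrightarrow> slash (mat 1) P = P"
  by (intro Sym_eqI[of _ n]) (auto simp: slash_in_Sym dehom_slash[of _ n] SL2Z_one)

lemma sym_power_simps [simp]:
  "P \<oplus>\<^bsub>sym_power n\<^esub> Q = P + Q" "\<zero>\<^bsub>sym_power n\<^esub> = 0" "c \<odot>\<^bsub>sym_power n\<^esub> P = const_poly c * P"
  by (simp_all add: sym_power_def)

lemma abelian_group_sym_power: "abelian_group (sym_power n)"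
proof (rule abelian_groupI)
  fix x assume "x \<in> Sym n"
  thus "\<exists>y\<in>Sym n. y \<oplus>\<^bsub>sym_power n\<^esub> x = \<zero>\<^bsub>sym_power n\<^esub>"
    by (intro bexI[of _ "- x"]) (auto intro: Sym_uminus)
qed (auto intro: Sym_add Sym_zero)

lemma sym_power_minus:
  assumes "P \<in> Sym n" "Q \<in> Sym n"
  shows "P \<ominus>\<^bsub>sym_power n\<^esub> Q = P - Q"
proof -
  have "\<ominus>\<^bsub>sym_power n\<^esub> Q = - Q"
    using assms by (intro abelian_group.minus_equality[OF abelian_group_sym_power]) (auto intro: Sym_uminus)
  thus ?thesis by (simp add: a_minus_def)
qed

section \<open>Iterated derivatives and Bol's identity\<close>

lemma qderiv_unique: "(f has_field_derivative f') (at z) \<Longrightarrow> Im z > 0 \<Longrightarrow> qderiv f z = f' / (2 * of_real pi * \<i>)"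
  by (simp add: qderiv_def DERIV_imp_deriv)

lemma qderiv_eqI: "(f has_field_derivative 2 * of_real pi * \<i> * v) (at z) \<Longrightarrow> Im z > 0 \<Longrightarrow> qderiv f z = v"
  by (simp add: qderiv_unique)

lemma qderiv_cong:
  assumes "\<And>z. Im z > 0 \<Longrightarrow> f z = g z" "Im z > 0"
  shows "qderiv f z = qderiv g z"
proof -
  have "eventually (\<lambda>w. f w = g w) (nhds z)"
    using eventually_nhds_in_open[OF open_UHP, of z] assms by (auto elim: eventually_mono)
  from deriv_cong_ev[OF this refl] show ?thesis by (simp add: qderiv_def)
qed

lemma qderiv_iter_cong:
  assumes "\<And>z. Im z > 0 \<Longrightarrow> f z = g z" "Im z > 0"
  shows "(qderiv ^^ k) f z = (qderiv ^^ k) g z"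
  using assms(2)
proof (induction k arbitrary: z)
  case (Suc k)
  show ?case using qderiv_cong[OF Suc.IH Suc.prems] by simp
qed (use assms in simp)

lemma holomorphic_qderiv_iter: "f holomorphic_on \<H> \<Longrightarrow> (qderiv ^^ k) f holomorphic_on \<H>"
  by (induction k) (auto intro: holomorphic_qderiv)

lemma qderiv_iter_linear:
  assumes f: "f holomorphic_on \<H>" and g: "g holomorphic_on \<H>" and z: "Im z > 0"
  shows "(qderiv ^^ k) (\<lambda>z. f z + c * g z) z = (qderiv ^^ k) f z + c * (qderiv ^^ k) g z"
  using z
proof (induction k arbitrary: z)
  case (Suc k)
  have "((\<lambda>z. (qderiv ^^ k) f z + c * (qderiv ^^ k) g z) has_field_derivative
     2 * of_real pi * \<i> * (qderiv ((qderiv ^^ k) f) z + c * qderiv ((qderiv ^^ k) g) z)) (at z)"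
    by (auto intro!: derivative_eq_intros has_field_derivative_qderiv[OF _ Suc.prems] holomorphic_qderiv_iter f g
          simp: algebra_simps)
  from qderiv_eqI[OF this Suc.prems]
  have "qderiv (\<lambda>z. (qderiv ^^ k) f z + c * (qderiv ^^ k) g z) z = qderiv ((qderiv ^^ k) f) z + c * qderiv ((qderiv ^^ k) g) z" .
  moreover have "qderiv ((qderiv ^^ k) (\<lambda>z. f z + c * g z)) z = qderiv (\<lambda>z. (qderiv ^^ k) f z + c * (qderiv ^^ k) g z) z"
    by (intro qderiv_cong Suc.IH Suc.prems)
  ultimately show ?case by simp
qed simp

text \<open>The Leibniz rule with a linear factor has two terms.\<close>
lemma qderiv_iter_linear_factor:
  assumes f: "f holomorphic_on \<H>" and z: "Im z > 0"
  shows "(qderiv ^^ Suc k) (\<lambda>z. (a * z + b) * f z) z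
       = (a * z + b) * (qderiv ^^ Suc k) f z + of_nat (Suc k) * (a / (2 * of_real pi * \<i>)) * (qderiv ^^ k) f z"
  using z
proof (induction k arbitrary: z)
  case 0
  have "((\<lambda>z. (a * z + b) * f z) has_field_derivative (a * f z + (a * z + b) * (2 * of_real pi * \<i> * qderiv f z))) (at z)"
    by (auto intro!: derivative_eq_intros has_field_derivative_qderiv[OF f 0])
  from qderiv_unique[OF this 0] show ?case by (simp add: field_simps)
next
  case (Suc k)
  define p :: complex where "p = 2 * of_real pi * \<i>"
  have p: "p \<noteq> 0" by (simp add: p_def)
  define F G where "F = (qderiv ^^ Suc k) f" and "G = (qderiv ^^ k) f"
  have F: "(F has_field_derivative (p * qderiv F z)) (at z)" and G: "(G has_field_derivative (p * F z)) (at z)"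
    using has_field_derivative_qderiv[OF holomorphic_qderiv_iter[OF f] Suc.prems, of "Suc k"]
      has_field_derivative_qderiv[OF holomorphic_qderiv_iter[OF f] Suc.prems, of k]
    by (simp_all add: F_def G_def p_def)
  have "((\<lambda>z. (a * z + b) * F z + of_nat (Suc k) * (a / p) * G z) has_field_derivative
     (a * F z + (a * z + b) * (p * qderiv F z) + of_nat (Suc k) * (a / p) * (p * F z))) (at z)"
    by (auto intro!: derivative_eq_intros F G)
  also have "a * F z + (a * z + b) * (p * qderiv F z) + of_nat (Suc k) * (a / p) * (p * F z)
     = p * ((a * z + b) * qderiv F z + of_nat (Suc (Suc k)) * (a / p) * F z)"
    using p by (simp add: field_simps)
  finally have "qderiv (\<lambda>z. (a * z + b) * F z + of_nat (Suc k) * (a / p) * G z) z = (a * z + b) * qderiv F z + of_nat (Suc (Suc k)) * (a / p) * F z"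
    unfolding p_def by (rule qderiv_eqI[OF _ Suc.prems])
  moreover have "qderiv ((qderiv ^^ Suc k) (\<lambda>z. (a * z + b) * f z)) z = qderiv (\<lambda>z. (a * z + b) * F z + of_nat (Suc k) * (a / p) * G z) z"
    using Suc.IH by (intro qderiv_cong Suc.prems) (simp only: F_def G_def p_def)
  ultimately show ?case by (simp add: F_def p_def)
qed

lemma has_field_derivative_automorphy:
  "(automorphy_factor \<gamma> has_field_derivative of_int (m21 \<gamma>)) (at z)"
  unfolding automorphy_factor_def by (auto intro!: derivative_eq_intros)

lemma holomorphic_automorphy: "automorphy_factor \<gamma> holomorphic_on A"
  unfolding automorphy_factor_def by (intro holomorphic_intros)

lemma holomorphic_compose_moebius:
  assumes "h holomorphic_on \<H>" "\<gamma> \<in> carrier SL2Z"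
  shows "(\<lambda>z. h (moebius_action \<gamma> z)) holomorphic_on \<H>"
proof -
  have "moebius_action \<gamma> ` \<H> \<subseteq> \<H>" using moebius_in_UHP[OF assms(2)] by auto
  from holomorphic_on_compose_gen[OF holomorphic_moebius[OF assms(2)] assms(1) this] show ?thesis by (simp add: o_def)
qed

lemma has_field_derivative_compose_moebius:
  assumes "(h has_field_derivative h') (at (moebius_action \<gamma> z))" "\<gamma> \<in> carrier SL2Z" "Im z > 0"
  shows "((\<lambda>z. h (moebius_action \<gamma> z)) has_field_derivative h' / (automorphy_factor \<gamma> z)\<^sup>2) (at z)"
  using DERIV_chain2[OF assms(1) has_field_derivative_moebius[OF assms(2)]] assms(3) by simp

text \<open>
  By induction on \<open>m\<close>: the factor \<open>c z + d\<close> that is split off is linear, so only two terms of the Leibniz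
  rule survive, and the second cancels the derivative of \<open>(c z + d)\<^sup>-\<^sup>m\<^sup>-\<^sup>2\<close>.
\<close>
lemma bol_identity:
  assumes h: "h holomorphic_on \<H>" and g: "\<gamma> \<in> carrier SL2Z" and z: "Im z > 0"
  shows "(qderiv ^^ Suc m) (\<lambda>z. automorphy_factor \<gamma> z ^ m * h (moebius_action \<gamma> z)) z
       = (qderiv ^^ Suc m) h (moebius_action \<gamma> z) / automorphy_factor \<gamma> z ^ (m + 2)"
  using z
proof (induction m arbitrary: z)
  case 0
  have "Im (moebius_action \<gamma> z) > 0" using 0 g by simp
  from qderiv_unique[OF has_field_derivative_compose_moebius[OF has_field_derivative_qderiv[OF h this] g 0] 0]
  show ?case by (simp add: power2_eq_square)
next
  case (Suc m)
  define p :: complex where "p = 2 * of_real pi * \<i>"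
  have p: "p \<noteq> 0" by (simp add: p_def)
  define j where "j = automorphy_factor \<gamma>"
  define \<phi> where "\<phi> = (\<lambda>z. j z ^ m * h (moebius_action \<gamma> z))"
  define H where "H = (qderiv ^^ Suc m) h"
  define c where "c = complex_of_int (m21 \<gamma>)"
  have j0: "j z \<noteq> 0" using automorphy_nonzero[OF g] Suc.prems by (simp add: j_def)
  have mz: "Im (moebius_action \<gamma> z) > 0" using Suc.prems g by simp
  have \<phi>: "\<phi> holomorphic_on \<H>" unfolding \<phi>_def j_def
    by (intro holomorphic_intros holomorphic_automorphy holomorphic_compose_moebius h g)
  have Hh: "H holomorphic_on \<H>" unfolding H_def by (rule holomorphic_qderiv_iter[OF h])
  have lin: "(\<lambda>z. j z ^ Suc m * h (moebius_action \<gamma> z)) = (\<lambda>z. (c * z + of_int (m22 \<gamma>)) * \<phi> z)"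
    by (auto simp: \<phi>_def j_def c_def automorphy_factor_def mult_ac)
  have IH: "(qderiv ^^ Suc m) \<phi> w = H (moebius_action \<gamma> w) / j w ^ (m + 2)" if "Im w > 0" for w
    using Suc.IH[OF that] unfolding \<phi>_def j_def H_def .
  define X Y t N where "X = H (moebius_action \<gamma> z)" and "Y = qderiv H (moebius_action \<gamma> z)" and "t = j z ^ m"
    and "N = complex_of_nat (m + 2)"
  have t0: "t \<noteq> 0" using j0 by (simp add: t_def)
  have pw: "j z ^ (m + k) = t * j z ^ k" for k by (simp add: t_def power_add)
  have "((\<lambda>w. j w ^ (m + 2)) has_field_derivative N * (c * j z ^ (m + 1))) (at z)"
    using DERIV_power[OF has_field_derivative_automorphy, where n = "m + 2"] by (simp add: N_def c_def j_def)
  from DERIV_divide[OF has_field_derivative_compose_moebius[OF has_field_derivative_qderiv[OF Hh mz] g Suc.prems] this]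
  have "((\<lambda>w. H (moebius_action \<gamma> w) / j w ^ (m + 2)) has_field_derivative
     ((p * Y / (j z)\<^sup>2) * j z ^ (m + 2) - X * (N * (c * j z ^ (m + 1)))) / (j z ^ (m + 2) * j z ^ (m + 2))) (at z)"
    using j0 by (simp add: p_def X_def Y_def j_def)
  also have "((p * Y / (j z)\<^sup>2) * j z ^ (m + 2) - X * (N * (c * j z ^ (m + 1)))) / (j z ^ (m + 2) * j z ^ (m + 2))
     = p * (Y / j z ^ (m + 4) - N * (c / p) * X / j z ^ (m + 3))"
    unfolding pw using j0 t0 p by (simp add: field_simps eval_nat_numeral)
  finally have "qderiv (\<lambda>w. H (moebius_action \<gamma> w) / j w ^ (m + 2)) z
     = Y / j z ^ (m + 4) - N * (c / p) * X / j z ^ (m + 3)"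
    unfolding p_def by (rule qderiv_eqI[OF _ Suc.prems])
  moreover have "qderiv ((qderiv ^^ Suc m) \<phi>) z = qderiv (\<lambda>w. H (moebius_action \<gamma> w) / j w ^ (m + 2)) z"
    by (intro qderiv_cong IH Suc.prems)
  ultimately have D: "(qderiv ^^ Suc (Suc m)) \<phi> z
     = Y / j z ^ (m + 4) - N * (c / p) * X / j z ^ (m + 3)"
    by simp
  have "(qderiv ^^ Suc (Suc m)) (\<lambda>z. j z ^ Suc m * h (moebius_action \<gamma> z)) z
     = j z * (qderiv ^^ Suc (Suc m)) \<phi> z + N * (c / p) * (qderiv ^^ Suc m) \<phi> z"
    unfolding lin qderiv_iter_linear_factor[OF \<phi> Suc.prems] by (simp add: j_def c_def automorphy_factor_def p_def N_def)
  also have "\<dots> = Y / j z ^ (m + 3)"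
    unfolding D IH[OF Suc.prems] X_def[symmetric] pw using j0 t0 p by (simp add: field_simps eval_nat_numeral)
  finally show ?case by (simp add: j_def H_def Y_def eval_nat_numeral)
qed

lemma q_expansion_qderiv_iter:
  assumes "q_expansion f r F"
  shows "q_expansion ((qderiv ^^ k) f) r (Abs_fps (\<lambda>j. (of_int r + of_nat j) ^ k * fps_nth F j))"
proof (induction k)
  case 0
  have "Abs_fps (\<lambda>j. (of_int r + of_nat j) ^ 0 * fps_nth F j) = F" by (rule fps_ext) simp
  thus ?case using assms by simp
next
  case (Suc k)
  let ?G = "Abs_fps (\<lambda>j. (of_int r + of_nat j) ^ k * fps_nth F j)"
  have "fps_const (of_int r) * ?G + fps_X * fps_deriv ?G = Abs_fps (\<lambda>j. (of_int r + of_nat j) ^ Suc k * fps_nth F j)"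
  proof (rule fps_ext)
    fix j show "fps_nth (fps_const (of_int r) * ?G + fps_X * fps_deriv ?G) j = fps_nth (Abs_fps (\<lambda>j. (of_int r + of_nat j) ^ Suc k * fps_nth F j)) j"
      unfolding qderiv_fps_nth by simp
  qed
  with q_expansion_qderiv[OF Suc] show ?case by simp
qed

text \<open>
  Bol's identity gives modularity, and the operator multiplies the coefficient of \<open>q\<^sup>k\<close> by the rational number
  \<open>k\<^sup>n\<^sup>+\<^sup>1\<close>.
\<close>
theorem bol_forms:
  assumes K: "coeff_field K" and g: "g \<in> forms_over K (- int n)"
  shows "(qderiv ^^ (n + 1)) g \<in> forms_over K (int n + 2)"
proof -
  obtain r F where F: "q_expansion g r F" "\<And>k. fps_nth F k \<in> K" using g by (auto simp: forms_over_def)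
  note gm = modular_functionsD[OF forms_overD[OF g]]
  have "(qderiv ^^ (n + 1)) g \<in> modular_functions (int n + 2)"
    unfolding modular_functions_def
  proof (safe intro!: holomorphic_qderiv_iter gm(2))
    fix z assume "z \<notin> \<H>"
    thus "(qderiv ^^ (n + 1)) g z = 0" by (simp add: qderiv_def)
  next
    fix \<gamma> z assume \<gamma>: "\<gamma> \<in> carrier SL2Z" and zH: "z \<in> \<H>"
    hence z: "Im z > 0" by simp
    have eq: "g w = automorphy_factor \<gamma> w ^ n * g (moebius_action \<gamma> w)" if "Im w > 0" for w
      using gm(3)[OF \<gamma>, of w] automorphy_nonzero[OF \<gamma>, of w] that by (simp add: power_int_minus)
    have "(qderiv ^^ Suc n) g z = (qderiv ^^ Suc n) g (moebius_action \<gamma> z) / automorphy_factor \<gamma> z ^ (n + 2)"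
      using qderiv_iter_cong[OF eq z, where k = "Suc n"] bol_identity[OF gm(2) \<gamma> z, of n] by simp
    moreover have "automorphy_factor \<gamma> z powi (int n + 2) = automorphy_factor \<gamma> z ^ (n + 2)"
      by (metis int_ops(3) of_nat_add of_nat_numeral power_int_of_nat)
    ultimately show "(qderiv ^^ (n + 1)) g (moebius_action \<gamma> z) = automorphy_factor \<gamma> z powi (int n + 2) * (qderiv ^^ (n + 1)) g z"
      using automorphy_nonzero[OF \<gamma> zH] by (simp add: field_simps)
  qed
  thus ?thesis
  proof (rule forms_overI[OF _ q_expansion_qderiv_iter[OF F(1)]])
    have pw: "x ^ m \<in> K" if "x \<in> K" for x m using that K by (auto simp: coeff_field_def)
    thus "fps_nth (Abs_fps (\<lambda>j. (of_int r + of_nat j) ^ (n + 1) * fps_nth F j)) k \<in> K" for k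
      unfolding fps_nth_Abs_fps by (intro coeff_field_closed(3,4,5,7)[OF K] pw F)
  qed
qed

lemma constant_on_UHP:
  assumes "g holomorphic_on \<H>" "\<And>z. Im z > 0 \<Longrightarrow> qderiv g z = 0"
  obtains c where "\<And>z. Im z > 0 \<Longrightarrow> g z = c"
proof -
  have "g constant_on \<H>"
  proof (rule has_field_derivative_0_imp_constant_on)
    fix z assume "z \<in> \<H>"
    thus "(g has_field_derivative 0) (at z)" using has_field_derivative_qderiv[OF assms(1), of z] assms(2)[of z] by simp
  qed (auto simp: open_UHP convex_UHP convex_connected)
  thus ?thesis using that by (auto simp: constant_on_def)
qed

lemma poly_antiderivative:
  obtains P :: "complex poly" where "pderiv P = p" "degree P \<le> Suc (degree p)"
proof
  define P where "P = pCons 0 (\<Sum>i\<le>degree p. monom (coeff p i / of_nat (Suc i)) i)"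
  have c: "coeff P (Suc m) = coeff p m / of_nat (Suc m)" for m
  proof -
    have "coeff P (Suc m) = (\<Sum>i\<le>degree p. if i = m then coeff p i / of_nat (Suc i) else 0)"
      unfolding P_def coeff_pCons_Suc coeff_sum by (intro sum.cong) (auto simp: coeff_monom)
    thus ?thesis by (cases "m \<le> degree p") (simp_all add: coeff_eq_0)
  qed
  show "pderiv P = p" by (rule poly_eqI) (simp add: coeff_pderiv c del: of_nat_Suc)
  show "degree P \<le> Suc (degree p)"
  proof (rule degree_le, safe)
    fix i assume "Suc (degree p) < i"
    thus "coeff P i = 0" using c[of "i - 1"] by (simp add: coeff_eq_0)
  qed
qed

lemma qderiv_iter_zero_imp_polynomial:
  assumes "g holomorphic_on \<H>" "\<And>z. Im z > 0 \<Longrightarrow> (qderiv ^^ Suc n) g z = 0"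
  shows "\<exists>p. degree p \<le> n \<and> (\<forall>z. Im z > 0 \<longrightarrow> g z = poly p z)"
  using assms
proof (induction n arbitrary: g)
  case 0
  then obtain c where "\<And>z. Im z > 0 \<Longrightarrow> g z = c" using constant_on_UHP[of g] by auto
  thus ?case by (intro exI[of _ "[:c:]"]) simp
next
  case (Suc n)
  have "(qderiv ^^ Suc n) (qderiv g) z = 0" if "Im z > 0" for z
    using Suc.prems(2)[OF that] unfolding funpow_Suc_right[of "Suc n"] by simp
  then obtain p where p: "degree p \<le> n" "\<And>z. Im z > 0 \<Longrightarrow> qderiv g z = poly p z"
    using Suc.IH[OF holomorphic_qderiv[OF Suc.prems(1)]] by blast
  obtain P where P: "pderiv P = Polynomial.smult (2 * of_real pi * \<i>) p" "degree P \<le> Suc n"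
    using poly_antiderivative[of "Polynomial.smult (2 * of_real pi * \<i>) p"] p(1) order_trans
    by (metis (no_types, lifting) Suc_le_mono degree_smult_le)
  have "qderiv (\<lambda>z. g z - poly P z) z = 0" if z: "Im z > 0" for z
  proof -
    have "((\<lambda>z. g z - poly P z) has_field_derivative (2 * of_real pi * \<i> * qderiv g z - poly (pderiv P) z)) (at z)"
      by (intro DERIV_diff has_field_derivative_qderiv[OF Suc.prems(1) z] poly_DERIV)
    from qderiv_unique[OF this z] show ?thesis using p(2)[OF z] P(1) by simp
  qed
  moreover have "(\<lambda>z. g z - poly P z) holomorphic_on \<H>" by (intro holomorphic_intros Suc.prems(1))
  ultimately obtain c where c: "\<And>z. Im z > 0 \<Longrightarrow> g z - poly P z = c"
    using constant_on_UHP[of "\<lambda>z. g z - poly P z"] by blast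
  have "degree (P + [:c:]) \<le> Suc n" using P(2) by (intro degree_add_le) auto
  moreover have "g z = poly (P + [:c:]) z" if "Im z > 0" for z using c[OF that] by (simp add: algebra_simps)
  ultimately show ?case by blast
qed

lemma qderiv_iter_polynomial:
  assumes "degree p \<le> n" "Im z > 0"
  shows "(qderiv ^^ Suc n) (poly p) z = 0"
  using assms
proof (induction n arbitrary: p z)
  case 0
  hence "pderiv p = 0" by (simp add: pderiv_eq_0_iff)
  with qderiv_unique[OF poly_DERIV 0(2), of p] show ?case by simp
next
  case (Suc n)
  define p' where "p' = Polynomial.smult (1 / (2 * of_real pi * \<i>)) (pderiv p)"
  have "degree p' \<le> n" using Suc.prems(1) by (simp add: p'_def degree_pderiv)
  hence "(qderiv ^^ Suc n) (poly p') z = 0" using Suc by blast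
  moreover have "qderiv (poly p) w = poly p' w" if "Im w > 0" for w
    using qderiv_unique[OF poly_DERIV that] by (simp add: p'_def)
  ultimately show ?case unfolding funpow_Suc_right[of "Suc n"] using qderiv_iter_cong[of "qderiv (poly p)" "poly p'" z "Suc n"] Suc.prems(2) by simp
qed

lemma qderiv_iter_zero: "Im z > 0 \<Longrightarrow> (qderiv ^^ Suc n) (\<lambda>z. 0) z = 0"
  using qderiv_iter_polynomial[of 0 n z] qderiv_iter_cong[of "\<lambda>z. 0" "poly 0" z "Suc n"] by simp

text \<open>
  The termwise antiderivative \<open>g0\<close> of \<open>f\<close> leaves out the constant term, so \<open>g - g0\<close> is a polynomial in
  \<open>z\<close>; being periodic, it is constant.
\<close>
lemma q_expansion_antiderivative:
  assumes f: "q_expansion f r F" and g: "g holomorphic_on \<H>" "\<And>z. Im z > 0 \<Longrightarrow> g (z + 1) = g z"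
    and fg: "\<And>z. Im z > 0 \<Longrightarrow> (qderiv ^^ k) g z = f z"
  shows "\<exists>s G. q_expansion g s G"
proof -
  define G where "G = Abs_fps (\<lambda>j. if of_int r + of_nat j = (0::complex) then 0 else fps_nth F j / (of_int r + of_nat j) ^ k)"
  have Gle: "norm (fps_nth G j) \<le> norm (fps_nth F j)" for j
  proof (cases "r + int j = 0")
    case True
    hence "of_int (r + int j) = (0::complex)" by simp
    thus ?thesis by (simp add: G_def)
  next
    case False
    define w where "w = (of_int r + of_nat j :: complex)"
    have w: "w = of_int (r + int j)" by (simp add: w_def)
    have "1 \<le> \<bar>r + int j\<bar>" using False by simp
    hence "1 \<le> real_of_int \<bar>r + int j\<bar>" by linarith
    hence w1: "1 \<le> norm w" unfolding w by (simp only: norm_of_int of_int_abs)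
    hence w0: "w \<noteq> 0" by auto
    have "1 \<le> norm (w ^ k)" using w1 by (simp only: norm_power one_le_power)
    hence "norm (fps_nth F j) / norm (w ^ k) \<le> norm (fps_nth F j) / 1"
      using w0 by (intro divide_left_mono) auto
    thus ?thesis using w0 unfolding G_def fps_nth_Abs_fps w_def[symmetric] by (simp add: norm_divide)
  qed
  have cG: "fps_conv_radius G \<ge> 1"
    unfolding fps_conv_radius_def
  proof (rule conv_radius_geI_ex')
    fix x :: real assume x: "0 < x" "ereal x < 1"
    hence "summable (\<lambda>n. norm (fps_nth F n * (of_real x :: complex) ^ n))"
      by (intro norm_summable_fps fps_conv_radius_ge_1D q_expansionD(1)[OF f]) simp
    thus "summable (\<lambda>n. fps_nth G n * (of_real x :: complex) ^ n)"
      by (rule summable_norm_cancel[OF summable_comparison_test'[where N = 0]])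
         (simp add: norm_mult Gle mult_right_mono)
  qed
  define g0 where "g0 = (\<lambda>z. nome z powi r * eval_fps G (nome z))"
  have g0: "q_expansion g0 r G" using cG by (simp add: q_expansion_def g0_def)
  have g0h: "g0 holomorphic_on \<H>" by (rule holomorphic_q_expansion[OF g0])
  define d where "d = (\<lambda>z. g z + (- 1) * g0 z)"
  have dh: "d holomorphic_on \<H>" unfolding d_def by (intro holomorphic_intros g g0h)
  define F' where "F' = Abs_fps (\<lambda>j. (of_int r + of_nat j) ^ k * fps_nth G j)"
  have "(qderiv ^^ Suc k) d z = 0" if z: "Im z > 0" for z
  proof -
    have "q_expansion (\<lambda>z. f z - (qderiv ^^ k) g0 z) r (F - F')"
      unfolding F'_def by (intro q_expansion_diff f q_expansion_qderiv_iter g0)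
    from q_expansion_qderiv[OF this]
    have "q_expansion (qderiv (\<lambda>z. f z - (qderiv ^^ k) g0 z)) r (fps_const (of_int r) * (F - F') + fps_X * fps_deriv (F - F'))" .
    moreover have "fps_const (of_int r) * (F - F') + fps_X * fps_deriv (F - F') = 0"
      by (rule fps_ext, unfold qderiv_fps_nth) (auto simp: F'_def G_def)
    ultimately have "qderiv (\<lambda>z. f z - (qderiv ^^ k) g0 z) z = 0" using z by (simp add: q_expansion_def)
    moreover have "(qderiv ^^ k) d w = f w - (qderiv ^^ k) g0 w" if "Im w > 0" for w
      using qderiv_iter_linear[OF g(1) g0h that, of k "- 1"] fg[OF that] by (simp add: d_def)
    ultimately show ?thesis using qderiv_cong[of "(qderiv ^^ k) d" "\<lambda>w. f w - (qderiv ^^ k) g0 w" z] z by simp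
  qed
  then obtain p where p: "\<And>z. Im z > 0 \<Longrightarrow> d z = poly p z" using qderiv_iter_zero_imp_polynomial[OF dh] by blast
  have per: "poly p (\<i> + of_nat m) = poly p \<i>" for m
  proof (induction m)
    case (Suc m)
    have "d (\<i> + of_nat m + 1) = d (\<i> + of_nat m)"
      using g(2)[of "\<i> + of_nat m"] q_expansion_periodic[OF g0, of "\<i> + of_nat m"] by (simp add: d_def)
    hence "poly p (\<i> + of_nat m + 1) = poly p (\<i> + of_nat m)" using p[of "\<i> + of_nat m + 1"] p[of "\<i> + of_nat m"] by simp
    thus ?case using Suc by (simp add: add_ac)
  qed simp
  have "range (\<lambda>m. \<i> + of_nat m) \<subseteq> {x. poly (p - [:poly p \<i>:]) x = 0}" using per by auto
  moreover have "infinite (range (\<lambda>m. \<i> + of_nat m))" by (intro range_inj_infinite injI) simp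
  ultimately have "infinite {x. poly (p - [:poly p \<i>:]) x = 0}" using finite_subset by blast
  hence "p - [:poly p \<i>:] = 0" using poly_roots_finite by blast
  hence pc: "poly p z = poly p \<i>" for z by (metis eq_iff_diff_eq_0 mult_zero_right poly_0 poly_pCons add.right_neutral)
  have "q_expansion (\<lambda>z. g0 z + poly p \<i>) (min r 0) (fps_X ^ nat (r - min r 0) * G + fps_X ^ nat (0 - min r 0) * fps_const (poly p \<i>))"
    by (intro q_expansion_add q_expansion_lower g0 q_expansion_const) auto
  hence "q_expansion g (min r 0) (fps_X ^ nat (r - min r 0) * G + fps_X ^ nat (0 - min r 0) * fps_const (poly p \<i>))"
  proof (rule q_expansion_cong)
    fix z assume z: "Im z > 0"
    show "g0 z + poly p \<i> = g z" using p[OF z] pc[of z] by (simp add: d_def algebra_simps)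
  qed
  thus ?thesis by blast
qed

section \<open>Eichler integrals and period cocycles\<close>

text \<open>Some primitive of \<open>f(z) z\<^sup>i\<close>; only its differences are meaningful.\<close>
definition moment :: "(complex \<Rightarrow> complex) \<Rightarrow> nat \<Rightarrow> complex \<Rightarrow> complex" where
  "moment f i = (SOME M. \<forall>z. Im z > 0 \<longrightarrow> (M has_field_derivative f z * z ^ i) (at z))"

lemma has_field_derivative_moment:
  assumes f: "f holomorphic_on \<H>" and z: "Im z > 0"
  shows "(moment f i has_field_derivative f z * z ^ i) (at z)"
proof -
  have "(\<lambda>z. f z * z ^ i) holomorphic_on \<H>" by (intro holomorphic_intros f)
  from holomorphic_UHP_primitive[OF this]
  obtain P where P: "\<And>z. Im z > 0 \<Longrightarrow> (P has_field_derivative f z * z ^ i) (at z)" by metis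
  have "\<exists>M. \<forall>z. Im z > 0 \<longrightarrow> (M has_field_derivative f z * z ^ i) (at z)"
    by (rule exI[of _ P]) (simp add: P)
  hence "\<forall>z. Im z > 0 \<longrightarrow> (moment f i has_field_derivative f z * z ^ i) (at z)"
    unfolding moment_def by (rule someI_ex)
  thus ?thesis using z by simp
qed

lemma contour_integral_moment:
  assumes f: "f holomorphic_on \<H>" and ab: "Im a > 0" "Im b > 0"
  shows "contour_integral (linepath a b) (\<lambda>z. c * (f z * z ^ i)) = c * (moment f i b - moment f i a)"
proof -
  have "path_image (linepath a b) \<subseteq> \<H>"
    using ab convex_UHP by (simp add: closed_segment_subset)
  moreover have "((\<lambda>z. c * moment f i z) has_field_derivative c * (f x * x ^ i)) (at x within \<H>)" if "x \<in> \<H>" for x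
    using that by (intro DERIV_cmult has_field_derivative_at_within[OF has_field_derivative_moment[OF f]]) simp
  ultimately have "((\<lambda>z. c * (f z * z ^ i)) has_contour_integral c * moment f i b - c * moment f i a) (linepath a b)"
    using contour_integral_primitive[of \<H> "\<lambda>z. c * moment f i z" "\<lambda>z. c * (f z * z ^ i)" "linepath a b"] by simp
  thus ?thesis by (simp add: contour_integral_unique right_diff_distrib)
qed

text \<open>A primitive, in the variable \<open>u\<close>, of \<open>f(u) (u - w)\<^sup>m\<close>.\<close>
definition eichler :: "(complex \<Rightarrow> complex) \<Rightarrow> nat \<Rightarrow> complex \<Rightarrow> complex \<Rightarrow> complex" where
  "eichler f m u w = (\<Sum>i\<le>m. of_nat (m choose i) * (- w) ^ (m - i) * moment f i u)"

lemma has_field_derivative_eichler: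
  assumes f: "f holomorphic_on \<H>" and u: "Im u > 0"
  shows "((\<lambda>u. eichler f m u w) has_field_derivative f u * (u - w) ^ m) (at u)"
proof -
  have "((\<lambda>u. eichler f m u w) has_field_derivative (\<Sum>i\<le>m. of_nat (m choose i) * (- w) ^ (m - i) * (f u * u ^ i))) (at u)"
    unfolding eichler_def by (intro DERIV_sum DERIV_cmult has_field_derivative_moment f u)
  moreover have "(\<Sum>i\<le>m. of_nat (m choose i) * (- w) ^ (m - i) * (f u * u ^ i)) = f u * (u + - w) ^ m"
    unfolding binomial_ring sum_distrib_left by (intro sum.cong) auto
  ultimately show ?thesis by simp
qed

text \<open>
  Both sides have the same derivative in \<open>u\<close>: the factors \<open>(c u + d)\<close> from \<open>f\<close>, from \<open>(\<gamma> u - \<gamma> w)\<^sup>n\<close> and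
  from the differential cancel.
\<close>
lemma eichler_moebius:
  assumes f: "f \<in> modular_functions (int n + 2)" and g: "\<gamma> \<in> carrier SL2Z"
    and u: "Im u > 0" "Im u' > 0" and w: "Im w > 0"
  shows "automorphy_factor \<gamma> w ^ n * (eichler f n (moebius_action \<gamma> u) (moebius_action \<gamma> w) - eichler f n (moebius_action \<gamma> u') (moebius_action \<gamma> w))
       = eichler f n u w - eichler f n u' w"
proof -
  note fD = modular_functionsD[OF f]
  define j where "j = automorphy_factor \<gamma>"
  define R where "R = (\<lambda>u. j w ^ n * eichler f n (moebius_action \<gamma> u) (moebius_action \<gamma> w) - eichler f n u w)"
  have j0: "j v \<noteq> 0" if "Im v > 0" for v using automorphy_nonzero[OF g] that by (simp add: j_def)
  have "R constant_on \<H>"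
  proof (rule has_field_derivative_0_imp_constant_on)
    fix v assume "v \<in> \<H>"
    hence v: "Im v > 0" by simp
    have mv: "Im (moebius_action \<gamma> v) > 0" using g v by simp
    have fv: "f (moebius_action \<gamma> v) = j v ^ n * (j v)\<^sup>2 * f v"
    proof -
      have "j v powi (int n + 2) = j v ^ (n + 2)"
        by (metis int_ops(3) of_nat_add of_nat_numeral power_int_of_nat)
      thus ?thesis using fD(3)[OF g, of v] v by (simp add: j_def power_add power2_eq_square)
    qed
    have dv: "moebius_action \<gamma> v - moebius_action \<gamma> w = (v - w) / (j v * j w)"
      unfolding j_def by (intro moebius_diff g automorphy_nonzero) (use v w in auto)
    have "(R has_field_derivative (j w ^ n * (f (moebius_action \<gamma> v) * (moebius_action \<gamma> v - moebius_action \<gamma> w) ^ n / (j v)\<^sup>2) - f v * (v - w) ^ n)) (at v)"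
      unfolding R_def
      by (intro DERIV_diff DERIV_cmult has_field_derivative_eichler[OF fD(2) v])
         (use has_field_derivative_compose_moebius[OF has_field_derivative_eichler[OF fD(2) mv] g v] in \<open>simp add: j_def\<close>)
    also have "j w ^ n * (f (moebius_action \<gamma> v) * (moebius_action \<gamma> v - moebius_action \<gamma> w) ^ n / (j v)\<^sup>2) - f v * (v - w) ^ n = 0"
      unfolding fv dv using j0[OF v] j0[OF w] by (simp add: power_divide power_mult_distrib)
    finally show "(R has_field_derivative 0) (at v)" .
  qed (auto simp: open_UHP convex_UHP convex_connected)
  then obtain c where "\<And>v. Im v > 0 \<Longrightarrow> R v = c" by (auto simp: constant_on_def)
  hence "R u = R u'" using u by simp
  thus ?thesis by (simp add: R_def j_def algebra_simps)
qed

lemma const_poly_hom: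
  "const_poly (x * y) = const_poly x * const_poly y" "const_poly (x ^ k) = const_poly x ^ k"
  "const_poly (of_nat m) = of_nat m" "const_poly (- x) = - const_poly x" "const_poly 1 = 1" "const_poly 0 = 0"
  "const_poly (x + y) = const_poly x + const_poly y"
proof -
  show 1: "const_poly (x * y) = const_poly x * const_poly y" for x y by (simp add: const_poly_def)
  show 2: "const_poly 1 = 1" by (simp add: const_poly_def one_pCons)
  show "const_poly (x ^ k) = const_poly x ^ k" by (induction k) (simp_all add: 1 2)
qed (simp_all add: const_poly_def of_nat_poly)

text \<open>
  The binomial formula, in a shape from which the coefficient of each monomial can be read off.
\<close>
lemma kernel_expand:
  "const_poly c * (const_poly z * var_a - var_b) ^ n
     = (\<Sum>i\<le>n. monom (monom (c * of_nat (n choose i) * z ^ i * (- 1) ^ (n - i)) (n - i)) i)"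
proof -
  have "(const_poly z * var_a + - var_b) ^ n = (\<Sum>i\<le>n. of_nat (n choose i) * (const_poly z * var_a) ^ i * (- var_b) ^ (n - i))"
    by (rule binomial_ring)
  moreover have "const_poly c * (of_nat (n choose i) * (const_poly z * var_a) ^ i * (- var_b) ^ (n - i))
     = monom (monom (c * of_nat (n choose i) * z ^ i * (- 1) ^ (n - i)) (n - i)) i" for i
    unfolding monomial_eq[symmetric] const_poly_hom power_mult_distrib power_minus[of var_b] by (simp add: mult_ac)
  ultimately show ?thesis by (simp add: sum_distrib_left)
qed

lemma coeff_kernel:
  assumes "i \<le> n"
  shows "coeff (coeff (const_poly c * (const_poly z * var_a - var_b) ^ n) i) (n - i) = c * of_nat (n choose i) * z ^ i * (- 1) ^ (n - i)"
proof -
  have "coeff (coeff (const_poly c * (const_poly z * var_a - var_b) ^ n) i) (n - i)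
    = (\<Sum>k\<le>n. if k = i then c * of_nat (n choose k) * z ^ k * (- 1) ^ (n - k) else 0)"
    unfolding kernel_expand coeff_sum using assms by (intro sum.cong) (auto simp: coeff_monom)
  thus ?thesis using assms by simp
qed

definition bol_const :: "nat \<Rightarrow> complex" where
  "bol_const n = (2 * of_real pi * \<i>) ^ (n + 1)"

lemma period_cocycle_eval:
  assumes f: "f holomorphic_on \<H>" and z0: "Im z0 > 0" and g: "\<gamma> \<in> carrier SL2Z"
  shows period_cocycle_in_Sym: "period_cocycle n f z0 \<gamma> \<in> Sym n"
    and dehom_period_cocycle: "dehom (period_cocycle n f z0 \<gamma>) w
       = bol_const n * (eichler f n z0 w - eichler f n (moebius_action (inv\<^bsub>SL2Z\<^esub> \<gamma>) z0) w)"
proof -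
  define z1 where "z1 = moebius_action (inv\<^bsub>SL2Z\<^esub> \<gamma>) z0"
  have z1: "Im z1 > 0" unfolding z1_def using z0 group.inv_closed[OF group_SL2Z g] by simp
  define F where "F = (\<lambda>z. const_poly (f z) * (const_poly z * var_a - var_b) ^ n)"
  have coeff: "contour_integral (linepath z1 z0) (\<lambda>z. coeff (coeff (F z) i) (n - i))
     = of_nat (n choose i) * (- 1) ^ (n - i) * (moment f i z0 - moment f i z1)" if "i \<le> n" for i
  proof -
    have "(\<lambda>z. coeff (coeff (F z) i) (n - i)) = (\<lambda>z. of_nat (n choose i) * (- 1) ^ (n - i) * (f z * z ^ i))"
      unfolding F_def coeff_kernel[OF that] by (auto simp: mult_ac)
    thus ?thesis by (simp add: contour_integral_moment[OF f z1 z0])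
  qed
  have pc: "period_cocycle n f z0 \<gamma> = const_poly (bol_const n) * sym_contour_integral n (linepath z1 z0) F"
    using g by (simp add: period_cocycle_def bol_const_def z1_def F_def)
  have "sym_contour_integral n (linepath z1 z0) F \<in> Sym n"
    unfolding sym_contour_integral_def monomial_eq by (intro Sym_sum monomial_in_Sym) auto
  thus "period_cocycle n f z0 \<gamma> \<in> Sym n" unfolding pc by (rule Sym_const_mult)
  have "dehom (sym_contour_integral n (linepath z1 z0) F) w
     = (\<Sum>i\<le>n. of_nat (n choose i) * (- 1) ^ (n - i) * (moment f i z0 - moment f i z1) * w ^ (n - i))"
    unfolding sym_contour_integral_def eval_ab_sum by (intro sum.cong) (auto simp: coeff)
  also have "\<dots> = (\<Sum>i\<le>n. of_nat (n choose i) * (- w) ^ (n - i) * moment f i z0 - of_nat (n choose i) * (- w) ^ (n - i) * moment f i z1)"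
    by (intro sum.cong refl) (simp add: power_minus[of w] algebra_simps)
  finally show "dehom (period_cocycle n f z0 \<gamma>) w
       = bol_const n * (eichler f n z0 w - eichler f n (moebius_action (inv\<^bsub>SL2Z\<^esub> \<gamma>) z0) w)"
    unfolding pc by (simp add: eichler_def sum_subtractf z1_def)
qed

lemma eichler_polynomial:
  obtains P where "P \<in> Sym n" "\<And>w. dehom P w = eichler f n u w"
proof -
  define p where "p = (\<Sum>i\<le>n. monom (of_nat (n choose i) * (- 1) ^ (n - i) * moment f i u) (n - i))"
  have d: "degree p \<le> n" unfolding p_def by (intro degree_sum_le) (auto intro: order_trans[OF degree_monom_le])
  have "poly p w = eichler f n u w" for w
    unfolding p_def eichler_def poly_sum poly_monom by (intro sum.cong refl, subst (2) power_minus) (simp add: mult_ac)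
  thus ?thesis using Sym_of_poly[OF d] that by metis
qed

text \<open>
  The segment from \<open>(g h)\<^sup>-\<^sup>1 z0\<close> to \<open>z0\<close> is replaced by one through \<open>h\<^sup>-\<^sup>1 z0\<close>; the first part is the
  image under \<open>h\<^sup>-\<^sup>1\<close> of the path for \<open>g\<close>.
\<close>
theorem period_cocycle_cocycle:
  assumes f: "f \<in> modular_functions (int n + 2)" and z0: "Im z0 > 0"
    and g: "g \<in> carrier SL2Z" and h: "h \<in> carrier SL2Z"
  shows "period_cocycle n f z0 (g ** h) = slash h (period_cocycle n f z0 g) + period_cocycle n f z0 h"
proof -
  note fh = modular_functionsD(2)[OF f]
  note grp = group.inv_closed[OF group_SL2Z]
  note pc = period_cocycle_in_Sym[OF fh z0]
  show ?thesis
  proof (rule Sym_eqI[OF pc[OF SL2Z_closed[OF g h]] Sym_add[OF slash_in_Sym[OF pc[OF g]] pc[OF h]]])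
    fix w assume w: "Im w > 0"
    define zg zh where "zg = moebius_action (inv\<^bsub>SL2Z\<^esub> g) z0" and "zh = moebius_action (inv\<^bsub>SL2Z\<^esub> h) z0"
    have z: "Im zg > 0" "Im zh > 0" unfolding zg_def zh_def using z0 grp[OF g] grp[OF h] by simp_all
    define zgh where "zgh = moebius_action (inv\<^bsub>SL2Z\<^esub> h) zg"
    have zgh: "Im zgh > 0" unfolding zgh_def using z grp[OF h] by simp
    have inv: "inv\<^bsub>SL2Z\<^esub> (g ** h) = inv\<^bsub>SL2Z\<^esub> h ** inv\<^bsub>SL2Z\<^esub> g"
      using group.inv_mult_group[OF group_SL2Z g h] by simp
    have m: "moebius_action (inv\<^bsub>SL2Z\<^esub> (g ** h)) z0 = zgh"
      unfolding inv zgh_def zg_def using grp[OF g] grp[OF h] z0 by (simp add: moebius_compose)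
    have e: "moebius_action h zh = z0" "moebius_action h zgh = zg"
      unfolding zh_def zgh_def using moebius_inv(1)[OF h] z0 z by simp_all
    have t: "automorphy_factor h w ^ n * (eichler f n z0 (moebius_action h w) - eichler f n zg (moebius_action h w))
       = eichler f n zh w - eichler f n zgh w"
      using eichler_moebius[OF f h z(2) zgh w] by (simp add: e)
    have "dehom (slash h (period_cocycle n f z0 g)) w = bol_const n * (eichler f n zh w - eichler f n zgh w)"
      unfolding dehom_slash[OF pc[OF g] h w] dehom_period_cocycle[OF fh z0 g] zg_def[symmetric] t[symmetric] by simp
    thus "dehom (period_cocycle n f z0 (g ** h)) w = dehom (slash h (period_cocycle n f z0 g) + period_cocycle n f z0 h) w"
      unfolding dehom_period_cocycle[OF fh z0 SL2Z_closed[OF g h]] m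
      by (simp add: dehom_period_cocycle[OF fh z0 h] zh_def[symmetric] algebra_simps)
  qed
qed

text \<open>
  The polynomial \<open>v\<close> is the integral of \<open>f(z) (z a - b)\<^sup>n\<close> between the two base points. Its explicit
  form is needed when these are the two elliptic points.
\<close>
theorem period_cocycle_base_point:
  assumes f: "f \<in> modular_functions (int n + 2)" and z: "Im z0 > 0" "Im z1 > 0"
  obtains v where "v \<in> Sym n" "\<And>w. dehom v w = - bol_const n * (eichler f n z1 w - eichler f n z0 w)"
    "\<And>\<gamma>. \<gamma> \<in> carrier SL2Z \<Longrightarrow> period_cocycle n f z1 \<gamma> - period_cocycle n f z0 \<gamma> = slash \<gamma> v - v"
proof -
  note fh = modular_functionsD(2)[OF f]
  obtain P where P: "P \<in> Sym n" "\<And>w. dehom P w = eichler f n z1 w" by (rule eichler_polynomial[where f = f and n = n and u = z1]) blast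
  obtain Q where Q: "Q \<in> Sym n" "\<And>w. dehom Q w = eichler f n z0 w" by (rule eichler_polynomial[where f = f and n = n and u = z0]) blast
  define v where "v = const_poly (- bol_const n) * (P - Q)"
  have v: "v \<in> Sym n" unfolding v_def by (intro Sym_const_mult Sym_diff P Q)
  have ev: "dehom v w = - bol_const n * (eichler f n z1 w - eichler f n z0 w)" for w by (simp add: v_def P Q)
  show ?thesis
  proof (rule that[OF v ev])
    fix \<gamma> assume g: "\<gamma> \<in> carrier SL2Z"
    note pc0 = period_cocycle_in_Sym[OF fh z(1) g] and pc1 = period_cocycle_in_Sym[OF fh z(2) g]
    show "period_cocycle n f z1 \<gamma> - period_cocycle n f z0 \<gamma> = slash \<gamma> v - v"
    proof (rule Sym_eqI[OF Sym_diff[OF pc1 pc0] Sym_diff[OF slash_in_Sym[OF v] v]])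
      fix w assume w: "Im w > 0"
      define y0 y1 where "y0 = moebius_action (inv\<^bsub>SL2Z\<^esub> \<gamma>) z0" and "y1 = moebius_action (inv\<^bsub>SL2Z\<^esub> \<gamma>) z1"
      have y: "Im y0 > 0" "Im y1 > 0" "moebius_action \<gamma> y0 = z0" "moebius_action \<gamma> y1 = z1"
        unfolding y0_def y1_def using z group.inv_closed[OF group_SL2Z g] moebius_inv(1)[OF g] by simp_all
      have t: "automorphy_factor \<gamma> w ^ n * (eichler f n z1 (moebius_action \<gamma> w) - eichler f n z0 (moebius_action \<gamma> w))
         = eichler f n y1 w - eichler f n y0 w"
        using eichler_moebius[OF f g y(2,1) w] by (simp add: y)
      have "dehom (slash \<gamma> v) w = - bol_const n * (automorphy_factor \<gamma> w ^ n * (eichler f n z1 (moebius_action \<gamma> w) - eichler f n z0 (moebius_action \<gamma> w)))"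
        unfolding dehom_slash[OF v g w] ev by simp
      thus "dehom (period_cocycle n f z1 \<gamma> - period_cocycle n f z0 \<gamma>) w = dehom (slash \<gamma> v - v) w"
        unfolding t by (simp add: dehom_period_cocycle[OF fh z(1) g] dehom_period_cocycle[OF fh z(2) g] ev y0_def y1_def algebra_simps)
    qed
  qed
qed

text \<open>The Eichler integral \<open>\<integral> f(z) (z - w)\<^sup>m dz\<close> from \<open>z0\<close> to \<open>w\<close>.\<close>
definition eichler_integral :: "(complex \<Rightarrow> complex) \<Rightarrow> nat \<Rightarrow> complex \<Rightarrow> complex \<Rightarrow> complex" where
  "eichler_integral f m z0 w = eichler f m w w - eichler f m z0 w"

lemma eichler_integral_altdef:
  "eichler_integral f m z0 w = (\<Sum>i\<le>m. of_nat (m choose i) * (- w) ^ (m - i) * (moment f i w - moment f i z0))"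
  by (simp add: eichler_integral_def eichler_def sum_subtractf right_diff_distrib)

lemma has_field_derivative_eichler_integral:
  assumes f: "f holomorphic_on \<H>" and w: "Im w > 0"
  shows "(eichler_integral f 0 z0 has_field_derivative f w) (at w)"
    and "(eichler_integral f (Suc m) z0 has_field_derivative - of_nat (Suc m) * eichler_integral f m z0 w) (at w)"
proof -
  have "((\<lambda>w. moment f 0 w - moment f 0 z0) has_field_derivative f w * w ^ 0 - 0) (at w)"
    by (intro DERIV_diff has_field_derivative_moment f w DERIV_const)
  thus "(eichler_integral f 0 z0 has_field_derivative f w) (at w)"
    unfolding eichler_integral_altdef[abs_def] by simp
  define D where "D = (\<lambda>i. moment f i w - moment f i z0)"
  have "((\<lambda>w. \<Sum>i\<le>Suc m. of_nat (Suc m choose i) * (- w) ^ (Suc m - i) * (moment f i w - moment f i z0)) has_field_derivative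
     (\<Sum>i\<le>Suc m. of_nat (Suc m choose i) * (- w) ^ (Suc m - i) * (f w * w ^ i)
        + of_nat (Suc m choose i) * (of_nat (Suc m - i) * (- 1 * (- w) ^ (Suc m - i - 1))) * D i)) (at w)"
    unfolding D_def
    by (intro DERIV_sum) (auto intro!: derivative_eq_intros has_field_derivative_moment[OF f w] simp: algebra_simps)
  also have "(\<Sum>i\<le>Suc m. of_nat (Suc m choose i) * (- w) ^ (Suc m - i) * (f w * w ^ i)
        + of_nat (Suc m choose i) * (of_nat (Suc m - i) * (- 1 * (- w) ^ (Suc m - i - 1))) * D i)
     = (\<Sum>i\<le>Suc m. of_nat (Suc m choose i) * (- w) ^ (Suc m - i) * (f w * w ^ i))
      + (\<Sum>i\<le>Suc m. of_nat (Suc m choose i) * (of_nat (Suc m - i) * (- 1 * (- w) ^ (Suc m - i - 1))) * D i)"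
    by (rule sum.distrib)
  also have "(\<Sum>i\<le>Suc m. of_nat (Suc m choose i) * (- w) ^ (Suc m - i) * (f w * w ^ i)) = f w * (w + - w) ^ Suc m"
    unfolding binomial_ring sum_distrib_left by (intro sum.cong) auto
  also have "(\<Sum>i\<le>Suc m. of_nat (Suc m choose i) * (of_nat (Suc m - i) * (- 1 * (- w) ^ (Suc m - i - 1))) * D i)
     = (\<Sum>i\<le>m. of_nat (Suc m choose i) * (of_nat (Suc m - i) * (- 1 * (- w) ^ (Suc m - i - 1))) * D i)" by simp
  also have "\<dots> = (\<Sum>i\<le>m. - of_nat (Suc m) * (of_nat (m choose i) * (- w) ^ (m - i) * D i))"
  proof (intro sum.cong refl)
    fix i assume "i \<in> {..m}"
    hence "(Suc m choose i) * (Suc m - i) = Suc m * (m choose i)"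
      using binomial_absorb_comp[of "Suc m" i] by (simp add: mult.commute)
    hence eq: "of_nat (Suc m choose i) * of_nat (Suc m - i) = (of_nat (Suc m) * of_nat (m choose i) :: complex)"
      by (metis of_nat_mult)
    have "of_nat (Suc m choose i) * (of_nat (Suc m - i) * (- 1 * (- w) ^ (Suc m - i - 1))) * D i
       = - (of_nat (Suc m choose i) * of_nat (Suc m - i)) * ((- w) ^ (m - i) * D i)" by simp
    also have "\<dots> = - of_nat (Suc m) * (of_nat (m choose i) * (- w) ^ (m - i) * D i)" unfolding eq by (simp only: mult_minus_left mult.assoc)
    finally show "of_nat (Suc m choose i) * (of_nat (Suc m - i) * (- 1 * (- w) ^ (Suc m - i - 1))) * D i
       = - of_nat (Suc m) * (of_nat (m choose i) * (- w) ^ (m - i) * D i)" .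
  qed
  also have "\<dots> = - of_nat (Suc m) * eichler_integral f m z0 w"
    unfolding eichler_integral_altdef D_def sum_distrib_left ..
  finally show "(eichler_integral f (Suc m) z0 has_field_derivative - of_nat (Suc m) * eichler_integral f m z0 w) (at w)"
    unfolding eichler_integral_altdef[abs_def] by simp
qed

lemma holomorphic_eichler_integral: "f holomorphic_on \<H> \<Longrightarrow> eichler_integral f m z0 holomorphic_on \<H>"
  unfolding holomorphic_on_open[OF open_UHP]
  using has_field_derivative_eichler_integral[of f] unfolding holomorphic_on_open[OF open_UHP, symmetric]
  by (cases m) (metis in_UHP holomorphic_on_open open_UHP)+

lemma qderiv_iter_eichler_integral:
  assumes f: "f holomorphic_on \<H>" and w: "Im w > 0"
  shows "bol_const m * (qderiv ^^ Suc m) (eichler_integral f m z0) w = (- 1) ^ m * fact m * f w"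
  using w
proof (induction m arbitrary: w)
  case 0
  show ?case using qderiv_unique[OF has_field_derivative_eichler_integral(1)[OF f 0] 0, of z0] by (simp add: bol_const_def)
next
  case (Suc m)
  define p :: complex where "p = 2 * of_real pi * \<i>"
  have p: "p \<noteq> 0" by (simp add: p_def)
  define c where "c = - of_nat (Suc m) / p"
  have q: "qderiv (eichler_integral f (Suc m) z0) v = 0 + c * eichler_integral f m z0 v" if "Im v > 0" for v
    using qderiv_unique[OF has_field_derivative_eichler_integral(2)[OF f that] that, of m z0] by (simp add: c_def p_def)
  have "(qderiv ^^ Suc m) (qderiv (eichler_integral f (Suc m) z0)) w = (qderiv ^^ Suc m) (\<lambda>v. 0 + c * eichler_integral f m z0 v) w"
    by (rule qderiv_iter_cong[OF q Suc.prems])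
  also have "\<dots> = (qderiv ^^ Suc m) (\<lambda>v. 0) w + c * (qderiv ^^ Suc m) (eichler_integral f m z0) w"
    by (rule qderiv_iter_linear[OF _ holomorphic_eichler_integral[OF f] Suc.prems]) auto
  also have "(qderiv ^^ Suc m) (\<lambda>v. 0) w = 0" by (rule qderiv_iter_zero[OF Suc.prems])
  finally have "(qderiv ^^ Suc (Suc m)) (eichler_integral f (Suc m) z0) w = c * (qderiv ^^ Suc m) (eichler_integral f m z0) w"
    unfolding funpow_Suc_right[of "Suc m"] by simp
  hence "bol_const (Suc m) * (qderiv ^^ Suc (Suc m)) (eichler_integral f (Suc m) z0) w
     = (p * c) * (bol_const m * (qderiv ^^ Suc m) (eichler_integral f m z0) w)"
    by (simp add: bol_const_def p_def mult_ac)
  also have "p * c = - of_nat (Suc m)" using p by (simp add: c_def)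
  also have "- of_nat (Suc m) * (bol_const m * (qderiv ^^ Suc m) (eichler_integral f m z0) w) = (- 1) ^ Suc m * fact (Suc m) * f w"
    unfolding Suc.IH[OF Suc.prems] by (simp add: algebra_simps)
  finally show ?case .
qed

text \<open>
  The cocycle of \<open>f\<close> measures how far the Eichler integral, corrected by a polynomial \<open>v\<close> of degree at
  most \<open>n\<close>, is from being modular of weight \<open>- n\<close>.
\<close>
lemma eichler_integral_defect:
  assumes f: "f \<in> modular_functions (int n + 2)" and z0: "Im z0 > 0" and v: "v \<in> Sym n"
    and g: "\<gamma> \<in> carrier SL2Z" and w: "Im w > 0"
  defines "E \<equiv> (\<lambda>w. bol_const n * eichler_integral f n z0 w - dehom v w)"
  shows "automorphy_factor \<gamma> w ^ n * E (moebius_action \<gamma> w) - E w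
       = dehom (period_cocycle n f z0 \<gamma> - (slash \<gamma> v - v)) w"
proof -
  note fh = modular_functionsD(2)[OF f]
  define y where "y = moebius_action (inv\<^bsub>SL2Z\<^esub> \<gamma>) z0"
  have y: "Im y > 0" "moebius_action \<gamma> y = z0"
    unfolding y_def using z0 group.inv_closed[OF group_SL2Z g] moebius_inv(1)[OF g] by simp_all
  have t: "automorphy_factor \<gamma> w ^ n * eichler_integral f n z0 (moebius_action \<gamma> w) = eichler f n w w - eichler f n y w"
    unfolding eichler_integral_def using eichler_moebius[OF f g w y(1) w] by (simp add: y)
  have "automorphy_factor \<gamma> w ^ n * E (moebius_action \<gamma> w)
     = bol_const n * (automorphy_factor \<gamma> w ^ n * eichler_integral f n z0 (moebius_action \<gamma> w)) - dehom (slash \<gamma> v) w"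
    unfolding dehom_slash[OF v g w] E_def by (simp add: algebra_simps)
  thus ?thesis unfolding t
    by (simp add: E_def eichler_integral_def dehom_period_cocycle[OF fh z0 g] y_def algebra_simps)
qed

text \<open>
  Apply \<open>(q d/dq)\<^sup>n\<^sup>+\<^sup>1\<close> to the Eichler integral minus the polynomial \<open>v\<close>: this gives \<open>(-1)\<^sup>n n! f\<close>.
  If the difference is modular of weight \<open>- n\<close>, it is a weakly holomorphic form because its derivative has an
  expansion at the cusp. Conversely, a form whose derivative is \<open>f\<close> differs from the Eichler integral by a
  polynomial of degree at most \<open>n\<close>.
\<close>
theorem period_cocycle_coboundary_iff:
  assumes f: "f \<in> forms_over UNIV (int n + 2)" and z0: "Im z0 > 0"
  shows "(\<exists>v\<in>Sym n. \<forall>\<gamma>\<in>carrier SL2Z. period_cocycle n f z0 \<gamma> = slash \<gamma> v - v)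
     \<longleftrightarrow> f \<in> (qderiv ^^ (n + 1)) ` forms_over UNIV (- int n)"
proof
  note fm = forms_overD[OF f]
  note fh = modular_functionsD(2)[OF fm]
  define k :: complex where "k = (- 1) ^ n * fact n"
  have k: "k \<noteq> 0" by (simp add: k_def)
  have pw: "x powi (- int n) = inverse (x ^ n)" for x :: complex by (simp add: power_int_minus)
  {
    assume "\<exists>v\<in>Sym n. \<forall>\<gamma>\<in>carrier SL2Z. period_cocycle n f z0 \<gamma> = slash \<gamma> v - v"
    then obtain v where v: "v \<in> Sym n" and vc: "\<And>\<gamma>. \<gamma> \<in> carrier SL2Z \<Longrightarrow> period_cocycle n f z0 \<gamma> = slash \<gamma> v - v" by blast
    define E where "E = (\<lambda>w. bol_const n * eichler_integral f n z0 w - dehom v w)"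
    define g where "g = (\<lambda>w. if w \<in> \<H> then E w / k else 0)"
    obtain p where p: "degree p \<le> n" "\<And>w. dehom v w = poly p w" using dehom_polynomial[OF v] by blast
    have ph: "poly p holomorphic_on \<H>" by (intro holomorphic_intros)
    have Eh: "E holomorphic_on \<H>"
      unfolding E_def p by (intro holomorphic_intros holomorphic_eichler_integral fh)
    have "(\<lambda>w. E w / k) holomorphic_on \<H>" using k by (intro holomorphic_intros Eh) auto
    hence gh: "g holomorphic_on \<H>" by (rule holomorphic_transform) (simp add: g_def)
    have gm: "g \<in> modular_functions (- int n)"
      unfolding modular_functions_def
    proof (safe intro!: gh)
      fix \<gamma> w assume g': "\<gamma> \<in> carrier SL2Z" and wH: "w \<in> \<H>"
      hence w: "Im w > 0" by simp
      have "automorphy_factor \<gamma> w ^ n * E (moebius_action \<gamma> w) = E w"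
        using eichler_integral_defect[OF fm z0 v g' w] vc[OF g'] by (simp add: E_def)
      hence "inverse (automorphy_factor \<gamma> w ^ n) * E w = E (moebius_action \<gamma> w)"
        using automorphy_nonzero[OF g' wH] by (simp add: mult.assoc[symmetric] flip: \<open>automorphy_factor \<gamma> w ^ n * E (moebius_action \<gamma> w) = E w\<close>)
      moreover have "g (moebius_action \<gamma> w) = E (moebius_action \<gamma> w) / k" "g w = E w / k" using w g' by (simp_all add: g_def)
      ultimately show "g (moebius_action \<gamma> w) = automorphy_factor \<gamma> w powi (- int n) * g w"
        unfolding pw by (metis times_divide_eq_right)
    qed (simp add: g_def)
    have D: "(qderiv ^^ Suc n) g w = f w" if w: "Im w > 0" for w
    proof -
      have eqg: "g u = (0 + bol_const n / k * eichler_integral f n z0 u) + (- 1 / k) * poly p u" if "Im u > 0" for u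
        using that k by (simp add: g_def E_def p diff_divide_distrib)
      have "(qderiv ^^ Suc n) g w = (qderiv ^^ Suc n) (\<lambda>u. (0 + bol_const n / k * eichler_integral f n z0 u) + (- 1 / k) * poly p u) w"
        by (rule qderiv_iter_cong[OF eqg w])
      also have "\<dots> = (qderiv ^^ Suc n) (\<lambda>u. 0 + bol_const n / k * eichler_integral f n z0 u) w + (- 1 / k) * (qderiv ^^ Suc n) (poly p) w"
        by (intro qderiv_iter_linear w ph holomorphic_intros holomorphic_eichler_integral fh)
      also have "(qderiv ^^ Suc n) (\<lambda>u. 0 + bol_const n / k * eichler_integral f n z0 u) w
         = (qderiv ^^ Suc n) (\<lambda>u. 0) w + bol_const n / k * (qderiv ^^ Suc n) (eichler_integral f n z0) w"
        by (intro qderiv_iter_linear w holomorphic_intros holomorphic_eichler_integral fh)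
      also have "(qderiv ^^ Suc n) (\<lambda>u. 0) w = 0" by (rule qderiv_iter_zero[OF w])
      also have "(qderiv ^^ Suc n) (poly p) w = 0" by (rule qderiv_iter_polynomial[OF p(1) w])
      finally show ?thesis using qderiv_iter_eichler_integral[OF fh w, of n z0] k by (simp add: k_def field_simps)
    qed
    obtain r F where F: "q_expansion f r F" using f by (auto simp: forms_over_UNIV)
    have "\<exists>s G. q_expansion g s G"
      by (rule q_expansion_antiderivative[OF F gh modular_functionsD(4)[OF gm] D])
    hence gf: "g \<in> forms_over UNIV (- int n)" using gm by (simp add: forms_over_UNIV)
    have "(qderiv ^^ (n + 1)) g = f"
    proof
      fix w show "(qderiv ^^ (n + 1)) g w = f w"
        using D[of w] modular_functionsD(1)[OF fm, of w] by (cases "Im w > 0") (simp_all add: qderiv_def)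
    qed
    thus "f \<in> (qderiv ^^ (n + 1)) ` forms_over UNIV (- int n)" using gf by blast
  }
  {
    assume "f \<in> (qderiv ^^ (n + 1)) ` forms_over UNIV (- int n)"
    then obtain g where g: "g \<in> forms_over UNIV (- int n)" "f = (qderiv ^^ Suc n) g" by auto
    note gm = forms_overD[OF g(1)]
    note gh = modular_functionsD(2)[OF gm]
    have bh: "(\<lambda>u. 0 + bol_const n * eichler_integral f n z0 u) holomorphic_on \<H>"
      by (intro holomorphic_intros holomorphic_eichler_integral fh)
    define d where "d = (\<lambda>u. (0 + bol_const n * eichler_integral f n z0 u) + (- k) * g u)"
    have dh: "d holomorphic_on \<H>" unfolding d_def by (intro holomorphic_intros bh gh)
    have "(qderiv ^^ Suc n) d w = 0" if w: "Im w > 0" for w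
    proof -
      have "(qderiv ^^ Suc n) d w = (qderiv ^^ Suc n) (\<lambda>u. 0 + bol_const n * eichler_integral f n z0 u) w + (- k) * (qderiv ^^ Suc n) g w"
        unfolding d_def by (rule qderiv_iter_linear[OF bh gh w])
      also have "(qderiv ^^ Suc n) (\<lambda>u. 0 + bol_const n * eichler_integral f n z0 u) w
         = (qderiv ^^ Suc n) (\<lambda>u. 0) w + bol_const n * (qderiv ^^ Suc n) (eichler_integral f n z0) w"
        by (intro qderiv_iter_linear w holomorphic_intros holomorphic_eichler_integral fh)
      also have "(qderiv ^^ Suc n) (\<lambda>u. 0) w = 0" by (rule qderiv_iter_zero[OF w])
      finally show ?thesis using qderiv_iter_eichler_integral[OF fh w, of n z0] g(2) by (simp add: k_def)
    qed
    then obtain p where p: "degree p \<le> n" "\<And>w. Im w > 0 \<Longrightarrow> d w = poly p w"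
      using qderiv_iter_zero_imp_polynomial[OF dh] by blast
    obtain v where v: "v \<in> Sym n" "\<And>w. dehom v w = poly p w" using Sym_of_poly[OF p(1)] by blast
    define E where "E = (\<lambda>w. bol_const n * eichler_integral f n z0 w - dehom v w)"
    have E: "E w = k * g w" if "Im w > 0" for w using p(2)[OF that] by (simp add: E_def v d_def algebra_simps)
    have "period_cocycle n f z0 \<gamma> = slash \<gamma> v - v" if g': "\<gamma> \<in> carrier SL2Z" for \<gamma>
    proof (rule Sym_eqI[OF period_cocycle_in_Sym[OF fh z0 g'] Sym_diff[OF slash_in_Sym[OF v(1)] v(1)]])
      fix w assume w: "Im w > 0"
      have "g (moebius_action \<gamma> w) = inverse (automorphy_factor \<gamma> w ^ n) * g w"
        using modular_functionsD(3)[OF gm g', of w] w unfolding pw by simp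
      hence "automorphy_factor \<gamma> w ^ n * E (moebius_action \<gamma> w) = E w"
        using automorphy_nonzero[OF g', of w] w g' by (simp add: E field_simps)
      thus "dehom (period_cocycle n f z0 \<gamma>) w = dehom (slash \<gamma> v - v) w"
        using eichler_integral_defect[OF fm z0 v(1) g' w] by (simp add: E_def)
    qed
    thus "\<exists>v\<in>Sym n. \<forall>\<gamma>\<in>carrier SL2Z. period_cocycle n f z0 \<gamma> = slash \<gamma> v - v" using v(1) by blast
  }
qed

section \<open>Every cocycle is a period cocycle up to a coboundary\<close>

lemma moment_linear:
  assumes f: "f holomorphic_on \<H>" and g: "g holomorphic_on \<H>" and ab: "Im a > 0" "Im b > 0"
  shows "moment (\<lambda>z. f z + c * g z) i b - moment (\<lambda>z. f z + c * g z) i a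
       = (moment f i b - moment f i a) + c * (moment g i b - moment g i a)"
proof -
  define R where "R = (\<lambda>z. moment (\<lambda>z. f z + c * g z) i z - (moment f i z + c * moment g i z))"
  have h: "(\<lambda>z. f z + c * g z) holomorphic_on \<H>" by (intro holomorphic_intros f g)
  have "R constant_on \<H>"
  proof (rule has_field_derivative_0_imp_constant_on)
    fix z assume "z \<in> \<H>"
    hence z: "Im z > 0" by simp
    have "(R has_field_derivative (f z + c * g z) * z ^ i - (f z * z ^ i + c * (g z * z ^ i))) (at z)"
      unfolding R_def by (intro DERIV_diff DERIV_add DERIV_cmult has_field_derivative_moment h f g z)
    thus "(R has_field_derivative 0) (at z)" by (simp add: algebra_simps)
  qed (auto simp: open_UHP convex_UHP convex_connected)
  then obtain d where "\<And>v. Im v > 0 \<Longrightarrow> R v = d" by (auto simp: constant_on_def)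
  hence "R a = R b" using ab by simp
  thus ?thesis by (simp add: R_def algebra_simps)
qed

lemma period_cocycle_linear:
  assumes f: "f holomorphic_on \<H>" and g: "g holomorphic_on \<H>" and z0: "Im z0 > 0" and \<gamma>: "\<gamma> \<in> carrier SL2Z"
  shows "period_cocycle n (\<lambda>z. f z + c * g z) z0 \<gamma> = period_cocycle n f z0 \<gamma> + const_poly c * period_cocycle n g z0 \<gamma>"
proof -
  have h: "(\<lambda>z. f z + c * g z) holomorphic_on \<H>" by (intro holomorphic_intros f g)
  note pc = period_cocycle_in_Sym[OF _ z0 \<gamma>]
  define y where "y = moebius_action (inv\<^bsub>SL2Z\<^esub> \<gamma>) z0"
  have y: "Im y > 0" unfolding y_def using z0 group.inv_closed[OF group_SL2Z \<gamma>] by simp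
  have *: "eichler f' n z0 w - eichler f' n y w = (\<Sum>i\<le>n. of_nat (n choose i) * (- w) ^ (n - i) * (moment f' i z0 - moment f' i y))" for f' w
    by (simp add: eichler_def sum_subtractf[symmetric] right_diff_distrib)
  show ?thesis
  proof (rule Sym_eqI[OF pc[OF h] Sym_add[OF pc[OF f] Sym_const_mult[OF pc[OF g]]]])
    fix w
    have "eichler (\<lambda>z. f z + c * g z) n z0 w - eichler (\<lambda>z. f z + c * g z) n y w
      = (eichler f n z0 w - eichler f n y w) + c * (eichler g n z0 w - eichler g n y w)"
      unfolding * moment_linear[OF f g y z0] sum_distrib_left sum.distrib[symmetric]
      by (intro sum.cong refl) (simp only: distrib_left mult_ac)
    thus "dehom (period_cocycle n (\<lambda>z. f z + c * g z) z0 \<gamma>) w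
        = dehom (period_cocycle n f z0 \<gamma> + const_poly c * period_cocycle n g z0 \<gamma>) w"
      unfolding eval_ab_simps dehom_period_cocycle[OF h z0 \<gamma>] dehom_period_cocycle[OF f z0 \<gamma>] dehom_period_cocycle[OF g z0 \<gamma>]
        y_def[symmetric] by (simp only: distrib_left mult.left_commute)
  qed
qed

lemma period_cocycle_fixed_point:
  assumes f: "f holomorphic_on \<H>" and z0: "Im z0 > 0" and g: "\<gamma> \<in> carrier SL2Z" "moebius_action \<gamma> z0 = z0"
  shows "period_cocycle n f z0 \<gamma> = 0"
proof (rule Sym_eqI[OF period_cocycle_in_Sym[OF f z0 g(1)] Sym_zero])
  have "moebius_action (inv\<^bsub>SL2Z\<^esub> \<gamma>) z0 = z0" using moebius_inv(2)[OF g(1), of z0] z0 g(2) by simp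
  thus "dehom (period_cocycle n f z0 \<gamma>) w = dehom 0 w" for w by (simp add: dehom_period_cocycle[OF f z0 g(1)])
qed

definition sym_cocycles :: "nat \<Rightarrow> (int^2^2 \<Rightarrow> complex poly poly) set" where
  "sym_cocycles n = {\<kappa>. (\<forall>g\<in>carrier SL2Z. \<kappa> g \<in> Sym n) \<and>
     (\<forall>g\<in>carrier SL2Z. \<forall>h\<in>carrier SL2Z. \<kappa> (g ** h) = slash h (\<kappa> g) + \<kappa> h)}"

lemma slash_zero: "\<gamma> \<in> carrier SL2Z \<Longrightarrow> slash \<gamma> 0 = 0"
  using slash_diff[OF Sym_zero Sym_zero, of \<gamma>] by simp

lemma sym_cocycle_one:
  assumes "\<kappa> \<in> sym_cocycles n"
  shows "\<kappa> (mat 1) = 0"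
proof -
  have k: "\<kappa> (mat 1) \<in> Sym n" "\<kappa> (mat 1 ** mat 1) = slash (mat 1) (\<kappa> (mat 1)) + \<kappa> (mat 1)"
    using assms SL2Z_one unfolding sym_cocycles_def by blast+
  thus ?thesis using slash_one[OF k(1)] by simp
qed

lemma sym_cocycles_diff:
  assumes "\<kappa> \<in> sym_cocycles n" "\<mu> \<in> sym_cocycles n"
  shows "(\<lambda>g. \<kappa> g - \<mu> g) \<in> sym_cocycles n"
  using assms slash_diff[of _ n] by (auto simp: sym_cocycles_def Sym_diff algebra_simps)

lemma coboundary_sym_cocycle:
  assumes "v \<in> Sym n"
  shows "(\<lambda>g. slash g v - v) \<in> sym_cocycles n"
  using assms by (auto simp: sym_cocycles_def Sym_diff slash_in_Sym slash_compose slash_diff[of _ n])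

lemma period_sym_cocycle:
  "f \<in> modular_functions (int n + 2) \<Longrightarrow> Im z0 > 0 \<Longrightarrow> period_cocycle n f z0 \<in> sym_cocycles n"
  using period_cocycle_cocycle[of f n z0] period_cocycle_in_Sym[OF modular_functionsD(2)] by (auto simp: sym_cocycles_def)

text \<open>
  An element of order three modulo \<open>\<plusminus>1\<close>; together with \<open>S_mat\<close> it generates the group.
\<close>
definition U_mat :: "int^2^2" where "U_mat = S_mat ** T_mat 1"

lemma U_mat_in_SL2Z: "U_mat \<in> carrier SL2Z"
  unfolding U_mat_def by (intro SL2Z_closed S_T_in_SL2Z)

lemma sym_cocycle_zero:
  assumes k: "\<kappa> \<in> sym_cocycles n" and S: "\<kappa> S_mat = 0" and U: "\<kappa> U_mat = 0" and g: "\<gamma> \<in> carrier SL2Z"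
  shows "\<kappa> \<gamma> = 0"
proof -
  have c: "\<kappa> (g ** h) = slash h (\<kappa> g) + \<kappa> h" if "g \<in> carrier SL2Z" "h \<in> carrier SL2Z" for g h
    using k that by (simp add: sym_cocycles_def)
  have step: "\<kappa> (g ** h) = 0" if "g \<in> carrier SL2Z" "h \<in> carrier SL2Z" "\<kappa> g = 0" "\<kappa> h = 0" for g h
    using c[OF that(1,2)] that by (simp add: slash_zero)
  have T: "\<kappa> (T_mat 1) = 0"
    using c[of S_mat "T_mat 1"] U S by (simp add: U_mat_def slash_zero)
  have "T_mat 1 ** T_mat (- 1) = mat 1" by (rule mat2_eqI) (simp_all add: T_mat_def mat2_mult_nth mat_one_nth)
  hence T': "\<kappa> (T_mat (- 1)) = 0"
    using c[of "T_mat 1" "T_mat (- 1)"] T sym_cocycle_one[OF k] by (simp add: slash_zero)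
  from g show ?thesis
  proof (induction rule: SL2Z_generated)
    case one show ?case by (rule sym_cocycle_one[OF k])
  qed (auto intro: step S T T')
qed

definition neg_one :: "int^2^2" where "neg_one = mat2 (- 1) 0 0 (- 1)"

lemma neg_one_in_SL2Z: "neg_one \<in> carrier SL2Z"
  by (simp add: neg_one_def carrier_SL2Z)

lemma slash_neg_one:
  assumes "P \<in> Sym n"
  shows "slash neg_one P = const_poly ((- 1) ^ n) * P"
  using assms neg_one_in_SL2Z
  by (intro Sym_eqI[of _ n])
     (auto simp: slash_in_Sym Sym_const_mult dehom_slash[of _ n], simp add: neg_one_def automorphy_factor_def moebius_action_def)

lemma const_poly_halves: "const_poly (1 / 2) * P + const_poly (1 / 2) * P = P"
  and const_poly_thirds: "const_poly (1 / 3) * P + const_poly (1 / 3) * P + const_poly (1 / 3) * P = P"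
proof -
  have "const_poly (1 / 2) + const_poly (1 / 2) = 1" "const_poly (1 / 3) + const_poly (1 / 3) + const_poly (1 / 3) = 1"
    unfolding const_poly_hom(7)[symmetric] by (simp_all add: const_poly_hom)
  thus "const_poly (1 / 2) * P + const_poly (1 / 2) * P = P"
    "const_poly (1 / 3) * P + const_poly (1 / 3) * P + const_poly (1 / 3) * P = P"
    by (metis distrib_right mult_1)+
qed

text \<open>
  Averaging over a finite cyclic group: if \<open>\<gamma>\<close> has order \<open>2\<close> or \<open>3\<close> modulo \<open>\<plusminus>1\<close>, then the
  restriction of a cocycle to the group generated by \<open>\<gamma>\<close> is a coboundary.
\<close>
lemma sym_cocycle_split_on_generators:
  assumes k: "\<kappa> \<in> sym_cocycles n" and n: "even n"
  obtains P Q where "P \<in> Sym n" "\<kappa> S_mat = slash S_mat P - P" "Q \<in> Sym n" "\<kappa> U_mat = slash U_mat Q - Q"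
proof -
  have kS: "\<kappa> g \<in> Sym n" if "g \<in> carrier SL2Z" for g using k that by (simp add: sym_cocycles_def)
  have c: "\<kappa> (g ** h) = slash h (\<kappa> g) + \<kappa> h" if "g \<in> carrier SL2Z" "h \<in> carrier SL2Z" for g h
    using k that by (simp add: sym_cocycles_def)
  have "neg_one ** neg_one = mat 1" by (rule mat2_eqI) (simp_all add: neg_one_def mat2_mult_nth mat_one_nth)
  hence "\<kappa> neg_one + \<kappa> neg_one = 0"
    using c[OF neg_one_in_SL2Z neg_one_in_SL2Z] slash_neg_one[OF kS[OF neg_one_in_SL2Z]] n sym_cocycle_one[OF k]
    by (simp add: const_poly_hom)
  hence k1: "\<kappa> neg_one = 0" using const_poly_halves[of "\<kappa> neg_one"] by (metis distrib_left mult_zero_right)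
  note SU = S_T_in_SL2Z(1) U_mat_in_SL2Z
  have "S_mat ** S_mat = neg_one" by (rule mat2_eqI) (simp_all add: neg_one_def S_mat_def mat2_mult_nth)
  hence S2: "slash S_mat (\<kappa> S_mat) = - \<kappa> S_mat" using c[OF SU(1) SU(1)] k1 by (simp add: add_eq_0_iff2)
  have "U_mat ** (U_mat ** U_mat) = neg_one"
    by (rule mat2_eqI) (simp_all add: neg_one_def U_mat_def S_mat_def T_mat_def mat2_mult_nth)
  hence U3: "slash (U_mat ** U_mat) (\<kappa> U_mat) = - (slash U_mat (\<kappa> U_mat) + \<kappa> U_mat)"
    using c[OF SU(2) SL2Z_closed[OF SU(2) SU(2)]] c[OF SU(2) SU(2)] k1 by (simp add: add_eq_0_iff2)
  define h t where "h = const_poly (1 / 2)" and "t = const_poly (1 / 3)"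
  define x y where "x = \<kappa> U_mat" and "y = slash U_mat x"
  have xy: "x \<in> Sym n" "y \<in> Sym n" unfolding x_def y_def by (intro slash_in_Sym kS SU)+
  have sy: "slash U_mat y = - (y + x)"
    using U3 slash_compose[OF xy(1) SU(2) SU(2)] by (simp add: x_def y_def)
  define P where "P = - (h * \<kappa> S_mat)"
  define Q where "Q = - (t * (x + x + y))"
  have P: "P \<in> Sym n" unfolding P_def h_def by (intro Sym_uminus Sym_const_mult kS SU)
  have Q: "Q \<in> Sym n" unfolding Q_def t_def by (intro Sym_uminus Sym_const_mult Sym_add xy)
  have "slash S_mat P = h * \<kappa> S_mat"
    unfolding P_def h_def slash_uminus[OF Sym_const_mult[OF kS[OF SU(1)]] SU(1)] slash_const_mult[OF kS[OF SU(1)] SU(1)] S2 by simp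
  hence "slash S_mat P - P = h * \<kappa> S_mat + h * \<kappa> S_mat" by (simp add: P_def)
  hence PS: "\<kappa> S_mat = slash S_mat P - P" by (simp add: h_def const_poly_halves)
  note xxy = Sym_add[OF Sym_add[OF xy(1) xy(1)] xy(2)]
  have sQ: "slash U_mat Q = - (t * (y + y - (y + x)))"
    unfolding Q_def t_def slash_uminus[OF Sym_const_mult[OF xxy] SU(2)] slash_const_mult[OF xxy SU(2)]
      slash_add[OF Sym_add[OF xy(1) xy(1)] xy(2) SU(2)] slash_add[OF xy(1) xy(1) SU(2)] sy
    by (simp add: y_def)
  have "slash U_mat Q - Q = t * (x + x + y) - t * (y + y - (y + x))"
    unfolding sQ unfolding Q_def by (simp only: minus_diff_minus minus_diff_eq)
  also have "\<dots> = t * x + t * x + t * x" by (simp add: algebra_simps)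
  finally have "\<kappa> U_mat = slash U_mat Q - Q" by (simp only: t_def const_poly_thirds x_def)
  thus ?thesis using that[OF P PS Q] by blast
qed

lemma U_mat_fixes_rho: "moebius_action U_mat rho = rho"
proof -
  have U: "moebius_action U_mat z = - 1 / (z + 1)" for z
    by (simp add: U_mat_def S_mat_def T_mat_def moebius_action_def automorphy_factor_def mat2_mult_nth)
  have r: "rho * (rho + 1) = - 1" "rho + 1 \<noteq> 0"
    by (auto simp: rho_def complex_eq_iff cos_120 sin_120)
  thus ?thesis unfolding U by (metis nonzero_eq_divide_eq)
qed

text \<open>
  For odd \<open>n\<close> the central element \<open>-1\<close> acts by \<open>-1\<close>, and every cocycle is a coboundary. For even
  \<open>n\<close> a cocycle is determined by polynomials \<open>P\<close>, \<open>Q\<close> splitting it on the two generators of finite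
  order, and up to coboundaries by \<open>Q - P\<close>. For the cocycle of \<open>f\<close>, based at the fixed point of one generator, this
  difference is the integral of \<open>f(z)(z a - b)\<^sup>n\<close> between the two fixed points, which is arbitrary.
\<close>
theorem cocycle_is_period_cocycle:
  assumes k: "\<kappa> \<in> sym_cocycles n"
  obtains f v where "f \<in> forms_over UNIV (int n + 2)" "v \<in> Sym n"
    "\<And>\<gamma>. \<gamma> \<in> carrier SL2Z \<Longrightarrow> \<kappa> \<gamma> = period_cocycle n f \<i> \<gamma> + (slash \<gamma> v - v)"
proof (cases "even n")
  case True
  obtain P Q where PQ: "P \<in> Sym n" "\<kappa> S_mat = slash S_mat P - P" "Q \<in> Sym n" "\<kappa> U_mat = slash U_mat Q - Q"
    using sym_cocycle_split_on_generators[OF k True] by blast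
  define D where "D = Q - P"
  have D: "D \<in> Sym n" unfolding D_def by (intro Sym_diff PQ)
  define \<tau> where "\<tau> = (\<lambda>i. coeff (coeff D i) (n - i) / (bol_const n * of_nat (n choose i) * (- 1) ^ (n - i)))"
  obtain f where f: "f \<in> forms_over UNIV (int n + 2)"
    and per: "\<And>i. i \<le> n \<Longrightarrow> contour_integral (linepath \<i> rho) (\<lambda>z. f z * z ^ i) = \<tau> i"
    using periods_surjective[OF True, of \<tau>] by blast
  note fm = forms_overD[OF f]
  note fh = modular_functionsD(2)[OF fm]
  have i: "Im \<i> > 0" by simp
  obtain v where v: "v \<in> Sym n" "\<And>w. dehom v w = - bol_const n * (eichler f n \<i> w - eichler f n rho w)"
    and vc: "\<And>\<gamma>. \<gamma> \<in> carrier SL2Z \<Longrightarrow> period_cocycle n f \<i> \<gamma> - period_cocycle n f rho \<gamma> = slash \<gamma> v - v"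
    by (rule period_cocycle_base_point[OF fm Im_rho i]) blast
  have "v = D"
  proof (rule Sym_eqI[OF v(1) D])
    fix w
    have "dehom v w = (\<Sum>i\<le>n. bol_const n * (of_nat (n choose i) * (- w) ^ (n - i)) * (moment f i rho - moment f i \<i>))"
      unfolding v(2) eichler_def sum_subtractf[symmetric] sum_distrib_left
      by (intro sum.cong refl) (simp add: algebra_simps)
    also have "\<dots> = (\<Sum>i\<le>n. coeff (coeff D i) (n - i) * 1 ^ i * w ^ (n - i))"
    proof (intro sum.cong refl)
      fix i assume "i \<in> {..n}"
      hence i': "i \<le> n" by simp
      have m: "moment f i rho - moment f i \<i> = \<tau> i"
        using contour_integral_moment[OF fh i Im_rho, of 1 i] per[OF i'] by simp
      have b: "bol_const n \<noteq> 0" by (simp add: bol_const_def)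
      have "(of_nat (n choose i) :: complex) \<noteq> 0" using i' by simp
      thus "bol_const n * (of_nat (n choose i) * (- w) ^ (n - i)) * (moment f i rho - moment f i \<i>)
         = coeff (coeff D i) (n - i) * 1 ^ i * w ^ (n - i)"
        unfolding m \<tau>_def power_minus[of w] using b by (simp add: field_simps)
    qed
    also have "\<dots> = dehom D w" by (rule eval_ab_Sym[OF D, symmetric])
    finally show "dehom v w = dehom D w" .
  qed
  define \<mu> where "\<mu> = (\<lambda>g. (\<kappa> g - period_cocycle n f \<i> g) - (slash g P - P))"
  have m: "\<mu> \<in> sym_cocycles n"
    unfolding \<mu>_def by (intro sym_cocycles_diff k period_sym_cocycle fm i coboundary_sym_cocycle PQ)
  have "\<mu> S_mat = 0"
    using period_cocycle_fixed_point[OF fh i S_T_in_SL2Z(1)] by (simp add: \<mu>_def PQ)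
  moreover have "\<mu> U_mat = 0"
  proof -
    have "period_cocycle n f \<i> U_mat = slash U_mat (Q - P) - (Q - P)"
      using vc[OF U_mat_in_SL2Z] period_cocycle_fixed_point[OF fh Im_rho U_mat_in_SL2Z U_mat_fixes_rho] \<open>v = D\<close> by (simp add: D_def)
    thus ?thesis unfolding \<mu>_def PQ slash_diff[OF PQ(3,1) U_mat_in_SL2Z] by simp
  qed
  ultimately have "\<mu> \<gamma> = 0" if "\<gamma> \<in> carrier SL2Z" for \<gamma> using sym_cocycle_zero[OF m _ _ that] by blast
  hence "\<kappa> \<gamma> = period_cocycle n f \<i> \<gamma> + (slash \<gamma> P - P)" if "\<gamma> \<in> carrier SL2Z" for \<gamma>
    using that by (simp add: \<mu>_def algebra_simps)
  thus ?thesis using that[OF f PQ(1)] by blast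
next
  case False
  have kS: "\<kappa> g \<in> Sym n" if "g \<in> carrier SL2Z" for g using k that by (simp add: sym_cocycles_def)
  have c: "\<kappa> (g ** h) = slash h (\<kappa> g) + \<kappa> h" if "g \<in> carrier SL2Z" "h \<in> carrier SL2Z" for g h
    using k that by (simp add: sym_cocycles_def)
  define v where "v = - (const_poly (1 / 2) * \<kappa> neg_one)"
  note m1 = neg_one_in_SL2Z
  have v: "v \<in> Sym n" unfolding v_def by (intro Sym_uminus Sym_const_mult kS m1)
  have hz: "(\<lambda>z :: complex. 0 :: complex) holomorphic_on \<H>" by simp
  show ?thesis
  proof (rule that[OF forms_over_zero[of UNIV] v])
    fix \<gamma> assume g: "\<gamma> \<in> carrier SL2Z"
    have pc: "period_cocycle n (\<lambda>z. 0) \<i> \<gamma> = 0"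
      using period_cocycle_linear[OF hz hz _ g, of \<i> n "- 1"] by (simp add: const_poly_hom)
    have "neg_one ** \<gamma> = \<gamma> ** neg_one" by (rule mat2_eqI) (simp_all add: neg_one_def mat2_mult_nth)
    hence "slash \<gamma> (\<kappa> neg_one) + \<kappa> \<gamma> = - \<kappa> \<gamma> + \<kappa> neg_one"
      using c[OF m1 g] c[OF g m1] slash_neg_one[OF kS[OF g]] False by (simp add: const_poly_hom)
    hence "\<kappa> \<gamma> + \<kappa> \<gamma> = \<kappa> neg_one - slash \<gamma> (\<kappa> neg_one)" by (simp add: algebra_simps)
    hence "const_poly (1 / 2) * (\<kappa> neg_one - slash \<gamma> (\<kappa> neg_one)) = \<kappa> \<gamma>"
      using const_poly_halves[of "\<kappa> \<gamma>"] by (metis distrib_left)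
    moreover have "slash \<gamma> v - v = const_poly (1 / 2) * (\<kappa> neg_one - slash \<gamma> (\<kappa> neg_one))"
      unfolding v_def slash_uminus[OF Sym_const_mult[OF kS[OF m1]] g] slash_const_mult[OF kS[OF m1] g] by (simp add: right_diff_distrib)
    ultimately show "\<kappa> \<gamma> = period_cocycle n (\<lambda>z. 0) \<i> \<gamma> + (slash \<gamma> v - v)" unfolding pc by simp
  qed auto
qed

section \<open>Quotients of vector spaces\<close>

text \<open>
  The scalars act on the abelian group only by additive endomorphisms, as they do on the free abelian group
  of pairs, whose quotient by the bilinearity relations is a vector space.
\<close>
locale linear_subspace = abelian_group M for M :: "('r, 'm) module" (structure) +
  fixes U :: "'m set"
  assumes additive_subgroup: "subgroup U (add_monoid M)"
    and smult_closed: "x \<in> carrier M \<Longrightarrow> r \<odot> x \<in> carrier M"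
    and smult_add: "x \<in> carrier M \<Longrightarrow> y \<in> carrier M \<Longrightarrow> r \<odot> (x \<oplus> y) = r \<odot> x \<oplus> r \<odot> y"
    and smult_stable: "u \<in> U \<Longrightarrow> r \<odot> u \<in> U"
begin

lemma normal_subspace: "U \<lhd> add_monoid M"
  using additive_subgroup comm_group.subgroup_imp_normal[OF a_comm_group] by blast

lemma subspace_carrier: "u \<in> U \<Longrightarrow> u \<in> carrier M"
  using subgroup.subset[OF additive_subgroup] by auto

lemma coset_shift:
  assumes "u \<in> U" "x \<in> carrier M"
  shows "U +> (u \<oplus> x) = U +> x"
proof -
  have "u \<oplus> x \<in> U +> x" using assms(1) by (auto simp: a_r_coset_def r_coset_def)
  thus ?thesis
    using group.repr_independence[OF a_group, of "u \<oplus> x" U x] assms additive_subgroup by (simp add: a_r_coset_def)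
qed

lemma coset_eqD:
  assumes "U +> x = U +> y" "x \<in> carrier M" "y \<in> carrier M"
  obtains u where "u \<in> U" "x = u \<oplus> y"
proof -
  have "x \<in> U +> x"
    using group.rcos_self[OF a_group, of x U] assms(2) additive_subgroup by (simp add: a_r_coset_def)
  hence "x \<in> U +> y" unfolding assms(1) .
  thus ?thesis using that by (auto simp: a_r_coset_def r_coset_def)
qed

lemma quotient_FactGroup:
  "carrier (quotient_module M U) = carrier (add_monoid M Mod U)"
  "X \<oplus>\<^bsub>quotient_module M U\<^esub> Y = X \<otimes>\<^bsub>add_monoid M Mod U\<^esub> Y"
  by (simp_all add: quotient_module_def FactGroup_def A_RCOSETS_def set_add_def)

lemma quotient_carrier: "carrier (quotient_module M U) = (\<lambda>x. U +> x) ` carrier M"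
  by (auto simp: quotient_module_def A_RCOSETS_def RCOSETS_def a_r_coset_def)

lemma quotient_add:
  assumes "x \<in> carrier M" "y \<in> carrier M"
  shows "(U +> x) \<oplus>\<^bsub>quotient_module M U\<^esub> (U +> y) = U +> (x \<oplus> y)"
  using normal.rcos_sum[OF normal_subspace] assms by (simp add: quotient_module_def set_add_def a_r_coset_def)

lemma quotient_smult:
  assumes x: "x \<in> carrier M"
  shows "r \<odot>\<^bsub>quotient_module M U\<^esub> (U +> x) = U +> (r \<odot> x)"
proof -
  have "U +> (r \<odot> y) = U +> (r \<odot> x)" if y: "y \<in> U +> x" for y
  proof -
    obtain u where u: "u \<in> U" "y = u \<oplus> x" using y by (auto simp: a_r_coset_def r_coset_def)
    show ?thesis
      unfolding u(2) smult_add[OF subspace_carrier[OF u(1)] x] by (rule coset_shift[OF smult_stable[OF u(1)] smult_closed[OF x]])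
  qed
  moreover have "x \<in> U +> x"
    using group.rcos_self[OF a_group, of x U] x additive_subgroup by (simp add: a_r_coset_def)
  ultimately have "(\<Union>y\<in>U +> x. U +> (r \<odot> y)) = U +> (r \<odot> x)" by blast
  thus ?thesis by (simp add: quotient_module_def)
qed

lemma quotient_group: "group (add_monoid M Mod U)"
  by (rule normal.factorgroup_is_group[OF normal_subspace])

lemma quotient_hom: "(\<lambda>x. U +> x) \<in> hom (add_monoid M) (add_monoid M Mod U)"
  using normal.r_coset_hom_Mod[OF normal_subspace] by (simp add: a_r_coset_def)

end

text \<open>The first isomorphism theorem for \<open>x \<mapsto> L + \<psi> x\<close>.\<close>
lemma quotient_linear_iso:
  fixes A :: "('r, 'a) module" and B :: "('r, 'b) module"
  assumes K: "linear_subspace A K" and L: "linear_subspace B L"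
    and closed: "\<And>x. x \<in> carrier A \<Longrightarrow> \<psi> x \<in> carrier B"
    and add: "\<And>x y. x \<in> carrier A \<Longrightarrow> y \<in> carrier A \<Longrightarrow> \<psi> (x \<oplus>\<^bsub>A\<^esub> y) = \<psi> x \<oplus>\<^bsub>B\<^esub> \<psi> y"
    and smult: "\<And>r x. x \<in> carrier A \<Longrightarrow> \<psi> (r \<odot>\<^bsub>A\<^esub> x) = r \<odot>\<^bsub>B\<^esub> \<psi> x"
    and ker: "\<And>x. x \<in> carrier A \<Longrightarrow> \<psi> x \<in> L \<longleftrightarrow> x \<in> K"
    and onto: "\<And>y. y \<in> carrier B \<Longrightarrow> \<exists>x\<in>carrier A. \<exists>l\<in>L. y = l \<oplus>\<^bsub>B\<^esub> \<psi> x"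
  obtains \<Phi> where "\<Phi> \<in> linear_iso (quotient_module A K) (quotient_module B L)"
    "\<And>x. x \<in> carrier A \<Longrightarrow> \<Phi> (K +>\<^bsub>A\<^esub> x) = L +>\<^bsub>B\<^esub> \<psi> x"
proof -
  interpret A: linear_subspace A K by fact
  interpret B: linear_subspace B L by fact
  define h where "h = (\<lambda>x. L +>\<^bsub>B\<^esub> \<psi> x)"
  have "\<psi> \<in> hom (add_monoid A) (add_monoid B)" using closed add by (auto simp: hom_def)
  from hom_compose[OF this B.quotient_hom]
  have hom: "h \<in> hom (add_monoid A) (add_monoid B Mod L)" by (simp add: h_def o_def)
  interpret h: group_hom "add_monoid A" "add_monoid B Mod L" h
    by (intro group_hom.intro A.a_group B.quotient_group group_hom_axioms.intro hom)
  have "h x = L \<longleftrightarrow> x \<in> K" if x: "x \<in> carrier A" for x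
    using group.coset_join1[OF B.a_group, of L "\<psi> x"] group.coset_join2[OF B.a_group, of "\<psi> x" L] B.additive_subgroup ker[OF x] closed[OF x]
    by (auto simp: h_def a_r_coset_def)
  hence "kernel (add_monoid A) (add_monoid B Mod L) h = {x \<in> carrier A. x \<in> K}"
    by (auto simp: kernel_def FactGroup_def)
  hence kern: "kernel (add_monoid A) (add_monoid B Mod L) h = K" using A.subspace_carrier by auto
  have img: "h ` carrier (add_monoid A) = carrier (add_monoid B Mod L)"
  proof
    show "h ` carrier (add_monoid A) \<subseteq> carrier (add_monoid B Mod L)" using h.hom_closed by blast
    show "carrier (add_monoid B Mod L) \<subseteq> h ` carrier (add_monoid A)"
    proof
      fix Y assume "Y \<in> carrier (add_monoid B Mod L)"
      then obtain y where y: "y \<in> carrier B" "Y = L +>\<^bsub>B\<^esub> y" using B.quotient_carrier by (auto simp flip: B.quotient_FactGroup)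
      obtain x l where x: "x \<in> carrier A" "l \<in> L" "y = l \<oplus>\<^bsub>B\<^esub> \<psi> x" using onto[OF y(1)] by blast
      have "Y = h x" unfolding y(2) x(3) h_def by (rule B.coset_shift[OF x(2) closed[OF x(1)]])
      thus "Y \<in> h ` carrier (add_monoid A)" using x(1) by simp
    qed
  qed
  define \<Phi> where "\<Phi> = (\<lambda>X. the_elem (h ` X))"
  have val: "\<Phi> (K +>\<^bsub>A\<^esub> x) = L +>\<^bsub>B\<^esub> \<psi> x" if x: "x \<in> carrier A" for x
  proof -
    have "h y = h x" if y: "y \<in> K +>\<^bsub>A\<^esub> x" for y
    proof -
      obtain u where u: "u \<in> K" "y = u \<oplus>\<^bsub>A\<^esub> x" using y by (auto simp: a_r_coset_def r_coset_def)
      have uA: "u \<in> carrier A" using u(1) by (rule A.subspace_carrier)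
      show ?thesis unfolding u(2) h_def add[OF uA x] by (rule B.coset_shift[OF _ closed[OF x]]) (use ker[OF uA] u in simp)
    qed
    moreover have "x \<in> K +>\<^bsub>A\<^esub> x"
      using group.rcos_self[OF A.a_group, of x K] x A.additive_subgroup by (simp add: a_r_coset_def)
    ultimately have "h ` (K +>\<^bsub>A\<^esub> x) = {h x}" by blast
    thus ?thesis by (simp add: \<Phi>_def h_def)
  qed
  have iso: "\<Phi> \<in> iso (add_monoid (quotient_module A K)) (add_monoid (quotient_module B L))"
    using h.FactGroup_iso_set[OF img] unfolding kern \<Phi>_def[symmetric]
    by (simp add: iso_def hom_def A.quotient_FactGroup B.quotient_FactGroup)
  have "\<Phi> (r \<odot>\<^bsub>quotient_module A K\<^esub> X) = r \<odot>\<^bsub>quotient_module B L\<^esub> \<Phi> X"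
    if X: "X \<in> carrier (quotient_module A K)" for r X
  proof -
    obtain x where x: "x \<in> carrier A" "X = K +>\<^bsub>A\<^esub> x" using X by (auto simp: A.quotient_carrier)
    show ?thesis
      unfolding x(2) A.quotient_smult[OF x(1)] val[OF x(1)] val[OF A.smult_closed[OF x(1)]] B.quotient_smult[OF closed[OF x(1)]] smult[OF x(1)] ..
  qed
  hence "\<Phi> \<in> linear_iso (quotient_module A K) (quotient_module B L)" using iso by (simp add: linear_iso_def)
  thus ?thesis using that val by blast
qed

section \<open>Complexification of a quotient of rational function spaces\<close>

definition function_module :: "(complex \<Rightarrow> complex) set \<Rightarrow> (rat, complex \<Rightarrow> complex) module" where
  "function_module V = \<lparr>carrier = V, monoid.mult = undefined, monoid.one = undefined,
      ring.zero = (\<lambda>z. 0), ring.add = (\<lambda>f g z. f z + g z), module.smult = (\<lambda>r f z. of_rat r * f z)\<rparr>"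

lemma function_module_simps [simp]:
  "carrier (function_module V) = V" "\<zero>\<^bsub>function_module V\<^esub> = (\<lambda>z. 0)"
  "f \<oplus>\<^bsub>function_module V\<^esub> g = (\<lambda>z. f z + g z)" "r \<odot>\<^bsub>function_module V\<^esub> f = (\<lambda>z. of_rat r * f z)"
  by (simp_all add: function_module_def)

fun lin_comb :: "((complex \<Rightarrow> complex) \<times> complex) list \<Rightarrow> complex \<Rightarrow> complex" where
  "lin_comb [] = (\<lambda>z. 0)"
| "lin_comb ((f, c) # xs) = (\<lambda>z. lin_comb xs z + c * f z)"

lemma complex_span_lin_comb: "set xs \<subseteq> S \<times> UNIV \<Longrightarrow> lin_comb xs \<in> complex_span S"
  by (induction xs rule: lin_comb.induct) (auto intro: complex_span.intros)

lemma complex_span_imp_lin_comb: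
  assumes "f \<in> complex_span S"
  obtains xs where "set xs \<subseteq> S \<times> UNIV" "f = lin_comb xs"
proof -
  have "\<exists>xs. set xs \<subseteq> S \<times> UNIV \<and> f = lin_comb xs" using assms
  proof induction
    case zero
    show ?case by (rule exI[of _ "[]"]) simp
  next
    case (step f g c)
    then obtain xs where "set xs \<subseteq> S \<times> UNIV" "f = lin_comb xs" by blast
    thus ?case using step.hyps by (intro exI[of _ "(g, c) # xs"]) auto
  qed
  thus ?thesis using that by blast
qed

lemma lin_comb_append: "lin_comb (xs @ ys) z = lin_comb xs z + lin_comb ys z"
  by (induction xs rule: lin_comb.induct) auto

lemma lin_comb_scale: "lin_comb (map (\<lambda>(f, d). (f, c * d)) xs) z = c * lin_comb xs z"
  by (induction xs rule: lin_comb.induct) (auto simp: algebra_simps)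

lemma complex_span_cmult:
  assumes "f \<in> complex_span S" shows "(\<lambda>z. c * f z) \<in> complex_span S"
proof -
  obtain xs where xs: "set xs \<subseteq> S \<times> UNIV" "f = lin_comb xs" using assms by (rule complex_span_imp_lin_comb) blast
  have "(\<lambda>z. c * f z) = lin_comb (map (\<lambda>(f, d). (f, c * d)) xs)" unfolding xs(2) lin_comb_scale ..
  moreover have "set (map (\<lambda>(f, d). (f, c * d)) xs) \<subseteq> S \<times> UNIV" using xs(1) by auto
  ultimately show ?thesis using complex_span_lin_comb by metis
qed

lemma complex_span_diff:
  assumes "f \<in> complex_span S" "g \<in> complex_span S" shows "(\<lambda>z. f z - g z) \<in> complex_span S"
  using complex_span_add[OF assms(1) complex_span_cmult[OF assms(2), of "- 1"]] by simp

text \<open>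
  A rational space \<open>V\<close> of complex functions with a subspace \<open>U\<close>. The functionals say that rational
  linear relations are detected rationally, so that \<open>V \<otimes> \<complex>\<close> is the complex span of \<open>V\<close>; for modular
  forms they are the Fourier coefficients.
\<close>
locale rational_structure =
  fixes V U :: "(complex \<Rightarrow> complex) set"
  assumes V_zero: "(\<lambda>z. 0) \<in> V" and V_add: "f \<in> V \<Longrightarrow> g \<in> V \<Longrightarrow> (\<lambda>z. f z + g z) \<in> V"
    and V_scale: "f \<in> V \<Longrightarrow> (\<lambda>z. of_rat r * f z) \<in> V"
    and U_zero: "(\<lambda>z. 0) \<in> U" and U_add: "f \<in> U \<Longrightarrow> g \<in> U \<Longrightarrow> (\<lambda>z. f z + g z) \<in> U"
    and U_scale: "f \<in> U \<Longrightarrow> (\<lambda>z. of_rat r * f z) \<in> U" and U_subset: "U \<subseteq> V"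
    and rational_functional: "f \<in> V \<Longrightarrow> f \<noteq> (\<lambda>z. 0) \<Longrightarrow> \<exists>\<alpha> :: (complex \<Rightarrow> complex) \<Rightarrow> complex. \<alpha> f \<noteq> 0 \<and>
       (\<forall>g\<in>V. \<alpha> g \<in> \<rat>) \<and> (\<forall>g\<in>complex_span V. \<forall>h\<in>V. \<forall>c. \<alpha> (\<lambda>z. g z + c * h z) = \<alpha> g + c * \<alpha> h)"
begin

lemma abelian_group_V: "abelian_group (function_module V)"
proof (rule abelian_groupI)
  fix f assume "f \<in> carrier (function_module V)"
  thus "\<exists>g\<in>carrier (function_module V). g \<oplus>\<^bsub>function_module V\<^esub> f = \<zero>\<^bsub>function_module V\<^esub>"
    using V_scale[of f "- 1"] by (intro bexI[of _ "\<lambda>z. of_rat (- 1) * f z"]) auto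
qed (auto simp: V_zero V_add add.assoc add.commute)

lemma V_diff: "f \<in> V \<Longrightarrow> g \<in> V \<Longrightarrow> (\<lambda>z. f z - g z) \<in> V"
  using V_add[of f "\<lambda>z. of_rat (- 1) * g z"] V_scale[of g "- 1"] by simp

lemma linear_subspace_U: "linear_subspace (function_module V) U"
proof (intro linear_subspace.intro abelian_group_V linear_subspace_axioms.intro)
  interpret abelian_group "function_module V" by (rule abelian_group_V)
  show "subgroup U (add_monoid (function_module V))"
  proof (rule group.subgroupI[OF a_group])
    fix f assume f: "f \<in> U"
    have "inv\<^bsub>add_monoid (function_module V)\<^esub> f = (\<lambda>z. of_rat (- 1) * f z)"
      using f U_subset V_scale[of f "- 1"] by (intro group.inv_equality[OF a_group]) auto
    thus "inv\<^bsub>add_monoid (function_module V)\<^esub> f \<in> U" using U_scale[OF f, of "- 1"] by simp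
  qed (use U_subset U_zero U_add in auto)
qed (auto simp: V_scale U_scale distrib_left)

sublocale Q: linear_subspace "function_module V" U
  by (rule linear_subspace_U)

abbreviation "W \<equiv> quotient_module (function_module V) U"
abbreviation "cls f \<equiv> U +>\<^bsub>function_module V\<^esub> f"

definition rep :: "(complex \<Rightarrow> complex) set \<Rightarrow> complex \<Rightarrow> complex" where
  "rep w = (SOME f. f \<in> V \<and> w = cls f)"

lemma rep: "w \<in> carrier W \<Longrightarrow> rep w \<in> V" "w \<in> carrier W \<Longrightarrow> cls (rep w) = w"
proof -
  assume "w \<in> carrier W"
  then obtain f where "f \<in> V \<and> w = cls f" by (auto simp: Q.quotient_carrier)
  hence "rep w \<in> V \<and> w = cls (rep w)" unfolding rep_def by (rule someI[of "\<lambda>f. f \<in> V \<and> w = cls f"])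
  thus "rep w \<in> V" "cls (rep w) = w" by auto
qed

lemma cls_in_W: "f \<in> V \<Longrightarrow> cls f \<in> carrier W"
  by (simp add: Q.quotient_carrier)

lemma cls_eqD:
  assumes "cls f = cls g" "f \<in> V" "g \<in> V"
  shows "(\<lambda>z. f z - g z) \<in> U"
proof -
  obtain u where "u \<in> U" "f = u \<oplus>\<^bsub>function_module V\<^esub> g" using Q.coset_eqD[OF assms(1)] assms(2,3) by auto
  thus ?thesis by simp
qed

lemma cls_U: "u \<in> U \<Longrightarrow> cls u = cls (\<lambda>z. 0)"
  using Q.coset_shift[of u "\<lambda>z. 0"] V_zero by simp

subsection \<open>The relations of the tensor product\<close>

abbreviation "A \<equiv> free_on_pairs W"
abbreviation "K \<equiv> tensor_kernel W"

lemma A_simps [simp]: "p \<oplus>\<^bsub>A\<^esub> q = p + q" "\<zero>\<^bsub>A\<^esub> = 0"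
  "c \<odot>\<^bsub>A\<^esub> p = frag_extend (\<lambda>(w, d). frag_of (w, c * d)) p"
  by (simp_all add: free_on_pairs_def)

lemma A_carrier: "p \<in> carrier A \<longleftrightarrow> Poly_Mapping.keys p \<subseteq> carrier W \<times> UNIV"
  by (simp add: free_on_pairs_def free_Abelian_group_def)

abbreviation "F \<equiv> free_Abelian_group (carrier W \<times> (UNIV :: complex set))"

lemma F_carrier: "carrier F = carrier A"
  by (simp add: free_on_pairs_def)

lemma abelian_group_A: "abelian_group A"
proof (rule abelian_groupI)
  fix p assume "p \<in> carrier A"
  thus "\<exists>q\<in>carrier A. q \<oplus>\<^bsub>A\<^esub> p = \<zero>\<^bsub>A\<^esub>" by (intro bexI[of _ "- p"]) (auto simp: A_carrier)
next
  fix p q assume "p \<in> carrier A" "q \<in> carrier A"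
  thus "p \<oplus>\<^bsub>A\<^esub> q \<in> carrier A" using keys_add[of p q] by (auto simp: A_carrier)
qed (auto simp: A_carrier add.assoc add.commute)

lemma A_diff: "p \<in> carrier A \<Longrightarrow> q \<in> carrier A \<Longrightarrow> p - q \<in> carrier A"
  using keys_diff[of p q] by (auto simp: A_carrier)

lemma W_closed:
  assumes "x \<in> carrier W"
  shows "y \<in> carrier W \<Longrightarrow> x \<oplus>\<^bsub>W\<^esub> y \<in> carrier W" "r \<odot>\<^bsub>W\<^esub> x \<in> carrier W"
proof -
  obtain f where f: "f \<in> V" "x = cls f" using assms by (auto simp: Q.quotient_carrier)
  show "r \<odot>\<^bsub>W\<^esub> x \<in> carrier W" using Q.quotient_smult[of f r] cls_in_W[OF V_scale] f by simp
  show "x \<oplus>\<^bsub>W\<^esub> y \<in> carrier W" if y: "y \<in> carrier W"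
  proof -
    obtain g where g: "g \<in> V" "y = cls g" using y by (auto simp: Q.quotient_carrier)
    show ?thesis using Q.quotient_add[of f g] cls_in_W[OF V_add] f g by simp
  qed
qed

lemma relations_subset: "tensor_relations W \<subseteq> carrier A"
proof
  fix p assume "p \<in> tensor_relations W"
  thus "p \<in> carrier A"
    unfolding tensor_relations_def by (auto intro!: A_diff simp: A_carrier[of "frag_of _"] W_closed)
qed

lemma K_subgroup: "subgroup K F"
  unfolding tensor_kernel_def
  by (intro group.generate_is_subgroup[OF group_free_Abelian_group]) (use relations_subset in \<open>simp only: F_carrier\<close>)

lemma K_subset: "p \<in> K \<Longrightarrow> p \<in> carrier A"
  using subgroup.subset[OF K_subgroup] F_carrier by auto

lemma K_zero: "0 \<in> K" using subgroup.one_closed[OF K_subgroup] by simp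

lemma K_add: "p \<in> K \<Longrightarrow> q \<in> K \<Longrightarrow> p + q \<in> K" using subgroup.m_closed[OF K_subgroup] by simp

lemma F_inv: "p \<in> carrier A \<Longrightarrow> inv\<^bsub>F\<^esub> p = - p"
  by (intro group.inv_equality[OF group_free_Abelian_group]) (auto simp: A_carrier)

lemma A_inv: "p \<in> carrier A \<Longrightarrow> inv\<^bsub>add_monoid A\<^esub> p = - p"
  by (intro group.inv_equality[OF abelian_group.a_group[OF abelian_group_A]]) (auto simp: A_carrier)

lemma K_uminus: "p \<in> K \<Longrightarrow> - p \<in> K"
  using subgroup.m_inv_closed[OF K_subgroup] F_inv[OF K_subset] by simp

lemma K_diff: "p \<in> K \<Longrightarrow> q \<in> K \<Longrightarrow> p - q \<in> K" using K_add[of p "- q"] K_uminus by simp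

lemma K_additive_subgroup: "subgroup K (add_monoid A)"
  by (rule group.subgroupI[OF abelian_group.a_group[OF abelian_group_A]])
     (use K_subset K_zero K_add K_uminus A_inv in auto)

lemma relation_in_K: "p \<in> tensor_relations W \<Longrightarrow> p \<in> K"
  by (simp add: tensor_kernel_def generate.incl)

lemma K_relations:
  assumes f: "f \<in> V"
  shows K_add_left: "g \<in> V \<Longrightarrow> frag_of (cls (\<lambda>z. f z + g z), c) - frag_of (cls f, c) - frag_of (cls g, c) \<in> K"
    and K_add_right: "frag_of (cls f, c + d) - frag_of (cls f, c) - frag_of (cls f, d) \<in> K"
    and K_smult: "frag_of (cls (\<lambda>z. of_rat r * f z), c) - frag_of (cls f, of_rat r * c) \<in> K"
    and K_zero_right: "frag_of (cls f, 0) \<in> K"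
    and K_neg_right: "frag_of (cls f, - c) + frag_of (cls f, c) \<in> K"
proof -
  show "frag_of (cls (\<lambda>z. f z + g z), c) - frag_of (cls f, c) - frag_of (cls g, c) \<in> K" if "g \<in> V"
  proof (rule relation_in_K)
    have eq: "cls (\<lambda>z. f z + g z) = cls f \<oplus>\<^bsub>W\<^esub> cls g" using Q.quotient_add[of f g] f that by simp
    show "frag_of (cls (\<lambda>z. f z + g z), c) - frag_of (cls f, c) - frag_of (cls g, c) \<in> tensor_relations W"
      unfolding eq tensor_relations_def using cls_in_W[OF f] cls_in_W[OF that] by blast
  qed
  show ar: "frag_of (cls f, c + d) - frag_of (cls f, c) - frag_of (cls f, d) \<in> K" for c d
    using cls_in_W[OF f] by (intro relation_in_K) (unfold tensor_relations_def, blast)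
  show "frag_of (cls (\<lambda>z. of_rat r * f z), c) - frag_of (cls f, of_rat r * c) \<in> K"
  proof (rule relation_in_K)
    have eq: "cls (\<lambda>z. of_rat r * f z) = r \<odot>\<^bsub>W\<^esub> cls f" using Q.quotient_smult[of f r] f by simp
    show "frag_of (cls (\<lambda>z. of_rat r * f z), c) - frag_of (cls f, of_rat r * c) \<in> tensor_relations W"
      unfolding eq tensor_relations_def using cls_in_W[OF f] by blast
  qed
  show z: "frag_of (cls f, 0) \<in> K" using K_uminus[OF ar[of 0 0]] by simp
  show "frag_of (cls f, - c) + frag_of (cls f, c) \<in> K" using K_diff[OF z ar[of "- c" c]] by (simp add: add.commute)
qed

lemma K_zero_left: "frag_of (cls (\<lambda>z. 0), c) \<in> K"
  using K_uminus[OF K_add_left[OF V_zero V_zero, of c]] by simp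

subsection \<open>Evaluation of tensors\<close>

fun formal_comb :: "((complex \<Rightarrow> complex) \<times> complex) list \<Rightarrow> (complex \<Rightarrow> complex) set \<times> complex \<Rightarrow>\<^sub>0 int" where
  "formal_comb [] = 0"
| "formal_comb ((f, c) # xs) = formal_comb xs + frag_of (cls f, c)"

lemma formal_comb_append: "formal_comb (xs @ ys) = formal_comb xs + formal_comb ys"
  by (induction xs rule: formal_comb.induct) (auto simp: algebra_simps)

lemma formal_comb_in_A: "set xs \<subseteq> V \<times> UNIV \<Longrightarrow> formal_comb xs \<in> carrier A"
proof (induction xs rule: formal_comb.induct)
  case (2 f c xs)
  have "formal_comb xs \<in> carrier A" "frag_of (cls f, c) \<in> carrier A"
    using 2 cls_in_W[of f] by (auto simp: A_carrier)
  thus ?case using keys_add[of "formal_comb xs" "frag_of (cls f, c)"] by (auto simp: A_carrier)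
qed (simp add: A_carrier)

text \<open>
  A vanishing combination of rational functions is trivial in the tensor product, by induction
  on its length: a rational functional that does not vanish on the first function \<open>f\<close> expresses the coefficient of \<open>f\<close>
  rationally by the other coefficients, and \<open>f\<close> is absorbed into the other functions.
\<close>
lemma vanishing_combination_in_K:
  assumes "set xs \<subseteq> V \<times> UNIV" "lin_comb xs = (\<lambda>z. 0)"
  shows "formal_comb xs \<in> K"
  using assms
proof (induction "length xs" arbitrary: xs)
  case 0
  thus ?case by (simp add: K_zero)
next
  case (Suc N)
  then obtain f c ys where xs: "xs = (f, c) # ys" by (cases xs) auto
  have f: "f \<in> V" and ys: "set ys \<subseteq> V \<times> UNIV" using Suc.prems xs by auto
  show ?case
  proof (cases "f = (\<lambda>z. 0)")
    case True
    have "formal_comb ys \<in> K" using Suc.hyps(1)[of ys] Suc.hyps(2) Suc.prems xs True ys by simp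
    thus ?thesis using K_add K_zero_left[of c] by (simp add: xs True)
  next
    case False
    obtain \<alpha> where a: "\<alpha> f \<noteq> 0" "\<And>g. g \<in> V \<Longrightarrow> \<alpha> g \<in> \<rat>"
      "\<And>g h c. g \<in> complex_span V \<Longrightarrow> h \<in> V \<Longrightarrow> \<alpha> (\<lambda>z. g z + c * h z) = \<alpha> g + c * \<alpha> h"
      using rational_functional[OF f False] by metis
    have a0: "\<alpha> (\<lambda>z. 0) = 0" using a(3)[OF complex_span.zero V_zero, of "- 1"] by simp
    have "\<exists>r. of_rat r = \<alpha> g / \<alpha> f" if "g \<in> V" for g
      using a(2)[OF that] a(2)[OF f] by (metis Rats_divide Rats_cases)
    then obtain q where q: "\<And>g. g \<in> V \<Longrightarrow> of_rat (q g) = \<alpha> g / \<alpha> f" by metis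
    \<comment> \<open>The step of the elimination: \<open>g\<close> is replaced by \<open>g - q f\<close>, on which \<open>\<alpha>\<close> vanishes.\<close>
    define red where "red = map (\<lambda>(g, d). (\<lambda>z. g z - of_rat (q g) * f z, d :: complex))"
    define s where "s = (\<lambda>ys. \<Sum>(g, d)\<leftarrow>ys. of_rat (q g) * d :: complex)"
    have red: "set (red ys) \<subseteq> V \<times> UNIV \<and> (\<forall>z. lin_comb (red ys) z = lin_comb ys z - s ys * f z) \<and>
        formal_comb ys - formal_comb (red ys) - frag_of (cls f, s ys) \<in> K \<and> \<alpha> (lin_comb ys) = s ys * \<alpha> f"
      if "set ys \<subseteq> V \<times> UNIV" for ys using that
    proof (induction ys rule: lin_comb.induct)
      case 1
      show ?case using K_uminus[OF K_zero_right[OF f]] by (simp add: red_def s_def a0)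
    next
      case (2 g d ys)
      hence g: "g \<in> V" and ys: "set ys \<subseteq> V \<times> UNIV" by auto
      note IH = 2(1)[OF ys]
      define r where "r = q g"
      define g' where "g' = (\<lambda>z. g z - of_rat r * f z)"
      have rf: "(\<lambda>z. of_rat r * f z) \<in> V" by (rule V_scale[OF f])
      have g': "g' \<in> V" unfolding g'_def by (rule V_diff[OF g rf])
      have "(\<lambda>z. g' z + of_rat r * f z) = g" by (simp add: g'_def)
      hence k1: "frag_of (cls g, d) - frag_of (cls g', d) - frag_of (cls (\<lambda>z. of_rat r * f z), d) \<in> K"
        using K_add_left[OF g' rf, of d] by simp
      have k2: "frag_of (cls (\<lambda>z. of_rat r * f z), d) - frag_of (cls f, of_rat r * d) \<in> K" by (rule K_smult[OF f])
      have sy: "s ((g, d) # ys) = of_rat r * d + s ys" by (simp add: s_def r_def)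
      have ry: "red ((g, d) # ys) = (g', d) # red ys" by (simp add: red_def g'_def r_def)
      have k3: "frag_of (cls f, of_rat r * d + s ys) - frag_of (cls f, of_rat r * d) - frag_of (cls f, s ys) \<in> K" by (rule K_add_right[OF f])
      have k4: "formal_comb ys - formal_comb (red ys) - frag_of (cls f, s ys) \<in> K" using IH by blast
      have "formal_comb ((g, d) # ys) - formal_comb (red ((g, d) # ys)) - frag_of (cls f, s ((g, d) # ys))
        = (frag_of (cls g, d) - frag_of (cls g', d) - frag_of (cls (\<lambda>z. of_rat r * f z), d))
          + (frag_of (cls (\<lambda>z. of_rat r * f z), d) - frag_of (cls f, of_rat r * d))
          + (formal_comb ys - formal_comb (red ys) - frag_of (cls f, s ys))
          - (frag_of (cls f, of_rat r * d + s ys) - frag_of (cls f, of_rat r * d) - frag_of (cls f, s ys))"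
        unfolding sy ry formal_comb.simps by simp
      hence kk: "formal_comb ((g, d) # ys) - formal_comb (red ((g, d) # ys)) - frag_of (cls f, s ((g, d) # ys)) \<in> K"
        using K_diff[OF K_add[OF K_add[OF k1 k2] k4] k3] by (simp only:)
      have "\<alpha> (lin_comb ((g, d) # ys)) = s ys * \<alpha> f + d * \<alpha> g"
        using a(3)[OF complex_span_lin_comb[OF ys] g, of d] IH by simp
      also have "d * \<alpha> g = of_rat r * d * \<alpha> f" using q[OF g] a(1) by (simp add: r_def)
      finally have aa: "\<alpha> (lin_comb ((g, d) # ys)) = s ((g, d) # ys) * \<alpha> f" by (simp add: sy algebra_simps)
      have "set (red ((g, d) # ys)) \<subseteq> V \<times> UNIV" using IH g' by (simp add: ry)
      moreover have "lin_comb (red ((g, d) # ys)) z = lin_comb ((g, d) # ys) z - s ((g, d) # ys) * f z" for z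
        using IH by (simp add: ry sy) (simp add: g'_def algebra_simps)
      ultimately show ?case using kk aa by blast
    qed
    note R = red[OF ys]
    have "\<alpha> (lin_comb xs) = s ys * \<alpha> f + c * \<alpha> f"
      unfolding xs lin_comb.simps using a(3)[OF complex_span_lin_comb[OF ys] f, of c] R by simp
    hence "(s ys + c) * \<alpha> f = 0" using Suc.prems(2) a0 by (simp add: distrib_right)
    hence "s ys + c = 0" using a(1) by simp
    hence c: "c = - s ys" by (metis add.commute add_eq_0_iff)
    have "lin_comb (red ys) z = lin_comb xs z" for z using R by (simp add: xs c)
    hence "lin_comb (red ys) = (\<lambda>z. 0)" using Suc.prems(2) by auto
    moreover have "length (red ys) = N" using Suc.hyps(2) by (simp add: xs red_def)
    ultimately have "formal_comb (red ys) \<in> K" using Suc.hyps(1)[of "red ys"] R by simp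
    moreover have "formal_comb xs = (formal_comb ys - formal_comb (red ys) - frag_of (cls f, s ys)) + formal_comb (red ys)
       + (frag_of (cls f, - s ys) + frag_of (cls f, s ys))"
      by (simp add: xs c)
    ultimately show ?thesis using K_add[OF K_add K_neg_right[OF f, of "s ys"]] R by metis
  qed
qed

text \<open>
  The linear extension of \<open>(w, c) \<mapsto> c f\<close>, where \<open>f\<close> is a chosen representative of the coset \<open>w\<close>. The choice
  affects the value only by elements of the complex span of \<open>U\<close>.
\<close>
definition eval_tensor :: "((complex \<Rightarrow> complex) set \<times> complex \<Rightarrow>\<^sub>0 int) \<Rightarrow> complex \<Rightarrow> complex" where
  "eval_tensor p z = (\<Sum>k\<in>Poly_Mapping.keys p. of_int (Poly_Mapping.lookup p k) * (snd k * rep (fst k) z))"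

lemma eval_tensor_superset:
  assumes "finite I" "Poly_Mapping.keys p \<subseteq> I"
  shows "eval_tensor p z = (\<Sum>k\<in>I. of_int (Poly_Mapping.lookup p k) * (snd k * rep (fst k) z))"
  unfolding eval_tensor_def using assms by (intro sum.mono_neutral_left) (auto simp: in_keys_iff)

lemma eval_tensor_add: "eval_tensor (p + q) z = eval_tensor p z + eval_tensor q z"
  and eval_tensor_diff: "eval_tensor (p - q) z = eval_tensor p z - eval_tensor q z"
proof -
  let ?I = "Poly_Mapping.keys p \<union> Poly_Mapping.keys q"
  have "eval_tensor r z = (\<Sum>k\<in>?I. of_int (Poly_Mapping.lookup r k) * (snd k * rep (fst k) z))"
    if "Poly_Mapping.keys r \<subseteq> ?I" for r using that by (intro eval_tensor_superset) auto
  note e = this[OF keys_add] this[OF keys_diff] this[OF Un_upper1] this[OF Un_upper2]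
  show "eval_tensor (p + q) z = eval_tensor p z + eval_tensor q z"
    unfolding e by (simp add: lookup_add distrib_right sum.distrib)
  show "eval_tensor (p - q) z = eval_tensor p z - eval_tensor q z"
    unfolding e by (simp add: lookup_minus left_diff_distrib sum_subtractf)
qed

lemma eval_tensor_zero: "eval_tensor 0 z = 0" by (simp add: eval_tensor_def)

lemma eval_tensor_frag_of: "eval_tensor (frag_of (w, c)) z = c * rep w z"
  by (simp add: eval_tensor_def)

lemma A_smult_diff: "c \<odot>\<^bsub>A\<^esub> (p - q) = c \<odot>\<^bsub>A\<^esub> p - c \<odot>\<^bsub>A\<^esub> q"
  by (simp add: frag_extend_diff)

lemma eval_tensor_smult: "eval_tensor (c \<odot>\<^bsub>A\<^esub> p) z = c * eval_tensor p z"
proof (induction p rule: frag_induction[of _ UNIV, OF subset_UNIV])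
  case (2 x)
  show ?case by (cases x) (simp add: eval_tensor_frag_of)
next
  case (3 a b)
  thus ?case by (simp only: A_smult_diff eval_tensor_diff right_diff_distrib)
qed (simp add: eval_tensor_zero)

text \<open>The representatives chosen in the evaluation serve for the combination as well.\<close>
lemma tensor_normal_form:
  assumes "p \<in> carrier A"
  obtains xs where "set xs \<subseteq> V \<times> UNIV" "p - formal_comb xs \<in> K" "eval_tensor p = lin_comb xs"
proof -
  have "\<exists>xs. set xs \<subseteq> V \<times> UNIV \<and> p - formal_comb xs \<in> K \<and> (\<forall>z. eval_tensor p z = lin_comb xs z)"
    using assms[unfolded A_carrier]
  proof (induction p rule: frag_induction)
    case zero
    show ?case by (rule exI[of _ "[]"]) (simp add: K_zero eval_tensor_zero)
  next
    case (one x)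
    obtain w c where x: "x = (w, c)" "w \<in> carrier W" using one by auto
    show ?case by (rule exI[of _ "[(rep w, c)]"]) (simp add: x rep K_zero eval_tensor_frag_of)
  next
    case (diff a b)
    obtain xs ys where xs: "set xs \<subseteq> V \<times> UNIV" "a - formal_comb xs \<in> K" "\<And>z. eval_tensor a z = lin_comb xs z"
      and ys: "set ys \<subseteq> V \<times> UNIV" "b - formal_comb ys \<in> K" "\<And>z. eval_tensor b z = lin_comb ys z" using diff by blast
    define ys' where "ys' = map (\<lambda>(f, d). (f, - 1 * d :: complex)) ys"
    have "formal_comb (map (\<lambda>(f, d). (f, - 1 * d :: complex)) ys) + formal_comb ys \<in> K" if "set ys \<subseteq> V \<times> UNIV" for ys
      using that
    proof (induction ys rule: formal_comb.induct)
      case (2 f c ys)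
      hence "formal_comb (map (\<lambda>(f, d). (f, - 1 * d :: complex)) ys) + formal_comb ys \<in> K" "f \<in> V" by auto
      from K_add[OF this(1) K_neg_right[OF this(2), of c]] show ?case by (simp add: add_ac)
    qed (simp add: K_zero)
    from this[OF ys(1)] have n: "formal_comb ys' + formal_comb ys \<in> K" by (simp add: ys'_def)
    have "a - b - formal_comb (xs @ ys') = (a - formal_comb xs) - (b - formal_comb ys) - (formal_comb ys' + formal_comb ys)"
      by (simp add: formal_comb_append)
    hence "a - b - formal_comb (xs @ ys') \<in> K" using K_diff[OF K_diff[OF xs(2) ys(2)] n] by (simp only:)
    moreover have "eval_tensor (a - b) z = lin_comb (xs @ ys') z" for z
      unfolding eval_tensor_diff lin_comb_append ys'_def lin_comb_scale xs(3) ys(3) by simp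
    moreover have "set (xs @ ys') \<subseteq> V \<times> UNIV" using xs ys by (auto simp: ys'_def)
    ultimately show ?case by blast
  qed
  thus ?thesis using that by blast
qed

lemma eval_tensor_in_span: "p \<in> carrier A \<Longrightarrow> eval_tensor p \<in> complex_span V"
  by (metis tensor_normal_form complex_span_lin_comb)

lemma eval_tensor_relations:
  assumes "p \<in> tensor_relations W"
  shows "eval_tensor p \<in> complex_span U"
proof -
  have sp: "(\<lambda>z. c * u z) \<in> complex_span U" if "u \<in> U" for c u by (rule complex_span_base[OF that])
  from assms consider x y c where "p = frag_of (x \<oplus>\<^bsub>W\<^esub> y, c) - frag_of (x, c) - frag_of (y, c)" "x \<in> carrier W" "y \<in> carrier W"
    | x c d where "p = frag_of (x, c + d) - frag_of (x, c) - frag_of (x, d)"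
    | r x c where "p = frag_of (r \<odot>\<^bsub>W\<^esub> x, c) - frag_of (x, of_rat r * c)" "x \<in> carrier W"
    unfolding tensor_relations_def by blast
  thus ?thesis
  proof cases
    case (1 x y c)
    define s where "s = (\<lambda>z. rep x z + rep y z)"
    have s: "s \<in> V" unfolding s_def by (intro V_add rep 1)
    have xy: "x \<oplus>\<^bsub>W\<^esub> y = cls s" using Q.quotient_add[of "rep x" "rep y"] rep[OF 1(2)] rep[OF 1(3)] by (simp add: s_def)
    have "(\<lambda>z. rep (cls s) z - s z) \<in> U" using rep[OF cls_in_W[OF s]] s by (intro cls_eqD) auto
    from sp[OF this, of c] show ?thesis
      unfolding 1(1) xy eval_tensor_diff[abs_def] eval_tensor_frag_of by (simp add: s_def algebra_simps)
  next
    case (2 x c d)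
    have "eval_tensor p = (\<lambda>z. 0)" unfolding 2 by (simp add: fun_eq_iff eval_tensor_diff eval_tensor_add eval_tensor_frag_of algebra_simps)
    thus ?thesis using complex_span.zero by simp
  next
    case (3 r x c)
    define s where "s = (\<lambda>z. of_rat r * rep x z)"
    have s: "s \<in> V" unfolding s_def by (intro V_scale rep 3)
    have rx: "r \<odot>\<^bsub>W\<^esub> x = cls s" using Q.quotient_smult[of "rep x" r] rep[OF 3(2)] by (simp add: s_def)
    have "(\<lambda>z. rep (cls s) z - s z) \<in> U" using rep[OF cls_in_W[OF s]] s by (intro cls_eqD) auto
    from sp[OF this, of c] show ?thesis
      unfolding 3(1) rx eval_tensor_diff[abs_def] eval_tensor_frag_of by (simp add: s_def algebra_simps)
  qed
qed

text \<open>
  If the value is a complex combination of elements of \<open>U\<close>, subtracting this combination, which is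
  trivial in the tensor product, leads to a vanishing combination of elements of \<open>V\<close>. Conversely each relation
  evaluates to a multiple of an element of \<open>U\<close>.
\<close>
theorem eval_tensor_kernel:
  assumes p: "p \<in> carrier A"
  shows "eval_tensor p \<in> complex_span U \<longleftrightarrow> p \<in> K"
proof
  assume "p \<in> K"
  let ?H = "{p \<in> carrier A. eval_tensor p \<in> complex_span U}"
  have e: "eval_tensor (p - q) = (\<lambda>z. eval_tensor p z - eval_tensor q z)" "eval_tensor (p + q) = (\<lambda>z. eval_tensor p z + eval_tensor q z)"
    "eval_tensor 0 = (\<lambda>z. 0)" for p q
    by (auto simp: eval_tensor_diff eval_tensor_add eval_tensor_zero)
  have H0: "0 \<in> ?H" using complex_span.zero[of U] by (simp add: e A_carrier)
  have Hd: "p - q \<in> ?H" if "p \<in> ?H" "q \<in> ?H" for p q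
    using that A_diff[of p q] unfolding mem_Collect_eq e by (auto intro: complex_span_diff)
  have "subgroup ?H F"
  proof (rule group.subgroupI[OF group_free_Abelian_group])
    show "inv\<^bsub>F\<^esub> q \<in> ?H" if "q \<in> ?H" for q using Hd[OF H0 that] F_inv[of q] that by simp
    show "q \<otimes>\<^bsub>F\<^esub> r \<in> ?H" if "q \<in> ?H" "r \<in> ?H" for q r using Hd[OF that(1) Hd[OF H0 that(2)]] by simp
  qed (use H0 F_carrier in blast)+
  moreover have "tensor_relations W \<subseteq> ?H" using relations_subset eval_tensor_relations by auto
  ultimately have "K \<subseteq> ?H"
    unfolding tensor_kernel_def by (intro group.generate_subgroup_incl[OF group_free_Abelian_group])
  thus "eval_tensor p \<in> complex_span U" using \<open>p \<in> K\<close> by blast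
next
  assume "eval_tensor p \<in> complex_span U"
  then obtain us where us: "set us \<subseteq> U \<times> UNIV" "eval_tensor p = lin_comb us" by (rule complex_span_imp_lin_comb) blast
  obtain xs where xs: "set xs \<subseteq> V \<times> UNIV" "p - formal_comb xs \<in> K" "eval_tensor p = lin_comb xs"
    using tensor_normal_form[OF p] by blast
  define us' where "us' = map (\<lambda>(f, d). (f, - 1 * d :: complex)) us"
  have us': "set us' \<subseteq> U \<times> UNIV" using us(1) by (auto simp: us'_def)
  have "formal_comb us \<in> K" if "set us \<subseteq> U \<times> UNIV" for us using that
    by (induction us rule: formal_comb.induct) (auto intro: K_zero K_add simp: cls_U K_zero_left)
  hence k: "formal_comb us' \<in> K" using us' by blast
  have "set (xs @ us') \<subseteq> V \<times> UNIV" using xs us' U_subset by auto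
  moreover have "lin_comb (xs @ us') = (\<lambda>z. 0)"
    unfolding lin_comb_append[abs_def] us'_def lin_comb_scale us(2)[symmetric] xs(3)[symmetric] by simp
  ultimately have "formal_comb (xs @ us') \<in> K" by (rule vanishing_combination_in_K)
  from K_diff[OF this k] have "formal_comb xs \<in> K" by (simp add: formal_comb_append)
  from K_add[OF xs(2) this] show "p \<in> K" by simp
qed

lemma eval_formal_comb:
  assumes "set xs \<subseteq> V \<times> UNIV"
  shows "(\<lambda>z. lin_comb xs z - eval_tensor (formal_comb xs) z) \<in> complex_span U"
  using assms
proof (induction xs rule: formal_comb.induct)
  case 1
  show ?case using complex_span.zero by (simp add: eval_tensor_zero)
next
  case (2 f c xs)
  hence f: "f \<in> V" and IH: "(\<lambda>z. lin_comb xs z - eval_tensor (formal_comb xs) z) \<in> complex_span U" by auto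
  have "(\<lambda>z. f z - rep (cls f) z) \<in> U" using rep[OF cls_in_W[OF f]] f by (intro cls_eqD) auto
  from complex_span.step[OF IH this, of c] show ?case
    by (simp add: eval_tensor_add eval_tensor_frag_of algebra_simps)
qed

lemma linear_subspace_K: "linear_subspace A K"
proof (intro linear_subspace.intro abelian_group_A linear_subspace_axioms.intro K_additive_subgroup)
  fix c x show "x \<in> carrier A \<Longrightarrow> c \<odot>\<^bsub>A\<^esub> x \<in> carrier A"
    using keys_frag_extend[of "\<lambda>(w, d). frag_of (w, c * d)" x] by (fastforce simp: A_carrier)
  note cl = this
  assume x: "x \<in> K"
  have "eval_tensor (c \<odot>\<^bsub>A\<^esub> x) = (\<lambda>z. c * eval_tensor x z)" by (rule ext) (rule eval_tensor_smult)
  hence "eval_tensor (c \<odot>\<^bsub>A\<^esub> x) \<in> complex_span U"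
    using x eval_tensor_kernel[OF K_subset[OF x]] complex_span_cmult by simp
  thus "c \<odot>\<^bsub>A\<^esub> x \<in> K" using eval_tensor_kernel[OF cl[OF K_subset[OF x]]] by blast
qed (simp_all add: frag_extend_add)

end

section \<open>The rational structure on modular forms\<close>

text \<open>
  The coefficient of \<open>q\<^sup>k\<close>, which does not depend on the exponent at which the expansion starts.
\<close>
definition fourier_coeff :: "int \<Rightarrow> (complex \<Rightarrow> complex) \<Rightarrow> complex" where
  "fourier_coeff k f = (THE c. \<exists>r F. q_expansion f r F \<and> r \<le> k \<and> c = fps_nth F (nat (k - r)))"

lemma fourier_coeff_eq:
  assumes F: "q_expansion f r F" "r \<le> k"
  shows "fourier_coeff k f = fps_nth F (nat (k - r))"
  unfolding fourier_coeff_def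
proof (rule the_equality)
  show "\<exists>s G. q_expansion f s G \<and> s \<le> k \<and> fps_nth F (nat (k - r)) = fps_nth G (nat (k - s))" using assms by blast
  fix c assume "\<exists>s G. q_expansion f s G \<and> s \<le> k \<and> c = fps_nth G (nat (k - s))"
  then obtain s G where G: "q_expansion f s G" "s \<le> k" "c = fps_nth G (nat (k - s))" by blast
  define t where "t = min r s"
  have t: "t \<le> r" "t \<le> s" by (simp_all add: t_def)
  have "fps_X ^ nat (r - t) * F = fps_X ^ nat (s - t) * G"
    by (rule q_expansion_unique[OF q_expansion_lower[OF F(1) t(1)] q_expansion_lower[OF G(1) t(2)]])
  hence eq: "fps_nth (fps_X ^ nat (r - t) * F) (nat (k - t)) = fps_nth (fps_X ^ nat (s - t) * G) (nat (k - t))" by simp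
  have n: "\<not> nat (k - t) < nat (r - t)" "nat (k - t) - nat (r - t) = nat (k - r)"
    "\<not> nat (k - t) < nat (s - t)" "nat (k - t) - nat (s - t) = nat (k - s)"
    using t F(2) G(2) by auto
  show "c = fps_nth F (nat (k - r))"
    using eq unfolding fps_X_power_mult_nth n(2,4) G(3) using n(1,3) by (simp only: if_False)
qed

lemma fourier_coeff_linear:
  assumes "f \<in> forms_over UNIV m" "g \<in> forms_over UNIV m"
  shows "fourier_coeff k (\<lambda>z. f z + c * g z) = fourier_coeff k f + c * fourier_coeff k g"
proof -
  obtain r F s G where F: "q_expansion f r F" and G: "q_expansion g s G"
    using assms by (auto simp: forms_over_UNIV)
  define t where "t = min k (min r s)"
  note F' = q_expansion_lower[OF F, of t] and G' = q_expansion_lower[OF G, of t]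
  have t: "t \<le> r" "t \<le> s" "t \<le> k" by (simp_all add: t_def)
  show ?thesis
    using fourier_coeff_eq[OF q_expansion_add[OF F'[OF t(1)] q_expansion_cmult[OF G'[OF t(2)], of c]] t(3)]
      fourier_coeff_eq[OF F'[OF t(1)] t(3)] fourier_coeff_eq[OF G'[OF t(2)] t(3)] by simp
qed

lemma fourier_coeff_rational:
  assumes "f \<in> forms_over \<rat> m"
  shows "fourier_coeff k f \<in> \<rat>"
proof -
  obtain r F where F: "q_expansion f r F" "\<And>i. fps_nth F i \<in> \<rat>" using assms by (auto simp: forms_over_def)
  define t where "t = min k r"
  have t: "t \<le> r" "t \<le> k" by (simp_all add: t_def)
  show ?thesis
    unfolding fourier_coeff_eq[OF q_expansion_lower[OF F(1) t(1)] t(2)] by (rule fps_X_power_mult_coeffs) (simp_all add: F)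
qed

lemma fourier_coeff_nonzero:
  assumes f: "f \<in> forms_over K m" "f \<noteq> (\<lambda>z. 0)"
  obtains k where "fourier_coeff k f \<noteq> 0"
proof -
  obtain r F where F: "q_expansion f r F" using f(1) by (auto simp: forms_over_def)
  have "F \<noteq> 0"
  proof
    assume "F = 0"
    hence "f z = 0" for z
      using q_expansionD(2)[OF F, of z] modular_functionsD(1)[OF forms_overD[OF f(1)], of z] by (cases "Im z > 0") auto
    thus False using f(2) by auto
  qed
  then obtain j where "fps_nth F j \<noteq> 0" by (auto simp: fps_eq_iff)
  thus ?thesis using that[of "r + int j"] fourier_coeff_eq[OF F, of "r + int j"] by simp
qed

lemma complex_span_forms:
  "f \<in> complex_span (forms_over \<rat> m) \<Longrightarrow> f \<in> forms_over UNIV m"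
proof (induction rule: complex_span.induct)
  case (step f g c)
  show ?case by (intro forms_over_add forms_over_cmult step.IH forms_over_mono[OF step.hyps(2)]) auto
qed (simp add: forms_over_zero)

lemma qderiv_iter_Suc_outside: "z \<notin> \<H> \<Longrightarrow> (qderiv ^^ (n + 1)) f z = 0"
  by (simp add: qderiv_def)

lemma bol_linear:
  assumes "f \<in> forms_over K m" "g \<in> forms_over K' m"
  shows "(qderiv ^^ (n + 1)) (\<lambda>z. f z + c * g z) = (\<lambda>z. (qderiv ^^ (n + 1)) f z + c * (qderiv ^^ (n + 1)) g z)"
proof
  fix z
  show "(qderiv ^^ (n + 1)) (\<lambda>z. f z + c * g z) z = (qderiv ^^ (n + 1)) f z + c * (qderiv ^^ (n + 1)) g z"
  proof (cases "z \<in> \<H>")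
    case True
    thus ?thesis by (intro qderiv_iter_linear forms_over_holomorphic[OF assms(1)] forms_over_holomorphic[OF assms(2)]) simp
  next
    case False
    show ?thesis unfolding qderiv_iter_Suc_outside[OF False] by simp
  qed
qed

lemma bol_zero: "(qderiv ^^ (n + 1)) (\<lambda>z. 0) = (\<lambda>z. 0)"
proof -
  have z: "(\<lambda>z. 0) \<in> forms_over \<rat> 0" by (rule forms_over_zero) simp
  from bol_linear[OF z z, of n "- 1"] show ?thesis by simp
qed

abbreviation (input) bol_image :: "complex set \<Rightarrow> nat \<Rightarrow> (complex \<Rightarrow> complex) set" where
  "bol_image K n \<equiv> (qderiv ^^ (n + 1)) ` forms_over K (- int n)"

text \<open>The operator is complex linear, and complex forms are spanned by rational forms.\<close>
lemma complex_span_bol_image: "complex_span (bol_image \<rat> n) = bol_image UNIV n"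
proof (intro equalityI subsetI)
  fix f assume "f \<in> complex_span (bol_image \<rat> n)"
  thus "f \<in> bol_image UNIV n"
  proof induction
    case zero
    show ?case using bol_zero[of n] forms_over_zero[of UNIV "- int n"] by (metis coeff_field(2) imageI)
  next
    case (step f g c)
    then obtain f' g' where f: "f = (qderiv ^^ (n + 1)) f'" "f' \<in> forms_over UNIV (- int n)"
      and g: "g = (qderiv ^^ (n + 1)) g'" "g' \<in> forms_over \<rat> (- int n)" by blast
    have "(\<lambda>z. f' z + c * g' z) \<in> forms_over UNIV (- int n)"
      using f(2) forms_over_mono[OF g(2)] by (intro forms_over_add forms_over_cmult) auto
    thus ?case unfolding f(1) g(1) bol_linear[OF f(2) g(2), of n c, symmetric] by blast
  qed
next
  fix f assume "f \<in> bol_image UNIV n"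
  then obtain g where g: "f = (qderiv ^^ (n + 1)) g" "g \<in> forms_over UNIV (- int n)" by blast
  have "g \<in> complex_span (forms_over \<rat> (- int n))" by (rule forms_over_UNIV_eq_span[OF g(2)])
  hence "(qderiv ^^ (n + 1)) g \<in> complex_span (bol_image \<rat> n)"
  proof induction
    case zero
    show ?case unfolding bol_zero by (rule complex_span.zero)
  next
    case (step g h c)
    show ?case unfolding bol_linear[OF complex_span_forms[OF step.hyps(1)] step.hyps(2)]
      by (rule complex_span.step[OF step.IH]) (use step.hyps in blast)
  qed
  thus "f \<in> complex_span (bol_image \<rat> n)" unfolding g(1) .
qed

lemma rational_structure_forms: "rational_structure (forms_over \<rat> (int n + 2)) (bol_image \<rat> n)"
proof
  show "\<exists>\<alpha> :: (complex \<Rightarrow> complex) \<Rightarrow> complex. \<alpha> f \<noteq> 0 \<and> (\<forall>g\<in>forms_over \<rat> (int n + 2). \<alpha> g \<in> \<rat>) \<and>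
      (\<forall>g\<in>complex_span (forms_over \<rat> (int n + 2)). \<forall>h\<in>forms_over \<rat> (int n + 2). \<forall>c. \<alpha> (\<lambda>z. g z + c * h z) = \<alpha> g + c * \<alpha> h)"
    if f: "f \<in> forms_over \<rat> (int n + 2)" "f \<noteq> (\<lambda>z. 0)" for f
  proof -
    obtain k where "fourier_coeff k f \<noteq> 0" using fourier_coeff_nonzero[OF f] by blast
    thus ?thesis
      by (intro exI[of _ "fourier_coeff k"] conjI ballI allI fourier_coeff_rational)
         (auto intro!: fourier_coeff_linear dest: complex_span_forms forms_over_mono)
  qed
  have lin: "(\<lambda>z. f z + c * g z) \<in> bol_image \<rat> n" if "f \<in> bol_image \<rat> n" "g \<in> bol_image \<rat> n" "c \<in> \<rat>" for f g c
  proof -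
    obtain f' g' where f: "f = (qderiv ^^ (n + 1)) f'" "f' \<in> forms_over \<rat> (- int n)"
      and g: "g = (qderiv ^^ (n + 1)) g'" "g' \<in> forms_over \<rat> (- int n)" using \<open>f \<in> _\<close> \<open>g \<in> _\<close> by blast
    have "(\<lambda>z. f' z + c * g' z) \<in> forms_over \<rat> (- int n)"
      using f(2) g(2) \<open>c \<in> \<rat>\<close> by (intro forms_over_add forms_over_cmult) auto
    thus ?thesis unfolding f(1) g(1) bol_linear[OF f(2) g(2), of n c, symmetric] by blast
  qed
  show z: "(\<lambda>z. 0) \<in> bol_image \<rat> n" using bol_zero[of n] forms_over_zero[of \<rat> "- int n"] by (metis coeff_field(1) imageI)
  show "(\<lambda>z. f z + g z) \<in> bol_image \<rat> n" if "f \<in> bol_image \<rat> n" "g \<in> bol_image \<rat> n" for f g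
    using lin[OF that, of 1] by simp
  show "(\<lambda>z. of_rat r * f z) \<in> bol_image \<rat> n" if "f \<in> bol_image \<rat> n" for f r
    using lin[OF z that, of "of_rat r"] by simp
  show "bol_image \<rat> n \<subseteq> forms_over \<rat> (int n + 2)" using bol_forms[of \<rat>] by auto
qed (auto intro: forms_over_zero forms_over_add forms_over_cmult)

section \<open>The first cohomology group of the modular group\<close>

abbreviation (input) cocycles_mod :: "nat \<Rightarrow> (complex, int^2^2 \<Rightarrow> complex poly poly) module" where
  "cocycles_mod n \<equiv> cocycle_module SL2Z (sym_power n) slash"
abbreviation (input) cobs :: "nat \<Rightarrow> (int^2^2 \<Rightarrow> complex poly poly) set" where
  "cobs n \<equiv> coboundaries SL2Z (sym_power n) slash"

lemma cocycles_mod_simps [simp]: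
  "\<zero>\<^bsub>cocycles_mod n\<^esub> = (\<lambda>g\<in>carrier SL2Z. 0)"
  "\<kappa> \<oplus>\<^bsub>cocycles_mod n\<^esub> \<mu> = (\<lambda>g\<in>carrier SL2Z. \<kappa> g + \<mu> g)"
  "c \<odot>\<^bsub>cocycles_mod n\<^esub> \<kappa> = (\<lambda>g\<in>carrier SL2Z. const_poly c * \<kappa> g)"
  by (simp_all add: cocycle_module_def)

lemma cocycles_mod_carrier:
  "\<kappa> \<in> carrier (cocycles_mod n) \<longleftrightarrow> \<kappa> \<in> extensional (carrier SL2Z) \<and> \<kappa> \<in> sym_cocycles n"
  by (auto simp: cocycle_module_def sym_cocycles_def PiE_def)

lemma restrict_sym_cocycle:
  "(\<lambda>g\<in>carrier SL2Z. \<kappa> g) \<in> carrier (cocycles_mod n) \<longleftrightarrow> \<kappa> \<in> sym_cocycles n"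
  by (auto simp: cocycles_mod_carrier sym_cocycles_def SL2Z_closed)

lemma sym_cocycles_add_scale:
  assumes "\<kappa> \<in> sym_cocycles n"
  shows "\<mu> \<in> sym_cocycles n \<Longrightarrow> (\<lambda>g. \<kappa> g + \<mu> g) \<in> sym_cocycles n"
    and "(\<lambda>g. const_poly c * \<kappa> g) \<in> sym_cocycles n"
  using assms slash_add[of _ n] slash_const_mult[of _ n]
  by (auto simp: sym_cocycles_def Sym_add Sym_const_mult distrib_left add_ac)

lemma cobs_iff:
  "\<kappa> \<in> cobs n \<longleftrightarrow> \<kappa> \<in> extensional (carrier SL2Z) \<and> (\<exists>v\<in>Sym n. \<forall>\<gamma>\<in>carrier SL2Z. \<kappa> \<gamma> = slash \<gamma> v - v)"
proof -
  have *: "(\<lambda>g\<in>carrier SL2Z. slash g v \<ominus>\<^bsub>sym_power n\<^esub> v) = (\<lambda>g\<in>carrier SL2Z. slash g v - v)" if "v \<in> Sym n" for v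
    using sym_power_minus[OF slash_in_Sym[OF that] that] by simp
  have "\<kappa> \<in> cobs n \<longleftrightarrow> (\<exists>v\<in>Sym n. \<kappa> = (\<lambda>g\<in>carrier SL2Z. slash g v - v))"
    unfolding coboundaries_def mem_Collect_eq using * by metis
  also have "\<dots> \<longleftrightarrow> \<kappa> \<in> extensional (carrier SL2Z) \<and> (\<exists>v\<in>Sym n. \<forall>\<gamma>\<in>carrier SL2Z. \<kappa> \<gamma> = slash \<gamma> v - v)"
    by (auto intro!: extensionalityI[of \<kappa> "carrier SL2Z"])
  finally show ?thesis .
qed

lemma abelian_group_cocycles: "abelian_group (cocycles_mod n)"
proof (rule abelian_groupI)
  fix \<kappa> assume k: "\<kappa> \<in> carrier (cocycles_mod n)"
  hence ks: "\<kappa> \<in> sym_cocycles n" "\<kappa> \<in> extensional (carrier SL2Z)" by (auto simp: cocycles_mod_carrier)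
  show "\<exists>\<mu>\<in>carrier (cocycles_mod n). \<mu> \<oplus>\<^bsub>cocycles_mod n\<^esub> \<kappa> = \<zero>\<^bsub>cocycles_mod n\<^esub>"
    using sym_cocycles_add_scale(2)[OF ks(1), of "- 1"]
    by (intro bexI[of _ "\<lambda>g\<in>carrier SL2Z. const_poly (- 1) * \<kappa> g"]) (auto simp: restrict_sym_cocycle const_poly_hom)
  show "\<zero>\<^bsub>cocycles_mod n\<^esub> \<oplus>\<^bsub>cocycles_mod n\<^esub> \<kappa> = \<kappa>"
    using ks(2) by (auto intro!: extensionalityI[of _ "carrier SL2Z"])
next
  fix \<kappa> \<mu> assume "\<kappa> \<in> carrier (cocycles_mod n)" "\<mu> \<in> carrier (cocycles_mod n)"
  thus "\<kappa> \<oplus>\<^bsub>cocycles_mod n\<^esub> \<mu> \<in> carrier (cocycles_mod n)"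
    using sym_cocycles_add_scale(1)[of \<kappa> n \<mu>] by (auto simp: restrict_sym_cocycle) (auto simp: cocycles_mod_carrier)
next
  have "(\<lambda>g. 0) \<in> sym_cocycles n" by (auto simp: sym_cocycles_def slash_zero Sym_zero)
  thus "\<zero>\<^bsub>cocycles_mod n\<^esub> \<in> carrier (cocycles_mod n)" by (simp add: restrict_sym_cocycle)
qed (auto simp: add_ac)

lemma linear_subspace_cobs: "linear_subspace (cocycles_mod n) (cobs n)"
proof (intro linear_subspace.intro abelian_group_cocycles linear_subspace_axioms.intro)
  interpret abelian_group "cocycles_mod n" by (rule abelian_group_cocycles)
  have sub: "\<kappa> \<in> carrier (cocycles_mod n)" if k: "\<kappa> \<in> cobs n" for \<kappa>
  proof -
    obtain v where v: "v \<in> Sym n" "\<And>\<gamma>. \<gamma> \<in> carrier SL2Z \<Longrightarrow> \<kappa> \<gamma> = slash \<gamma> v - v" and e: "\<kappa> \<in> extensional (carrier SL2Z)"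
      using k by (auto simp: cobs_iff)
    have "\<kappa> = (\<lambda>g\<in>carrier SL2Z. slash g v - v)" by (rule extensionalityI[OF e]) (auto simp: v)
    thus ?thesis using coboundary_sym_cocycle[OF v(1)] by (simp add: restrict_sym_cocycle)
  qed
  have scale: "c \<odot>\<^bsub>cocycles_mod n\<^esub> \<kappa> \<in> cobs n" if k: "\<kappa> \<in> cobs n" for c \<kappa>
  proof -
    obtain v where v: "v \<in> Sym n" "\<And>\<gamma>. \<gamma> \<in> carrier SL2Z \<Longrightarrow> \<kappa> \<gamma> = slash \<gamma> v - v" using k by (auto simp: cobs_iff)
    show ?thesis using v slash_const_mult[OF v(1)]
      by (auto simp: cobs_iff right_diff_distrib intro!: bexI[of _ "const_poly c * v"] Sym_const_mult)
  qed
  show "subgroup (cobs n) (add_monoid (cocycles_mod n))"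
  proof (rule group.subgroupI[OF a_group])
    show "cobs n \<subseteq> carrier (add_monoid (cocycles_mod n))" using sub by auto
    have "(\<lambda>g\<in>carrier SL2Z. 0) \<in> cobs n" by (auto simp: cobs_iff slash_zero intro!: bexI[of _ 0] Sym_zero)
    thus "cobs n \<noteq> {}" by blast
    fix \<kappa> assume k: "\<kappa> \<in> cobs n"
    have "inv\<^bsub>add_monoid (cocycles_mod n)\<^esub> \<kappa> = (- 1) \<odot>\<^bsub>cocycles_mod n\<^esub> \<kappa>"
      using sub[OF k] sub[OF scale[OF k, of "- 1"]] by (intro group.inv_equality[OF a_group]) (auto simp: const_poly_hom)
    thus "inv\<^bsub>add_monoid (cocycles_mod n)\<^esub> \<kappa> \<in> cobs n" using scale[OF k, of "- 1"] by simp
    fix \<mu> assume m: "\<mu> \<in> cobs n"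
    obtain v w where "v \<in> Sym n" "\<And>\<gamma>. \<gamma> \<in> carrier SL2Z \<Longrightarrow> \<kappa> \<gamma> = slash \<gamma> v - v"
      "w \<in> Sym n" "\<And>\<gamma>. \<gamma> \<in> carrier SL2Z \<Longrightarrow> \<mu> \<gamma> = slash \<gamma> w - w" using k m by (auto simp: cobs_iff)
    thus "\<kappa> \<otimes>\<^bsub>add_monoid (cocycles_mod n)\<^esub> \<mu> \<in> cobs n"
      by (auto simp: cobs_iff slash_add[of _ n] intro!: bexI[of _ "v + w"] Sym_add)
  qed
  show "c \<odot>\<^bsub>cocycles_mod n\<^esub> \<kappa> \<in> carrier (cocycles_mod n)" if "\<kappa> \<in> carrier (cocycles_mod n)" for c \<kappa>
    using that sym_cocycles_add_scale(2)[of \<kappa> n c] by (simp add: restrict_sym_cocycle) (simp add: cocycles_mod_carrier)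
  show "\<kappa> \<in> cobs n \<Longrightarrow> c \<odot>\<^bsub>cocycles_mod n\<^esub> \<kappa> \<in> cobs n" for c \<kappa> by (rule scale)
qed (auto simp: distrib_left)

lemma period_cocycle_in_cocycles:
  assumes "f \<in> modular_functions (int n + 2)" "Im z0 > 0"
  shows "period_cocycle n f z0 \<in> carrier (cocycles_mod n)"
  using period_sym_cocycle[OF assms] by (simp add: cocycles_mod_carrier period_cocycle_def)

lemma cohomology_class_eqI:
  assumes k: "\<kappa> \<in> carrier (cocycles_mod n)" and m: "\<mu> \<in> carrier (cocycles_mod n)"
    and v: "v \<in> Sym n" "\<And>\<gamma>. \<gamma> \<in> carrier SL2Z \<Longrightarrow> \<kappa> \<gamma> = \<mu> \<gamma> + (slash \<gamma> v - v)"
  shows "cohomology_class SL2Z (sym_power n) slash \<kappa> = cohomology_class SL2Z (sym_power n) slash \<mu>"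
proof -
  define \<beta> where "\<beta> = (\<lambda>\<gamma>\<in>carrier SL2Z. slash \<gamma> v - v)"
  have b: "\<beta> \<in> cobs n" using v(1) by (auto simp: cobs_iff \<beta>_def)
  have "\<kappa> = \<beta> \<oplus>\<^bsub>cocycles_mod n\<^esub> \<mu>"
    by (rule extensionalityI[of _ "carrier SL2Z"]) (use k v in \<open>auto simp: cocycles_mod_carrier \<beta>_def\<close>)
  thus ?thesis unfolding cohomology_class_def
    using linear_subspace.coset_shift[OF linear_subspace_cobs b m] by simp
qed

lemma cohomology_class_base_point:
  assumes f: "f \<in> modular_functions (int n + 2)" and z: "Im z0 > 0" "Im z1 > 0"
  shows "cohomology_class SL2Z (sym_power n) slash (period_cocycle n f z0) = cohomology_class SL2Z (sym_power n) slash (period_cocycle n f z1)"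
proof -
  obtain v where v: "v \<in> Sym n" "\<And>\<gamma>. \<gamma> \<in> carrier SL2Z \<Longrightarrow> period_cocycle n f z0 \<gamma> - period_cocycle n f z1 \<gamma> = slash \<gamma> v - v"
    using period_cocycle_base_point[OF f z(2,1)] by metis
  show ?thesis
    by (rule cohomology_class_eqI[OF period_cocycle_in_cocycles[OF f z(1)] period_cocycle_in_cocycles[OF f z(2)] v(1)])
       (use v(2) in \<open>simp add: algebra_simps\<close>)
qed

lemma period_cocycle_difference:
  assumes f: "f \<in> forms_over UNIV (int n + 2)" and g: "g \<in> forms_over UNIV (int n + 2)" and z0: "Im z0 > 0"
    and fg: "(\<lambda>z. f z - g z) \<in> bol_image UNIV n"
  obtains v where "v \<in> Sym n" "\<And>\<gamma>. \<gamma> \<in> carrier SL2Z \<Longrightarrow> period_cocycle n f z0 \<gamma> = period_cocycle n g z0 \<gamma> + (slash \<gamma> v - v)"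
proof -
  have d: "(\<lambda>z. f z - g z) \<in> forms_over UNIV (int n + 2)" using fg bol_forms[of UNIV] by auto
  obtain v where v: "v \<in> Sym n" "\<And>\<gamma>. \<gamma> \<in> carrier SL2Z \<Longrightarrow> period_cocycle n (\<lambda>z. f z - g z) z0 \<gamma> = slash \<gamma> v - v"
    using period_cocycle_coboundary_iff[OF d z0] fg by blast
  have "period_cocycle n f z0 \<gamma> = period_cocycle n g z0 \<gamma> + (slash \<gamma> v - v)" if "\<gamma> \<in> carrier SL2Z" for \<gamma>
    using period_cocycle_linear[OF forms_over_holomorphic[OF g] forms_over_holomorphic[OF d] z0 that, of n 1] v(2)[OF that]
    by (simp add: const_poly_hom)
  thus ?thesis using that v(1) by blast
qed

section \<open>The Eichler-Shimura isomorphism\<close>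

text \<open>
  The isomorphism is induced by taking a tensor to the period cocycle, based at \<open>\<i>\<close>, of its value, a
  complex form of weight \<open>n + 2\<close>.
\<close>
theorem corollary1p4:
  fixes n :: nat
  shows "(\<forall>f\<in>weakly_holomorphic_forms (int n + 2). \<forall>z0\<in>upper_half_plane.
            period_cocycle n f z0 \<in> carrier (cocycle_module SL2Z (sym_power n) slash))
       \<and> (\<forall>f\<in>weakly_holomorphic_forms (int n + 2).
            \<forall>z0\<in>upper_half_plane. \<forall>z1\<in>upper_half_plane.
              cohomology_class SL2Z (sym_power n) slash (period_cocycle n f z0)
              = cohomology_class SL2Z (sym_power n) slash (period_cocycle n f z1))
       \<and> (\<exists>\<Phi>\<in>linear_iso (tensor_complex (forms_mod_bol n)) (H1 SL2Z (sym_power n) slash).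
            \<forall>f\<in>weakly_holomorphic_forms (int n + 2). \<forall>z0\<in>upper_half_plane.
              \<Phi> (pure_tensor (forms_mod_bol n) (form_class n f) 1)
              = cohomology_class SL2Z (sym_power n) slash (period_cocycle n f z0))"
proof (intro conjI ballI)
  fix f z0 assume "f \<in> weakly_holomorphic_forms (int n + 2)" "z0 \<in> upper_half_plane"
  hence f: "f \<in> modular_functions (int n + 2)" and z0: "Im z0 > 0" by (auto simp: weakly_holomorphic_forms_eq dest: forms_overD)
  show "period_cocycle n f z0 \<in> carrier (cocycle_module SL2Z (sym_power n) slash)" by (rule period_cocycle_in_cocycles[OF f z0])
  fix z1 assume "z1 \<in> upper_half_plane"
  thus "cohomology_class SL2Z (sym_power n) slash (period_cocycle n f z0) = cohomology_class SL2Z (sym_power n) slash (period_cocycle n f z1)"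
    by (intro cohomology_class_base_point f z0) simp
next
  define V U where "V = forms_over \<rat> (int n + 2)" and "U = bol_image \<rat> n"
  interpret R: rational_structure V U unfolding V_def U_def by (rule rational_structure_forms)
  have spanU: "complex_span U = bol_image UNIV n" unfolding U_def by (rule complex_span_bol_image)
  have W: "forms_mod_bol n = R.W"
    by (simp add: forms_mod_bol_def weakly_holomorphic_module_def function_module_def weakly_holomorphic_forms_eq V_def U_def)
  have cls: "form_class n f = R.cls f" for f
    by (simp add: form_class_def weakly_holomorphic_module_def function_module_def weakly_holomorphic_forms_eq V_def U_def)
  \<comment> \<open>The value of a tensor is only defined modulo derivatives, whose cocycles are coboundaries.\<close>
  define \<psi> where "\<psi> = (\<lambda>p. period_cocycle n (R.eval_tensor p) \<i>)"
  have i: "Im \<i> > 0" by simp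
  have ev: "R.eval_tensor p \<in> forms_over UNIV (int n + 2)" if "p \<in> carrier R.A" for p
    using complex_span_forms R.eval_tensor_in_span[OF that] by (simp add: V_def)
  note evh = forms_over_holomorphic[OF ev]
  have ext: "period_cocycle n f \<i> \<in> extensional (carrier SL2Z)" for f by (simp add: period_cocycle_def)
  obtain \<Phi> where \<Phi>: "\<Phi> \<in> linear_iso (quotient_module R.A R.K) (quotient_module (cocycles_mod n) (cobs n))"
    and val: "\<And>p. p \<in> carrier R.A \<Longrightarrow> \<Phi> (R.K +>\<^bsub>R.A\<^esub> p) = cobs n +>\<^bsub>cocycles_mod n\<^esub> \<psi> p"
  proof (rule quotient_linear_iso[OF R.linear_subspace_K linear_subspace_cobs, of \<psi>])
    fix p assume p: "p \<in> carrier R.A"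
    show "\<psi> p \<in> carrier (cocycles_mod n)"
      unfolding \<psi>_def by (rule period_cocycle_in_cocycles[OF forms_overD[OF ev[OF p]] i])
    show "\<psi> (p \<oplus>\<^bsub>R.A\<^esub> q) = \<psi> p \<oplus>\<^bsub>cocycles_mod n\<^esub> \<psi> q" if q: "q \<in> carrier R.A" for q
    proof -
      have "R.eval_tensor (p + q) = (\<lambda>z. R.eval_tensor p z + 1 * R.eval_tensor q z)" by (simp add: fun_eq_iff R.eval_tensor_add)
      thus ?thesis unfolding \<psi>_def
        by (intro extensionalityI[OF ext]) (simp_all add: period_cocycle_linear[OF evh[OF p] evh[OF q], where c = 1, simplified] const_poly_hom)
    qed
    show "\<psi> (c \<odot>\<^bsub>R.A\<^esub> p) = c \<odot>\<^bsub>cocycles_mod n\<^esub> \<psi> p" for c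
    proof -
      have "R.eval_tensor (c \<odot>\<^bsub>R.A\<^esub> p) = (\<lambda>z. R.eval_tensor p z + (c - 1) * R.eval_tensor p z)"
        unfolding fun_eq_iff R.eval_tensor_smult by (simp add: left_diff_distrib)
      moreover have cc: "const_poly c = 1 + const_poly (c - 1)" by (simp add: const_poly_def one_pCons)
      ultimately have "\<psi> (c \<odot>\<^bsub>R.A\<^esub> p) g = const_poly c * \<psi> p g" if "g \<in> carrier SL2Z" for g
        using period_cocycle_linear[OF evh[OF p] evh[OF p] i that, of n "c - 1"]
        by (simp only: \<psi>_def cc distrib_right mult_1)
      thus ?thesis by (intro extensionalityI[of _ "carrier SL2Z"]) (auto simp: \<psi>_def ext simp del: R.A_simps)
    qed
    show "\<psi> p \<in> cobs n \<longleftrightarrow> p \<in> R.K"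
      using period_cocycle_coboundary_iff[OF ev[OF p] i] R.eval_tensor_kernel[OF p] ext[of "R.eval_tensor p"]
      unfolding spanU by (simp add: cobs_iff \<psi>_def)
  next
    fix \<kappa> assume "\<kappa> \<in> carrier (cocycles_mod n)"
    hence k: "\<kappa> \<in> sym_cocycles n" "\<kappa> \<in> extensional (carrier SL2Z)" by (auto simp: cocycles_mod_carrier)
    obtain f v where f: "f \<in> forms_over UNIV (int n + 2)" and v: "v \<in> Sym n"
      "\<And>\<gamma>. \<gamma> \<in> carrier SL2Z \<Longrightarrow> \<kappa> \<gamma> = period_cocycle n f \<i> \<gamma> + (slash \<gamma> v - v)"
      using cocycle_is_period_cocycle[OF k(1)] by blast
    have "f \<in> complex_span V" unfolding V_def by (rule forms_over_UNIV_eq_span[OF f])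
    then obtain xs where xs: "set xs \<subseteq> V \<times> UNIV" "f = lin_comb xs" by (rule complex_span_imp_lin_comb) blast
    define p where "p = R.formal_comb xs"
    have p: "p \<in> carrier R.A" unfolding p_def by (rule R.formal_comb_in_A[OF xs(1)])
    have "(\<lambda>z. f z - R.eval_tensor p z) \<in> bol_image UNIV n"
      using R.eval_formal_comb[OF xs(1)] unfolding spanU p_def xs(2) .
    then obtain w where w: "w \<in> Sym n" "\<And>\<gamma>. \<gamma> \<in> carrier SL2Z \<Longrightarrow> period_cocycle n f \<i> \<gamma> = \<psi> p \<gamma> + (slash \<gamma> w - w)"
      using period_cocycle_difference[OF f ev[OF p] i] unfolding \<psi>_def by blast
    define \<beta> where "\<beta> = (\<lambda>\<gamma>\<in>carrier SL2Z. slash \<gamma> (v + w) - (v + w))"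
    have "\<beta> \<in> cobs n" using v(1) w(1) by (auto simp: cobs_iff \<beta>_def intro!: bexI[of _ "v + w"] Sym_add)
    moreover have "\<kappa> = \<beta> \<oplus>\<^bsub>cocycles_mod n\<^esub> \<psi> p"
      by (rule extensionalityI[OF k(2)]) (auto simp: v(2) w(2) \<beta>_def slash_add[OF v(1) w(1)])
    ultimately show "\<exists>p\<in>carrier R.A. \<exists>\<beta>\<in>cobs n. \<kappa> = \<beta> \<oplus>\<^bsub>cocycles_mod n\<^esub> \<psi> p" using p by blast
  qed blast
  have "\<Phi> (pure_tensor (forms_mod_bol n) (form_class n f) 1) = cohomology_class SL2Z (sym_power n) slash (period_cocycle n f z0)"
    if "f \<in> weakly_holomorphic_forms (int n + 2)" "z0 \<in> upper_half_plane" for f z0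
  proof -
    have f: "f \<in> V" and z0: "Im z0 > 0" using that by (simp_all add: weakly_holomorphic_forms_eq V_def)
    have fU: "f \<in> forms_over UNIV (int n + 2)" using f unfolding V_def by (rule forms_over_mono)
    define p where "p = frag_of (R.cls f, 1 :: complex)"
    have p: "p \<in> carrier R.A" using R.cls_in_W[OF f] by (simp add: p_def R.A_carrier)
    have "R.cls f = R.cls (R.rep (R.cls f))" using R.rep(2)[OF R.cls_in_W[OF f]] by simp
    hence "(\<lambda>z. f z - R.rep (R.cls f) z) \<in> U" by (rule R.cls_eqD[OF _ f R.rep(1)[OF R.cls_in_W[OF f]]])
    moreover have "R.eval_tensor p = R.rep (R.cls f)" by (simp add: fun_eq_iff p_def R.eval_tensor_frag_of)
    ultimately have "(\<lambda>z. f z - R.eval_tensor p z) \<in> bol_image UNIV n"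
      unfolding spanU[symmetric] using complex_span_base[of _ U 1] by fastforce
    then obtain w where w: "w \<in> Sym n" "\<And>\<gamma>. \<gamma> \<in> carrier SL2Z \<Longrightarrow> period_cocycle n f \<i> \<gamma> = \<psi> p \<gamma> + (slash \<gamma> w - w)"
      using period_cocycle_difference[OF fU ev[OF p] i] unfolding \<psi>_def by blast
    have "\<Phi> (pure_tensor (forms_mod_bol n) (form_class n f) 1) = cohomology_class SL2Z (sym_power n) slash (\<psi> p)"
      unfolding W cls pure_tensor_def cohomology_class_def p_def[symmetric] by (rule val[OF p])
    also have "\<dots> = cohomology_class SL2Z (sym_power n) slash (period_cocycle n f \<i>)"
      by (rule cohomology_class_eqI[OF period_cocycle_in_cocycles[OF forms_overD[OF fU] i] _ w, symmetric])
         (simp_all add: \<psi>_def period_cocycle_in_cocycles[OF forms_overD[OF ev[OF p]] i])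
    also have "\<dots> = cohomology_class SL2Z (sym_power n) slash (period_cocycle n f z0)"
      by (rule cohomology_class_base_point[OF forms_overD[OF fU] i z0])
    finally show ?thesis .
  qed
  moreover have "\<Phi> \<in> linear_iso (tensor_complex (forms_mod_bol n)) (H1 SL2Z (sym_power n) slash)"
    using \<Phi> unfolding tensor_complex_def H1_def W .
  ultimately show "\<exists>\<Phi>\<in>linear_iso (tensor_complex (forms_mod_bol n)) (H1 SL2Z (sym_power n) slash).
            \<forall>f\<in>weakly_holomorphic_forms (int n + 2). \<forall>z0\<in>upper_half_plane.
              \<Phi> (pure_tensor (forms_mod_bol n) (form_class n f) 1)
              = cohomology_class SL2Z (sym_power n) slash (period_cocycle n f z0)" by blast
qed

end
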